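(* Consider LinUCB run for $T$ rounds on the unit ball $\mathcal B^d$ with exploration parameter $\beta$ (chosen as described in the context, at failure level $\delta=1/\log T$), under the sub-Gaussian noise assumption described in the context. Let $\lambda_{t,d}$ be the minimum eigenvalue of $\boldsymbol\Lambda_t$ and $\boldsymbol v_{t,1}$ a unit leading eigenvector of $\boldsymbol\Lambda_t$. There exists $t_2=O\!\left(\beta^8/(\sigma^6d^2)\right)$ such that, with probability at least $1-\frac1{\log T}$, the following holds simultaneously for all $t_2\le t\le T$: $$\|\boldsymbol v_{t,1}-\boldsymbol\theta^\star\|_2\lesssim\frac{\sigma\sqrt{d+\log\log T}+1}{\sqrt{\lambda_{t,d}}},\qquad \|\boldsymbol v_{t,1}-\widehat{\boldsymbol\theta}_t\|_2\lesssim\frac{\sigma\sqrt{d+\log\log T}+1}{\sqrt{\lambda_{t,d}}}.$$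
   Context: Setting. Let $d\ge 2$, let $T\ge3$ be the horizon, and let $\boldsymbol\theta^\star\in\mathbb R^d$ with $\|\boldsymbol\theta^\star\|_2=1$. In each round $t=1,\dots,T$ the learner picks an action $\boldsymbol a_t$ in the unit ball $\mathcal B^d=\{\boldsymbol x\in\mathbb R^d:\|\boldsymbol x\|_2\le 1\}$ (every vector of the ball is available in every round) and observes $r_t=\langle\boldsymbol a_t,\boldsymbol\theta^\star\rangle+\epsilon_t$. With $\mathcal F_t=\sigma(\boldsymbol a_1,r_1,\dots,\boldsymbol a_t,r_t)$, the noise satisfies $\mathbb E[\epsilon_t\mid\mathcal F_{t-1}]=0$, $\mathrm{Var}[\epsilon_t\mid\mathcal F_{t-1}]=\sigma^2$, and $\mathbb E[\exp(\lambda\epsilon_t)\mid\mathcal F_{t-1}]\le\exp(\sigma^2\lambda^2/2)$ for all $\lambda\in\mathbb R$ and $t\ge1$, where $\sigma>0$. LinUCB with deterministic exploration parameter $\beta=\beta(T,d)>0$: $\boldsymbol\Lambda_0=\boldsymbol I_d$, $\boldsymbol\Lambda_t=\boldsymbol I_d+\sum_{s=1}^t\boldsymbol a_s\boldsymbol a_s^\top$, ridge estimator $\overline{\boldsymbol\theta}_t=\boldsymbol\Lambda_t^{-1}\sum_{s=1}^t\boldsymbol a_s r_s$, projected estimator $\widehat{\boldsymbol\theta}_t=\overline{\boldsymbol\theta}_t/\|\overline{\boldsymbol\theta}_t\|_2$ (an arbitrary unit vector if $\overline{\boldsymbol\theta}_t=0$, e.g. at $t=0$), UCB score $\mathrm{UCB}_t(\boldsymbol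 a)=\langle\boldsymbol a,\widehat{\boldsymbol\theta}_{t-1}\rangle+\beta\sqrt{\boldsymbol a^\top\boldsymbol\Lambda_{t-1}^{-1}\boldsymbol a}$, and $\boldsymbol a_t\in\arg\max_{\boldsymbol a\in\mathcal B^d}\mathrm{UCB}_t(\boldsymbol a)$. Choice of $\beta$ at failure level $\delta$: $\beta$ is chosen so that, with probability at least $1-\delta$, $\langle\boldsymbol a,\boldsymbol\theta^\star\rangle\le\mathrm{UCB}_t(\boldsymbol a)$ holds uniformly over all $t$ and all $\boldsymbol a\in\mathcal B^d$ (optimism). Notation: the sign of $\boldsymbol v_{t,1}$ is chosen so that $\langle\boldsymbol v_{t,1},\boldsymbol\theta^\star\rangle\ge0$. $f\lesssim g$ (equivalently $f=O(g)$) means $|f|\le c_1|g|$ for a constant $c_1>0$ not depending on $T$ (or $t$). *)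

theory Defs
  imports "HOL-Probability.Probability"
begin

definition eigenvector_of :: "real^'d^'d \<Rightarrow> real \<Rightarrow> real^'d \<Rightarrow> bool" where
  "eigenvector_of A \<mu> v \<longleftrightarrow> v \<noteq> 0 \<and> A *v v = \<mu> *\<^sub>R v"

definition eigenvalues :: "real^'d^'d \<Rightarrow> real set" where
  "eigenvalues A = {\<mu>. \<exists>v. eigenvector_of A \<mu> v}"

text \<open>These are only used for symmetric matrices, whose set of real eigenvalues is finite and
  nonempty.\<close>

definition min_eigenvalue :: "real^'d^'d \<Rightarrow> real" where
  "min_eigenvalue A = Min (eigenvalues A)"

definition max_eigenvalue :: "real^'d^'d \<Rightarrow> real" where
  "max_eigenvalue A = Max (eigenvalues A)"

definition unit_leading_eigenvector :: "real^'d^'d \<Rightarrow> real^'d \<Rightarrow> bool" where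
  "unit_leading_eigenvector A v \<longleftrightarrow> norm v = 1 \<and> eigenvector_of A (max_eigenvalue A) v"

definition design_matrix :: "(nat \<Rightarrow> real^'d) \<Rightarrow> nat \<Rightarrow> real^'d^'d" where
  "design_matrix x t = mat 1 + 
     (\<Sum>s=1..t. (columnvector (x s) :: real^1^'d) ** rowvector (x s))"

definition ridge :: "(nat \<Rightarrow> real^'d) \<Rightarrow> (nat \<Rightarrow> real) \<Rightarrow> nat \<Rightarrow> real^'d" where
  "ridge x r t = matrix_inv (design_matrix x t) *v (\<Sum>s=1..t. r s *\<^sub>R x s)"

definition ucb_score :: "real \<Rightarrow> real^'d^'d \<Rightarrow> real^'d \<Rightarrow> real^'d \<Rightarrow> real" where
  "ucb_score \<beta> \<Lambda> \<theta>h x = x \<bullet> \<theta>h + \<beta> * sqrt (x \<bullet> (matrix_inv \<Lambda> *v x))"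

definition reward ::
  "real^'d \<Rightarrow> (nat \<Rightarrow> 'w \<Rightarrow> real^'d) \<Rightarrow> (nat \<Rightarrow> 'w \<Rightarrow> real) \<Rightarrow> nat \<Rightarrow> 'w \<Rightarrow> real" where
  "reward \<theta> a \<epsilon> t \<omega> = a t \<omega> \<bullet> \<theta> + \<epsilon> t \<omega>"

text \<open>The sigma-algebra generated by \<open>a 1, r 1, \<dots>, a t, r t\<close>; trivial for \<open>t = 0\<close>.\<close>

definition history ::
  "'w measure \<Rightarrow> (nat \<Rightarrow> 'w \<Rightarrow> real^'d) \<Rightarrow> (nat \<Rightarrow> 'w \<Rightarrow> real) \<Rightarrow> nat \<Rightarrow> 'w measure" where
  "history M a r t = sigma (space M)
     (\<Union>s\<in>{1..t}. sets (vimage_algebra (space M) (a s) borel) \<union>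
                 sets (vimage_algebra (space M) (r s) borel))"

definition cond_variance :: "'w measure \<Rightarrow> 'w measure \<Rightarrow> ('w \<Rightarrow> real) \<Rightarrow> 'w \<Rightarrow> real" where
  "cond_variance M F X =
     real_cond_exp M F (\<lambda>\<omega>. (X \<omega> - real_cond_exp M F X \<omega>)\<^sup>2)"

text \<open>The property is not required to be a measurable set of outcomes, only to contain an event
  of large enough probability.\<close>

definition with_prob_at_least :: "'w measure \<Rightarrow> real \<Rightarrow> ('w \<Rightarrow> bool) \<Rightarrow> bool" where
  "with_prob_at_least M p P \<longleftrightarrow> (\<exists>E\<in>sets M. measure M E \<ge> p \<and> (\<forall>\<omega>\<in>E. P \<omega>))"

text \<open>
  A run of LinUCB for \<open>T\<close> rounds: \<open>a t\<close> is the action and \<open>\<epsilon> t\<close> the noise of round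
  \<open>t \<in> {1..T}\<close>, and \<open>\<theta>h t\<close> the projected estimator after round \<open>t\<close>. Ties in the maximisation,
  and the unit vector used when the ridge estimator vanishes, are arbitrary functions of the
  history (measurability assumptions \<open>action_predictable\<close> and \<open>estimator_adapted\<close>).
  The integrability assumptions make the conditional expectations meaningful, since
  \<^const>\<open>real_cond_exp\<close> is total.
\<close>

locale linucb_run = prob_space M
  for M :: "'w measure" +
  fixes \<theta> :: "real^'d"
    and \<sigma> \<beta> :: real
    and T :: nat
    and a :: "nat \<Rightarrow> 'w \<Rightarrow> real^'d"
    and \<epsilon> :: "nat \<Rightarrow> 'w \<Rightarrow> real"
    and \<theta>h :: "nat \<Rightarrow> 'w \<Rightarrow> real^'d"
  assumes noise_integrable:
      "t \<in> {1..T} \<Longrightarrow> integrable M (\<epsilon> t)"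
      "t \<in> {1..T} \<Longrightarrow> integrable M (\<lambda>\<omega>. (\<epsilon> t \<omega>)\<^sup>2)"
      "t \<in> {1..T} \<Longrightarrow> integrable M (\<lambda>\<omega>. exp (l * \<epsilon> t \<omega>))"
    and noise_mean: "t \<in> {1..T} \<Longrightarrow>
      AE \<omega> in M. real_cond_exp M (history M a (reward \<theta> a \<epsilon>) (t - 1)) (\<epsilon> t) \<omega> = 0"
    and noise_variance: "t \<in> {1..T} \<Longrightarrow>
      AE \<omega> in M. cond_variance M (history M a (reward \<theta> a \<epsilon>) (t - 1)) (\<epsilon> t) \<omega> = \<sigma>\<^sup>2"
    and noise_subgaussian: "t \<in> {1..T} \<Longrightarrow>
      AE \<omega> in M. real_cond_exp M (history M a (reward \<theta> a \<epsilon>) (t - 1)) (\<lambda>\<omega>. exp (l * \<epsilon> t \<omega>)) \<omega>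
        \<le> exp (\<sigma>\<^sup>2 * l\<^sup>2 / 2)"
    and action_predictable: "t \<in> {1..T} \<Longrightarrow>
      a t \<in> borel_measurable (history M a (reward \<theta> a \<epsilon>) (t - 1))"
    and estimator_adapted: "t \<in> {0..T} \<Longrightarrow>
      \<theta>h t \<in> borel_measurable (history M a (reward \<theta> a \<epsilon>) t)"
    and estimator: "t \<in> {0..T} \<Longrightarrow> \<omega> \<in> space M \<Longrightarrow>
      (let \<theta>b = ridge (\<lambda>s. a s \<omega>) (\<lambda>s. reward \<theta> a \<epsilon> s \<omega>) t
       in if \<theta>b = 0 then norm (\<theta>h t \<omega>) = 1 else \<theta>h t \<omega> = (1 / norm \<theta>b) *\<^sub>R \<theta>b)"
    and action: "t \<in> {1..T} \<Longrightarrow> \<omega> \<in> space M \<Longrightarrow>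
      is_arg_max (ucb_score \<beta> (design_matrix (\<lambda>s. a s \<omega>) (t - 1)) (\<theta>h (t - 1) \<omega>))
        (\<lambda>x. x \<in> cball 0 1) (a t \<omega>)"

definition optimistic ::
  "real^'d \<Rightarrow> real \<Rightarrow> nat \<Rightarrow> (nat \<Rightarrow> 'w \<Rightarrow> real^'d) \<Rightarrow> (nat \<Rightarrow> 'w \<Rightarrow> real^'d) \<Rightarrow> 'w \<Rightarrow> bool" where
  "optimistic \<theta> \<beta> T a \<theta>h \<omega> \<longleftrightarrow> (\<forall>t\<in>{1..T}. \<forall>x\<in>cball 0 1.
     x \<bullet> \<theta> \<le> ucb_score \<beta> (design_matrix (\<lambda>s. a s \<omega>) (t - 1)) (\<theta>h (t - 1) \<omega>) x)"

end

(* Write each action as a multiple of \<theta> plus an orthogonal part y, let G be the inverse of the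
   design matrix, m the orthogonal part of (design matrix applied to \<theta>) divided by its \<theta>-part, and
   B = 1 + sum |y|^2. The leading eigenvector is then within 3|m| of \<theta>.

   The first-order conditions for the maximiser of the score force |y|^2 to be of order \<beta>^2 tr G and
   each step to lower tr G by a multiple of \<beta>^2 (tr G)^3, so that tr G decays like 1/(\<beta> sqrt t)
   while B grows like \<beta> sqrt t. Hence the least eigenvalue and B are comparable.

   Let L = sqrt (d + ln ln T). If \<beta> >= \<kappa> L, exponential inequalities over a finite net of directions
   (dyadic scales make the number of directions polynomial in ln T) bound the self-normalised noise by
   a multiple of L with probability 1 - 1/ln T. This controls the estimator, and a Lyapunov function
   for |m - (orthogonal part of the ridge estimator)| shows that |m| is of order
   L / sqrt (least eigenvalue) once t exceeds a multiple of \<beta>^8.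

   If \<beta> < \<kappa> L and T is large, optimism with probability 1 - 1/ln T is impossible unless \<beta> sqrt T is
   bounded, in which case so is the least eigenvalue and nothing is to be shown. Indeed, tilting the
   law of the noise shifts the ridge estimator by a vector of length more than \<beta> / sqrt (least
   eigenvalue); the density of the tilted law has second moment at most ln T / 16, so an event of
   probability 1/ln T stays improbable under it. *)

theory Submission
  imports Defs "HOL-Real_Asymp.Real_Asymp"
begin

section \<open>Symmetric and positive definite matrices\<close>

text \<open>All constants may depend on d and \<sigma> but not on \<beta>, T or the run. The power
  \<beta>^8 accumulates in three stages. About \<beta>^2 rounds pass until the least eigenvalue
  exceeds a multiple of \<beta>^2. About \<beta>^4 rounds pass until r^(1/4) exceeds a multiple of
  \<beta>, as the Lyapunov step requires. A further factor \<beta>^4 is spent until the initial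
  value of the potential, whose share of the bound decays only like t^(-1/4), falls below L. The
  noise bound is circular. A net of fixed size controls the noise only while B is at most J times
  the least eigenvalue; J comes out of the growth estimates, and these presuppose the noise bound.
  The constant of the noise bound grows only logarithmically in J, so a suitable J exists, and the
  growth induction supplies the comparison round by round before the noise bound is invoked. The
  split constant \<kappa> is dictated by the change of measure: the second moment of the density is
  exponential in \<beta>^2, so \<beta> < \<kappa> L makes it a power of ln T, and \<kappa> brings
  that power down to 1/2.\<close>

lemma sym_matrix_dot:
  fixes A :: "real^'n^'n"
  assumes "transpose A = A"
  shows "(A *v x) \<bullet> y = x \<bullet> (A *v y)"
  by (metis assms dot_lmul_matrix inner_commute vector_transpose_matrix)

definition seminorm_of :: "real^'n^'n \<Rightarrow> real^'n \<Rightarrow> real" where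
  "seminorm_of A x = sqrt (x \<bullet> (A *v x))"

text \<open>The quadratic s -> (x - s y) . A (x - s y) is never negative. Semidefiniteness is all
  that is assumed because the inequality is later applied to differences such as c I - A, which have
  a kernel.\<close>

lemma psd_cauchy_schwarz_sq:
  fixes A :: "real^'n^'n"
  assumes sym: "transpose A = A" and psd: "\<And>x. 0 \<le> x \<bullet> (A *v x)"
  shows "(x \<bullet> (A *v y))\<^sup>2 \<le> (x \<bullet> (A *v x)) * (y \<bullet> (A *v y))"
proof -
  let ?a = "y \<bullet> (A *v y)" and ?b = "x \<bullet> (A *v y)" and ?c = "x \<bullet> (A *v x)"
  have yx: "y \<bullet> (A *v x) = ?b"
    using sym_matrix_dot[OF sym, of y x] by (simp add: inner_commute)
  have q: "0 \<le> ?c - 2 * s * ?b + s^2 * ?a" for s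
  proof -
    have "0 \<le> (x - s *\<^sub>R y) \<bullet> (A *v (x - s *\<^sub>R y))" by (rule psd)
    also have "... = ?c - 2 * s * ?b + s^2 * ?a"
      using yx by (simp add: matrix_vector_mult_diff_distrib inner_diff_left inner_diff_right
          matrix_vector_mult_scaleR power2_eq_square algebra_simps)
    finally show ?thesis .
  qed
  show ?thesis
  proof (cases "?a = 0")
    case True
    have "?b = 0"
    proof (rule ccontr)
      assume nb: "?b \<noteq> 0"
      \<comment> \<open>Without a quadratic term the expression is affine in s, and this s brings it
        down to -1.\<close>
      have "0 \<le> ?c - 2 * ((?c + 1) / (2 * ?b)) * ?b" using q[of "(?c + 1) / (2 * ?b)"] True by simp
      also have "... = -1" using nb by (simp add: field_simps)
      finally show False by simp
    qed
    then show ?thesis using True by simp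
  next
    case False
    then have a: "?a > 0" using psd[of y] by simp
    have "0 \<le> ?c - 2 * (?b / ?a) * ?b + (?b / ?a)\<^sup>2 * ?a" by (rule q)
    also have "... = ?c - ?b\<^sup>2 / ?a" using a by (simp add: power2_eq_square field_simps)
    finally show ?thesis using a by (simp add: field_simps)
  qed
qed

lemma psd_cauchy_schwarz:
  fixes A :: "real^'n^'n"
  assumes "transpose A = A" "\<And>x. 0 \<le> x \<bullet> (A *v x)"
  shows "\<bar>x \<bullet> (A *v y)\<bar> \<le> seminorm_of A x * seminorm_of A y"
proof -
  have "\<bar>x \<bullet> (A *v y)\<bar> = sqrt ((x \<bullet> (A *v y))\<^sup>2)" by simp
  also have "... \<le> sqrt ((x \<bullet> (A *v x)) * (y \<bullet> (A *v y)))"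
    using psd_cauchy_schwarz_sq[OF assms] by (rule real_sqrt_le_mono)
  finally show ?thesis by (simp add: seminorm_of_def real_sqrt_mult)
qed

lemma seminorm_of_triangle:
  fixes A :: "real^'n^'n"
  assumes sym: "transpose A = A" and psd: "\<And>x. 0 \<le> x \<bullet> (A *v x)"
  shows "seminorm_of A (x + y) \<le> seminorm_of A x + seminorm_of A y"
proof -
  have yx: "y \<bullet> (A *v x) = x \<bullet> (A *v y)"
    using sym_matrix_dot[OF sym, of y x] by (simp add: inner_commute)
  have "(x + y) \<bullet> (A *v (x + y)) = x \<bullet> (A *v x) + 2 * (x \<bullet> (A *v y)) + y \<bullet> (A *v y)"
    using yx by (simp add: matrix_vector_right_distrib inner_add_left inner_add_right)
  also have "... \<le> (seminorm_of A x)\<^sup>2 + 2 * (seminorm_of A x * seminorm_of A y) + (seminorm_of A y)\<^sup>2"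
    using psd_cauchy_schwarz[OF sym psd, of x y] psd by (simp add: seminorm_of_def)
  also have "... = (seminorm_of A x + seminorm_of A y)\<^sup>2" by (simp add: power2_sum)
  finally show ?thesis
    unfolding seminorm_of_def[of A "x + y"]
    using real_le_lsqrt psd by (simp add: seminorm_of_def)
qed

lemma seminorm_of_scaleR: "seminorm_of A (c *\<^sub>R x) = \<bar>c\<bar> * seminorm_of A x"
proof -
  have "(c *\<^sub>R x) \<bullet> (A *v (c *\<^sub>R x)) = c^2 * (x \<bullet> (A *v x))"
    by (simp add: matrix_vector_mult_scaleR power2_eq_square)
  then show ?thesis by (simp add: seminorm_of_def real_sqrt_mult)
qed

lemma seminorm_of_minus: "seminorm_of A (- x) = seminorm_of A x"
  using seminorm_of_scaleR[of A "-1" x] by simp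

lemma seminorm_of_power2:
  assumes "\<And>x. 0 \<le> x \<bullet> (A *v x)"
  shows "(seminorm_of A x)\<^sup>2 = x \<bullet> (A *v x)"
  using assms by (simp add: seminorm_of_def)

lemma seminorm_of_nonneg: "(\<And>x. 0 \<le> x \<bullet> (A *v x)) \<Longrightarrow> 0 \<le> seminorm_of A x"
  by (simp add: seminorm_of_def)

text \<open>A maximiser v of the form on the compact sphere gives c I - A positive semidefinite with
  value 0 at v; Cauchy-Schwarz for that form then annihilates (c I - A) v. This replaces Lagrange
  multipliers.\<close>

lemma quadratic_form_max_eigenvector:
  fixes A :: "real^'n^'n"
  assumes sym: "transpose A = A"
  obtains v c where "norm v = 1" "A *v v = c *\<^sub>R v" "\<And>x. x \<bullet> (A *v x) \<le> c * (norm x)\<^sup>2"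
proof -
  have ne: "sphere (0::real^'n) 1 \<noteq> {}"
    by (metis mem_sphere_0 empty_iff norm_axis_1)
  have cont: "continuous_on (sphere 0 1) (\<lambda>x::real^'n. x \<bullet> (A *v x))"
    by (intro continuous_on_inner continuous_on_id matrix_vector_mult_linear_continuous_on)
  obtain v where v: "v \<in> sphere 0 1" "\<And>x. x \<in> sphere 0 1 \<Longrightarrow> x \<bullet> (A *v x) \<le> v \<bullet> (A *v v)"
    using continuous_attains_sup[OF compact_sphere ne cont] by blast
  define c where "c = v \<bullet> (A *v v)"
  have nv: "norm v = 1" using v(1) by simp
  have le: "x \<bullet> (A *v x) \<le> c * (norm x)\<^sup>2" for x
  proof (cases "x = 0")
    case False
    have "((1 / norm x) *\<^sub>R x) \<bullet> (A *v ((1 / norm x) *\<^sub>R x)) \<le> c"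
      unfolding c_def by (rule v(2)) (use False in simp)
    then show ?thesis using False
      by (simp add: matrix_vector_mult_scaleR power2_eq_square field_simps)
  qed simp
  define C where "C = c *\<^sub>R mat 1 - A"
  have Cv: "C *v x = c *\<^sub>R x - A *v x" for x
    unfolding C_def by (simp add: matrix_vector_mult_diff_rdistrib scaleR_matrix_vector_assoc[symmetric])
  have symC: "transpose C = C"
    using sym unfolding C_def transpose_def by (simp add: vec_eq_iff mat_def)
  have psd: "0 \<le> x \<bullet> (C *v x)" for x
    using le[of x] by (simp add: Cv inner_diff_right power2_norm_eq_inner)
  have "v \<bullet> (C *v v) = 0" using nv by (simp add: Cv inner_diff_right c_def norm_eq_1)
  then have "(C *v v) \<bullet> (C *v v) = 0"
    using psd_cauchy_schwarz_sq[OF symC psd, of "C *v v" v] by simp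
  then have "A *v v = c *\<^sub>R v" by (simp add: Cv)
  then show thesis using that nv le by blast
qed

text \<open>Eigenvectors for different eigenvalues are orthogonal, hence independent. Finiteness is
  what gives \<open>Min\<close> and \<open>Max\<close> in the definitions of the extreme eigenvalues
  their meaning.\<close>

lemma finite_eigenvalues_symmetric:
  fixes A :: "real^'n^'n"
  assumes sym: "transpose A = A"
  shows "finite (eigenvalues A)"
proof -
  define f where "f \<mu> = (SOME v. eigenvector_of A \<mu> v)" for \<mu>
  have f: "eigenvector_of A \<mu> (f \<mu>)" if "\<mu> \<in> eigenvalues A" for \<mu>
    using that unfolding eigenvalues_def f_def by (auto intro: someI_ex)
  have orth: "f \<mu> \<bullet> f \<nu> = 0" if "\<mu> \<in> eigenvalues A" "\<nu> \<in> eigenvalues A" "\<mu> \<noteq> \<nu>" for \<mu> \<nu>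
  proof -
    have "\<mu> * (f \<mu> \<bullet> f \<nu>) = \<nu> * (f \<mu> \<bullet> f \<nu>)"
      using sym_matrix_dot[OF sym, of "f \<mu>" "f \<nu>"] f[OF that(1)] f[OF that(2)]
      by (simp add: eigenvector_of_def)
    then show ?thesis using that(3) by simp
  qed
  have nz: "f \<mu> \<noteq> 0" if "\<mu> \<in> eigenvalues A" for \<mu>
    using f[OF that] by (simp add: eigenvector_of_def)
  have inj: "inj_on f (eigenvalues A)"
    using orth nz by (metis inj_onI inner_eq_zero_iff)
  have "pairwise orthogonal (f ` eigenvalues A)"
    using orth by (auto simp: pairwise_def orthogonal_def)
  moreover have "0 \<notin> f ` eigenvalues A" using nz by auto
  ultimately have "independent (f ` eigenvalues A)"
    by (rule pairwise_orthogonal_independent)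
  then have "finite (f ` eigenvalues A)" by (rule independent_imp_finite)
  then show ?thesis using inj by (rule finite_imageD)
qed

lemma min_eigenvalue_symmetric:
  fixes A :: "real^'n^'n"
  assumes sym: "transpose A = A"
  shows "min_eigenvalue A * (norm x)\<^sup>2 \<le> x \<bullet> (A *v x)"
    and "\<exists>v. norm v = 1 \<and> A *v v = min_eigenvalue A *\<^sub>R v"
proof -
  have "transpose (- A) = - A" using sym by (simp add: transpose_def vec_eq_iff)
  then obtain v c where v: "norm v = 1" "(- A) *v v = c *\<^sub>R v" "\<And>x. x \<bullet> ((- A) *v x) \<le> c * (norm x)\<^sup>2"
    by (rule quadratic_form_max_eigenvector) blast
  have neg: "(- A) *v x = - (A *v x)" for x
    using matrix_vector_mult_diff_rdistrib[of 0 A x] by simp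
  have ev: "A *v v = (- c) *\<^sub>R v" using v(2) neg[of v] by (metis minus_equation_iff scaleR_minus_left)
  have le: "- c * (norm x)\<^sup>2 \<le> x \<bullet> (A *v x)" for x
    using v(3)[of x] neg[of x] by simp
  have mem: "- c \<in> eigenvalues A"
    unfolding eigenvalues_def eigenvector_of_def using ev v(1)
    by (intro CollectI exI[of _ v]) auto
  have "- c \<le> \<mu>" if "\<mu> \<in> eigenvalues A" for \<mu>
  proof -
    from that obtain u where u: "u \<noteq> 0" "A *v u = \<mu> *\<^sub>R u"
      unfolding eigenvalues_def eigenvector_of_def by blast
    have "- c * (norm u)\<^sup>2 \<le> \<mu> * (norm u)\<^sup>2"
      using le[of u] u(2) by (simp add: power2_norm_eq_inner)
    moreover have "(norm u)\<^sup>2 > 0" using u(1) by simp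
    ultimately show ?thesis by (metis mult_le_cancel_right_pos)
  qed
  then have m: "min_eigenvalue A = - c"
    unfolding min_eigenvalue_def using finite_eigenvalues_symmetric[OF sym] mem by (intro Min_eqI) auto
  show "min_eigenvalue A * (norm x)\<^sup>2 \<le> x \<bullet> (A *v x)" using le m by simp
  show "\<exists>v. norm v = 1 \<and> A *v v = min_eigenvalue A *\<^sub>R v" using ev v(1) m by auto
qed

lemma unit_leading_eigenvector_symmetric:
  fixes A :: "real^'n^'n"
  assumes sym: "transpose A = A" and lead: "unit_leading_eigenvector A v"
  shows "norm v = 1" "A *v v = max_eigenvalue A *\<^sub>R v" "x \<bullet> (A *v x) \<le> max_eigenvalue A * (norm x)\<^sup>2"
proof -
  show "norm v = 1" "A *v v = max_eigenvalue A *\<^sub>R v"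
    using lead by (auto simp: unit_leading_eigenvector_def eigenvector_of_def)
  obtain u c where u: "norm u = 1" "A *v u = c *\<^sub>R u" "\<And>x. x \<bullet> (A *v x) \<le> c * (norm x)\<^sup>2"
    using quadratic_form_max_eigenvector[OF sym] by blast
  have "c \<in> eigenvalues A"
    unfolding eigenvalues_def eigenvector_of_def using u(1,2)
    by (intro CollectI exI[of _ u]) auto
  then have "c \<le> max_eigenvalue A"
    unfolding max_eigenvalue_def using finite_eigenvalues_symmetric[OF sym] by (simp add: Max_ge)
  then have "c * (norm x)\<^sup>2 \<le> max_eigenvalue A * (norm x)\<^sup>2" by (simp add: mult_right_mono)
  then show "x \<bullet> (A *v x) \<le> max_eigenvalue A * (norm x)\<^sup>2" using u(3)[of x] by linarith
qed

section \<open>Matrices dominating the identity: inverse, dual norms, trace of the inverse\<close>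

locale posdef =
  fixes Lam :: "real^'d^'d"
  assumes sym: "transpose Lam = Lam" and ge_one: "\<And>x. (norm x)\<^sup>2 \<le> x \<bullet> (Lam *v x)"
begin

definition "Gm = matrix_inv Lam"
definition "ell = min_eigenvalue Lam"

lemma Lam_psd: "0 \<le> x \<bullet> (Lam *v x)"
  using ge_one[of x] by (meson order_trans zero_le_power2)

lemma invertible_Lam: "invertible Lam"
proof -
  have "x = 0" if "Lam *v x = 0" for x using ge_one[of x] that by simp
  then show ?thesis by (simp add: invertible_left_inverse matrix_left_invertible_ker)
qed

lemma Lam_Gm [simp]: "Lam *v (Gm *v x) = x"
  and Gm_Lam [simp]: "Gm *v (Lam *v x) = x"
proof -
  have "Lam ** Gm = mat 1 \<and> Gm ** Lam = mat 1"
    using invertible_Lam unfolding Gm_def matrix_inv_def invertible_def by (rule someI_ex)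
  then show "Lam *v (Gm *v x) = x" "Gm *v (Lam *v x) = x"
    by (simp_all add: matrix_vector_mul_assoc)
qed

lemma Lam_dot: "(Lam *v x) \<bullet> y = x \<bullet> (Lam *v y)" by (rule sym_matrix_dot[OF sym])

lemma Gm_dot: "(Gm *v x) \<bullet> y = x \<bullet> (Gm *v y)"
  by (metis Lam_Gm Lam_dot)

lemma Gm_dot_comm: "y \<bullet> (Gm *v x) = x \<bullet> (Gm *v y)"
  by (metis Gm_dot inner_commute)

lemma Gm_sym: "transpose Gm = Gm"
proof (rule matrix_eq[THEN iffD2], rule allI)
  fix x
  show "transpose Gm *v x = Gm *v x"
  proof (rule vector_eq_rdot[THEN iffD1], rule allI)
    fix y
    show "(transpose Gm *v x) \<bullet> y = (Gm *v x) \<bullet> y"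
      by (metis Gm_dot dot_lmul_matrix transpose_matrix_vector)
  qed
qed

lemma ell_le: "ell * (norm x)\<^sup>2 \<le> x \<bullet> (Lam *v x)"
  unfolding ell_def by (rule min_eigenvalue_symmetric(1)[OF sym])

lemma ell_vec: obtains v where "norm v = 1" "Lam *v v = ell *\<^sub>R v" "Gm *v v = (1 / ell) *\<^sub>R v"
proof -
  obtain v where v: "norm v = 1" "Lam *v v = ell *\<^sub>R v"
    unfolding ell_def using min_eigenvalue_symmetric(2)[OF sym] by blast
  have "ell \<noteq> 0" using v ge_one[of v] by auto
  moreover have "v = ell *\<^sub>R (Gm *v v)"
    using arg_cong[OF v(2), of "\<lambda>x. Gm *v x"] by (simp add: matrix_vector_mult_scaleR)
  ultimately have "Gm *v v = (1 / ell) *\<^sub>R v"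
    by (metis divide_self_if scaleR_one scaleR_scaleR times_divide_eq_left mult_1)
  then show thesis using that v by blast
qed

lemma ell_ge_one: "1 \<le> ell"
proof -
  obtain v where v: "norm v = 1" "Lam *v v = ell *\<^sub>R v" by (rule ell_vec)
  have "v \<bullet> v = 1" using v(1) by (simp add: norm_eq_1)
  then show ?thesis using ge_one[of v] v by simp
qed

lemma ell_pos: "0 < ell" using ell_ge_one by simp

lemma Gm_psd: "0 \<le> x \<bullet> (Gm *v x)"
  by (metis Gm_dot Lam_Gm Lam_psd)

lemma Gm_norm_sq: "(norm (Gm *v x))\<^sup>2 \<le> (x \<bullet> (Gm *v x)) / ell"
proof -
  have "ell * (norm (Gm *v x))\<^sup>2 \<le> (Gm *v x) \<bullet> (Lam *v (Gm *v x))" by (rule ell_le)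
  also have "... = x \<bullet> (Gm *v x)" by (simp add: Gm_dot)
  finally show ?thesis using ell_pos by (simp add: field_simps)
qed

lemma Gm_quad_le: "x \<bullet> (Gm *v x) \<le> (norm x)\<^sup>2 / ell"
proof (cases "x \<bullet> (Gm *v x) = 0")
  case True then show ?thesis using ell_pos by simp
next
  case False
  let ?q = "x \<bullet> (Gm *v x)"
  have q: "?q > 0" using False Gm_psd[of x] by simp
  have "?q\<^sup>2 \<le> (norm x)\<^sup>2 * (norm (Gm *v x))\<^sup>2"
    by (metis Cauchy_Schwarz_ineq power2_norm_eq_inner)
  also have "... \<le> (norm x)\<^sup>2 * (?q / ell)" by (rule mult_left_mono[OF Gm_norm_sq]) simp
  finally have "?q * ?q \<le> ((norm x)\<^sup>2 / ell) * ?q" by (simp add: power2_eq_square)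
  then show ?thesis using q by (rule mult_right_le_imp_le)
qed

lemma Gm_quad_le_one: "x \<bullet> (Gm *v x) \<le> (norm x)\<^sup>2"
proof -
  have "(norm x)\<^sup>2 / ell \<le> (norm x)\<^sup>2 / 1" using ell_ge_one by (intro divide_left_mono) auto
  then show ?thesis using Gm_quad_le[of x] by simp
qed

lemma Gm_norm: "norm (Gm *v x) \<le> norm x / ell"
proof -
  have "(norm (Gm *v x))\<^sup>2 \<le> (norm x)\<^sup>2 / ell / ell"
    using Gm_norm_sq[of x] Gm_quad_le[of x] ell_pos
    by (meson divide_right_mono less_imp_le order_trans)
  also have "... = (norm x / ell)\<^sup>2" by (simp add: power2_eq_square)
  finally show ?thesis using ell_pos by (rule_tac power2_le_imp_le) auto
qed

abbreviation "nG \<equiv> seminorm_of Gm"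
abbreviation "nL \<equiv> seminorm_of Lam"

lemmas nG_cs = psd_cauchy_schwarz[OF Gm_sym Gm_psd]
lemmas nG_triangle = seminorm_of_triangle[OF Gm_sym Gm_psd]
lemmas nL_cs = psd_cauchy_schwarz[OF sym Lam_psd]
lemmas nL_triangle = seminorm_of_triangle[OF sym Lam_psd]
lemmas nG_power2 = seminorm_of_power2[OF Gm_psd]
lemmas nL_power2 = seminorm_of_power2[OF Lam_psd]
lemmas nG_nonneg = seminorm_of_nonneg[OF Gm_psd]
lemmas nL_nonneg = seminorm_of_nonneg[OF Lam_psd]

lemma nL_Gm: "nL (Gm *v x) = nG x"
  by (simp add: seminorm_of_def Gm_dot)

lemma nG_le: "nG x \<le> norm x / sqrt ell"
proof -
  have "sqrt (x \<bullet> (Gm *v x)) \<le> sqrt ((norm x)\<^sup>2 / ell)" by (rule real_sqrt_le_mono[OF Gm_quad_le])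
  then show ?thesis by (simp add: seminorm_of_def real_sqrt_divide)
qed

lemma nL_ge: "sqrt ell * norm x \<le> nL x"
proof -
  have "sqrt (ell * (norm x)\<^sup>2) \<le> sqrt (x \<bullet> (Lam *v x))" by (rule real_sqrt_le_mono[OF ell_le])
  then show ?thesis by (simp add: seminorm_of_def real_sqrt_mult)
qed

lemma dual_cs: "\<bar>x \<bullet> y\<bar> \<le> nL x * nG y"
proof -
  have "\<bar>x \<bullet> (Lam *v (Gm *v y))\<bar> \<le> nL x * nL (Gm *v y)" by (rule nL_cs)
  then show ?thesis by (simp add: nL_Gm)
qed

lemma nG_triangle_diff: "nG x - nG y \<le> nG (x - y)"
  using nG_triangle[of "x - y" y] by simp

text \<open>The trace of the inverse stands in for 1 / ell: the two agree up to the factor d, and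
  unlike ell the trace changes by an explicit amount under a rank-one update.\<close>

definition "tau = (\<Sum>i\<in>UNIV. axis i 1 \<bullet> (Gm *v axis i 1))"

lemma tau_le: "tau \<le> real CARD('d) / ell"
proof -
  have "tau \<le> (\<Sum>i\<in>(UNIV::'d set). 1 / ell)"
    unfolding tau_def
  proof (rule sum_mono)
    fix i :: 'd
    show "axis i 1 \<bullet> (Gm *v axis i 1) \<le> 1 / ell"
      using Gm_quad_le[of "axis i 1"] by simp
  qed
  then show ?thesis by simp
qed

text \<open>Expanding the eigenvector for \<open>ell\<close> in coordinates, the triangle inequality
  for \<open>nG\<close> and Cauchy-Schwarz on the coefficients give the bound without a spectral
  decomposition.\<close>

lemma tau_ge: "1 / ell \<le> tau"
proof -
  obtain v where v: "norm v = 1" "Gm *v v = (1 / ell) *\<^sub>R v" by (rule ell_vec)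
  have vv: "v \<bullet> v = 1" using v(1) by (simp add: norm_eq_1)
  let ?e = "\<lambda>i::'d. axis i (1::real)"
  have nGs: "nG (\<Sum>i\<in>S. f i) \<le> (\<Sum>i\<in>S. nG (f i))" if "finite S" for S and f :: "'d \<Rightarrow> real^'d"
    using that
  proof (induction S rule: finite_induct)
    case empty show ?case by (simp add: seminorm_of_def)
  next
    case (insert i S) then show ?case using nG_triangle[of "f i" "\<Sum>i\<in>S. f i"] by simp
  qed
  have vsum: "v = (\<Sum>i\<in>UNIV. (v $ i) *\<^sub>R ?e i)"
    by (simp add: vec_eq_iff axis_def if_distrib cong: if_cong)
  have "nG v \<le> (\<Sum>i\<in>UNIV. nG ((v $ i) *\<^sub>R ?e i))" using nGs[of UNIV] vsum by (metis finite)
  also have "... = (\<Sum>i\<in>UNIV. \<bar>v $ i\<bar> * nG (?e i))" by (simp add: seminorm_of_scaleR)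
  finally have a: "nG v \<le> (\<Sum>i\<in>UNIV. \<bar>v $ i\<bar> * nG (?e i))" .
  have "1 / ell = (nG v)\<^sup>2" using v vv by (simp add: nG_power2)
  also have "... \<le> (\<Sum>i\<in>UNIV. \<bar>v $ i\<bar> * nG (?e i))\<^sup>2"
    using a nG_nonneg by (intro power_mono) auto
  also have "... \<le> (\<Sum>i\<in>UNIV. \<bar>v $ i\<bar>\<^sup>2) * (\<Sum>i\<in>UNIV. (nG (?e i))\<^sup>2)"
    by (rule Cauchy_Schwarz_ineq_sum)
  also have "(\<Sum>i\<in>UNIV. \<bar>v $ i\<bar>\<^sup>2) = 1"
    using vv by (simp add: inner_vec_def power2_eq_square)
  finally show ?thesis by (simp add: tau_def nG_power2)
qed

lemma tau_pos: "0 < tau"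
  using tau_ge ell_pos by (meson divide_pos_pos less_le_trans zero_less_one)

lemma ell_ge_tau: "1 / tau \<le> ell"
  using tau_ge tau_pos ell_pos by (simp add: field_simps)

end

section \<open>A single LinUCB step\<close>

locale ucb_step = posdef Lam for Lam :: "real^'d^'d" +
  fixes \<beta> :: real and hh a :: "real^'d"
  assumes beta_pos: "\<beta> > 0" and norm_hh: "norm hh = 1"
    and argmax: "is_arg_max (ucb_score \<beta> Lam hh) (\<lambda>x. x \<in> cball 0 1) a"
begin

definition "w = nG a"
definition "mu = a \<bullet> hh + \<beta> * w"

lemma score_eq: "ucb_score \<beta> Lam hh x = x \<bullet> hh + \<beta> * nG x"
  by (simp add: ucb_score_def seminorm_of_def Gm_def)

lemma score_le: "norm x \<le> 1 \<Longrightarrow> x \<bullet> hh + \<beta> * nG x \<le> mu"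
  using argmax unfolding is_arg_max_def score_eq mu_def w_def by (force simp: not_less)

lemma norm_a_le: "norm a \<le> 1"
  using argmax by (simp add: is_arg_max_def)

lemma mu_ge_one: "1 \<le> mu"
proof -
  have "hh \<bullet> hh + \<beta> * nG hh \<le> mu" using norm_hh by (intro score_le) simp
  moreover have "hh \<bullet> hh = 1" using norm_hh by (simp add: norm_eq_1)
  moreover have "0 \<le> \<beta> * nG hh" using beta_pos nG_nonneg by simp
  ultimately show ?thesis by simp
qed

lemma w_nonneg: "0 \<le> w" by (simp add: w_def nG_nonneg)

lemma w_sq: "w^2 = a \<bullet> (Gm *v a)" by (simp add: w_def nG_power2)

text \<open>If w vanished, so would a, and its score would be 0 while the score of \<open>hh\<close>
  is at least 1. Positivity allows the bonus to be differentiated at a.\<close>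

lemma w_pos: "0 < w"
proof (rule ccontr)
  assume "\<not> 0 < w"
  then have w0: "w = 0" using w_nonneg by simp
  then have "(norm (Gm *v a))\<^sup>2 \<le> 0" using Gm_norm_sq[of a] w_sq by simp
  then have "Gm *v a = 0" by simp
  then have "a = 0" by (metis Lam_Gm matrix_vector_mult_0_right)
  then show False using mu_ge_one w0 unfolding mu_def by simp
qed

text \<open>By convexity of the score, the supporting linear functional at the maximiser is itself
  maximised over the ball at the same point.\<close>

lemma kkt: "hh + (\<beta> / w) *\<^sub>R (Gm *v a) = mu *\<^sub>R a" and norm_a: "norm a = 1"
proof -
  define g where "g = hh + (\<beta> / w) *\<^sub>R (Gm *v a)"
  have ga: "g \<bullet> a = mu"
  proof -
    have "(Gm *v a) \<bullet> a = w * w" using w_sq by (simp add: inner_commute power2_eq_square)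
    then show ?thesis using w_pos unfolding g_def mu_def
      by (simp add: inner_add_left inner_commute[of hh a])
  qed
  have gx: "g \<bullet> x \<le> mu" if "norm x \<le> 1" for x
  proof -
    have "(Gm *v a) \<bullet> x \<le> w * nG x"
      using nG_cs[of x a] by (simp add: w_def inner_commute mult.commute)
    then have "(\<beta> / w) * ((Gm *v a) \<bullet> x) \<le> (\<beta> / w) * (w * nG x)"
      using beta_pos w_pos by (intro mult_left_mono) auto
    then have "g \<bullet> x \<le> x \<bullet> hh + \<beta> * nG x"
      using w_pos unfolding g_def inner_add_left inner_scaleR_left inner_commute[of hh x] by simp
    then show ?thesis using score_le[OF that] by linarith
  qed
  have g0: "g \<noteq> 0" using ga mu_ge_one by auto
  have "g \<bullet> ((1 / norm g) *\<^sub>R g) \<le> mu" using g0 by (intro gx) simp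
  then have ng: "norm g \<le> mu" using g0 by (simp add: dot_square_norm power2_eq_square)
  \<comment> \<open>The chain mu \<le> |g| |a| \<le> |g| \<le> mu closes up, so a has norm one, and
    the equality case of Cauchy-Schwarz yields g = mu a.\<close>
  have "mu \<le> norm g * norm a" using ga norm_cauchy_schwarz[of g a] by simp
  moreover have "norm g * norm a \<le> norm g" using norm_a_le by (simp add: mult_left_le)
  ultimately have eqs: "norm g = mu" "norm g * norm a = norm g" using ng by linarith+
  then show na: "norm a = 1" using g0 mu_ge_one by auto
  have "(norm (g - mu *\<^sub>R a))\<^sup>2 = (norm g)\<^sup>2 - 2 * mu * (g \<bullet> a) + mu^2 * (norm a)\<^sup>2"
    unfolding power2_norm_eq_inner
    by (simp add: inner_diff_left inner_diff_right inner_commute[of a g]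
        power2_eq_square algebra_simps)
  also have "... = 0" using eqs(1) na ga by (simp add: power2_eq_square)
  finally show "hh + (\<beta> / w) *\<^sub>R (Gm *v a) = mu *\<^sub>R a" by (simp add: g_def)
qed

lemma w_le: "w \<le> 1 / sqrt ell"
  using nG_le[of a] norm_a by (simp add: w_def)

lemma w_le_one: "w \<le> 1"
  using w_le ell_ge_one by (smt (verit) divide_le_eq_1 real_sqrt_ge_one)

lemma a_dot_le: "a \<bullet> hh \<le> 1"
  using norm_cauchy_schwarz[of a hh] norm_a norm_hh by simp

lemma mu_le: "mu \<le> 1 + \<beta> * w" using a_dot_le by (simp add: mu_def)

text \<open>Moving from \<open>hh\<close> to a loses |a - hh|^2 / 2 in the linear part of the score
  and gains at most \<beta> nG (a - hh) in the bonus. A quadratic loss against a linear gain bounds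
  the distance.\<close>

lemma dist_a_hh: "norm (a - hh) \<le> 2 * \<beta> / sqrt ell"
proof -
  have "(norm (a - hh))\<^sup>2 = 2 - 2 * (a \<bullet> hh)"
    using norm_a norm_hh
    by (simp add: power2_norm_eq_inner inner_diff_left inner_diff_right inner_commute norm_eq_1)
  also have "... \<le> 2 * \<beta> * (nG a - nG hh)"
  proof -
    have "hh \<bullet> hh + \<beta> * nG hh \<le> mu" using norm_hh by (intro score_le) simp
    then show ?thesis using norm_hh by (simp add: mu_def w_def norm_eq_1 algebra_simps)
  qed
  also have "... \<le> 2 * \<beta> * nG (a - hh)"
    using beta_pos nG_triangle_diff[of a hh] by (intro mult_left_mono) auto
  also have "... \<le> 2 * \<beta> * (norm (a - hh) / sqrt ell)"
    using beta_pos nG_le[of "a - hh"] by (intro mult_left_mono) auto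
  finally have "norm (a - hh) * norm (a - hh) \<le> (2 * \<beta> / sqrt ell) * norm (a - hh)"
    by (simp add: power2_eq_square)
  then show ?thesis
    using beta_pos ell_pos mult_right_le_imp_le[of "norm (a - hh)" "norm (a - hh)" "2 * \<beta> / sqrt ell"]
    by (cases "norm (a - hh) = 0") auto
qed

text \<open>Otherwise reflecting the action along an eigenvector for the least eigenvalue, or tilting it
  towards that eigenvector when the two are orthogonal, would increase the score.\<close>

lemma beta_le_w_mu_ell: "\<beta> \<le> w * mu * ell"
proof (rule ccontr)
  assume "\<not> \<beta> \<le> w * mu * ell"
  then have lt: "w * mu * ell < \<beta>" by simp
  obtain v where v: "norm v = 1" "Gm *v v = (1 / ell) *\<^sub>R v" by (rule ell_vec)
  have vv: "v \<bullet> v = 1" using v(1) by (simp add: norm_eq_1)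
  have aa: "a \<bullet> a = 1" using norm_a by (simp add: norm_eq_1)
  have Gav: "(Gm *v a) \<bullet> v = (a \<bullet> v) / ell" using Gm_dot[of a v] v(2) by simp
  have gap: "mu - \<beta> / (w * ell) < 0"
    using lt w_pos ell_pos by (simp add: field_simps)
  \<comment> \<open>The first-order condition paired with v: under the negated claim the coefficient
    is negative, so a and hh would have components of opposite sign along v.\<close>
  have hv: "hh \<bullet> v = (mu - \<beta> / (w * ell)) * (a \<bullet> v)"
    using arg_cong[OF kkt, of "\<lambda>x. x \<bullet> v"] Gav w_pos ell_pos
    by (simp add: inner_add_left field_simps)
  have av: "a \<bullet> v = 0"
  proof (rule ccontr)
    assume nz: "a \<bullet> v \<noteq> 0"
    define x where "x = a - (2 * (a \<bullet> v)) *\<^sub>R v"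
    have "x \<bullet> x = 1"
      by (simp add: x_def inner_diff_left inner_diff_right aa vv inner_commute)
    then have nx: "norm x = 1" by (simp add: norm_eq_1)
    have vGa: "v \<bullet> (Gm *v a) = (a \<bullet> v) / ell" using Gav by (simp add: inner_commute)
    have "x \<bullet> (Gm *v x) = a \<bullet> (Gm *v a)"
      using v(2) vv vGa inner_commute[of v a]
      by (simp add: x_def matrix_vector_mult_diff_distrib matrix_vector_mult_scaleR
          inner_diff_left inner_diff_right)
    then have "nG x = w" by (simp add: w_def seminorm_of_def)
    then have "x \<bullet> hh \<le> a \<bullet> hh" using score_le[of x] nx by (simp add: mu_def)
    then have "2 * (a \<bullet> v) * (hh \<bullet> v) \<ge> 0"
      by (simp add: x_def inner_diff_left inner_commute[of v hh])
    moreover have "(a \<bullet> v) * (hh \<bullet> v) = (mu - \<beta> / (w * ell)) * (a \<bullet> v)\<^sup>2"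
      unfolding hv by (simp add: power2_eq_square)
    ultimately have "0 \<le> (mu - \<beta> / (w * ell)) * (a \<bullet> v)\<^sup>2" by simp
    moreover have "(a \<bullet> v)\<^sup>2 > 0" using nz by simp
    ultimately show False using gap by (simp add: zero_le_mult_iff)
  qed
  then have hv0: "v \<bullet> hh = 0" using hv by (simp add: inner_commute)
  define al where "al = a \<bullet> hh"
  define b where "b = \<beta> * w"
  define e2 where "e2 = \<beta>^2 / ell"
  define g where "g = e2 - b * mu"
  define q where "q = e2 - b^2 + al^2"
  have mu: "mu = al + b" by (simp add: mu_def al_def b_def)
  have g: "g > 0"
  proof -
    have "\<beta> * (w * mu) < \<beta> * (\<beta> / ell)"
      using lt beta_pos ell_pos by (intro mult_strict_left_mono) (auto simp: field_simps)
    then show ?thesis by (simp add: g_def e2_def b_def power2_eq_square)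
  qed
  \<comment> \<open>The trial point has component 1 - r along a. To first order the squared bonus
    exceeds what is needed by 2 r g > 0, and r is small enough that the second-order term r^2 q
    cannot cancel this.\<close>
  define r where "r = min (1/2) (g / (\<bar>q\<bar> + 1))"
  define c where "c = 1 - r"
  have r: "0 < r" "r \<le> 1/2" using g by (simp_all only: r_def min_less_iff_conj min.cobounded1) auto
  have rq: "r * q < 2 * g"
  proof -
    have "r * q \<le> r * \<bar>q\<bar>" using r by (simp add: mult_left_mono)
    also have "... \<le> (g / (\<bar>q\<bar> + 1)) * \<bar>q\<bar>" by (intro mult_right_mono) (auto simp: r_def)
    also have "... \<le> g" using g by (simp add: field_simps)
    finally show ?thesis using g by simp
  qed
  define s where "s = sqrt (1 - c^2)"
  have c: "0 < c" "c < 1" using r by (auto simp: c_def)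
  have s2: "s^2 = 1 - c^2" using c by (simp add: s_def power_le_one)
  define x where "x = c *\<^sub>R a + s *\<^sub>R v"
  have va: "v \<bullet> a = 0" using av by (simp add: inner_commute)
  have "x \<bullet> x = c * c * (a \<bullet> a) + s * s * (v \<bullet> v)" using av va
    by (simp add: x_def inner_add_left inner_add_right)
  also have "... = 1" using s2 aa vv by (simp add: power2_eq_square)
  finally have "x \<bullet> x = 1" .
  then have nx: "norm x = 1" by (simp add: norm_eq_1)
  have vGa: "v \<bullet> (Gm *v a) = 0" using Gav av by (simp add: inner_commute)
  have "x \<bullet> (Gm *v x) = c * c * (a \<bullet> (Gm *v a)) + s * s * (1 / ell)"
    using v(2) vv av vGa
    by (simp add: x_def matrix_vector_right_distrib matrix_vector_mult_scaleR
        inner_add_left inner_add_right)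
  then have "x \<bullet> (Gm *v x) = c^2 * w^2 + s^2 / ell"
    using w_sq by (simp add: power2_eq_square)
  then have "nG x = sqrt (c^2 * w^2 + (1 - c^2) / ell)" unfolding seminorm_of_def s2 by simp
  then have "\<beta> * nG x = sqrt (\<beta>^2 * (c^2 * w^2 + (1 - c^2) / ell))"
    using beta_pos unfolding real_sqrt_mult by simp
  also have "\<beta>^2 * (c^2 * w^2 + (1 - c^2) / ell) = c^2 * b^2 + (1 - c^2) * e2"
    by (simp add: b_def e2_def power_mult_distrib algebra_simps)
  finally have bG: "\<beta> * nG x = sqrt (c^2 * b^2 + (1 - c^2) * e2)" .
  have "x \<bullet> hh = c * al" using hv0 by (simp add: x_def inner_add_left al_def)
  then have le: "c * al + sqrt (c^2 * b^2 + (1 - c^2) * e2) \<le> al + b"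
    using score_le[of x] nx bG mu by simp
  \<comment> \<open>Comparing the two squares avoids expanding the square root: the bonus at the
    trial point exceeds b + al r, which more than pays for the lost linear part al r.\<close>
  have "(c^2 * b^2 + (1 - c^2) * e2) - (al * r + b)\<^sup>2 = r * (2 * g - r * q)"
    by (simp add: c_def g_def q_def mu power2_eq_square algebra_simps)
  also have "... > 0" using r rq by simp
  finally have "al * r + b < sqrt (c^2 * b^2 + (1 - c^2) * e2)"
    by (intro real_less_rsqrt) simp
  moreover have "al * r = al - c * al" by (simp add: c_def algebra_simps)
  ultimately show False using le by linarith
qed

text \<open>Inserts mu \<le> 1 + \<beta> w and w \<le> 1 / sqrt ell into the bound above. The two
  terms of the denominator correspond to the regimes ell \<ge> \<beta>^2 and ell < \<beta>^2, which
  are exploited separately later.\<close>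

lemma w_lower: "\<beta> / (ell + \<beta> * sqrt ell) \<le> w"
proof -
  have sl: "sqrt ell > 0" using ell_pos by simp
  have "\<beta> * w \<le> \<beta> * (1 / sqrt ell)" using w_le beta_pos by (intro mult_left_mono) auto
  then have "\<beta> * w \<le> \<beta> / sqrt ell" by simp
  then have "mu \<le> 1 + \<beta> / sqrt ell" using mu_le by linarith
  then have "w * mu * ell \<le> w * (1 + \<beta> / sqrt ell) * ell"
    using w_pos ell_pos by (intro mult_right_mono mult_left_mono) auto
  also have "... = w * (ell + \<beta> * sqrt ell)"
    using ell_pos sl by (simp add: field_simps)
  finally have "\<beta> \<le> w * (ell + \<beta> * sqrt ell)" using beta_le_w_mu_ell by linarith
  moreover have "ell + \<beta> * sqrt ell > 0" using ell_pos beta_pos sl by (simp add: add_pos_pos)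
  ultimately show ?thesis by (simp add: field_simps)
qed

lemma w_lower_large:
  assumes "\<beta>^2 \<le> ell"
  shows "\<beta> / (2 * ell) \<le> w"
proof -
  have "\<beta> \<le> sqrt ell" using assms beta_pos by (simp add: real_le_rsqrt)
  then have "\<beta> * sqrt ell \<le> sqrt ell * sqrt ell" using ell_pos by (intro mult_right_mono) auto
  then have "ell + \<beta> * sqrt ell \<le> 2 * ell" using ell_pos by simp
  then have "\<beta> / (2 * ell) \<le> \<beta> / (ell + \<beta> * sqrt ell)"
    using beta_pos ell_pos by (intro divide_left_mono mult_pos_pos add_pos_nonneg) auto
  then show ?thesis using w_lower by linarith
qed

end

section \<open>Splitting off a unit direction\<close>

definition proj_orth :: "real^'d \<Rightarrow> real^'d \<Rightarrow> real^'d" where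
  "proj_orth u x = x - (x \<bullet> u) *\<^sub>R u"

lemma proj_orth_dot [simp]: "norm u = 1 \<Longrightarrow> proj_orth u x \<bullet> u = 0"
  by (simp add: proj_orth_def inner_diff_left norm_eq_1)

lemma proj_orth_dot' [simp]: "norm u = 1 \<Longrightarrow> u \<bullet> proj_orth u x = 0"
  by (simp add: proj_orth_def inner_diff_right norm_eq_1 inner_commute)

lemma proj_orth_id: "x \<bullet> u = 0 \<Longrightarrow> proj_orth u x = x"
  by (simp add: proj_orth_def)

lemma proj_orth_self [simp]: "norm u = 1 \<Longrightarrow> proj_orth u u = 0"
  by (simp add: proj_orth_def norm_eq_1)

lemma proj_orth_add: "proj_orth u (x + y) = proj_orth u x + proj_orth u y"
  by (simp add: proj_orth_def inner_add_left algebra_simps)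

lemma proj_orth_diff: "proj_orth u (x - y) = proj_orth u x - proj_orth u y"
  by (simp add: proj_orth_def inner_diff_left algebra_simps)

lemma proj_orth_scaleR: "proj_orth u (c *\<^sub>R x) = c *\<^sub>R proj_orth u x"
  by (simp add: proj_orth_def scaleR_diff_right)

lemma proj_orth_sum: "proj_orth u (\<Sum>i\<in>I. f i) = (\<Sum>i\<in>I. proj_orth u (f i))"
  by (induction I rule: infinite_finite_induct) (auto simp: proj_orth_add, simp_all add: proj_orth_def)

lemma proj_orth_decomp: "x = (x \<bullet> u) *\<^sub>R u + proj_orth u x"
  by (simp add: proj_orth_def)

lemma proj_orth_inner: "y \<bullet> u = 0 \<Longrightarrow> y \<bullet> proj_orth u x = y \<bullet> x"
  by (simp add: proj_orth_def inner_diff_right)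

lemma norm_proj_orth_sq: "norm u = 1 \<Longrightarrow> (norm (proj_orth u x))\<^sup>2 = (norm x)\<^sup>2 - (x \<bullet> u)\<^sup>2"
  unfolding proj_orth_def power2_norm_eq_inner norm_eq_1
  by (simp add: inner_diff_left inner_diff_right inner_commute[of u x] power2_eq_square)

lemma norm_proj_orth_le: "norm u = 1 \<Longrightarrow> norm (proj_orth u x) \<le> norm x"
  using norm_proj_orth_sq[of u x] by (rule_tac power2_le_imp_le) auto

locale posdef_dir = posdef Lam for Lam :: "real^'d^'d" +
  fixes th :: "real^'d"
  assumes norm_th [simp]: "norm th = 1"
begin

definition "pp = th \<bullet> (Lam *v th)"
definition "zz = proj_orth th (Lam *v th)"
text \<open>The slope of \<open>Lam *v th\<close> relative to th: \<open>Lam *v th\<close> is pp (th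
  + mm), so mm vanishes exactly when th is an eigenvector.\<close>

definition "mm = (1 / pp) *\<^sub>R zz"

lemma th_th [simp]: "th \<bullet> th = 1" using norm_th unfolding norm_eq_1 .

lemma pp_ge_one: "1 \<le> pp" using ge_one[of th] by (simp add: pp_def)
lemma pp_pos: "0 < pp" using pp_ge_one by simp

lemma mm_th [simp]: "mm \<bullet> th = 0" "th \<bullet> mm = 0" by (simp_all add: mm_def zz_def)

lemma Lam_th: "Lam *v th = pp *\<^sub>R (th + mm)"
  using proj_orth_decomp[of "Lam *v th" th] pp_pos
  by (simp add: mm_def zz_def pp_def inner_commute scaleR_add_right)

lemma Gm_th: "Gm *v th = (1 / pp) *\<^sub>R th - Gm *v mm"
proof -
  have "th = pp *\<^sub>R (Gm *v th + Gm *v mm)"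
    using arg_cong[OF Lam_th, of "\<lambda>x. Gm *v x"]
    by (simp add: matrix_vector_mult_scaleR matrix_vector_right_distrib)
  then have "(1 / pp) *\<^sub>R th = (1 / pp) *\<^sub>R (pp *\<^sub>R (Gm *v th + Gm *v mm))" by simp
  then have "(1 / pp) *\<^sub>R th = Gm *v th + Gm *v mm" using pp_pos by simp
  then show ?thesis by simp
qed

text \<open>Block elimination of the direction th: applying the inverse to Lam th = pp (th + mm)
  expresses G th through G mm, and everything outside the explicit multiple of th is G applied to a
  vector orthogonal to th.\<close>

lemma Gm_decomp:
  "Gm *v x = ((x \<bullet> th) / pp) *\<^sub>R th + Gm *v (proj_orth th x - (x \<bullet> th) *\<^sub>R mm)"
proof -
  have "Gm *v x = Gm *v ((x \<bullet> th) *\<^sub>R th + proj_orth th x)" using proj_orth_decomp[of x th] by simp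
  also have "... = (x \<bullet> th) *\<^sub>R (Gm *v th) + Gm *v proj_orth th x"
    by (simp add: matrix_vector_right_distrib matrix_vector_mult_scaleR)
  finally show ?thesis
    by (simp add: Gm_th matrix_vector_mult_diff_distrib matrix_vector_mult_scaleR scaleR_diff_right)
qed

lemma Gm_quad_decomp:
  defines "e \<equiv> \<lambda>x. proj_orth th x - (x \<bullet> th) *\<^sub>R mm"
  shows "x \<bullet> (Gm *v x) = (x \<bullet> th)\<^sup>2 / pp + e x \<bullet> (Gm *v e x)"
proof -
  have eth: "e x \<bullet> th = 0" by (simp add: e_def inner_diff_left)
  have "x \<bullet> (Gm *v x) = (x \<bullet> th)\<^sup>2 / pp + x \<bullet> (Gm *v e x)"
    using arg_cong[OF Gm_decomp[of x], of "\<lambda>u. x \<bullet> u"]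
    by (simp add: inner_add_right power2_eq_square e_def)
  moreover have "x \<bullet> (Gm *v e x) = e x \<bullet> (Gm *v x)" by (rule Gm_dot_comm)
  moreover have "e x \<bullet> (Gm *v x) = e x \<bullet> (Gm *v e x)"
    using arg_cong[OF Gm_decomp[of x], of "\<lambda>u. e x \<bullet> u"] eth
    by (simp add: inner_add_right e_def)
  ultimately show ?thesis by simp
qed

end

locale ucb_step_dir = ucb_step Lam \<beta> hh a + posdef_dir Lam th
  for Lam :: "real^'d^'d" and \<beta> hh a th
begin

definition "x0 = a \<bullet> th"
definition "yy = proj_orth th a"
text \<open>One vector with two roles: it carries the part of the bonus not due to th
  (\<open>w_sq_decomp\<close>), and it is the direction in which the slope m moves when a is added
  (\<open>m_Suc\<close>). This couples the choice of actions to the motion of m.\<close>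

definition "eta = yy - x0 *\<^sub>R mm"

lemma eta_th [simp]: "eta \<bullet> th = 0" "th \<bullet> eta = 0"
  by (simp_all add: eta_def yy_def inner_diff_left inner_diff_right)

lemma x0_sq: "x0^2 = 1 - (norm yy)\<^sup>2"
  using norm_proj_orth_sq[of th a] norm_a by (simp add: x0_def yy_def)

lemma Gm_a: "Gm *v a = (x0 / pp) *\<^sub>R th + Gm *v eta"
  using Gm_decomp[of a] by (simp add: x0_def eta_def yy_def)

lemma proj_Gm_a: "proj_orth th (Gm *v a) = proj_orth th (Gm *v eta)"
  by (simp add: Gm_a proj_orth_add proj_orth_scaleR)

lemma w_sq_decomp: "w^2 = x0^2 / pp + eta \<bullet> (Gm *v eta)"
  using Gm_quad_decomp[of a] by (simp add: w_sq x0_def eta_def yy_def)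

lemma eta_quad_le: "eta \<bullet> (Gm *v eta) \<le> norm eta * norm (proj_orth th (Gm *v a))"
proof -
  have "eta \<bullet> (Gm *v eta) = eta \<bullet> proj_orth th (Gm *v eta)" by (simp add: proj_orth_inner)
  then show ?thesis using norm_cauchy_schwarz proj_Gm_a by metis
qed

text \<open>As mu x0 is close to 1, this is nearly the orthogonal part of the estimator minus m. The
  first-order condition turns it into a positive semidefinite image of eta, which is the source of
  the contraction.\<close>

definition "DD = proj_orth th hh - (mu * x0) *\<^sub>R mm"

lemma DD_eq: "DD = mu *\<^sub>R eta - (\<beta> / w) *\<^sub>R proj_orth th (Gm *v eta)"
proof -
  have "proj_orth th hh + (\<beta> / w) *\<^sub>R proj_orth th (Gm *v eta) = mu *\<^sub>R yy"
    using arg_cong[OF kkt, of "proj_orth th"]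
    by (simp add: proj_orth_add proj_orth_scaleR proj_Gm_a yy_def)
  then show ?thesis by (simp add: DD_def eta_def algebra_simps)
qed

text \<open>The matrix \<open>mu I - (\<beta> / w) G\<close> is positive semidefinite and at most \<open>mu\<close>.\<close>

lemma DD_monotone: "(norm DD)\<^sup>2 \<le> mu * (eta \<bullet> DD)"
proof -
  define k where "k = \<beta> / w"
  have k0: "k > 0" using beta_pos w_pos by (simp add: k_def)
  have kl: "k / ell \<le> mu" using beta_le_w_mu_ell w_pos ell_pos by (simp add: k_def field_simps)
  define C where "C = mu *\<^sub>R mat 1 - k *\<^sub>R Gm"
  have Cv: "C *v x = mu *\<^sub>R x - k *\<^sub>R (Gm *v x)" for x
    unfolding C_def by (simp add: matrix_vector_mult_diff_rdistrib scaleR_matrix_vector_assoc[symmetric])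
  have symC: "transpose C = C"
    using Gm_sym unfolding C_def transpose_def by (simp add: vec_eq_iff mat_def)
  have psd: "0 \<le> x \<bullet> (C *v x)" for x
  proof -
    have "k * (x \<bullet> (Gm *v x)) \<le> k * ((norm x)\<^sup>2 / ell)" using k0 Gm_quad_le by (intro mult_left_mono) auto
    also have "... \<le> mu * (norm x)\<^sup>2" using kl mult_right_mono[OF kl, of "(norm x)\<^sup>2"] by simp
    finally show ?thesis by (simp add: Cv inner_diff_right power2_norm_eq_inner)
  qed
  have DP: "DD = proj_orth th (C *v eta)"
    by (simp add: Cv DD_eq proj_orth_diff proj_orth_scaleR proj_orth_id k_def)
  have Dth: "DD \<bullet> th = 0" by (simp add: DP)
  have eD: "eta \<bullet> DD = eta \<bullet> (C *v eta)" by (simp add: DP proj_orth_inner)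
  have DD1: "(norm DD)\<^sup>2 = DD \<bullet> (C *v eta)"
    by (metis DP Dth power2_norm_eq_inner proj_orth_inner)
  have "((norm DD)\<^sup>2)\<^sup>2 \<le> (DD \<bullet> (C *v DD)) * (eta \<bullet> (C *v eta))"
    unfolding DD1 by (rule psd_cauchy_schwarz_sq[OF symC psd])
  also have "... \<le> (mu * (norm DD)\<^sup>2) * (eta \<bullet> (C *v eta))"
  proof (rule mult_right_mono)
    show "DD \<bullet> (C *v DD) \<le> mu * (norm DD)\<^sup>2"
      using k0 Gm_psd[of DD] by (simp add: Cv inner_diff_right power2_norm_eq_inner)
  qed (rule psd)
  finally have "(norm DD)\<^sup>2 * (norm DD)\<^sup>2 \<le> (mu * (eta \<bullet> DD)) * (norm DD)\<^sup>2"
    by (simp add: eD power2_eq_square mult_ac)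
  then show ?thesis
    using psd[of eta] eD mu_ge_one mult_right_le_imp_le[of "(norm DD)\<^sup>2" "(norm DD)\<^sup>2" "mu * (eta \<bullet> DD)"]
    by (cases "norm DD = 0") auto
qed

end

section \<open>Design matrices\<close>

lemma design_matrix_apply:
  "design_matrix x t *v v = v + (\<Sum>s=1..t. (x s \<bullet> v) *\<^sub>R x s)" for x :: "nat \<Rightarrow> real^'d"
proof -
  have cr: "((columnvector u :: real^1^'d) ** rowvector u) *v v = (u \<bullet> v) *\<^sub>R u" for u :: "real^'d"
    by (simp add: vec_eq_iff matrix_vector_mult_def matrix_matrix_mult_def columnvector_def
        rowvector_def inner_vec_def sum_distrib_left sum_distrib_right mult_ac)
  have "(\<Sum>s\<in>S. (columnvector (x s) :: real^1^'d) ** rowvector (x s)) *v v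
      = (\<Sum>s\<in>S. (x s \<bullet> v) *\<^sub>R x s)" if "finite S" for S
    using that by (induction S rule: finite_induct) (auto simp: matrix_vector_mult_add_rdistrib cr)
  then show ?thesis by (simp add: design_matrix_def matrix_vector_mult_add_rdistrib)
qed

lemma design_matrix_symmetric: "transpose (design_matrix x t) = design_matrix x t"
  for x :: "nat \<Rightarrow> real^'d"
  by (simp add: design_matrix_def transpose_def vec_eq_iff mat_def matrix_matrix_mult_def
      columnvector_def rowvector_def mult.commute)

lemma design_matrix_quadratic:
  "v \<bullet> (design_matrix x t *v u) = v \<bullet> u + (\<Sum>s=1..t. (x s \<bullet> v) * (x s \<bullet> u))" for x :: "nat \<Rightarrow> real^'d"
  by (simp add: design_matrix_apply inner_add_right inner_sum_right inner_commute mult.commute)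

lemma posdef_design_matrix: "posdef (design_matrix x t)" for x :: "nat \<Rightarrow> real^'d"
proof
  show "transpose (design_matrix x t) = design_matrix x t" by (rule design_matrix_symmetric)
  fix v :: "real^'d"
  have "0 \<le> (\<Sum>s=1..t. (x s \<bullet> v) * (x s \<bullet> v))" by (intro sum_nonneg) auto
  then show "(norm v)\<^sup>2 \<le> v \<bullet> (design_matrix x t *v v)"
    by (simp add: design_matrix_quadratic power2_norm_eq_inner)
qed

lemma exists_unit_orthogonal:
  fixes th :: "real^'d"
  assumes "2 \<le> CARD('d)"
  shows "\<exists>u :: real^'d. norm u = 1 \<and> u \<bullet> th = 0"
proof -
  have "2 \<le> DIM(real^'d)" using assms by simp
  then obtain x where x: "x \<noteq> 0" "orthogonal th x" by (rule orthogonal_to_vector_exists)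
  then have "x \<bullet> th = 0" by (simp add: orthogonal_def inner_commute)
  then show ?thesis using x(1) by (intro exI[of _ "(1 / norm x) *\<^sub>R x"]) simp
qed

section \<open>Rank-one updates of the quantities attached to a sequence of actions\<close>

locale design =
  fixes a :: "nat \<Rightarrow> real^'d" and th :: "real^'d"
  assumes norm_th_one: "norm th = 1"
begin

abbreviation "Lam \<equiv> design_matrix a"
abbreviation "G t \<equiv> posdef.Gm (Lam t)"
abbreviation "el t \<equiv> posdef.ell (Lam t)"
abbreviation "ta t \<equiv> posdef.tau (Lam t)"
abbreviation "p t \<equiv> posdef_dir.pp (Lam t) th"
abbreviation "z t \<equiv> posdef_dir.zz (Lam t) th"
abbreviation "m t \<equiv> posdef_dir.mm (Lam t) th"
abbreviation "y t \<equiv> proj_orth th (a t)"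
abbreviation "nGa t \<equiv> seminorm_of (G t) (a (Suc t))"
definition "B t = 1 + (\<Sum>s=1..t. (norm (y s))\<^sup>2)"

sublocale D: posdef_dir "Lam t" th for t
proof -
  interpret posdef "Lam t" by (rule posdef_design_matrix)
  show "posdef_dir (Lam t) th" by unfold_locales (rule norm_th_one)
qed

lemma Lam_Suc: "Lam (Suc t) *v x = Lam t *v x + (a (Suc t) \<bullet> x) *\<^sub>R a (Suc t)"
  by (simp add: design_matrix_apply)

lemma Lam_0: "Lam 0 *v x = x" by (simp add: design_matrix_apply)

lemma G_0: "G 0 *v x = x" using D.Gm_Lam[of 0 x] by (simp add: Lam_0)

lemma nGa_sq: "(nGa t)\<^sup>2 = a (Suc t) \<bullet> (G t *v a (Suc t))" by (rule D.nG_power2)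

text \<open>The Sherman-Morrison formula, verified by applying the updated design matrix to the
  candidate.\<close>

lemma G_Suc:
  "G (Suc t) *v x = G t *v x - ((a (Suc t) \<bullet> (G t *v x)) / (1 + (nGa t)\<^sup>2)) *\<^sub>R (G t *v a (Suc t))"
proof -
  let ?b = "a (Suc t)"
  let ?c = "(?b \<bullet> (G t *v x)) / (1 + (nGa t)\<^sup>2)"
  let ?u = "G t *v x - ?c *\<^sub>R (G t *v ?b)"
  have pos: "1 + (nGa t)\<^sup>2 > 0" by (simp add: add_pos_nonneg)
  have bu: "?b \<bullet> ?u = ?c"
  proof -
    have "?b \<bullet> ?u = ?b \<bullet> (G t *v x) - ?c * (nGa t)\<^sup>2" by (simp add: inner_diff_right nGa_sq)
    also have "... = ?c * (1 + (nGa t)\<^sup>2) - ?c * (nGa t)\<^sup>2" using pos by simp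
    also have "... = ?c" by (simp only: distrib_left mult_1_right add_diff_cancel_right')
    finally show ?thesis .
  qed
  have "Lam (Suc t) *v ?u = Lam t *v ?u + ?c *\<^sub>R ?b" unfolding Lam_Suc bu ..
  also have "... = x" by (simp add: matrix_vector_mult_diff_distrib matrix_vector_mult_scaleR)
  finally show ?thesis using D.Gm_Lam[of "Suc t" ?u] by simp
qed

lemma G_Suc_a: "G (Suc t) *v a (Suc t) = (1 / (1 + (nGa t)\<^sup>2)) *\<^sub>R (G t *v a (Suc t))"
proof -
  have pos: "1 + (nGa t)\<^sup>2 > 0" by (simp add: add_pos_nonneg)
  have "G (Suc t) *v a (Suc t)
      = (1 - (nGa t)\<^sup>2 / (1 + (nGa t)\<^sup>2)) *\<^sub>R (G t *v a (Suc t))"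
    by (simp add: G_Suc nGa_sq[symmetric] scaleR_diff_left)
  also have "1 - (nGa t)\<^sup>2 / (1 + (nGa t)\<^sup>2) = 1 / (1 + (nGa t)\<^sup>2)"
    using pos by (simp add: field_simps)
  finally show ?thesis .
qed

lemma norm_G_Suc_a_le: "norm (proj_orth th (G (Suc t) *v a (Suc t))) \<le> norm (proj_orth th (G t *v a (Suc t)))"
proof -
  have "1 / (1 + (nGa t)\<^sup>2) \<le> 1" by (simp add: divide_le_eq_1 add_pos_nonneg)
  then have "1 / (1 + (nGa t)\<^sup>2) * norm (proj_orth th (G t *v a (Suc t)))
      \<le> 1 * norm (proj_orth th (G t *v a (Suc t)))"
    by (intro mult_right_mono) auto
  moreover have "0 \<le> 1 + (nGa t)\<^sup>2" by (simp add: add_nonneg_nonneg)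
  ultimately show ?thesis by (simp add: G_Suc_a proj_orth_scaleR)
qed

text \<open>The trace of the Sherman-Morrison correction. Every step with G a nonzero is visible
  here, whereas a single rank-one update can leave the least eigenvalue where it is.\<close>

lemma ta_Suc: "ta (Suc t) = ta t - (norm (G t *v a (Suc t)))\<^sup>2 / (1 + (nGa t)\<^sup>2)"
proof -
  let ?g = "G t *v a (Suc t)"
  have "axis i 1 \<bullet> (G (Suc t) *v axis i 1)
      = axis i 1 \<bullet> (G t *v axis i 1) - (?g $ i)\<^sup>2 / (1 + (nGa t)\<^sup>2)" for i
  proof -
    have "a (Suc t) \<bullet> (G t *v axis i 1) = axis i 1 \<bullet> ?g" by (rule D.Gm_dot_comm)
    then show ?thesis
      by (simp add: G_Suc inner_diff_right inner_axis' power2_eq_square)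
  qed
  then have "ta (Suc t) = ta t - (\<Sum>i\<in>UNIV. (?g $ i)\<^sup>2 / (1 + (nGa t)\<^sup>2))"
    unfolding D.tau_def by (simp add: sum_subtractf)
  also have "(\<Sum>i\<in>UNIV. (?g $ i)\<^sup>2 / (1 + (nGa t)\<^sup>2)) = (norm ?g)\<^sup>2 / (1 + (nGa t)\<^sup>2)"
    unfolding power2_norm_eq_inner inner_vec_def
    by (simp add: sum_divide_distrib[symmetric] power2_eq_square)
  finally show ?thesis .
qed

lemma ta_Suc_le: "ta (Suc t) \<le> ta t"
  by (simp add: ta_Suc add_nonneg_nonneg)

lemma ta_mono: "s \<le> t \<Longrightarrow> ta t \<le> ta s"
  by (rule lift_Suc_antimono_le[of ta, OF ta_Suc_le])

lemma el_Suc_le: "el t \<le> el (Suc t)"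
proof -
  obtain v where v: "norm v = 1" "Lam (Suc t) *v v = el (Suc t) *\<^sub>R v" by (rule D.ell_vec)
  have "el t \<le> v \<bullet> (Lam t *v v)" using D.ell_le[of t v] v(1) by simp
  also have "... \<le> v \<bullet> (Lam (Suc t) *v v)" by (simp add: Lam_Suc inner_add_right inner_commute)
  also have "... = el (Suc t)" using v by (simp add: norm_eq_1)
  finally show ?thesis .
qed

lemma el_mono: "s \<le> t \<Longrightarrow> el s \<le> el t"
  by (rule lift_Suc_mono_le[of el, OF el_Suc_le])

lemma p_Suc: "p (Suc t) = p t + (a (Suc t) \<bullet> th)\<^sup>2"
  by (simp add: D.pp_def Lam_Suc inner_add_right inner_commute power2_eq_square)

lemma p_eq: "p t = 1 + (\<Sum>s=1..t. (a s \<bullet> th)\<^sup>2)"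
  using norm_th_one
  by (simp add: D.pp_def design_matrix_quadratic norm_eq_1 power2_eq_square)

lemma z_eq: "z t = (\<Sum>s=1..t. (a s \<bullet> th) *\<^sub>R y s)"
  by (simp add: D.zz_def design_matrix_apply proj_orth_add proj_orth_sum proj_orth_scaleR
      norm_th_one)

lemma z_Suc: "z (Suc t) = z t + (a (Suc t) \<bullet> th) *\<^sub>R y (Suc t)"
  by (simp add: z_eq)

lemma z_m: "z t = p t *\<^sub>R m t" using D.pp_pos[of t] by (simp add: D.mm_def)

lemma m_Suc:
  "m (Suc t) = m t + ((a (Suc t) \<bullet> th) / p (Suc t)) *\<^sub>R (y (Suc t) - (a (Suc t) \<bullet> th) *\<^sub>R m t)"
proof -
  let ?x = "a (Suc t) \<bullet> th"
  have "p (Suc t) *\<^sub>R m (Suc t) = p t *\<^sub>R m t + ?x *\<^sub>R y (Suc t)"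
    by (simp only: z_m[symmetric] z_Suc)
  also have "... = p (Suc t) *\<^sub>R m t + ?x *\<^sub>R (y (Suc t) - ?x *\<^sub>R m t)"
    by (simp add: p_Suc scaleR_add_left scaleR_diff_right power2_eq_square)
  finally have "(1 / p (Suc t)) *\<^sub>R (p (Suc t) *\<^sub>R m (Suc t))
      = (1 / p (Suc t)) *\<^sub>R (p (Suc t) *\<^sub>R m t + ?x *\<^sub>R (y (Suc t) - ?x *\<^sub>R m t))"
    by (rule arg_cong)
  then show ?thesis using D.pp_pos[of "Suc t"] by (simp add: scaleR_add_right)
qed

lemma B_Suc: "B (Suc t) = B t + (norm (y (Suc t)))\<^sup>2" by (simp add: B_def)
lemma B_0: "B 0 = 1" by (simp add: B_def)
lemma B_ge_one: "1 \<le> B t" by (simp add: B_def sum_nonneg)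
lemma B_mono: "s \<le> t \<Longrightarrow> B s \<le> B t"
  by (rule lift_Suc_mono_le[of B]) (auto simp: B_Suc)

text \<open>On the orthogonal complement of th only the parts y of the actions act, and B is one
  plus the sum of their squared norms.\<close>

lemma quad_le_B:
  assumes "u \<bullet> th = 0"
  shows "u \<bullet> (Lam t *v u) \<le> B t * (norm u)\<^sup>2"
proof -
  have "(a s \<bullet> u) * (a s \<bullet> u) \<le> (norm (y s))\<^sup>2 * (norm u)\<^sup>2" for s
  proof -
    have "a s \<bullet> u = y s \<bullet> u" using proj_orth_inner[OF assms, of "a s"] by (simp add: inner_commute)
    then show ?thesis
      by (metis Cauchy_Schwarz_ineq power2_eq_square power2_norm_eq_inner)
  qed
  then have "(\<Sum>s=1..t. (a s \<bullet> u) * (a s \<bullet> u)) \<le> (\<Sum>s=1..t. (norm (y s))\<^sup>2 * (norm u)\<^sup>2)"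
    by (intro sum_mono)
  then show ?thesis
    by (simp add: design_matrix_quadratic B_def power2_norm_eq_inner[of u, symmetric]
        sum_distrib_left distrib_left mult.commute)
qed

lemma el_le_B:
  assumes "2 \<le> CARD('d)"
  shows "el t \<le> B t"
proof -
  obtain u where u: "norm u = 1" "u \<bullet> th = 0"
    using exists_unit_orthogonal[OF assms] by blast
  have "el t \<le> u \<bullet> (Lam t *v u)" using D.ell_le[of t u] u by simp
  also have "... \<le> B t" using quad_le_B[OF u(2), of t] u(1) by simp
  finally show ?thesis .
qed

text \<open>Cauchy-Schwarz in the form of the design matrix for m and th, since m . Lam th = p
  |m|^2, combined with B as a bound on the form at m.\<close>

lemma p_norm_m_sq: "p t * (norm (m t))\<^sup>2 \<le> B t"
proof -
  have "p t * (norm (m t))\<^sup>2 = m t \<bullet> (Lam t *v th)"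
    by (simp add: D.Lam_th inner_add_right power2_norm_eq_inner)
  then have "(p t * (norm (m t))\<^sup>2)\<^sup>2 \<le> (m t \<bullet> (Lam t *v m t)) * p t"
    using psd_cauchy_schwarz_sq[of "Lam t", OF D.sym D.Lam_psd, of "m t" th] by (simp add: D.pp_def)
  also have "... \<le> (B t * (norm (m t))\<^sup>2) * p t"
    using quad_le_B[of "m t" t] D.pp_pos[of t] by (intro mult_right_mono) auto
  finally have "(p t * (norm (m t))\<^sup>2) * (p t * (norm (m t))\<^sup>2) \<le> B t * (p t * (norm (m t))\<^sup>2)"
    by (simp add: power2_eq_square mult_ac)
  then show ?thesis
    using D.pp_pos[of t] B_ge_one[of t]
      mult_right_le_imp_le[of "p t * (norm (m t))\<^sup>2" "p t * (norm (m t))\<^sup>2" "B t"]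
    by (cases "norm (m t) = 0") auto
qed

lemma norm_m_le_one_B: "norm (m t) \<le> sqrt (B t)"
proof -
  have "1 * (norm (m t))\<^sup>2 \<le> p t * (norm (m t))\<^sup>2" using D.pp_ge_one by (intro mult_right_mono) auto
  then show ?thesis using p_norm_m_sq[of t] by (intro real_le_rsqrt) simp
qed

lemma norm_y_le: "norm (a s) \<le> 1 \<Longrightarrow> norm (y s) \<le> 1"
  using norm_proj_orth_le[OF norm_th_one, of "a s"] by simp

lemma B_le:
  assumes "\<And>s. 1 \<le> s \<Longrightarrow> s \<le> t \<Longrightarrow> norm (a s) \<le> 1"
  shows "B t \<le> 1 + real t"
proof -
  have "(\<Sum>s=1..t. (norm (y s))\<^sup>2) \<le> (\<Sum>s=1..t. 1)"
    using assms norm_y_le by (intro sum_mono) (auto simp: power_le_one)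
  then show ?thesis by (simp add: B_def)
qed

lemma p_le:
  assumes "\<And>s. 1 \<le> s \<Longrightarrow> s \<le> t \<Longrightarrow> norm (a s) \<le> 1"
  shows "p t \<le> 1 + real t"
proof -
  have "(a s \<bullet> th)\<^sup>2 \<le> 1" if "1 \<le> s" "s \<le> t" for s
  proof -
    have "\<bar>a s \<bullet> th\<bar> \<le> norm (a s) * norm th" by (rule Cauchy_Schwarz_ineq2)
    then have "\<bar>a s \<bullet> th\<bar> \<le> 1" using assms[OF that] norm_th_one by simp
    then show ?thesis by (simp add: abs_square_le_1)
  qed
  then have "(\<Sum>s=1..t. (a s \<bullet> th)\<^sup>2) \<le> (\<Sum>s=1..t. 1)" by (intro sum_mono) auto
  then show ?thesis by (simp add: p_eq)
qed

lemma norm_z_le: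
  assumes "\<And>s. 1 \<le> s \<Longrightarrow> s \<le> t \<Longrightarrow> norm (a s) \<le> 1"
  shows "norm (z t) \<le> real t"
proof -
  have "norm (z t) \<le> (\<Sum>s=1..t. norm ((a s \<bullet> th) *\<^sub>R y s))" unfolding z_eq by (rule norm_sum)
  also have "... \<le> (\<Sum>s=1..t. 1)"
  proof (rule sum_mono)
    fix s assume "s \<in> {1..t}"
    then have "norm (a s) \<le> 1" using assms by simp
    moreover have "\<bar>a s \<bullet> th\<bar> \<le> norm (a s) * norm th" by (rule Cauchy_Schwarz_ineq2)
    ultimately have "\<bar>a s \<bullet> th\<bar> \<le> 1" "norm (y s) \<le> 1" using norm_th_one norm_y_le by auto
    then show "norm ((a s \<bullet> th) *\<^sub>R y s) \<le> 1" by (simp add: mult_le_one)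
  qed
  finally show ?thesis by simp
qed

definition "SS e t = (\<Sum>s=1..t. e s *\<^sub>R a s)" for e :: "nat \<Rightarrow> real"

lemma ridge_eq:
  "ridge a (\<lambda>s. a s \<bullet> th + e s) t = th + G t *v (SS e t - th)"
proof -
  have "(\<Sum>s=1..t. (a s \<bullet> th + e s) *\<^sub>R a s) = Lam t *v th - th + SS e t"
    by (simp add: design_matrix_apply SS_def scaleR_add_left sum.distrib)
  then have "(\<Sum>s=1..t. (a s \<bullet> th + e s) *\<^sub>R a s) = Lam t *v th + (SS e t - th)" by simp
  then have "ridge a (\<lambda>s. a s \<bullet> th + e s) t = G t *v (Lam t *v th + (SS e t - th))"
    unfolding ridge_def D.Gm_def by (simp only:)
  then show ?thesis by (simp add: matrix_vector_right_distrib)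
qed

text \<open>Recursive least squares: the normal equations of consecutive rounds differ by a rank-one
  term, and subtracting them leaves the prediction residual times the new action.\<close>

lemma ridge_Suc:
  fixes e :: "nat \<Rightarrow> real"
  defines "rd \<equiv> ridge a (\<lambda>s. a s \<bullet> th + e s)"
  shows "rd (Suc t) - rd t = (e (Suc t) + a (Suc t) \<bullet> (th - rd t)) *\<^sub>R (G (Suc t) *v a (Suc t))"
proof -
  let ?b = "a (Suc t)" and ?c = "e (Suc t) + a (Suc t) \<bullet> (th - rd t)"
  have L: "Lam s *v (rd s - th) = SS e s - th" for s
    by (simp add: rd_def ridge_eq)
  have "Lam (Suc t) *v (rd (Suc t) - rd t)
      = Lam (Suc t) *v (rd (Suc t) - th) - Lam (Suc t) *v (rd t - th)"
    by (simp add: matrix_vector_mult_diff_distrib)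
  also have "... = (SS e (Suc t) - th) - (Lam t *v (rd t - th) + (?b \<bullet> (rd t - th)) *\<^sub>R ?b)"
    by (simp only: L Lam_Suc)
  also have "... = ?c *\<^sub>R ?b"
    by (simp add: L SS_def inner_diff_right scaleR_add_left scaleR_diff_left)
  finally have "G (Suc t) *v (Lam (Suc t) *v (rd (Suc t) - rd t)) = G (Suc t) *v (?c *\<^sub>R ?b)"
    by (rule arg_cong)
  then show ?thesis by (simp add: matrix_vector_mult_scaleR)
qed

end

section \<open>Growth of the design matrix along a LinUCB path\<close>

text \<open>A single outcome: the growth analysis is deterministic, and the noise enters only
  through assumptions on hh and later on weighted noise sums.\<close>

locale ucb_path = design a th for a :: "nat \<Rightarrow> real^'d" and th +
  fixes hh :: "nat \<Rightarrow> real^'d" and \<beta> :: real and T :: nat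
  assumes b_pos: "\<beta> > 0"
    and norm_hh_one: "t \<le> T \<Longrightarrow> norm (hh t) = 1"
    and path_argmax: "t < T \<Longrightarrow>
      is_arg_max (ucb_score \<beta> (design_matrix a t) (hh t)) (\<lambda>x. x \<in> cball 0 1) (a (Suc t))"
begin

lemma step: "t < T \<Longrightarrow> ucb_step_dir (Lam t) \<beta> (hh t) (a (Suc t)) th"
proof -
  assume t: "t < T"
  interpret posdef "Lam t" by (rule posdef_design_matrix)
  show ?thesis
    by unfold_locales (use t b_pos norm_hh_one path_argmax norm_th_one in auto)
qed

lemma norm_a_one: "1 \<le> s \<Longrightarrow> s \<le> T \<Longrightarrow> norm (a s) = 1"
proof -
  assume "1 \<le> s" "s \<le> T"
  then obtain t where s: "s = Suc t" "t < T" by (cases s) auto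
  interpret ucb_step_dir "Lam t" \<beta> "hh t" "a (Suc t)" th using s by (intro step)
  show ?thesis using norm_a s by simp
qed

text \<open>While el stays below K \<beta>^2, the bonus w is at least of order 1 / sqrt el, so each
  step lowers the trace by at least c times its square and 1 / ta grows linearly. This would carry
  el past the threshold.\<close>

lemma el_crude:
  fixes K :: real
  assumes K: "1 \<le> K" and n: "n \<le> T"
    and large: "2 * (real CARD('d))\<^sup>2 * K * (1 + sqrt K)^4 * \<beta>^2 \<le> real n"
  shows "K * \<beta>^2 \<le> el n"
proof (rule ccontr)
  assume "\<not> K * \<beta>^2 \<le> el n"
  then have lt: "el n < K * \<beta>^2" by simp
  define d where "d = real CARD('d)"
  \<comment> \<open>The factor (1 + sqrt K)^4 comes from the lower bound on w^4, d^2 from comparing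
    ta with 1 / el, and 2 from the denominator 1 + w^2 \<le> 2 of the rank-one update.\<close>
  define c where "c = 1 / (2 * d^2 * (1 + sqrt K)^4)"
  have d1: "1 \<le> d" by (simp add: d_def)
  have K4: "(1 + sqrt K)^4 > 0" using K by (intro zero_less_power add_pos_nonneg) auto
  have c0: "c > 0" using d1 K4 by (simp add: c_def)
  have "c * real s \<le> 1 / ta s" if "s \<le> n" for s
    using that
  proof (induction s)
    case 0 show ?case using D.tau_pos[of 0] by simp
  next
    case (Suc s)
    interpret S: ucb_step_dir "Lam s" \<beta> "hh s" "a (Suc s)" th using Suc.prems n by (intro step) simp
    have els: "el s < K * \<beta>^2" using el_mono[of s n] Suc.prems lt by simp
    have sel: "sqrt (el s) > 0" using D.ell_pos by simp
    have "sqrt (el s) \<le> sqrt K * \<beta>"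
      using real_sqrt_le_mono[of "el s" "K * \<beta>^2"] els b_pos by (simp add: real_sqrt_mult)
    then have "sqrt (el s) * sqrt (el s) \<le> sqrt (el s) * (sqrt K * \<beta>)"
      using sel by (intro mult_left_mono) auto
    then have "el s + \<beta> * sqrt (el s) \<le> \<beta> * (sqrt (el s) * (1 + sqrt K))"
      using D.ell_pos[of s] by (simp add: algebra_simps)
    then have "\<beta> / (\<beta> * (sqrt (el s) * (1 + sqrt K))) \<le> \<beta> / (el s + \<beta> * sqrt (el s))"
      using b_pos D.ell_pos[of s] sel K by (intro divide_left_mono mult_pos_pos add_pos_pos add_pos_nonneg) auto
    then have "1 / (sqrt (el s) * (1 + sqrt K)) \<le> S.w"
      using S.w_lower b_pos by simp
    then have "(1 / (sqrt (el s) * (1 + sqrt K)))^4 \<le> S.w^4"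
      using sel K by (intro power_mono) auto
    moreover have "sqrt (el s)^4 = (el s)\<^sup>2"
    proof -
      have "sqrt (el s)^4 = ((sqrt (el s))\<^sup>2)\<^sup>2" unfolding power_mult[symmetric] by simp
      then show ?thesis using D.ell_pos[of s] by simp
    qed
    ultimately have h1: "1 / ((el s)\<^sup>2 * (1 + sqrt K)^4) \<le> S.w^4"
      by (simp add: power_divide power_mult_distrib)
    have h2: "c * (ta s)\<^sup>2 \<le> 1 / ((el s)\<^sup>2 * (1 + sqrt K)^4) / 2"
    proof -
      have "(ta s)\<^sup>2 \<le> (d / el s)\<^sup>2"
        using D.tau_le[of s] D.tau_pos[of s] by (intro power_mono) (auto simp: d_def)
      then have "c * (ta s)\<^sup>2 \<le> c * (d / el s)\<^sup>2" using c0 by (intro mult_left_mono) auto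
      also have "... = 1 / ((el s)\<^sup>2 * (1 + sqrt K)^4) / 2"
        using d1 by (simp add: c_def power_divide field_simps)
      finally show ?thesis .
    qed
    have h3: "S.w^4 / 2 \<le> (norm (G s *v a (Suc s)))\<^sup>2 / (1 + (nGa s)\<^sup>2)"
    proof -
      have "S.w\<^sup>2 \<le> norm (a (Suc s)) * norm (G s *v a (Suc s))"
        unfolding S.w_sq by (rule norm_cauchy_schwarz)
      then have "S.w\<^sup>2 \<le> norm (G s *v a (Suc s))" by (simp add: S.norm_a)
      then have "(S.w\<^sup>2)\<^sup>2 \<le> (norm (G s *v a (Suc s)))\<^sup>2" by (intro power_mono) auto
      moreover have "1 + (nGa s)\<^sup>2 \<le> 2"
        using S.w_le_one S.w_nonneg by (simp add: S.w_def power_le_one)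
      ultimately show ?thesis
        by (intro frac_le) (auto simp: add_pos_nonneg)
    qed
    have "c * (ta s)\<^sup>2 \<le> (norm (G s *v a (Suc s)))\<^sup>2 / (1 + (nGa s)\<^sup>2)"
      by (rule order_trans[OF h2 order_trans[OF divide_right_mono[OF h1] h3]]) simp
    then have dec: "ta (Suc s) \<le> ta s - c * (ta s)\<^sup>2" by (simp add: ta_Suc)
    have t0: "ta s > 0" "ta (Suc s) > 0" by (rule D.tau_pos)+
    \<comment> \<open>Positivity of the next trace forces x < 1, so that 1 + x \<le> 1 / (1 - x)
      converts the quadratic decrease into a linear increase of the reciprocal.\<close>
    define x where "x = c * ta s"
    have dec': "ta (Suc s) \<le> ta s * (1 - x)" using dec by (simp add: x_def power2_eq_square algebra_simps)
    have x1: "x < 1"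
    proof (rule ccontr)
      assume "\<not> x < 1" then have "ta s * (1 - x) \<le> 0" using t0 by (simp add: mult_nonneg_nonpos)
      then show False using dec' t0 by linarith
    qed
    have "c * real (Suc s) \<le> 1 / ta s + c" using Suc by (simp add: algebra_simps)
    also have "... = (1 + x) / ta s" using t0 by (simp add: x_def field_simps)
    also have "... \<le> (1 / (1 - x)) / ta s"
    proof (rule divide_right_mono)
      have "(1 + x) * (1 - x) \<le> 1" by (simp add: algebra_simps)
      then show "1 + x \<le> 1 / (1 - x)" using x1 by (simp add: field_simps)
    qed (use t0 in simp)
    also have "... = 1 / (ta s * (1 - x))" by simp
    also have "... \<le> 1 / ta (Suc s)" using dec' t0 by (intro divide_left_mono mult_pos_pos) (use x1 in auto)
    finally show ?case .
  qed
  then have "c * real n \<le> 1 / ta n" by simp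
  then have "c * real n \<le> el n" using D.ell_ge_tau[of n] by linarith
  moreover have "K * \<beta>^2 \<le> c * real n"
  proof -
    have "c * (2 * d^2 * K * (1 + sqrt K)^4 * \<beta>^2) \<le> c * real n"
      using large c0 unfolding d_def by (intro mult_left_mono) auto
    moreover have "c * (2 * d^2 * K * (1 + sqrt K)^4 * \<beta>^2) = K * \<beta>^2"
    proof -
      have "1 + sqrt K \<noteq> 0" using K by (smt (verit) real_sqrt_ge_zero)
      then show ?thesis using d1 by (simp add: c_def)
    qed
    ultimately show ?thesis by simp
  qed
  ultimately show False using lt by simp
qed

text \<open>If the bound is nearly attained, then el is small and w large, too large to be explained
  by the direction th alone. The rest of w^2 is at most |eta| times the orthogonal part of G a; a
  small eta therefore forces a large G a, hence a drop of the trace of order \<beta>^2 ta^3.\<close>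

lemma ta_step:
  fixes A E :: real
  assumes s: "1 \<le> s" "s < T"
    and A: "8 * real CARD('d) \<le> A" "32 * (real CARD('d))\<^sup>2 * E \<le> A" and E: "0 < E"
    and el: "\<beta>^2 \<le> el s" and p: "real s / 2 \<le> p s"
    and eta: "norm (y (Suc s) - (a (Suc s) \<bullet> th) *\<^sub>R m s) \<le> E * sqrt (A * \<beta>) / sqrt (sqrt (real s))"
    and ta: "ta s * \<beta> * sqrt (real s) \<le> A"
  shows "ta (Suc s) * \<beta> * sqrt (real (Suc s)) \<le> A"
proof -
  interpret S: ucb_step_dir "Lam s" \<beta> "hh s" "a (Suc s)" th using s by (intro step)
  define d where "d = real CARD('d)"
  define R where "R = sqrt (real s)"
  define R' where "R' = sqrt (real (Suc s))"
  have d1: "1 \<le> d" by (simp add: d_def)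
  have R1: "1 \<le> R" using s by (simp add: R_def)
  have RR: "R * R = real s" by (simp add: R_def)
  have RR': "R' * R' = R * R + 1" by (simp add: R'_def RR)
  have R'R: "R \<le> R'" by (simp add: R_def R'_def)
  have R'2: "R' \<le> 2 * R"
  proof -
    have "R' * R' \<le> (2 * R) * (2 * R)" using RR' R1 mult_mono[of 1 R 1 R] by simp
    then have "R'^2 \<le> (2 * R)\<^sup>2" by (simp only: power2_eq_square)
    then show ?thesis using R1 by (rule_tac power2_le_imp_le) auto
  qed
  have t0: "ta s > 0" "ta (Suc s) > 0" by (rule D.tau_pos)+
  have A0: "A > 0" using A(1) by (smt (verit) d1 d_def)
  have b: "\<beta> > 0" by (rule b_pos)
  show ?thesis
  \<comment> \<open>With a factor 2 to spare, the monotone trace and sqrt (s + 1) \<le> 2 sqrt s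
    settle the step.\<close>
  proof (cases "ta s * \<beta> * R \<le> A / 2")
    case True
    have "ta (Suc s) * \<beta> * R' \<le> ta s * \<beta> * (2 * R)"
      using ta_Suc_le[of s] t0 b R'2 R1 R'R by (intro mult_mono) auto
    then show ?thesis using True by (simp add: R'_def)
  next
    case False
    have w1: "A / (4 * d * R) \<le> S.w"
    proof -
      have "ta s \<le> d / el s" using D.tau_le[of s] by (simp add: d_def)
      then have "\<beta> * ta s / (2 * d) \<le> \<beta> * (d / el s) / (2 * d)"
        using b d1 by (intro divide_right_mono mult_left_mono) auto
      also have "... = \<beta> / (2 * el s)" using d1 by simp
      also have "... \<le> S.w" by (rule S.w_lower_large[OF el])
      finally have "\<beta> * ta s / (2 * d) \<le> S.w" .
      moreover have "A / (4 * d * R) \<le> \<beta> * ta s / (2 * d)"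
      proof -
        have "A / 2 / (2 * d * R) \<le> (ta s * \<beta> * R) / (2 * d * R)"
          using False d1 R1 by (intro divide_right_mono) auto
        then show ?thesis using R1 by (simp add: mult_ac)
      qed
      ultimately show ?thesis by simp
    qed
    then have w2: "A^2 / (16 * d^2 * real s) \<le> S.w\<^sup>2"
    proof -
      have "(A / (4 * d * R))\<^sup>2 \<le> S.w\<^sup>2" using w1 A0 d1 R1 by (intro power_mono) auto
      moreover have "(A / (4 * d * R))\<^sup>2 = A^2 / (16 * d^2 * real s)"
        by (simp add: power_divide power_mult_distrib RR[symmetric] power2_eq_square)
      ultimately show ?thesis by simp
    qed
    have s0: "real s > 0" using s by simp
    have x: "S.x0\<^sup>2 / p s \<le> S.w\<^sup>2 / 2"
    proof -
      have "S.x0\<^sup>2 \<le> 1" by (simp add: S.x0_sq)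
      then have "S.x0\<^sup>2 / p s \<le> 1 / (real s / 2)" using p s0 by (intro frac_le) auto
      also have "... \<le> A^2 / (16 * d^2 * real s) / 2"
      proof -
        have "(8 * d)\<^sup>2 \<le> A^2" using A(1) d1 unfolding d_def by (intro power_mono) auto
        then have "64 * d^2 \<le> A^2" by (simp add: power_mult_distrib)
        then have "64 * d^2 / (32 * d^2 * real s) \<le> A^2 / (32 * d^2 * real s)"
          by (intro divide_right_mono) auto
        moreover have "64 * d^2 / (32 * d^2 * real s) = 1 / (real s / 2)" using d1 by simp
        ultimately show ?thesis by simp
      qed
      also have "... \<le> S.w\<^sup>2 / 2" using w2 by (rule divide_right_mono) simp
      finally show ?thesis .
    qed
    define N where "N = norm (proj_orth th (G s *v a (Suc s)))"
    define h where "h = norm S.eta"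
    have "S.w\<^sup>2 / 2 \<le> h * N"
      using S.w_sq_decomp x S.eta_quad_le by (simp add: h_def N_def)
    then have "(S.w\<^sup>2 / 2)\<^sup>2 \<le> (h * N)\<^sup>2" by (intro power_mono) auto
    then have wh: "S.w^4 / 4 \<le> h^2 * N^2"
      by (simp add: power_divide power_mult_distrib power4_eq_xxxx power2_eq_square mult_ac)
    have h2: "h^2 \<le> E^2 * A * \<beta> / R"
    proof -
      have "h \<le> E * sqrt (A * \<beta>) / sqrt R"
        using eta by (simp add: h_def S.eta_def S.yy_def S.x0_def R_def)
      then have "h^2 \<le> (E * sqrt (A * \<beta>) / sqrt R)\<^sup>2" by (intro power_mono) (auto simp: h_def)
      then show ?thesis using A0 b R1 by (simp add: power_divide power_mult_distrib)
    qed
    have X0: "0 < E\<^sup>2 * A * \<beta> / R" using E A0 b R1 by simp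
    have "S.w^4 / 4 \<le> (E^2 * A * \<beta> / R) * N^2"
      using wh mult_right_mono[OF h2, of "N^2"] by (meson order_trans zero_le_power2)
    then have N2: "S.w^4 / (4 * (E^2 * A * \<beta> / R)) \<le> N^2"
    proof -
      have "q / 4 \<le> X * n \<Longrightarrow> q / (4 * X) \<le> n" if "0 < X" for q X n :: real
        using that by (simp add: field_simps)
      then show ?thesis using X0 \<open>S.w^4 / 4 \<le> (E^2 * A * \<beta> / R) * N^2\<close> by blast
    qed
    have w4: "A^4 / (256 * d^4 * (real s)\<^sup>2) \<le> S.w^4"
    proof -
      have "(A^2 / (16 * d^2 * real s))\<^sup>2 \<le> (S.w\<^sup>2)\<^sup>2"
        using w2 by (intro power_mono) auto
      then show ?thesis by (simp add: power_divide power_mult_distrib power_mult[symmetric])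
    qed
    have "A^3 / (1024 * d^4 * E^2 * \<beta> * (R * R * R)) \<le> N^2"
    proof -
      have "A^4 / (256 * d^4 * (real s)\<^sup>2) / (4 * (E^2 * A * \<beta> / R)) \<le> S.w^4 / (4 * (E^2 * A * \<beta> / R))"
        using w4 X0 by (intro divide_right_mono) auto
      moreover have "A^4 / (256 * d^4 * (real s)\<^sup>2) / (4 * (E^2 * A * \<beta> / R))
          = A^3 / (1024 * d^4 * E^2 * \<beta> * (R * R * R))"
        using A0 R1 E b d1 unfolding RR[symmetric]
        by (simp add: field_simps power2_eq_square power3_eq_cube power4_eq_xxxx)
      ultimately show ?thesis using N2 by linarith
    qed
    moreover have "N^2 / 2 \<le> (norm (G s *v a (Suc s)))\<^sup>2 / (1 + (nGa s)\<^sup>2)"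
    proof -
      have "N^2 \<le> (norm (G s *v a (Suc s)))\<^sup>2"
        unfolding N_def by (intro power_mono norm_proj_orth_le norm_th_one) auto
      moreover have "1 + (nGa s)\<^sup>2 \<le> 2"
        using S.w_le_one S.w_nonneg by (simp add: S.w_def power_le_one)
      ultimately show ?thesis
        by (intro frac_le) (auto simp: add_pos_nonneg)
    qed
    ultimately have dec: "ta (Suc s) \<le> ta s - A^3 / (2048 * d^4 * E^2 * \<beta> * (R * R * R))"
      by (simp add: ta_Suc field_simps)
    \<comment> \<open>The lower bound on A in terms of d^2 E makes the drop at least the decrease of
      A / (\<beta> sqrt s) over one step, which is at most A / (2 \<beta> s^(3/2)).\<close>
    have "A / (2 * \<beta> * (R * R * R)) \<le> A^3 / (2048 * d^4 * E^2 * \<beta> * (R * R * R))"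
    proof -
      have "(32 * d^2 * E)\<^sup>2 \<le> A^2" using A(2) E d1 unfolding d_def by (intro power_mono) auto
      then have "1024 * d^4 * E^2 \<le> A^2" by (simp add: power_mult_distrib power_mult[symmetric])
      then have "A * (1024 * d^4 * E^2) \<le> A * A^2" using A0 by (intro mult_left_mono) auto
      then have "A * (1024 * d^4 * E^2) / (2048 * d^4 * E^2 * \<beta> * (R * R * R))
          \<le> A^3 / (2048 * d^4 * E^2 * \<beta> * (R * R * R))"
        using b R1 by (intro divide_right_mono) (auto simp: power2_eq_square power3_eq_cube)
      moreover have "A * (1024 * d^4 * E^2) / (2048 * d^4 * E^2 * \<beta> * (R * R * R)) = A / (2 * \<beta> * (R * R * R))"
        using d1 E b R1 by (simp add: field_simps)
      ultimately show ?thesis by simp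
    qed
    then have "ta (Suc s) \<le> A / (\<beta> * R) - A / (2 * \<beta> * (R * R * R))"
    proof -
      have "ta s \<le> A / (\<beta> * R)" using ta b R1 by (simp add: R_def field_simps)
      then show ?thesis using dec \<open>A / (2 * \<beta> * (R * R * R)) \<le> _\<close> by linarith
    qed
    also have "... \<le> A / (\<beta> * R')"
    proof -
      have R'0: "R' > 0" using R1 R'R by simp
      have diff: "(R' - R) * (R' + R) = 1" using RR' by (simp add: algebra_simps)
      have "R' - R \<le> 1 / (2 * R)"
      proof -
        have "(R' - R) * (2 * R) \<le> (R' - R) * (R' + R)" using R'R by (intro mult_left_mono) auto
        then show ?thesis using diff R1 by (simp add: field_simps)
      qed
      then have "(R' - R) / (R * R') \<le> (1 / (2 * R)) / (R * R)"
        using R1 R'R by (intro frac_le mult_mono mult_pos_pos) auto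
      then have "1 / R - 1 / R' \<le> 1 / (2 * (R * R * R))"
        using R1 R'0 by (simp add: field_simps)
      then have "(A / \<beta>) * (1 / R - 1 / R') \<le> (A / \<beta>) * (1 / (2 * (R * R * R)))"
        using A0 b by (intro mult_left_mono) auto
      moreover have "A / (2 * \<beta> * (R * R * R)) = (A / \<beta>) * (1 / (2 * (R * R * R)))"
        "A / (\<beta> * R) = (A / \<beta>) * (1 / R)" "A / (\<beta> * R') = (A / \<beta>) * (1 / R')" by simp_all
      ultimately show ?thesis unfolding right_diff_distrib by linarith
    qed
    finally show ?thesis
      using b R1 R'R unfolding R'_def[symmetric] by (simp add: field_simps)
  qed
qed

text \<open>Four bounds proved by one induction because they feed each other: the trace bounds y, y
  bounds the increments of B and z and keeps p growing, z and p bound m, and y and m bound eta,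
  which drives \<open>ta_step\<close>. The hypothesis on y may itself use the current bounds on the
  trace and B.\<close>

lemma growth:
  fixes A K :: real
  assumes s0: "3 * s0 \<le> r1" "1 \<le> r1" "n \<le> T"
    and K: "2 \<le> K"
    and A: "8 * real CARD('d) \<le> A" "320 * (real CARD('d))\<^sup>2 * K \<le> A"
    and y_le: "\<And>r. s0 \<le> r \<Longrightarrow> r < n \<Longrightarrow> ta r * \<beta> * sqrt (real r) \<le> A \<Longrightarrow>
        B r \<le> B s0 + 1 + 4 * K^2 * A * \<beta> * sqrt (real r) \<Longrightarrow> norm (y (Suc r)) \<le> K * \<beta> * sqrt (ta r)"
    and base: "\<And>r. s0 \<le> r \<Longrightarrow> r \<le> r1 \<Longrightarrow> r \<le> n \<Longrightarrow> ta r * \<beta> * sqrt (real r) \<le> A"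
    and small: "4 * K^2 * \<beta>^2 * ta s0 \<le> 1"
    and init: "\<And>s. r1 \<le> s \<Longrightarrow> s \<le> n \<Longrightarrow>
        real s0 + 1 \<le> sqrt (A * \<beta>) * (sqrt (real s) * sqrt (sqrt (real s)))"
    and r: "s0 \<le> r" "r \<le> n"
  shows "ta r * \<beta> * sqrt (real r) \<le> A \<and> B r \<le> B s0 + 1 + 4 * K^2 * A * \<beta> * sqrt (real r) \<and>
    norm (z r) \<le> real s0 + 1 + 4 * K * sqrt (A * \<beta>) * (sqrt (real r) * sqrt (sqrt (real r))) \<and>
    1 + 3 / 4 * (real r - real s0) \<le> p r"
  using r
proof (induction r rule: nat_induct_at_least)
  case base
  have A0: "0 < A" using A(1) by (smt (verit) of_nat_0_less_iff zero_less_card_finite)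
  have f1: "norm (z s0) \<le> real s0" using base s0 norm_a_one by (intro norm_z_le) auto
  have f2: "0 \<le> 4 * K * sqrt (A * \<beta>) * (sqrt (real s0) * sqrt (sqrt (real s0)))"
    and f3: "0 \<le> 4 * K^2 * A * \<beta> * sqrt (real s0)"
    using A0 b_pos K by simp_all
  have f4: "ta s0 * \<beta> * sqrt (real s0) \<le> A" using assms(8)[of s0] base s0 by auto
  have "norm (z s0) \<le> real s0 + 1 + 4 * K * sqrt (A * \<beta>) * (sqrt (real s0) * sqrt (sqrt (real s0)))"
    using f1 f2 by linarith
  moreover have "B s0 \<le> B s0 + 1 + 4 * K^2 * A * \<beta> * sqrt (real s0)" using f3 by linarith
  ultimately show ?case using f4 D.pp_ge_one[of s0] by (simp only:) simp
next
  case (Suc r)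
  have rn: "r < n" "r < T" using Suc.prems s0 by auto
  interpret S: ucb_step_dir "Lam r" \<beta> "hh r" "a (Suc r)" th using rn by (intro step)
  have IHt: "ta r * \<beta> * sqrt (real r) \<le> A"
    and IHB: "B r \<le> B s0 + 1 + 4 * K^2 * A * \<beta> * sqrt (real r)"
    and IHz: "norm (z r) \<le> real s0 + 1 + 4 * K * sqrt (A * \<beta>) * (sqrt (real r) * sqrt (sqrt (real r)))"
    and IHp: "1 + 3 / 4 * (real r - real s0) \<le> p r"
    using Suc.IH[OF less_imp_le[OF rn(1)]] by blast+
  have A0: "0 < A" using A(1) by (smt (verit) of_nat_0_less_iff zero_less_card_finite)
  define v where "v = sqrt (sqrt (real r))"
  define u where "u = sqrt (sqrt (real (Suc r)))"
  define Q where "Q = sqrt (A * \<beta>)"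
  have Q0: "0 < Q" using A0 b_pos by (simp add: Q_def)
  have Q2: "Q * Q = A * \<beta>" using A0 b_pos by (simp add: Q_def)
  have v2: "sqrt (real r) = v * v" "sqrt (real (Suc r)) = u * u" by (simp_all add: v_def u_def)
  have v4: "real r = v^4" "real (Suc r) = u^4"
    by (simp_all add: v_def u_def power4_eq_xxxx mult.assoc)
  have v0: "0 \<le> v" "0 < u" by (simp_all add: v_def u_def)
  have svv: "sqrt (v * v) = v" "sqrt (u * u) = u" using v0 by simp_all
  define Y where "Y = norm (y (Suc r))"
  have Y: "Y \<le> K * \<beta> * sqrt (ta r)" unfolding Y_def by (rule y_le[OF Suc.hyps rn(1) IHt IHB])
  have Y0: "0 \<le> Y" by (simp add: Y_def)
  have Y1: "Y \<le> 1" unfolding Y_def using norm_a_one[of "Suc r"] rn by (intro norm_y_le) simp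
  have Y2: "Y^2 \<le> K^2 * \<beta>^2 * ta r"
  proof -
    have "Y^2 \<le> (K * \<beta> * sqrt (ta r))\<^sup>2" using Y Y0 by (intro power_mono)
    then show ?thesis using D.tau_pos[of r] by (simp add: power_mult_distrib)
  qed
  have "K^2 * \<beta>^2 * ta r \<le> K^2 * \<beta>^2 * ta s0"
    using ta_mono[OF Suc.hyps] by (intro mult_left_mono) auto
  \<comment> \<open>With |y|^2 \<le> 1/4 each step adds at least 3/4 to p; this is the slope in the
    last of the four bounds.\<close>
  then have Yq: "Y^2 \<le> 1 / 4" using Y2 small by linarith
  have x0: "(a (Suc r) \<bullet> th)\<^sup>2 = 1 - Y^2" using S.x0_sq by (simp add: S.x0_def S.yy_def Y_def)
  have x01: "\<bar>a (Suc r) \<bullet> th\<bar> \<le> 1"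
    using x0 by (intro abs_square_le_1[THEN iffD1]) simp
  have P: "1 + 3 / 4 * (real (Suc r) - real s0) \<le> p (Suc r)"
  proof -
    have "p (Suc r) = p r + (1 - Y^2)" by (simp only: p_Suc x0)
    moreover have "real (Suc r) = real r + 1" by simp
    ultimately show ?thesis using IHp Yq by argo
  qed
  have zS: "norm (z (Suc r)) \<le> norm (z r) + Y"
  proof -
    have "norm ((a (Suc r) \<bullet> th) *\<^sub>R y (Suc r)) \<le> 1 * Y"
      unfolding norm_scaleR real_norm_def Y_def using x01 by (intro mult_right_mono) auto
    then show ?thesis unfolding z_Suc using norm_triangle_ineq[of "z r"] by (smt (verit))
  qed
  show ?case
  \<comment> \<open>The increments used below divide by roots of r. The first round is absorbed by
    the summand 1 in the bounds on B and z.\<close>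
  proof (cases "r = 0")
    case True
    then have s00: "s0 = 0" using Suc.hyps by simp
    have "norm (z (Suc r)) \<le> real (Suc r)" using True rn norm_a_one by (intro norm_z_le) auto
    then have f1: "norm (z (Suc r)) \<le> real s0 + 1" using True s00 by simp
    have "(norm (y (Suc r)))\<^sup>2 \<le> 1" using Y1 Y0 unfolding Y_def by (rule_tac power_le_one)
    then have f2: "B (Suc r) \<le> B s0 + 1" using True s00 by (simp add: B_Suc)
    have f3: "0 \<le> 4 * K * sqrt (A * \<beta>) * (sqrt (real (Suc r)) * sqrt (sqrt (real (Suc r))))"
      and f4: "0 \<le> 4 * K^2 * A * \<beta> * sqrt (real (Suc r))"
      using A0 b_pos K by simp_all
    have f5: "ta (Suc r) * \<beta> * sqrt (real (Suc r)) \<le> A"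
      using True s0 s00 Suc.prems by (intro assms(8)) auto
    have "B (Suc r) \<le> B s0 + 1 + 4 * K^2 * A * \<beta> * sqrt (real (Suc r))" using f2 f4 by linarith
    moreover have "norm (z (Suc r)) \<le> real s0 + 1 + 4 * K * sqrt (A * \<beta>) * (sqrt (real (Suc r)) * sqrt (sqrt (real (Suc r))))"
      using f1 f3 by linarith
    ultimately show ?thesis using f5 P by blast
  next
    case False
    then have v1: "1 \<le> v" by (simp add: v_def)
    have u4: "u^4 = v^4 + 1" using v4 by simp
    have uv: "v \<le> u" by (simp add: u_def v_def)
    have u2v: "u \<le> 2 * v"
    proof -
      have "1 \<le> v^4" using v1 by (rule one_le_power)
      then have "u^4 \<le> 16 * v^4" using u4 by linarith
      then have "u^4 \<le> (2 * v)^4" by (simp add: power_mult_distrib)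
      then show ?thesis using v0 by (rule_tac power_le_imp_le_base[of _ 3]) auto
    qed
    \<comment> \<open>u and v are fourth roots of consecutive integers. The factorisation of u^4 -
      v^4 = 1 bounds the increments of the square root (for B) and of the power 3/4 (for z) from
      below.\<close>
    have fac: "(u - v) * (u + v) * (u * u + v * v) = 1"
      using u4 by (simp add: power4_eq_xxxx algebra_simps)
    have g1: "1 / (v * v) \<le> 4 * (u * u - v * v)"
    proof -
      have "u * u + v * v \<le> 4 * (v * v) + v * v" using mult_mono[OF u2v u2v] v0 by simp
      then have "(u * u - v * v) * (u * u + v * v) \<le> (u * u - v * v) * (5 * (v * v))"
        using uv v0 by (intro mult_left_mono) (auto simp: mult_mono)
      moreover have "(u * u - v * v) * (u * u + v * v) = 1" using fac by (simp add: algebra_simps)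
      moreover have "u * u \<le> 4 * (v * v)" using mult_mono[OF u2v u2v] v0 by simp
      moreover have s3: "u * u \<le> 3 * (v * v)"
      proof -
        have "(u * u) * (u * u) \<le> (3 * (v * v)) * (3 * (v * v))"
          using u4 one_le_power[OF v1, of 4] by (simp add: power4_eq_xxxx)
        then have "(u * u)\<^sup>2 \<le> (3 * (v * v))\<^sup>2" by (simp only: power2_eq_square)
        then show ?thesis by (rule_tac power2_le_imp_le) auto
      qed
      ultimately have "1 \<le> (u * u - v * v) * (4 * (v * v))"
      proof -
        have "(u * u - v * v) * (u * u + v * v) \<le> (u * u - v * v) * (4 * (v * v))"
          using uv v0 s3 by (intro mult_left_mono) (auto simp: mult_mono)
        then show ?thesis using \<open>(u * u - v * v) * (u * u + v * v) = 1\<close> by simp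
      qed
      then show ?thesis using v1 by (simp add: field_simps)
    qed
    have g2: "1 / v \<le> 4 * (u * u * u - v * v * v)"
    proof -
      have "1 = (u - v) * (u * u + v * v) * (u + v)" using fac by (simp add: mult_ac)
      also have "... \<le> (u - v) * (u * u + u * v + v * v) * (3 * v)"
        using uv u2v v0 by (intro mult_mono) auto
      also have "... = 3 * v * (u * u * u - v * v * v)" by (simp add: algebra_simps)
      finally have "1 \<le> 3 * v * (u * u * u - v * v * v)" .
      moreover have "0 \<le> u * u * u - v * v * v" using uv v0 by (simp add: mult_mono)
      ultimately show ?thesis using v1 by (simp add: field_simps)
    qed
    have tar: "ta r \<le> A / (\<beta> * (v * v))"
      using IHt b_pos v1 by (simp add: v2 field_simps)
    have Y3: "Y^2 \<le> K^2 * (A * \<beta>) / (v * v)"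
    proof -
      have "K^2 * \<beta>^2 * ta r \<le> K^2 * \<beta>^2 * (A / (\<beta> * (v * v)))"
        using tar by (intro mult_left_mono) auto
      also have "... = K^2 * (A * \<beta>) / (v * v)" using b_pos by (simp add: power2_eq_square)
      finally show ?thesis using Y2 by linarith
    qed
    have Y4: "Y \<le> K * Q / v"
    proof -
      have "(K * Q / v)\<^sup>2 = K^2 * (Q * Q) / (v * v)" by (simp add: power2_eq_square)
      then have "Y^2 \<le> (K * Q / v)\<^sup>2" using Y3 Q2 by simp
      then show ?thesis using K Q0 v1 by (rule_tac power2_le_imp_le) auto
    qed
    have BS: "B (Suc r) \<le> B s0 + 1 + 4 * K^2 * A * \<beta> * sqrt (real (Suc r))"
    proof -
      have "K^2 * (A * \<beta>) * (1 / (v * v)) \<le> K^2 * (A * \<beta>) * (4 * (u * u - v * v))"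
        using g1 A0 b_pos by (intro mult_left_mono) auto
      then have "Y^2 \<le> 4 * K^2 * A * \<beta> * (u * u) - 4 * K^2 * A * \<beta> * (v * v)"
        using Y3 by (simp add: algebra_simps)
      then show ?thesis using IHB unfolding B_Suc Y_def[symmetric] v2 by linarith
    qed
    have ZS: "norm (z (Suc r)) \<le> real s0 + 1 + 4 * K * Q * (u * u * u)"
    proof -
      have "K * Q * (1 / v) \<le> K * Q * (4 * (u * u * u - v * v * v))"
        using g2 K Q0 by (intro mult_left_mono) auto
      then have "Y \<le> 4 * K * Q * (u * u * u) - 4 * K * Q * (v * v * v)"
        using Y4 by (simp add: algebra_simps)
      moreover have "norm (z r) \<le> real s0 + 1 + 4 * K * Q * (v * v * v)"
        using IHz unfolding v2 svv Q_def[symmetric] by (simp only: mult.assoc)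
      ultimately show ?thesis using zS by linarith
    qed
    have TS: "ta (Suc r) * \<beta> * sqrt (real (Suc r)) \<le> A"
    proof (cases "Suc r \<le> r1")
      case True then show ?thesis using Suc by (intro assms(8)) auto
    next
      case rr: False
      \<comment> \<open>From r \<ge> 3 s0 on, 3/4 (r - s0) \<ge> r/2; this is why r1 is at least 3
        s0.\<close>
      have pr: "real r / 2 \<le> p r"
      proof -
        have "3 * real s0 \<le> real r" using rr s0 by simp
        then show ?thesis using IHp by argo
      qed
      have elb: "\<beta>^2 \<le> el r"
      proof -
        have "4 * K^2 * \<beta>^2 * ta r \<le> 4 * K^2 * \<beta>^2 * ta s0"
          using ta_mono[OF Suc.hyps] by (intro mult_left_mono) auto
        then have "4 * K^2 * \<beta>^2 * ta r \<le> 1" using small by linarith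
        then have "4 * K^2 * \<beta>^2 \<le> 1 / ta r" using D.tau_pos[of r] by (simp add: field_simps)
        then have "4 * K^2 * \<beta>^2 \<le> el r" using D.ell_ge_tau[of r] by linarith
        moreover have "1 * \<beta>^2 \<le> 4 * K^2 * \<beta>^2"
        proof (rule mult_right_mono)
          have "1 \<le> K^2" using K by (intro one_le_power) simp
          then show "1 \<le> 4 * K^2" by linarith
        qed simp
        ultimately show ?thesis by simp
      qed
      have mr: "norm (m r) \<le> (2 + 8 * K) * Q / v"
      proof -
        have "real s0 + 1 \<le> Q * (v * v * v)"
          using init[of r] rr rn unfolding v2 svv Q_def[symmetric] by (simp add: mult.assoc)
        moreover have "norm (z r) \<le> real s0 + 1 + 4 * K * Q * (v * v * v)"
          using IHz unfolding v2 svv Q_def[symmetric] by (simp only: mult.assoc)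
        ultimately have zr: "norm (z r) \<le> (1 + 4 * K) * Q * (v * v * v)" by (simp add: algebra_simps)
        have "norm (m r) = norm (z r) / p r"
          using D.pp_pos[of r] by (simp add: z_m)
        also have "... \<le> ((1 + 4 * K) * Q * (v * v * v)) / (v^4 / 2)"
          using zr pr v1 K Q0 unfolding v4 by (intro frac_le) (auto intro!: mult_nonneg_nonneg)
        also have "v^4 / 2 = (v * v * v) * (v / 2)" by (simp add: power4_eq_xxxx)
        also have "(1 + 4 * K) * Q * (v * v * v) / ((v * v * v) * (v / 2)) = (1 + 4 * K) * Q / (v / 2)"
          using v1 by (simp add: mult.commute[of _ "v * v * v"])
        also have "... = (2 + 8 * K) * Q / v" by (simp add: field_simps)
        finally show ?thesis .
      qed
      have "norm (y (Suc r) - (a (Suc r) \<bullet> th) *\<^sub>R m r) \<le> Y + norm ((a (Suc r) \<bullet> th) *\<^sub>R m r)"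
        unfolding Y_def by (rule norm_triangle_ineq4)
      also have "norm ((a (Suc r) \<bullet> th) *\<^sub>R m r) \<le> 1 * norm (m r)"
        unfolding norm_scaleR real_norm_def using x01 by (intro mult_right_mono) auto
      finally have "norm (y (Suc r) - (a (Suc r) \<bullet> th) *\<^sub>R m r) \<le> K * Q / v + (2 + 8 * K) * Q / v"
        using Y4 mr by simp
      also have "... = (9 * K + 2) * (Q / v)" using v1 by (simp add: field_simps)
      also have "... \<le> (10 * K) * (Q / v)" using K Q0 v1 by (intro mult_right_mono) auto
      finally have eta: "norm (y (Suc r) - (a (Suc r) \<bullet> th) *\<^sub>R m r) \<le> (10 * K) * sqrt (A * \<beta>) / sqrt (sqrt (real r))"
        unfolding Q_def v_def by (simp only: times_divide_eq_right)
      \<comment> \<open>E = 10 K in \<open>ta_step\<close> is the origin of the factor 320 in the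
        assumption on A.\<close>
      have "32 * (real CARD('d))\<^sup>2 * (10 * K) \<le> A" using A(2) by (simp add: mult_ac)
      then show ?thesis
        using False rn K A(1) elb pr eta IHt by (intro ta_step[of r A "10 * K"]) auto
    qed
    have "norm (z (Suc r)) \<le> real s0 + 1 + 4 * K * sqrt (A * \<beta>) * (sqrt (real (Suc r)) * sqrt (sqrt (real (Suc r))))"
      unfolding v2 svv Q_def[symmetric] using ZS by (simp only: mult.assoc)
    then show ?thesis using BS TS P by blast
  qed
qed

end

section \<open>Exponential inequalities for the noise\<close>

context linucb_run
begin

abbreviation "F \<equiv> history M a (reward \<theta> a \<epsilon>)"

lemma history_generators:
  "(\<Union>s\<in>{1..t}. sets (vimage_algebra (space M) (a s) borel) \<union>
      sets (vimage_algebra (space M) (reward \<theta> a \<epsilon> s) borel)) \<subseteq> Pow (space M)"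
  using sets.sets_into_space[of _ "vimage_algebra (space M) (a _) borel"]
    sets.sets_into_space[of _ "vimage_algebra (space M) (reward \<theta> a \<epsilon> _) borel"]
  by fastforce

lemma space_F [simp]: "space (F t) = space M"
  by (simp add: history_def space_measure_of_conv)

lemma sets_F: "sets (F t) = sigma_sets (space M) (\<Union>s\<in>{1..t}. sets (vimage_algebra (space M) (a s) borel) \<union>
      sets (vimage_algebra (space M) (reward \<theta> a \<epsilon> s) borel))"
  unfolding history_def by (rule sets_measure_of[OF history_generators])

lemma F_mono: "s \<le> t \<Longrightarrow> sets (F s) \<subseteq> sets (F t)"
  unfolding sets_F by (rule sigma_sets_mono') fastforce

lemma measurable_F_mono: "f \<in> measurable (F s) N \<Longrightarrow> s \<le> t \<Longrightarrow> f \<in> measurable (F t) N"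
  using F_mono[of s t] by (auto simp: measurable_def)

lemma eps_measurable: "t \<in> {1..T} \<Longrightarrow> \<epsilon> t \<in> borel_measurable M"
  using noise_integrable(1) by (rule borel_measurable_integrable)

text \<open>By induction on t: an action is assumed measurable only for the preceding history, so
  its measurability for M, and then that of its reward, has to be derived one round at a
  time.\<close>

lemma F_sub: "t \<le> T \<Longrightarrow> sets (F t) \<subseteq> sets M"
proof (induction t)
  case 0 show ?case by (simp add: sets_F sigma_sets_empty_eq)
next
  case (Suc t)
  have am: "a s \<in> borel_measurable M" if "s \<in> {1..Suc t}" for s
  proof -
    have "a s \<in> borel_measurable (F (s - 1))" using that Suc.prems by (intro action_predictable) auto
    then have "a s \<in> borel_measurable (F t)" by (rule measurable_F_mono) (use that in auto)
    then show ?thesis using Suc by (auto simp: measurable_def)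
  qed
  have rm: "reward \<theta> a \<epsilon> s \<in> borel_measurable M" if "s \<in> {1..Suc t}" for s
  proof -
    have [measurable]: "a s \<in> borel_measurable M" "\<epsilon> s \<in> borel_measurable M"
      using am[OF that] eps_measurable[of s] that Suc.prems by auto
    show ?thesis unfolding reward_def by measurable
  qed
  have "sets (vimage_algebra (space M) (a s) borel) \<subseteq> sets M" if "s \<in> {1..Suc t}" for s
    using measurable_sets[OF am[OF that]] by (auto simp: sets_vimage_algebra2)
  moreover have "sets (vimage_algebra (space M) (reward \<theta> a \<epsilon> s) borel) \<subseteq> sets M"
    if "s \<in> {1..Suc t}" for s
    using measurable_sets[OF rm[OF that]] by (auto simp: sets_vimage_algebra2)
  ultimately show ?case unfolding sets_F by (intro sets.sigma_sets_subset) blast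
qed

lemma measurable_F_M: "f \<in> measurable (F t) N \<Longrightarrow> t \<le> T \<Longrightarrow> f \<in> measurable M N"
  using F_sub[of t] by (auto simp: measurable_def)

lemma subalg: "t \<le> T \<Longrightarrow> sigma_finite_subalgebra M (F t)"
proof (rule finite_measure_subalgebra_is_sigma_finite)
  assume "t \<le> T"
  then show "finite_measure_subalgebra M (F t)"
    by unfold_locales (simp add: subalgebra_def F_sub)
qed

lemma a_measurable_F: "s \<in> {1..T} \<Longrightarrow> s \<le> Suc t \<Longrightarrow> a s \<in> borel_measurable (F t)"
  by (rule measurable_F_mono[OF action_predictable]) auto

lemma eps_measurable_F:
  assumes "s \<in> {1..t}" "t \<le> T"
  shows "\<epsilon> s \<in> borel_measurable (F t)"
proof -
  have [measurable]: "a s \<in> borel_measurable (F t)" using assms by (intro a_measurable_F) auto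
  have [measurable]: "reward \<theta> a \<epsilon> s \<in> borel_measurable (F t)"
  proof (rule measurableI)
    fix A :: "real set" assume "A \<in> sets borel"
    then have "reward \<theta> a \<epsilon> s -` A \<inter> space M \<in> sets (vimage_algebra (space M) (reward \<theta> a \<epsilon> s) borel)"
      by (rule in_vimage_algebra)
    then show "reward \<theta> a \<epsilon> s -` A \<inter> space (F t) \<in> sets (F t)"
      unfolding sets_F space_F using assms by (intro sigma_sets.Basic) auto
  qed simp
  have "\<epsilon> s = (\<lambda>w. reward \<theta> a \<epsilon> s w - a s w \<bullet> \<theta>)" by (simp add: reward_def)
  also have "... \<in> borel_measurable (F t)" by measurable
  finally show ?thesis .
qed

text \<open>Passing to the nonnegative conditional expectation lets the weight Z be any nonnegative
  measurable function, with no integrability to check along the supermartingale argument.\<close>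

lemma nn_integral_le_of_cond_exp:
  assumes t: "t \<le> T" and g: "integrable M g" "\<And>w. 0 \<le> g w" and c: "0 \<le> c"
    and le: "AE w in M. real_cond_exp M (F t) g w \<le> c"
    and Z [measurable]: "Z \<in> borel_measurable (F t)"
  shows "(\<integral>\<^sup>+w. Z w * ennreal (g w) \<partial>M) \<le> (\<integral>\<^sup>+w. Z w * ennreal c \<partial>M)"
proof -
  interpret S: sigma_finite_subalgebra M "F t" using t by (rule subalg)
  have [measurable]: "g \<in> borel_measurable M" using g(1) by simp
  let ?N = "nn_cond_exp M (F t) (\<lambda>w. ennreal (g w))"
  have "(\<integral>\<^sup>+w. ?N w \<partial>M) = (\<integral>\<^sup>+w. ennreal (g w) \<partial>M)"
    using S.nn_cond_exp_intg[of "\<lambda>_. 1" "\<lambda>w. ennreal (g w)"] by simp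
  \<comment> \<open>Finiteness is essential: \<open>enn2real\<close> sends infinity to 0, so where
    the value is infinite the real-valued bound would say nothing.\<close>
  also have "... \<noteq> \<infinity>" using integrableD(2)[OF g(1)] g(2) by simp
  finally have fin: "AE w in M. ?N w \<noteq> \<infinity>" by (intro nn_integral_PInf_AE) auto
  have z: "AE w in M. nn_cond_exp M (F t) (\<lambda>w. ennreal (- g w)) w = 0"
  proof -
    have "(\<integral>\<^sup>+w. nn_cond_exp M (F t) (\<lambda>w. ennreal (- g w)) w \<partial>M) = (\<integral>\<^sup>+w. ennreal (- g w) \<partial>M)"
      using S.nn_cond_exp_intg[of "\<lambda>_. 1" "\<lambda>w. ennreal (- g w)"] by simp
    also have "... = 0" using g(2) by (simp add: ennreal_neg)
    finally show ?thesis by (subst (asm) nn_integral_0_iff_AE) auto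
  qed
  have N: "AE w in M. ?N w \<le> ennreal c"
    using fin z le
  proof eventually_elim
    case (elim w)
    have "real_cond_exp M (F t) g w = enn2real (?N w)"
      unfolding real_cond_exp_def using elim(2) by simp
    then have "enn2real (?N w) \<le> c" using elim(3) by simp
    then have "ennreal (enn2real (?N w)) \<le> ennreal c" by (rule ennreal_leI)
    then show ?case using elim(1) by (simp add: less_top)
  qed
  have "(\<integral>\<^sup>+w. Z w * ennreal (g w) \<partial>M) = (\<integral>\<^sup>+w. Z w * ?N w \<partial>M)"
    by (rule S.nn_cond_exp_intg[symmetric]) auto
  also have "... \<le> (\<integral>\<^sup>+w. Z w * ennreal c \<partial>M)"
    using N by (intro nn_integral_mono_AE) (auto elim!: eventually_mono intro: mult_left_mono)
  finally show ?thesis .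
qed

lemma exp_step_const:
  assumes t: "t \<in> {1..T}" and Z [measurable]: "Z \<in> borel_measurable (F (t - 1))"
  shows "(\<integral>\<^sup>+w. Z w * ennreal (exp (l * \<epsilon> t w)) \<partial>M) \<le> (\<integral>\<^sup>+w. Z w * ennreal (exp (\<sigma>^2 * l^2 / 2)) \<partial>M)"
  by (rule nn_integral_le_of_cond_exp[OF _ noise_integrable(3)[OF t] _ _ noise_subgaussian[OF t] Z])
    (use t in auto)

text \<open>The sub-Gaussian bound holds for each fixed l outside a null set depending on l, so a
  predictable random coefficient cannot be substituted directly. It is rounded to multiples of 1 /
  (n + 1), of which boundedness leaves finitely many, and Fatou's lemma removes the
  rounding.\<close>

lemma exp_step:
  assumes t: "t \<in> {1..T}"
    and z [measurable]: "z \<in> borel_measurable (F (t - 1))" and z0: "\<And>w. 0 \<le> z w"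
    and k [measurable]: "k \<in> borel_measurable (F (t - 1))" and kc: "\<And>w. \<bar>k w\<bar> \<le> c"
  shows "(\<integral>\<^sup>+w. ennreal (z w * exp (k w * \<epsilon> t w - \<sigma>^2 * (k w)\<^sup>2 / 2)) \<partial>M) \<le> (\<integral>\<^sup>+w. ennreal (z w) \<partial>M)"
proof -
  let ?F = "F (t - 1)"
  have tT: "t - 1 \<le> T" using t by auto
  have [measurable]: "z \<in> borel_measurable M" "k \<in> borel_measurable M" "\<epsilon> t \<in> borel_measurable M"
    using measurable_F_M[OF z tT] measurable_F_M[OF k tT] eps_measurable[OF t] by auto
  define kn where "kn n w = of_int \<lfloor>real (Suc n) * k w\<rfloor> / real (Suc n)" for n w
  have kn_lim: "(\<lambda>n. kn n w) \<longlonglongrightarrow> k w" for w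
  proof (rule tendsto_sandwich)
    show "(\<lambda>n. k w - 1 / real (Suc n)) \<longlonglongrightarrow> k w"
      using tendsto_diff[OF tendsto_const LIMSEQ_inverse_real_of_nat] by (simp add: inverse_eq_divide)
    have "k w - 1 / real (Suc n) \<le> kn n w \<and> kn n w \<le> k w" for n
    proof -
      have "real (Suc n) * k w - 1 \<le> of_int \<lfloor>real (Suc n) * k w\<rfloor>"
        "of_int \<lfloor>real (Suc n) * k w\<rfloor> \<le> real (Suc n) * k w" by linarith+
      then have "(real (Suc n) * k w - 1) / real (Suc n) \<le> kn n w" "kn n w \<le> real (Suc n) * k w / real (Suc n)"
        unfolding kn_def by (intro divide_right_mono; simp)+
      then show ?thesis by (simp add: diff_divide_distrib)
    qed
    then show "\<forall>\<^sub>F n in sequentially. k w - 1 / real (Suc n) \<le> kn n w"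
      "\<forall>\<^sub>F n in sequentially. kn n w \<le> k w" by auto
  qed simp
  define u where "u n w = ennreal (z w * exp (kn n w * \<epsilon> t w - \<sigma>^2 * (kn n w)\<^sup>2 / 2))" for n w
  have [measurable]: "kn n \<in> borel_measurable M" "kn n \<in> borel_measurable ?F" for n
    unfolding kn_def by measurable
  have [measurable]: "u n \<in> borel_measurable M" for n unfolding u_def by measurable
  have u_le: "(\<integral>\<^sup>+w. u n w \<partial>M) \<le> (\<integral>\<^sup>+w. ennreal (z w) \<partial>M)" for n
  proof -
    define J where "J = {- \<lceil>real (Suc n) * c\<rceil> - 1 .. \<lceil>real (Suc n) * c\<rceil> + 1}"
    have mem: "\<lfloor>real (Suc n) * k w\<rfloor> \<in> J" for w
    proof -
      have "\<bar>real (Suc n) * k w\<bar> \<le> real (Suc n) * c"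
        unfolding abs_mult using kc[of w] by (intro mult_mono) auto
      then show ?thesis unfolding J_def atLeastAtMost_iff by linarith
    qed
    define v where "v j = of_int j / real (Suc n)" for j :: int
    define Zj where "Zj j w = ennreal (z w * exp (- (\<sigma>^2 * (v j)\<^sup>2 / 2))) * indicator {w. \<lfloor>real (Suc n) * k w\<rfloor> = j} w" for j w
    have [measurable]: "Zj j \<in> borel_measurable ?F" for j unfolding Zj_def by measurable
    have [measurable]: "Zj j \<in> borel_measurable M" for j by (rule measurable_F_M[OF _ tT]) measurable
    have split: "u n w = (\<Sum>j\<in>J. Zj j w * ennreal (exp (v j * \<epsilon> t w)))" for w
    proof -
      let ?j = "\<lfloor>real (Suc n) * k w\<rfloor>"
      have "(\<Sum>j\<in>J. Zj j w * ennreal (exp (v j * \<epsilon> t w))) = (\<Sum>j\<in>J. if j = ?j then u n w else 0)"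
      proof (rule sum.cong[OF refl])
        fix j
        show "Zj j w * ennreal (exp (v j * \<epsilon> t w)) = (if j = ?j then u n w else 0)"
        proof (cases "j = ?j")
          case True
          then have vk: "v j = kn n w" by (simp add: v_def kn_def)
          have "Zj j w * ennreal (exp (v j * \<epsilon> t w))
              = ennreal (z w * exp (- (\<sigma>^2 * (v j)\<^sup>2 / 2)) * exp (v j * \<epsilon> t w))"
            using z0[of w] True by (simp add: Zj_def ennreal_mult)
          also have "z w * exp (- (\<sigma>^2 * (v j)\<^sup>2 / 2)) * exp (v j * \<epsilon> t w)
              = z w * exp (kn n w * \<epsilon> t w - \<sigma>^2 * (kn n w)\<^sup>2 / 2)"
            unfolding vk mult.assoc exp_add[symmetric] by simp
          finally show ?thesis using True by (simp add: u_def)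
        qed (auto simp: Zj_def)
      qed
      then show ?thesis using mem[of w] by (simp add: J_def)
    qed
    have "(\<integral>\<^sup>+w. u n w \<partial>M) = (\<Sum>j\<in>J. \<integral>\<^sup>+w. Zj j w * ennreal (exp (v j * \<epsilon> t w)) \<partial>M)"
      unfolding split by (rule nn_integral_sum) measurable
    also have "... \<le> (\<Sum>j\<in>J. \<integral>\<^sup>+w. Zj j w * ennreal (exp (\<sigma>^2 * (v j)\<^sup>2 / 2)) \<partial>M)"
      by (intro sum_mono exp_step_const[OF t]) measurable
    also have "... = (\<integral>\<^sup>+w. (\<Sum>j\<in>J. Zj j w * ennreal (exp (\<sigma>^2 * (v j)\<^sup>2 / 2))) \<partial>M)"
      by (rule nn_integral_sum[symmetric]) measurable
    also have "... = (\<integral>\<^sup>+w. ennreal (z w) \<partial>M)"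
    proof (rule nn_integral_cong)
      fix w
      let ?j = "\<lfloor>real (Suc n) * k w\<rfloor>"
      have "(\<Sum>j\<in>J. Zj j w * ennreal (exp (\<sigma>^2 * (v j)\<^sup>2 / 2))) = (\<Sum>j\<in>J. if j = ?j then ennreal (z w) else 0)"
      proof (rule sum.cong[OF refl])
        fix j
        show "Zj j w * ennreal (exp (\<sigma>^2 * (v j)\<^sup>2 / 2)) = (if j = ?j then ennreal (z w) else 0)"
        proof (cases "j = ?j")
          case True
          have "Zj j w * ennreal (exp (\<sigma>^2 * (v j)\<^sup>2 / 2))
              = ennreal (z w * exp (- (\<sigma>^2 * (v j)\<^sup>2 / 2)) * exp (\<sigma>^2 * (v j)\<^sup>2 / 2))"
            using z0[of w] True by (simp add: Zj_def ennreal_mult)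
          also have "z w * exp (- (\<sigma>^2 * (v j)\<^sup>2 / 2)) * exp (\<sigma>^2 * (v j)\<^sup>2 / 2) = z w"
            unfolding mult.assoc exp_add[symmetric] by simp
          finally show ?thesis using True by simp
        qed (auto simp: Zj_def)
      qed
      then show "(\<Sum>j\<in>J. Zj j w * ennreal (exp (\<sigma>^2 * (v j)\<^sup>2 / 2))) = ennreal (z w)"
        using mem[of w] by (simp add: J_def)
    qed
    finally show ?thesis .
  qed
  have lim: "(\<lambda>n. u n w) \<longlonglongrightarrow> ennreal (z w * exp (k w * \<epsilon> t w - \<sigma>^2 * (k w)\<^sup>2 / 2))" for w
    unfolding u_def by (intro tendsto_intros kn_lim) auto
  have "(\<integral>\<^sup>+w. ennreal (z w * exp (k w * \<epsilon> t w - \<sigma>^2 * (k w)\<^sup>2 / 2)) \<partial>M) = (\<integral>\<^sup>+w. liminf (\<lambda>n. u n w) \<partial>M)"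
    by (intro nn_integral_cong lim_imp_Liminf[OF _ lim, symmetric]) simp
  also have "... \<le> liminf (\<lambda>n. \<integral>\<^sup>+w. u n w \<partial>M)" by (rule nn_integral_liminf) measurable
  also have "... \<le> (\<integral>\<^sup>+w. ennreal (z w) \<partial>M)"
    using Liminf_mono[of _ "\<lambda>_. \<integral>\<^sup>+w. ennreal (z w) \<partial>M" sequentially] u_le
    by (simp add: Liminf_const)
  finally show ?thesis .
qed

text \<open>The exponent of the exponential supermartingale with predictable weights k.\<close>

definition "expo k n w = (\<Sum>s=1..n. k s w * \<epsilon> s w - \<sigma>^2 * (k s w)\<^sup>2 / 2)"
  for k :: "nat \<Rightarrow> 'w \<Rightarrow> real"

lemma expo_measurable:
  assumes k: "\<And>s. s \<in> {1..T} \<Longrightarrow> k s \<in> borel_measurable (F (s - 1))" and n: "n \<le> t" "t \<le> T"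
  shows "expo k n \<in> borel_measurable (F t)"
proof -
  have "(\<lambda>w. k s w * \<epsilon> s w - \<sigma>^2 * (k s w)\<^sup>2 / 2) \<in> borel_measurable (F t)" if "s \<in> {1..n}" for s
  proof -
    have [measurable]: "k s \<in> borel_measurable (F t)"
      using that n by (intro measurable_F_mono[OF k]) auto
    have [measurable]: "\<epsilon> s \<in> borel_measurable (F t)" using that n by (intro eps_measurable_F) auto
    show ?thesis by measurable
  qed
  then show ?thesis unfolding expo_def by (rule borel_measurable_sum)
qed

lemma exp_expo_le_one:
  assumes k: "\<And>s. s \<in> {1..T} \<Longrightarrow> k s \<in> borel_measurable (F (s - 1))"
    and kc: "\<And>s w. s \<in> {1..T} \<Longrightarrow> \<bar>k s w\<bar> \<le> c" and n: "n \<le> T"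
  shows "(\<integral>\<^sup>+w. ennreal (exp (expo k n w)) \<partial>M) \<le> 1"
  using n
proof (induction n)
  case 0 show ?case by (simp add: expo_def emeasure_space_1)
next
  case (Suc n)
  have "(\<integral>\<^sup>+w. ennreal (exp (expo k (Suc n) w)) \<partial>M)
      = (\<integral>\<^sup>+w. ennreal (exp (expo k n w) * exp (k (Suc n) w * \<epsilon> (Suc n) w - \<sigma>^2 * (k (Suc n) w)\<^sup>2 / 2)) \<partial>M)"
    by (simp add: expo_def exp_add[symmetric])
  also have "... \<le> (\<integral>\<^sup>+w. ennreal (exp (expo k n w)) \<partial>M)"
  proof (rule exp_step[where c = c])
    have [measurable]: "expo k n \<in> borel_measurable (F n)"
      using Suc.prems by (intro expo_measurable k) auto
    show "(\<lambda>w. exp (expo k n w)) \<in> borel_measurable (F (Suc n - 1))" by simp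
  qed (use Suc.prems k[of "Suc n"] kc[of "Suc n"] in auto)
  also have "... \<le> 1" using Suc by simp
  finally show ?case .
qed

text \<open>Switching the weights off after the first crossing turns the supremum over time into a
  statement about the final time.\<close>

lemma maximal_inequality:
  assumes k: "\<And>s. s \<in> {1..T} \<Longrightarrow> k s \<in> borel_measurable (F (s - 1))"
    and kc: "\<And>s w. s \<in> {1..T} \<Longrightarrow> \<bar>k s w\<bar> \<le> c"
  shows "{w \<in> space M. \<exists>n\<le>T. x \<le> expo k n w} \<in> sets M"
    and "measure M {w \<in> space M. \<exists>n\<le>T. x \<le> expo k n w} \<le> exp (- x)"
proof -
  have em [measurable]: "expo k n \<in> borel_measurable M" if "n \<le> T" for n
    using measurable_F_M[OF expo_measurable[OF k, of n T]] that by simp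
  have "{w \<in> space M. \<exists>n\<le>T. x \<le> expo k n w} = (\<Union>n\<in>{..T}. {w \<in> space M. x \<le> expo k n w})" by auto
  also have "... \<in> sets M" using em by (intro sets.finite_UN) (auto intro: borel_measurable_le)
  finally show ms: "{w \<in> space M. \<exists>n\<le>T. x \<le> expo k n w} \<in> sets M" .
  define k' where "k' s w = (if \<exists>n<s. x \<le> expo k n w then 0 else k s w)" for s w
  have k': "k' s \<in> borel_measurable (F (s - 1))" if s: "s \<in> {1..T}" for s
  proof -
    have "{w \<in> space (F (s - 1)). \<exists>n<s. x \<le> expo k n w}
        = (\<Union>n\<in>{..<s}. {w \<in> space (F (s - 1)). x \<le> expo k n w})" by auto
    also have "... \<in> sets (F (s - 1))"
    proof (intro sets.finite_UN)
      fix n assume "n \<in> {..<s}"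
      then have "expo k n \<in> borel_measurable (F (s - 1))" using s by (intro expo_measurable k) auto
      then show "{w \<in> space (F (s - 1)). x \<le> expo k n w} \<in> sets (F (s - 1))" by measurable
    qed simp
    finally have ms: "{w \<in> space (F (s - 1)). \<exists>n<s. x \<le> expo k n w} \<in> sets (F (s - 1))" .
    show ?thesis unfolding k'_def by (rule measurable_If[OF _ k[OF s] ms]) simp
  qed
  have kc': "\<bar>k' s w\<bar> \<le> c" if "s \<in> {1..T}" for s w
    using kc[OF that, of w] by (auto simp: k'_def)
  have cross: "x \<le> expo k' T w" if "\<exists>n\<le>T. x \<le> expo k n w" for w
  proof -
    define N where "N = (LEAST n. x \<le> expo k n w)"
    from that obtain n where n: "n \<le> T" "x \<le> expo k n w" by blast
    have N: "x \<le> expo k N w" unfolding N_def using n(2) by (rule LeastI)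
    have NT: "N \<le> T" using n Least_le[of "\<lambda>n. x \<le> expo k n w" n] by (simp add: N_def)
    have less: "\<not> x \<le> expo k n w" if "n < N" for n using not_less_Least that unfolding N_def by blast
    have "expo k' T w = (\<Sum>s\<in>{1..T}. if s \<le> N then k s w * \<epsilon> s w - \<sigma>^2 * (k s w)\<^sup>2 / 2 else 0)"
      unfolding expo_def
    proof (rule sum.cong[OF refl])
      fix s
      show "k' s w * \<epsilon> s w - \<sigma>^2 * (k' s w)\<^sup>2 / 2
          = (if s \<le> N then k s w * \<epsilon> s w - \<sigma>^2 * (k s w)\<^sup>2 / 2 else 0)"
      proof -
        have "(\<exists>n<s. x \<le> expo k n w) \<longleftrightarrow> \<not> s \<le> N"
          using less N by (meson not_le order_less_le_trans)
        then show ?thesis by (simp add: k'_def)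
      qed
    qed
    also have "... = expo k N w"
      unfolding expo_def using NT by (simp add: sum.If_cases) (intro sum.cong; auto)
    finally show ?thesis using N by simp
  qed
  have [measurable]: "expo k' T \<in> borel_measurable M"
    using measurable_F_M[OF expo_measurable[OF k', of T T]] by simp
  have "emeasure M {w \<in> space M. \<exists>n\<le>T. x \<le> expo k n w} \<le> emeasure M {w \<in> space M. 1 \<le> ennreal (exp (- x)) * ennreal (exp (expo k' T w))}"
  proof (rule emeasure_mono)
    show "{w \<in> space M. \<exists>n\<le>T. x \<le> expo k n w} \<subseteq> {w \<in> space M. 1 \<le> ennreal (exp (- x)) * ennreal (exp (expo k' T w))}"
    proof safe
      fix w n assume "n \<le> T" "x \<le> expo k n w"
      then have "1 \<le> exp (- x) * exp (expo k' T w)" using cross by (simp add: exp_add[symmetric]) blast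
      then show "1 \<le> ennreal (exp (- x)) * ennreal (exp (expo k' T w))"
        by (simp add: ennreal_mult[symmetric])
    qed
  qed measurable
  also have "... \<le> ennreal (exp (- x)) * (\<integral>\<^sup>+w. ennreal (exp (expo k' T w)) * indicator (space M) w \<partial>M)"
    by (rule nn_integral_Markov_inequality) auto
  also have "... \<le> ennreal (exp (- x)) * 1"
    using exp_expo_le_one[OF k' kc' order_refl] by (intro mult_left_mono) (simp_all add: nn_integral_indicator_finite cong: nn_integral_cong)
  finally show "measure M {w \<in> space M. \<exists>n\<le>T. x \<le> expo k n w} \<le> exp (- x)"
    by (simp add: emeasure_eq_measure)
qed

end

section \<open>Self-normalised bounds from a finite net\<close>

text \<open>The net has to be deterministic while the relevant norm is given by the random design
  matrix. The indices i and j guess the dyadic sizes of p and B, which fix the mesh along th and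
  orthogonally to it; k and h count meshes. Only the number of scales depends on T, and only
  logarithmically.\<close>

definition grid_vector :: "real^'d \<Rightarrow> real \<Rightarrow> nat \<times> nat \<times> int \<times> ('d \<Rightarrow> int) \<Rightarrow> real^'d" where
  "grid_vector th \<Gamma> = (\<lambda>(i, j, k, h).
     (of_int k * (\<Gamma> / (8 * sqrt (2 ^ Suc i)))) *\<^sub>R th +
     proj_orth th (\<chi> l. of_int (h l) * (\<Gamma> / (8 * sqrt (real CARD('d)) * sqrt (2 ^ Suc j)))))"

definition grid_indices :: "nat \<Rightarrow> nat \<Rightarrow> (nat \<times> nat \<times> int \<times> ('d::finite \<Rightarrow> int)) set" where
  "grid_indices I N = {..I} \<times> {..I} \<times> {- int N..int N} \<times> (UNIV \<rightarrow>\<^sub>E {- int N..int N})"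

lemma finite_grid_indices: "finite (grid_indices I N :: (nat \<times> nat \<times> int \<times> ('d::finite \<Rightarrow> int)) set)"
  unfolding grid_indices_def by (intro finite_cartesian_product finite_PiE) auto

lemma card_grid_indices:
  "card (grid_indices I N :: (nat \<times> nat \<times> int \<times> ('d::finite \<Rightarrow> int)) set)
    = (Suc I)\<^sup>2 * (2 * N + 1) ^ Suc CARD('d)"
proof -
  have c: "card {- int N..int N} = 2 * N + 1" by simp
  show ?thesis
    unfolding grid_indices_def card_cartesian_product card_PiE[OF finite] c prod_constant card_atMost
    by (simp only: power2_eq_square power_Suc mult.assoc)
qed

lemma dyadic_scale:
  fixes x :: real
  assumes "1 \<le> x" "x < 2 ^ Suc I"
  obtains i where "i \<le> I" "2 ^ i \<le> x" "x < 2 ^ Suc i"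
proof -
  define i where "i = (LEAST i. x < 2 ^ Suc i)"
  have i: "x < 2 ^ Suc i" unfolding i_def using assms(2) by (rule LeastI)
  have iI: "i \<le> I" unfolding i_def using assms(2) by (rule Least_le)
  have "2 ^ i \<le> x"
  proof (cases i)
    case (Suc j)
    have "j < i" using Suc by simp
    then have "\<not> x < 2 ^ Suc j" unfolding i_def by (rule not_less_Least)
    then show ?thesis using Suc by simp
  qed (use assms in simp)
  then show thesis using that i iI by blast
qed

lemma floor_abs_le:
  fixes x s C :: real
  assumes "0 < s" "\<bar>x\<bar> \<le> C * s" "C + 1 \<le> real N"
  shows "\<lfloor>x / s\<rfloor> \<in> {- int N..int N}" "\<bar>of_int \<lfloor>x / s\<rfloor> * s - x\<bar> \<le> s"
proof -
  have "\<bar>x / s\<bar> \<le> C" using assms by (simp add: abs_div_pos[symmetric] pos_divide_le_eq)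
  then have "\<bar>x / s\<bar> \<le> real N - 1" using assms(3) by linarith
  then show "\<lfloor>x / s\<rfloor> \<in> {- int N..int N}" by (simp only: atLeastAtMost_iff) linarith
  have "\<bar>of_int \<lfloor>x / s\<rfloor> - x / s\<bar> \<le> 1" by linarith
  then have "\<bar>of_int \<lfloor>x / s\<rfloor> - x / s\<bar> * s \<le> 1 * s" using assms(1) by (intro mult_right_mono) auto
  moreover have "(of_int \<lfloor>x / s\<rfloor> - x / s) * s = of_int \<lfloor>x / s\<rfloor> * s - x"
    using assms(1) by (simp add: left_diff_distrib)
  then have "\<bar>of_int \<lfloor>x / s\<rfloor> - x / s\<bar> * s = \<bar>of_int \<lfloor>x / s\<rfloor> * s - x\<bar>"
    using assms(1) by (metis abs_mult abs_of_pos)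
  ultimately show "\<bar>of_int \<lfloor>x / s\<rfloor> * s - x\<bar> \<le> s" by simp
qed

context design
begin

lemma p_add_m_dot: "th \<bullet> (Lam t *v g) = p t * (g \<bullet> th + m t \<bullet> proj_orth th g)"
proof -
  have "th \<bullet> (Lam t *v g) = (Lam t *v th) \<bullet> g" using D.Lam_dot[of t th g] by simp
  also have "... = p t * (g \<bullet> th + m t \<bullet> g)"
    by (simp add: D.Lam_th inner_add_left inner_commute algebra_simps)
  also have "m t \<bullet> g = m t \<bullet> proj_orth th g" by (simp add: proj_orth_inner)
  finally show ?thesis .
qed

text \<open>The dual norm of S is attained in a direction whose components, measured in meshes of
  the right scale, are bounded because B and el are comparable. Rounding that direction to the net
  costs a quarter of its norm, so the linear bounds on the net yield the norm up to a
  factor.\<close>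

lemma self_normalised_bound:
  fixes J \<Gamma> \<sigma> :: real
  assumes a_le: "\<And>s. 1 \<le> s \<Longrightarrow> s \<le> t \<Longrightarrow> norm (a s) \<le> 1"
    and I: "real t + 1 < 2 ^ Suc I"
    and J: "1 \<le> J" "B t \<le> J * el t"
    and N: "12 * sqrt (real CARD('d)) * (2 + sqrt J) + 1 \<le> real N"
    and G: "0 < \<Gamma>"
    and net: "\<And>g. g \<in> grid_vector th \<Gamma> ` grid_indices I N \<Longrightarrow> g \<bullet> S \<le> \<sigma>^2 / 2 * (g \<bullet> (Lam t *v g)) + \<Gamma>^2"
  shows "seminorm_of (G t) S \<le> 2 * (1 + \<sigma>^2) * \<Gamma>"
proof (cases "seminorm_of (G t) S = 0")
  case True then show ?thesis using G by simp
next
  case False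
  define d where "d = real CARD('d)"
  have d1: "1 \<le> d" by (simp add: d_def)
  have sd1: "1 \<le> sqrt d" using d1 by simp
  define N0 where "N0 = seminorm_of (G t) S"
  have N0: "0 < N0" using False D.nG_nonneg[of t S] by (simp add: N0_def)
  have N0sq: "S \<bullet> (G t *v S) = N0 * N0" using D.nG_power2[of t S] by (simp add: N0_def power2_eq_square)
  \<comment> \<open>The maximiser of g . S among vectors of Lam-norm \<Gamma>: at that length the
    quadratic term and the threshold \<Gamma>^2 of the exponential bound are of the same
    order.\<close>
  define gs where "gs = (\<Gamma> / N0) *\<^sub>R (G t *v S)"
  define al where "al = gs \<bullet> th"
  define v where "v = proj_orth th gs"
  have nLgs: "D.nL t gs = \<Gamma>"
    using N0 G by (simp add: gs_def seminorm_of_scaleR D.nL_Gm N0_def[symmetric])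
  have gsS: "gs \<bullet> S = \<Gamma> * N0"
    using N0 N0sq by (simp add: gs_def inner_commute)
  have el0: "0 < el t" by (rule D.ell_pos)
  have p1: "1 \<le> p t" by (rule D.pp_ge_one)
  have B1: "1 \<le> B t" by (rule B_ge_one)
  have v_le: "norm v \<le> \<Gamma> / sqrt (el t)"
  proof -
    have "norm v \<le> norm gs" unfolding v_def by (rule norm_proj_orth_le[OF norm_th_one])
    moreover have "sqrt (el t) * norm gs \<le> \<Gamma>" using D.nL_ge[of t gs] nLgs by simp
    moreover have "0 \<le> sqrt (el t)" using el0 by simp
    ultimately have "sqrt (el t) * norm v \<le> \<Gamma>" by (meson mult_left_mono order_trans)
    then show ?thesis using el0 by (simp add: field_simps)
  qed
  have v_le': "norm v \<le> \<Gamma> * sqrt J / sqrt (B t)"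
  proof -
    have "sqrt (B t) \<le> sqrt J * sqrt (el t)"
      using real_sqrt_le_mono[OF J(2)] by (simp add: real_sqrt_mult)
    then have "1 / sqrt (el t) \<le> sqrt J / sqrt (B t)" using el0 B1 by (simp add: field_simps)
    then have "\<Gamma> * (1 / sqrt (el t)) \<le> \<Gamma> * (sqrt J / sqrt (B t))" using G by (intro mult_left_mono) auto
    then show ?thesis using v_le by simp
  qed
  \<comment> \<open>The component along th is not controlled by el at the required precision. It is
    recovered from th . Lam gs = p (al + m . v), where the m-term is bounded by
    \<open>p_norm_m_sq\<close>.\<close>
  have al_le: "\<bar>al\<bar> \<le> (1 + sqrt J) * \<Gamma> / sqrt (p t)"
  proof -
    have "\<bar>th \<bullet> (Lam t *v gs)\<bar> \<le> D.nL t th * D.nL t gs" by (rule D.nL_cs)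
    moreover have "D.nL t th = sqrt (p t)" by (simp add: seminorm_of_def D.pp_def)
    ultimately have "p t * \<bar>al + m t \<bullet> v\<bar> \<le> sqrt (p t) * \<Gamma>"
      using nLgs p1 by (simp add: p_add_m_dot abs_mult al_def v_def)
    then have "sqrt (p t) * (sqrt (p t) * \<bar>al + m t \<bullet> v\<bar>) \<le> sqrt (p t) * \<Gamma>"
      using p1 by (simp add: mult.assoc[symmetric])
    then have a1: "sqrt (p t) * \<bar>al + m t \<bullet> v\<bar> \<le> \<Gamma>" using p1 by simp
    have "sqrt (p t) * \<bar>m t \<bullet> v\<bar> \<le> sqrt (p t) * (norm (m t) * norm v)"
      using p1 by (intro mult_left_mono Cauchy_Schwarz_ineq2) auto
    also have "... = (sqrt (p t) * norm (m t)) * norm v" by simp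
    also have "... \<le> sqrt (B t) * (\<Gamma> * sqrt J / sqrt (B t))"
    proof (intro mult_mono v_le')
      have "sqrt (p t * (norm (m t))\<^sup>2) \<le> sqrt (B t)" by (rule real_sqrt_le_mono[OF p_norm_m_sq])
      then show "sqrt (p t) * norm (m t) \<le> sqrt (B t)" by (simp add: real_sqrt_mult)
    qed (use B1 in auto)
    also have "... = \<Gamma> * sqrt J" using B1 by simp
    finally have a2: "sqrt (p t) * \<bar>m t \<bullet> v\<bar> \<le> \<Gamma> * sqrt J" .
    have "\<bar>al\<bar> \<le> \<bar>al + m t \<bullet> v\<bar> + \<bar>m t \<bullet> v\<bar>" by linarith
    then have "sqrt (p t) * \<bar>al\<bar> \<le> sqrt (p t) * (\<bar>al + m t \<bullet> v\<bar> + \<bar>m t \<bullet> v\<bar>)"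
      using p1 by (intro mult_left_mono) auto
    then have "sqrt (p t) * \<bar>al\<bar> \<le> (1 + sqrt J) * \<Gamma>" using a1 a2 by (simp add: algebra_simps)
    then show ?thesis using p1 by (simp add: field_simps)
  qed
  obtain i where i: "i \<le> I" "2 ^ i \<le> p t" "p t < 2 ^ Suc i"
    using dyadic_scale[OF p1] p_le[OF a_le] I by (metis add.commute le_less_trans)
  obtain j where j: "j \<le> I" "2 ^ j \<le> B t" "B t < 2 ^ Suc j"
    using dyadic_scale[OF B1] B_le[OF a_le] I by (metis add.commute le_less_trans)
  have s2: "sqrt 2 \<le> 3 / 2" by (rule real_le_lsqrt) (auto simp: power2_eq_square)
  define s0 where "s0 = \<Gamma> / (8 * sqrt (2 ^ Suc i))"
  define s1 where "s1 = \<Gamma> / (8 * sqrt d * sqrt (2 ^ Suc j))"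
  have s0p: "0 < s0" and s1p: "0 < s1" using G d1 by (simp_all add: s0_def s1_def)
  have ratio: "1 / sqrt x \<le> (3 / 2) / sqrt (2 ^ Suc i)" if "2 ^ i \<le> x" for x :: real and i :: nat
  proof -
    have x0: "0 < x" using that by (meson less_le_trans zero_less_numeral zero_less_power)
    have "sqrt (2 ^ Suc i) = sqrt 2 * sqrt (2 ^ i)" by (simp add: real_sqrt_mult)
    also have "... \<le> (3 / 2) * sqrt x" using s2 that by (intro mult_mono) auto
    finally show ?thesis using x0 by (simp add: field_simps)
  qed
  have sJ: "0 \<le> sqrt J" using J by simp
  \<comment> \<open>12 is 8 times 3/2: the 8 is the fineness of the mesh, and 3/2 bounds the sqrt 2
    lost by replacing p by its dyadic scale.\<close>
  have al2: "\<bar>al\<bar> \<le> (12 * (1 + sqrt J)) * s0"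
  proof -
    have "(1 + sqrt J) * \<Gamma> * (1 / sqrt (p t)) \<le> (1 + sqrt J) * \<Gamma> * ((3 / 2) / sqrt (2 ^ Suc i))"
      using ratio[OF i(2)] G sJ by (intro mult_left_mono) auto
    also have "(1 + sqrt J) * \<Gamma> * ((3 / 2) / sqrt (2 ^ Suc i)) = (12 * (1 + sqrt J)) * s0"
      unfolding s0_def by (simp add: field_simps del: power_Suc)
    finally show ?thesis using al_le by simp
  qed
  have vl: "\<bar>v $ l\<bar> \<le> (12 * sqrt d * sqrt J) * s1" for l
  proof -
    have "\<bar>v $ l\<bar> \<le> norm v" by (rule component_le_norm_cart)
    also have "... \<le> (\<Gamma> * sqrt J) * (1 / sqrt (B t))" using v_le' by simp
    also have "... \<le> (\<Gamma> * sqrt J) * ((3 / 2) / sqrt (2 ^ Suc j))"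
      using ratio[OF j(2)] G sJ by (intro mult_left_mono) auto
    also have "... = (12 * sqrt d * sqrt J) * s1" using d1 by (simp add: s1_def)
    finally show ?thesis .
  qed
  have Nd: "12 * (1 + sqrt J) + 1 \<le> real N" "12 * sqrt d * sqrt J + 1 \<le> real N"
  proof -
    have "1 * (1 + sqrt J) \<le> sqrt d * (2 + sqrt J)" using sd1 sJ by (intro mult_mono) auto
    then show "12 * (1 + sqrt J) + 1 \<le> real N" using N unfolding d_def[symmetric] by argo
    have "sqrt d * sqrt J \<le> sqrt d * (2 + sqrt J)" using sd1 by (intro mult_left_mono) auto
    then show "12 * sqrt d * sqrt J + 1 \<le> real N" using N unfolding d_def[symmetric] by argo
  qed
  define k where "k = \<lfloor>al / s0\<rfloor>"
  define h where "h l = \<lfloor>v $ l / s1\<rfloor>" for l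
  have kN: "k \<in> {- int N..int N}" and kerr: "\<bar>of_int k * s0 - al\<bar> \<le> s0"
    using floor_abs_le[OF s0p al2 Nd(1)] by (simp_all add: k_def)
  have hN: "h l \<in> {- int N..int N}" and herr: "\<bar>of_int (h l) * s1 - v $ l\<bar> \<le> s1" for l
    using floor_abs_le[OF s1p vl Nd(2)] by (simp_all add: h_def)
  define u :: "real^'d" where "u = (\<chi> l. of_int (h l) * s1)"
  define g where "g = (of_int k * s0) *\<^sub>R th + proj_orth th u"
  have "(i, j, k, h) \<in> grid_indices I N"
    using i(1) j(1) kN hN by (auto simp: grid_indices_def)
  moreover have "g = grid_vector th \<Gamma> (i, j, k, h)"
    by (simp add: grid_vector_def g_def u_def s0_def s1_def d_def)
  ultimately have gnet: "g \<bullet> S \<le> \<sigma>^2 / 2 * (g \<bullet> (Lam t *v g)) + \<Gamma>^2" by (intro net) blast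
  have uv: "norm (u - v) \<le> sqrt d * s1"
  proof -
    have "(norm (u - v))\<^sup>2 = (\<Sum>l\<in>UNIV. (of_int (h l) * s1 - v $ l)\<^sup>2)"
      unfolding power2_norm_eq_inner inner_vec_def by (simp add: u_def power2_eq_square)
    also have "... \<le> (\<Sum>l\<in>(UNIV::'d set). s1\<^sup>2)"
    proof (rule sum_mono)
      fix l
      show "(of_int (h l) * s1 - v $ l)\<^sup>2 \<le> s1^2"
        using herr[of l] s1p by (metis abs_le_square_iff abs_of_pos)
    qed
    also have "... = (sqrt d * s1)\<^sup>2" using d1 by (simp add: d_def power_mult_distrib)
    finally show ?thesis using d1 s1p by (rule_tac power2_le_imp_le) auto
  qed
  have dec: "gs = al *\<^sub>R th + v" using proj_orth_decomp[of gs th] by (simp add: al_def v_def)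
  have "g - gs = (of_int k * s0 - al) *\<^sub>R th + proj_orth th (u - v)"
  proof -
    have "proj_orth th v = v" by (rule proj_orth_id) (simp add: v_def norm_th_one)
    then show ?thesis unfolding g_def proj_orth_diff by (subst dec) (simp add: scaleR_diff_left)
  qed
  then have "D.nL t (g - gs) \<le> D.nL t ((of_int k * s0 - al) *\<^sub>R th) + D.nL t (proj_orth th (u - v))"
    by (simp add: D.nL_triangle)
  also have "D.nL t ((of_int k * s0 - al) *\<^sub>R th) \<le> s0 * sqrt (p t)"
    using kerr p1 by (simp add: seminorm_of_scaleR seminorm_of_def[of _ th] D.pp_def[symmetric] mult_right_mono)
  also have "s0 * sqrt (p t) \<le> \<Gamma> / 8"
  proof -
    have "sqrt (p t) \<le> sqrt (2 ^ Suc i)" using i(3) by (intro real_sqrt_le_mono) simp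
    then have "s0 * sqrt (p t) \<le> s0 * sqrt (2 ^ Suc i)" using s0p by (intro mult_left_mono) auto
    then show ?thesis by (simp add: s0_def)
  qed
  also have "D.nL t (proj_orth th (u - v)) \<le> \<Gamma> / 8"
  proof -
    have "proj_orth th (u - v) \<bullet> th = 0" by (simp add: norm_th_one)
    then have "D.nL t (proj_orth th (u - v)) \<le> sqrt (B t * (norm (proj_orth th (u - v)))\<^sup>2)"
      unfolding seminorm_of_def by (intro real_sqrt_le_mono quad_le_B)
    also have "... = sqrt (B t) * norm (proj_orth th (u - v))" by (simp add: real_sqrt_mult)
    also have "... \<le> sqrt (2 ^ Suc j) * (sqrt d * s1)"
      using j(3) uv norm_proj_orth_le[OF norm_th_one, of "u - v"] d1 s1p by (intro mult_mono real_sqrt_le_mono) auto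
    also have "... = \<Gamma> / 8" using d1 by (simp add: s1_def)
    finally show ?thesis .
  qed
  \<comment> \<open>One eighth of \<Gamma> from each of the two components, in the norm of the
    design matrix.\<close>
  finally have err: "D.nL t (g - gs) \<le> \<Gamma> / 4" by simp
  have "D.nL t g \<le> D.nL t gs + D.nL t (g - gs)" using D.nL_triangle[of t gs "g - gs"] by simp
  then have nLg: "D.nL t g \<le> 5 / 4 * \<Gamma>" using err nLgs by simp
  have "(D.nL t g)\<^sup>2 \<le> (5 / 4 * \<Gamma>)\<^sup>2" using nLg D.nL_nonneg by (intro power_mono) auto
  then have gg: "g \<bullet> (Lam t *v g) \<le> 25 / 16 * \<Gamma>^2"
    by (simp add: D.nL_power2 power_mult_distrib power_divide)
  have "\<bar>(g - gs) \<bullet> S\<bar> \<le> D.nL t (g - gs) * N0" unfolding N0_def by (rule D.dual_cs)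
  also have "... \<le> \<Gamma> / 4 * N0" using err N0 by (intro mult_right_mono) auto
  finally have ab: "\<bar>(g - gs) \<bullet> S\<bar> \<le> \<Gamma> / 4 * N0" .
  have "- ((g - gs) \<bullet> S) \<le> \<Gamma> / 4 * N0" by (rule order_trans[OF abs_ge_minus_self ab])
  moreover have "g \<bullet> S = \<Gamma> * N0 + (g - gs) \<bullet> S" using gsS by (simp add: inner_diff_left)
  ultimately have "g \<bullet> S \<ge> \<Gamma> * N0 - \<Gamma> / 4 * N0" by linarith
  moreover have "g \<bullet> S \<le> \<sigma>^2 / 2 * (25 / 16 * \<Gamma>^2) + \<Gamma>^2"
    using gnet mult_left_mono[OF gg, of "\<sigma>^2 / 2"] by simp
  ultimately have "\<Gamma> * (3 / 4 * N0) \<le> \<Gamma> * ((25 / 32 * \<sigma>^2 + 1) * \<Gamma>)"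
    by (simp add: power2_eq_square algebra_simps)
  then have "3 / 4 * N0 \<le> (25 / 32 * \<sigma>^2 + 1) * \<Gamma>" using G by simp
  moreover have "(25 / 32 * \<sigma>^2 + 1) * \<Gamma> \<le> 3 / 4 * (2 * (1 + \<sigma>^2) * \<Gamma>)"
  proof -
    have "(25 / 32 * \<sigma>^2 + 1) * \<Gamma> \<le> (3 / 2 * (1 + \<sigma>^2)) * \<Gamma>"
    proof (rule mult_right_mono)
      have "0 \<le> \<sigma>^2" by simp
      then show "25 / 32 * \<sigma>^2 + 1 \<le> 3 / 2 * (1 + \<sigma>^2)" by argo
    qed (use G in simp)
    also have "(3 / 2 * (1 + \<sigma>^2)) * \<Gamma> = 3 / 4 * (2 * (1 + \<sigma>^2) * \<Gamma>)" by (simp add: algebra_simps)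
    finally show ?thesis .
  qed
  ultimately show ?thesis unfolding N0_def[symmetric] by linarith
qed

end

section \<open>Measurability of the path quantities\<close>

text \<open>The rank-one recursion reduces measurability of the inverse to inner products and
  division, so matrix inversion itself never has to be shown measurable.\<close>

lemma measurable_Gm_design:
  fixes a :: "nat \<Rightarrow> 'w \<Rightarrow> real^'d"
  assumes "\<And>s. 1 \<le> s \<Longrightarrow> s \<le> t \<Longrightarrow> a s \<in> borel_measurable N" "X \<in> borel_measurable N"
  shows "(\<lambda>w. posdef.Gm (design_matrix (\<lambda>s. a s w) t) *v X w) \<in> borel_measurable N"
  using assms
proof (induction t arbitrary: X)
  case 0
  obtain th :: "real^'d" where th: "norm th = 1" using norm_axis_1 by blast
  have "posdef.Gm (design_matrix (\<lambda>s. a s w) 0) *v X w = X w" for w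
    by (rule design.G_0[of th]) (simp add: design_def th)
  then show ?case using 0 by simp
next
  case (Suc t)
  obtain th :: "real^'d" where th: "norm th = 1" using norm_axis_1 by blast
  let ?G = "\<lambda>w. posdef.Gm (design_matrix (\<lambda>s. a s w) t)"
  let ?q = "\<lambda>w. a (Suc t) w \<bullet> (?G w *v a (Suc t) w)"
  have eq: "posdef.Gm (design_matrix (\<lambda>s. a s w) (Suc t)) *v X w
      = ?G w *v X w - ((a (Suc t) w \<bullet> (?G w *v X w)) / (1 + ?q w)) *\<^sub>R (?G w *v a (Suc t) w)" for w
  proof -
    interpret design "\<lambda>s. a s w" th by unfold_locales (rule th)
    show ?thesis using G_Suc[of t "X w"] by (simp add: nGa_sq)
  qed
  have [measurable]: "a (Suc t) \<in> borel_measurable N" "X \<in> borel_measurable N" using Suc.prems by auto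
  have [measurable]: "(\<lambda>w. ?G w *v X w) \<in> borel_measurable N"
    "(\<lambda>w. ?G w *v a (Suc t) w) \<in> borel_measurable N"
    using Suc.prems by (auto intro!: Suc.IH)
  show ?case unfolding eq by measurable
qed

lemma measurable_proj_orth [measurable]:
  "X \<in> borel_measurable N \<Longrightarrow> (\<lambda>w. proj_orth u (X w)) \<in> borel_measurable N"
  for X :: "'w \<Rightarrow> real^'d"
  unfolding proj_orth_def
  by (intro borel_measurable_diff borel_measurable_scaleR borel_measurable_inner borel_measurable_const)

lemma measurable_mm_design:
  fixes a :: "nat \<Rightarrow> 'w \<Rightarrow> real^'d"
  assumes th: "norm th = 1" and a: "\<And>s. 1 \<le> s \<Longrightarrow> s \<le> t \<Longrightarrow> a s \<in> borel_measurable N"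
  shows "(\<lambda>w. posdef_dir.mm (design_matrix (\<lambda>s. a s w) t) th) \<in> borel_measurable N"
proof -
  have eq: "posdef_dir.mm (design_matrix (\<lambda>s. a s w) t) th
      = (1 / (1 + (\<Sum>s=1..t. (a s w \<bullet> th)\<^sup>2))) *\<^sub>R (\<Sum>s=1..t. (a s w \<bullet> th) *\<^sub>R proj_orth th (a s w))" for w
  proof -
    interpret design "\<lambda>s. a s w" th by unfold_locales (rule th)
    show ?thesis by (simp only: D.mm_def z_eq p_eq)
  qed
  have "(\<lambda>w. (a s w \<bullet> th)\<^sup>2) \<in> borel_measurable N"
    "(\<lambda>w. (a s w \<bullet> th) *\<^sub>R proj_orth th (a s w)) \<in> borel_measurable N"
    if "s \<in> {1..t}" for s
  proof -
    have as: "a s \<in> borel_measurable N" using a that by simp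
    show "(\<lambda>w. (a s w \<bullet> th)\<^sup>2) \<in> borel_measurable N"
      by (intro borel_measurable_power borel_measurable_inner as borel_measurable_const)
    show "(\<lambda>w. (a s w \<bullet> th) *\<^sub>R proj_orth th (a s w)) \<in> borel_measurable N"
      by (intro borel_measurable_scaleR borel_measurable_inner measurable_proj_orth as borel_measurable_const)
  qed
  then have [measurable]: "(\<lambda>w. \<Sum>s\<in>{1..t}. (a s w \<bullet> th)\<^sup>2) \<in> borel_measurable N"
    "(\<lambda>w. \<Sum>s\<in>{1..t}. (a s w \<bullet> th) *\<^sub>R proj_orth th (a s w)) \<in> borel_measurable N"
    by (auto intro!: borel_measurable_sum simp del: atLeastAtMost_iff)
  show ?thesis unfolding eq by measurable
qed

context linucb_run
begin

text \<open>Union bound over the maximal inequalities; one event serves all weights in the family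
  and all times up to T.\<close>

lemma family_event:
  assumes fin: "finite I"
    and k: "\<And>i s. i \<in> I \<Longrightarrow> s \<in> {1..T} \<Longrightarrow> k i s \<in> borel_measurable (F (s - 1))"
    and kc: "\<And>i s w. i \<in> I \<Longrightarrow> s \<in> {1..T} \<Longrightarrow> \<bar>k i s w\<bar> \<le> c i"
  shows "\<exists>E\<in>sets M. 1 - real (card I) * exp (- x) \<le> measure M E \<and>
    (\<forall>w\<in>E. w \<in> space M \<and> (\<forall>i\<in>I. \<forall>n\<le>T. expo (k i) n w < x))"
proof -
  define A where "A i = {w \<in> space M. \<exists>n\<le>T. x \<le> expo (k i) n w}" for i
  have A: "A i \<in> sets M" "measure M (A i) \<le> exp (- x)" if "i \<in> I" for i
    unfolding A_def
    using maximal_inequality(1)[OF k[OF that] kc[OF that]] maximal_inequality(2)[OF k[OF that] kc[OF that]]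
    by blast+
  define U where "U = (\<Union>i\<in>I. A i)"
  have U: "U \<in> sets M" unfolding U_def using fin A by (intro sets.finite_UN) auto
  have "measure M U \<le> (\<Sum>i\<in>I. measure M (A i))"
    unfolding U_def using fin A by (intro finite_measure_subadditive_finite) auto
  also have "... \<le> (\<Sum>i\<in>I. exp (- x))" using A by (intro sum_mono) auto
  finally have "measure M U \<le> real (card I) * exp (- x)" by simp
  then have "1 - real (card I) * exp (- x) \<le> measure M (space M - U)"
    using prob_compl[OF U] by simp
  moreover have "\<forall>w\<in>space M - U. w \<in> space M \<and> (\<forall>i\<in>I. \<forall>n\<le>T. expo (k i) n w < x)"
    unfolding U_def A_def by (blast intro: not_le_imp_less)
  ultimately show ?thesis using U by (intro bexI[of _ "space M - U"]) auto
qed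

end

section \<open>The estimator on a path with controlled noise\<close>

context ucb_path
begin

definition "rd e t = ridge a (\<lambda>s. a s \<bullet> th + e s) t" for e :: "nat \<Rightarrow> real"

lemma rd_eq: "rd e t - th = G t *v (SS e t - th)"
  by (simp add: rd_def ridge_eq)

lemma nG_SS_th: "seminorm_of (G t) (SS e t - th) \<le> seminorm_of (G t) (SS e t) + 1"
proof -
  have "seminorm_of (G t) (SS e t - th) \<le> seminorm_of (G t) (SS e t) + seminorm_of (G t) (- th)"
    using D.nG_triangle[of t "SS e t" "- th"] by simp
  moreover have "seminorm_of (G t) (- th) \<le> 1"
  proof -
    have "th \<bullet> (G t *v th) \<le> 1" using D.Gm_quad_le_one[of th t] norm_th_one by simp
    then show ?thesis unfolding seminorm_of_minus by (simp add: seminorm_of_def)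
  qed
  ultimately show ?thesis by simp
qed

lemma rd_dist: "norm (rd e t - th) \<le> seminorm_of (G t) (SS e t - th) / sqrt (el t)"
proof -
  have "sqrt (el t) * norm (rd e t - th) \<le> seminorm_of (G t) (SS e t - th)"
    using D.nL_ge[of t "rd e t - th"] by (simp add: rd_eq D.nL_Gm)
  then show ?thesis using D.ell_pos[of t] by (simp add: field_simps)
qed

lemma normalise_dist:
  fixes x :: "real^'d"
  assumes "norm (x - th) \<le> 1 / 2"
  shows "x \<noteq> 0" "norm ((1 / norm x) *\<^sub>R x - th) \<le> 2 * norm (x - th)" "\<bar>1 - norm x\<bar> \<le> norm (x - th)"
proof -
  have n: "\<bar>norm x - norm th\<bar> \<le> norm (x - th)" by (rule norm_triangle_ineq3)
  show n1: "\<bar>1 - norm x\<bar> \<le> norm (x - th)" using n norm_th_one by simp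
  show x0: "x \<noteq> 0" using n1 assms by auto
  have "norm ((1 / norm x) *\<^sub>R x - x) = norm ((1 / norm x - 1) *\<^sub>R x)" by (simp add: scaleR_diff_left)
  also have "... = \<bar>1 / norm x - 1\<bar> * norm x" by simp
  also have "... = \<bar>(1 / norm x - 1) * norm x\<bar>" by (simp only: abs_mult abs_norm_cancel)
  also have "(1 / norm x - 1) * norm x = 1 - norm x" using x0 by (simp add: left_diff_distrib)
  finally have "norm ((1 / norm x) *\<^sub>R x - x) \<le> norm (x - th)" using n1 by simp
  then show "norm ((1 / norm x) *\<^sub>R x - th) \<le> 2 * norm (x - th)"
    using norm_triangle_ineq[of "(1 / norm x) *\<^sub>R x - x" "x - th"] by simp
qed

definition "normalised e \<longleftrightarrow> (\<forall>t\<le>T. rd e t \<noteq> 0 \<longrightarrow> hh t = (1 / norm (rd e t)) *\<^sub>R rd e t)"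

lemma hh_dist:
  assumes "normalised e" "t \<le> T" "seminorm_of (G t) (SS e t) \<le> Cs" "(2 * (Cs + 1))\<^sup>2 \<le> el t" "0 \<le> Cs"
  shows "norm (rd e t - th) \<le> (Cs + 1) / sqrt (el t)" "norm (rd e t - th) \<le> 1 / 2"
    "hh t = (1 / norm (rd e t)) *\<^sub>R rd e t" "norm (hh t - th) \<le> 2 * (Cs + 1) / sqrt (el t)"
proof -
  have el0: "0 < sqrt (el t)" using D.ell_pos[of t] by simp
  have "seminorm_of (G t) (SS e t - th) \<le> Cs + 1" using nG_SS_th[of t e] assms(3) by linarith
  then have "seminorm_of (G t) (SS e t - th) / sqrt (el t) \<le> (Cs + 1) / sqrt (el t)"
    using el0 by (intro divide_right_mono) auto
  then show d: "norm (rd e t - th) \<le> (Cs + 1) / sqrt (el t)" using rd_dist[of e t] by linarith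
  have "2 * (Cs + 1) \<le> sqrt (el t)" using assms(4) by (rule real_le_rsqrt)
  then have "(Cs + 1) / sqrt (el t) \<le> 1 / 2" using el0 by (simp add: field_simps)
  then show h: "norm (rd e t - th) \<le> 1 / 2" using d by linarith
  show hh: "hh t = (1 / norm (rd e t)) *\<^sub>R rd e t"
    using assms(1,2) normalise_dist(1)[OF h] by (simp add: normalised_def)
  show "norm (hh t - th) \<le> 2 * (Cs + 1) / sqrt (el t)"
  proof -
    have "2 * (Cs + 1) / sqrt (el t) = 2 * ((Cs + 1) / sqrt (el t))" by simp
    then show ?thesis unfolding hh using normalise_dist(2)[OF h] d by linarith
  qed
qed

text \<open>The action lies within 2 \<beta> / sqrt el of the estimator, which explains the K - 2
  left for the estimator itself.\<close>

lemma a_dist: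
  assumes "t < T" "norm (hh t - th) \<le> (K - 2) * \<beta> / sqrt (el t)"
  shows "norm (a (Suc t) - th) \<le> K * \<beta> / sqrt (el t)"
proof -
  interpret S: ucb_step_dir "Lam t" \<beta> "hh t" "a (Suc t)" th using assms(1) by (rule step)
  have "norm (a (Suc t) - th) \<le> norm (a (Suc t) - hh t) + norm (hh t - th)"
    using norm_triangle_ineq[of "a (Suc t) - hh t" "hh t - th"] by simp
  also have "... \<le> 2 * \<beta> / sqrt (el t) + (K - 2) * \<beta> / sqrt (el t)"
    using S.dist_a_hh assms(2) by (rule add_mono)
  also have "... = K * \<beta> / sqrt (el t)" by (simp add: add_divide_distrib[symmetric] algebra_simps)
  finally show ?thesis .
qed

lemma y_le_dist: "norm (y s) \<le> norm (a s - th)"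
proof -
  have "y s = proj_orth th (a s - th)" by (simp add: proj_orth_diff norm_th_one)
  then show ?thesis using norm_proj_orth_le[OF norm_th_one] by metis
qed

lemma inverse_sqrt_el_le: "1 / sqrt (el t) \<le> sqrt (ta t)"
  using real_sqrt_le_mono[OF D.tau_ge[of t]] by (simp add: real_sqrt_divide)

text \<open>\<open>growth\<close> with r1 = 3 s0. The conditions at s0 provide the start: el is
  large enough for y to be small, D1 absorbs the initial value of B into a multiple of \<beta> sqrt
  r, and the initial z is dominated by its growth rate.\<close>

lemma growth_after:
  fixes A K D1 :: real
  assumes K: "2 \<le> K"
    and A: "8 * real CARD('d) \<le> A" "320 * (real CARD('d))\<^sup>2 * K \<le> A"
    and s0: "1 \<le> s0" "4 * real CARD('d) * K^2 * \<beta>^2 \<le> el s0"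
      "2 + real s0 \<le> D1 * \<beta> * sqrt (real s0)"
      "sqrt (3 * real s0) \<le> 4 * K^2 * \<beta> * A"
      "real s0 + 1 \<le> sqrt (A * \<beta>) * (sqrt (real s0) * sqrt (sqrt (real s0)))"
    and y_le: "\<And>r. s0 \<le> r \<Longrightarrow> r < T \<Longrightarrow> ta r * \<beta> * sqrt (real r) \<le> A \<Longrightarrow>
        B r \<le> (D1 + 4 * K^2 * A) * \<beta> * sqrt (real r) \<Longrightarrow> norm (y (Suc r)) \<le> K * \<beta> * sqrt (ta r)"
    and r: "s0 \<le> r" "r \<le> T"
  shows "ta r * \<beta> * sqrt (real r) \<le> A" "B r \<le> (D1 + 4 * K^2 * A) * \<beta> * sqrt (real r)"
    "norm (z r) \<le> real s0 + 1 + 4 * K * sqrt (A * \<beta>) * (sqrt (real r) * sqrt (sqrt (real r)))"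
    "real s0 + 1 \<le> sqrt (A * \<beta>) * (sqrt (real r) * sqrt (sqrt (real r)))"
    "3 * s0 \<le> r \<Longrightarrow> real r / 2 \<le> p r"
proof -
  have d1: "1 \<le> real CARD('d)" by simp
  have A0: "0 < A" using A(1) d1 by linarith
  have b: "0 < \<beta>" by (rule b_pos)
  have B0: "B s0 \<le> 1 + real s0"
    using B_le[of s0] norm_a_one r by auto
  have Bbound: "B r \<le> (D1 + 4 * K^2 * A) * \<beta> * sqrt (real r)"
    if "s0 \<le> r" "B r \<le> B s0 + 1 + 4 * K^2 * A * \<beta> * sqrt (real r)" for r
  proof -
    have D1: "0 \<le> D1"
    proof (rule ccontr)
      assume "\<not> 0 \<le> D1"
      then have "D1 * \<beta> * sqrt (real s0) \<le> 0" using b by (simp add: mult_nonpos_nonneg)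
      then show False using s0(3) by simp
    qed
    have "D1 * \<beta> * sqrt (real s0) \<le> D1 * \<beta> * sqrt (real r)"
      using D1 b that(1) by (intro mult_left_mono) auto
    then have "B s0 + 1 \<le> D1 * \<beta> * sqrt (real r)" using B0 s0(3) by linarith
    then show ?thesis using that(2) by (simp add: algebra_simps)
  qed
  have tas0: "4 * K^2 * \<beta>^2 * ta s0 \<le> 1"
  proof -
    have e0: "0 < el s0" by (rule D.ell_pos)
    have "4 * K^2 * \<beta>^2 * ta s0 \<le> 4 * K^2 * \<beta>^2 * (real CARD('d) / el s0)"
      using D.tau_le[of s0] by (intro mult_left_mono) auto
    also have "... = (4 * real CARD('d) * K^2 * \<beta>^2) / el s0" by simp
    also have "... \<le> 1" using s0(2) e0 by (simp add: divide_le_eq_1)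
    finally show ?thesis .
  qed
  \<comment> \<open>Throughout the window up to 3 s0 the value of the trace at s0 suffices: it is at
    most 1 / (4 K^2 \<beta>^2), and sqrt (3 s0) is at most 4 K^2 \<beta> A.\<close>
  have base: "ta r * \<beta> * sqrt (real r) \<le> A" if "s0 \<le> r" "r \<le> 3 * s0" for r
  proof -
    have "ta r * \<beta> * sqrt (real r) \<le> ta s0 * \<beta> * sqrt (3 * real s0)"
      using ta_mono[OF that(1)] that(2) b D.tau_pos[of r] D.tau_pos[of s0]
      by (intro mult_mono real_sqrt_le_mono) auto
    also have "... \<le> ta s0 * \<beta> * (4 * K^2 * \<beta> * A)"
      using s0(4) b D.tau_pos[of s0] by (intro mult_left_mono) auto
    also have "... = (4 * K^2 * \<beta>^2 * ta s0) * A" by (simp add: power2_eq_square)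
    also have "... \<le> 1 * A" using tas0 A0 by (intro mult_right_mono) auto
    finally show ?thesis by simp
  qed
  have init: "real s0 + 1 \<le> sqrt (A * \<beta>) * (sqrt (real s) * sqrt (sqrt (real s)))" if "s0 \<le> s" for s
  proof -
    have "sqrt (A * \<beta>) * (sqrt (real s0) * sqrt (sqrt (real s0))) \<le> sqrt (A * \<beta>) * (sqrt (real s) * sqrt (sqrt (real s)))"
      using that A0 b by (intro mult_left_mono mult_mono) auto
    then show ?thesis using s0(5) by linarith
  qed
  have gr: "ta r * \<beta> * sqrt (real r) \<le> A \<and> B r \<le> B s0 + 1 + 4 * K^2 * A * \<beta> * sqrt (real r) \<and>
    norm (z r) \<le> real s0 + 1 + 4 * K * sqrt (A * \<beta>) * (sqrt (real r) * sqrt (sqrt (real r))) \<and>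
    1 + 3 / 4 * (real r - real s0) \<le> p r"
  proof (rule growth[of s0 "3 * s0" T])
    fix q assume q: "s0 \<le> q" "q < T" "ta q * \<beta> * sqrt (real q) \<le> A"
      "B q \<le> B s0 + 1 + 4 * K^2 * A * \<beta> * sqrt (real q)"
    show "norm (y (Suc q)) \<le> K * \<beta> * sqrt (ta q)"
      using q(1-3) Bbound[OF q(1,4)] by (rule y_le)
  qed (use s0(1) K A base tas0 init r in auto)
  then show "ta r * \<beta> * sqrt (real r) \<le> A" and "B r \<le> (D1 + 4 * K^2 * A) * \<beta> * sqrt (real r)"
    and "norm (z r) \<le> real s0 + 1 + 4 * K * sqrt (A * \<beta>) * (sqrt (real r) * sqrt (sqrt (real r)))"
    using Bbound[OF r(1)] by blast+
  show "real s0 + 1 \<le> sqrt (A * \<beta>) * (sqrt (real r) * sqrt (sqrt (real r)))" by (rule init[OF r(1)])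
  show "real r / 2 \<le> p r" if "3 * s0 \<le> r"
  proof -
    have "3 * real s0 \<le> real r" using that by linarith
    then show ?thesis using gr by argo
  qed
qed

text \<open>The noise bound is available only in rounds where B \<le> J el, which is itself a
  consequence of the growth bounds. There is no vicious circle: the induction offers the current
  trace and B bounds before asking for the next y, and their product form gives B \<le> J
  el.\<close>

lemma noise_growth:
  fixes A K J Cs D1 :: real
  assumes nrm: "normalised e"
    and noise: "\<And>r. r \<le> T \<Longrightarrow> B r \<le> J * el r \<Longrightarrow> seminorm_of (G r) (SS e r) \<le> Cs"
    and Cs: "0 \<le> Cs" "2 * (Cs + 1) \<le> (K - 2) * \<beta>"
    and K: "2 \<le> K"
    and A: "8 * real CARD('d) \<le> A" "320 * (real CARD('d))\<^sup>2 * K \<le> A"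
    and s0: "1 \<le> s0" "4 * real CARD('d) * K^2 * \<beta>^2 \<le> el s0"
      "2 + real s0 \<le> D1 * \<beta> * sqrt (real s0)"
      "sqrt (3 * real s0) \<le> 4 * K^2 * \<beta> * A"
      "real s0 + 1 \<le> sqrt (A * \<beta>) * (sqrt (real s0) * sqrt (sqrt (real s0)))"
    and J: "(D1 + 4 * K^2 * A) * A \<le> J"
    and r: "s0 \<le> r" "r \<le> T"
  shows "ta r * \<beta> * sqrt (real r) \<le> A" "B r \<le> (D1 + 4 * K^2 * A) * \<beta> * sqrt (real r)" "B r \<le> J * el r"
    "(2 * (Cs + 1))\<^sup>2 \<le> el r"
    "r < T \<Longrightarrow> norm (a (Suc r) - th) \<le> K * \<beta> * sqrt (ta r)"
    "3 * s0 \<le> r \<Longrightarrow> real r / 2 \<le> p r"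
    "3 * s0 \<le> r \<Longrightarrow> norm (m r) \<le> (2 + 8 * K) * sqrt (A * \<beta>) / sqrt (sqrt (real r))"
proof -
  have d1: "1 \<le> real CARD('d)" by simp
  have A0: "0 < A" using A(1) d1 by linarith
  have b: "0 < \<beta>" by (rule b_pos)
  have BJ: "B r \<le> J * el r"
    if "s0 \<le> r" "ta r * \<beta> * sqrt (real r) \<le> A" "B r \<le> (D1 + 4 * K^2 * A) * \<beta> * sqrt (real r)" for r
  proof -
    let ?D = "D1 + 4 * K^2 * A"
    have D0: "0 \<le> ?D"
    proof (rule ccontr)
      assume "\<not> 0 \<le> ?D"
      then have "?D * \<beta> * sqrt (real r) \<le> 0" using b by (simp add: mult_nonpos_nonneg)
      then show False using that(3) B_ge_one[of r] by linarith
    qed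
    have "\<beta> * sqrt (real r) \<le> A * (1 / ta r)"
      using that(2) D.tau_pos[of r] by (simp add: field_simps)
    also have "... \<le> A * el r" using D.ell_ge_tau[of r] A0 by (intro mult_left_mono) auto
    finally have "?D * (\<beta> * sqrt (real r)) \<le> ?D * (A * el r)" using D0 by (intro mult_left_mono)
    also have "... = (?D * A) * el r" by simp
    also have "... \<le> J * el r" using J D.ell_pos[of r] by (intro mult_right_mono) auto
    finally show ?thesis using that(3) by (simp add: mult.assoc)
  qed
  have big: "(2 * (Cs + 1))\<^sup>2 \<le> el r" if "s0 \<le> r" for r
  proof -
    have "(2 * (Cs + 1))\<^sup>2 \<le> ((K - 2) * \<beta>)\<^sup>2" using Cs by (intro power_mono) auto
    also have "... \<le> (K * \<beta>)\<^sup>2" using K b by (intro power_mono mult_right_mono) auto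
    also have "... = 1 * K^2 * \<beta>^2" by (simp add: power_mult_distrib)
    also have "... \<le> 4 * real CARD('d) * K^2 * \<beta>^2"
    proof (intro mult_right_mono)
      show "1 \<le> 4 * real CARD('d)" using d1 by linarith
    qed auto
    also have "... \<le> el s0" by (rule s0)
    also have "... \<le> el r" by (rule el_mono[OF that])
    finally show ?thesis .
  qed
  have ad: "norm (a (Suc r) - th) \<le> K * \<beta> * sqrt (ta r)"
    if "s0 \<le> r" "r < T" "ta r * \<beta> * sqrt (real r) \<le> A" "B r \<le> (D1 + 4 * K^2 * A) * \<beta> * sqrt (real r)" for r
  proof -
    have "seminorm_of (G r) (SS e r) \<le> Cs" using noise BJ[OF that(1,3,4)] that(2) by simp
    then have "norm (hh r - th) \<le> 2 * (Cs + 1) / sqrt (el r)"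
      using hh_dist(4)[OF nrm _ _ big[OF that(1)] Cs(1)] that(2) by simp
    also have "... \<le> (K - 2) * \<beta> / sqrt (el r)"
      using Cs(2) D.ell_pos[of r] by (intro divide_right_mono) auto
    finally have "norm (a (Suc r) - th) \<le> K * \<beta> * (1 / sqrt (el r))"
      using a_dist[OF that(2)] by simp
    also have "... \<le> K * \<beta> * sqrt (ta r)"
      using inverse_sqrt_el_le[of r] K b by (intro mult_left_mono) auto
    finally show ?thesis .
  qed
  have yl: "norm (y (Suc q)) \<le> K * \<beta> * sqrt (ta q)"
    if "s0 \<le> q" "q < T" "ta q * \<beta> * sqrt (real q) \<le> A" "B q \<le> (D1 + 4 * K^2 * A) * \<beta> * sqrt (real q)" for q
    using ad[OF that] y_le_dist[of "Suc q"] by linarith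
  note g = growth_after[OF K A s0 yl r]
  show g1: "ta r * \<beta> * sqrt (real r) \<le> A" and g2: "B r \<le> (D1 + 4 * K^2 * A) * \<beta> * sqrt (real r)"
    by (rule g(1,2); assumption)+
  have g3: "norm (z r) \<le> real s0 + 1 + 4 * K * sqrt (A * \<beta>) * (sqrt (real r) * sqrt (sqrt (real r)))"
    and g4: "real s0 + 1 \<le> sqrt (A * \<beta>) * (sqrt (real r) * sqrt (sqrt (real r)))"
    by (rule g(3,4); assumption)+
  show "B r \<le> J * el r" by (rule BJ[OF r(1) g1 g2])
  show "(2 * (Cs + 1))\<^sup>2 \<le> el r" by (rule big[OF r(1)])
  show "norm (a (Suc r) - th) \<le> K * \<beta> * sqrt (ta r)" if "r < T" by (rule ad[OF r(1) that g1 g2])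
  show pr: "real r / 2 \<le> p r" if "3 * s0 \<le> r" by (rule g(5)[OF _ _ _ _ that])
  show "norm (m r) \<le> (2 + 8 * K) * sqrt (A * \<beta>) / sqrt (sqrt (real r))" if r3: "3 * s0 \<le> r"
  proof -
    define v where "v = sqrt (sqrt (real r))"
    define Q where "Q = sqrt (A * \<beta>)"
    have Q0: "0 < Q" using A0 b by (simp add: Q_def)
    have r1: "1 \<le> real r" using s0(1) r by simp
    have v1: "1 \<le> v" using r1 by (simp add: v_def)
    have vv: "sqrt (real r) = v * v" "sqrt (v * v) = v" using v1 by (simp_all add: v_def)
    have v4: "real r = v^4" by (simp add: v_def power4_eq_xxxx mult.assoc)
    have "real s0 + 1 \<le> Q * (v * v * v)"
      using g4 unfolding vv Q_def by (simp add: mult.assoc)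
    moreover have "norm (z r) \<le> real s0 + 1 + 4 * K * Q * (v * v * v)"
      using g3 unfolding vv Q_def by (simp only: mult.assoc)
    ultimately have zr: "norm (z r) \<le> (1 + 4 * K) * Q * (v * v * v)" by (simp add: algebra_simps)
    have "norm (m r) = norm (z r) / p r" using D.pp_pos[of r] by (simp add: z_m)
    also have "... \<le> ((1 + 4 * K) * Q * (v * v * v)) / (v^4 / 2)"
      using zr pr[OF r3] v1 K Q0 unfolding v4 by (intro frac_le) (auto intro!: mult_nonneg_nonneg)
    also have "v^4 / 2 = (v * v * v) * (v / 2)" by (simp add: power4_eq_xxxx)
    also have "(1 + 4 * K) * Q * (v * v * v) / ((v * v * v) * (v / 2)) = (1 + 4 * K) * Q / (v / 2)"
      using v1 by (simp add: mult.commute[of _ "v * v * v"])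
    also have "... = (2 + 8 * K) * Q / v" by (simp add: field_simps)
    finally show ?thesis by (simp add: Q_def v_def)
  qed
qed

end

section \<open>Convergence of the leading direction\<close>

context ucb_path
begin

text \<open>Since \<open>m\<close> moves by \<open>(x0 / p) eta\<close> and \<open>eta\<close> has a nonnegative product with the difference of
  the estimation error and \<open>m\<close>, the squared distance between the two contracts. The square of the
  estimation error itself is left out of the potential, as its increments are not controlled.\<close>

definition "Psi e t = (norm (m t))\<^sup>2 - 2 * (m t \<bullet> proj_orth th (rd e t))"

text \<open>cc (r + 1) is the coefficient, up to the factor -2, of the new noise in (r + 1) Psi. It
  involves m and G after the action of that round has been added, but not the noise of that round,
  so it is predictable.\<close>

definition "cc t = real t * (m t \<bullet> (G t *v a t))"

lemma rd_Suc: "rd e (Suc t) = rd e t + (e (Suc t) + a (Suc t) \<bullet> (th - rd e t)) *\<^sub>R (G (Suc t) *v a (Suc t))"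
  using ridge_Suc[of e t] by (simp add: rd_def algebra_simps)

text \<open>One step of the Lyapunov argument. Multiplying Psi by the time turns the contraction
  rate 1 / r into a telescoping sum. What remains besides the martingale term is an error of order
  (L^2 + L Y) / (\<beta> sqrt r), where Y is |m| measured in its target scale.\<close>

lemma psi_step:
  fixes C L b v Y :: real
  assumes r: "r < T" "real r = v^4" and b: "0 < b" "b * b = \<beta>" and C: "2 \<le> C" and L: "1 \<le> L" "L \<le> C * \<beta>"
    and v: "8 * C^2 * b \<le> v" "b * b \<le> v" "2 \<le> v"
    and H1: "ta r \<le> C * (1 / (b * v))\<^sup>2"
    and H2: "norm (a (Suc r) - th) \<le> C * (b / v)"
    and H3: "norm (m r) \<le> C * (b / v)"
    and H4: "v^4 / 2 \<le> p r"
    and H5: "seminorm_of (G r) (SS e r - th) \<le> C * L"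
    and H6: "norm (rd e r - th) \<le> C * L * (1 / (b * v))"
    and H7: "hh r = (1 / norm (rd e r)) *\<^sub>R rd e r"
    and Y: "norm (m r) = Y * (1 / (b * v))"
  shows "real (Suc r) * Psi e (Suc r) \<le> real r * Psi e r + 500 * C^6 * (L^2 + L * Y) * (1 / (b * v))\<^sup>2
      - 2 * cc (Suc r) * e (Suc r)"
    and "\<bar>cc (Suc r)\<bar> \<le> 4 * C^2 * (Y + 4 * C) / \<beta>"
proof -
  interpret S: ucb_step_dir "Lam r" \<beta> "hh r" "a (Suc r)" th using r(1) by (rule step)
  \<comment> \<open>Natural units: n is the scale of 1 / sqrt el and the target scale of m; g =
    \<beta> n is that of the deviation of actions from th; q = g n = 1 / sqrt r is that of the bonus
    w.\<close>
  define n where "n = 1 / (b * v)"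
  define g where "g = b / v"
  define q where "q = 1 / (v * v)"
  have v0: "0 < v" using v by simp
  have pos: "0 < n" "0 < g" "0 < q" using b v0 by (simp_all add: n_def g_def q_def)
  have gn: "g * n = q" using b v0 by (simp add: n_def g_def q_def)
  have bq: "\<beta> * q = g * g" using b by (simp add: q_def g_def)
  have bn: "\<beta> * n = g" using b v0 by (simp add: n_def g_def b(2)[symmetric])
  have rq: "1 / real r = q * q" using v0 by (simp add: r(2) q_def power4_eq_xxxx)
  have r16: "16 \<le> real r"
  proof -
    have "2^4 \<le> v^4" using v(3) by (intro power_mono) auto
    then show ?thesis by (simp add: r(2))
  qed
  have r0: "0 < real r" using r16 by simp
  have q1: "q \<le> 1"
  proof -
    have "1 * 1 \<le> v * v" using v(3) by (intro mult_mono) auto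
    then show ?thesis using v0 by (simp add: q_def divide_le_eq_1)
  qed
  have C4: "4 \<le> C^2"
    using power_mono[OF C, of 2] by simp
  have g8: "8 * C^2 * g \<le> 1" using v(1) v0 by (simp add: g_def divide_le_eq_1 field_simps)
  have g32: "g \<le> 1 / 32"
  proof -
    have "8 * 4 * g \<le> 8 * C^2 * g" using C4 pos by (intro mult_right_mono) auto
    then show ?thesis using g8 by linarith
  qed
  have bv: "b * b \<le> v * v"
    using v by (smt (verit) mult_less_cancel_left1)
  have gq: "g * q \<le> n"
  proof -
    have "g * q = n * ((b * b) / (v * v))" using b v0 by (simp add: n_def g_def q_def field_simps)
    also have "... \<le> n * 1" using bv v0 pos by (intro mult_left_mono) (auto simp: divide_le_eq_1)
    finally show ?thesis by simp
  qed
  have g3: "g * g * g \<le> n"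
  proof -
    have "(b * b) * (b * b) \<le> v * v" using v b by (intro mult_mono) auto
    then have "(b * b) * (b * b) / (v * v) \<le> 1" using v0 by (simp add: divide_le_eq_1)
    then have "n * ((b * b) * (b * b) / (v * v)) \<le> n * 1" using pos by (intro mult_left_mono) auto
    moreover have "g * g * g = n * ((b * b) * (b * b) / (v * v))" using b(1) v0 by (simp add: n_def g_def)
    ultimately show ?thesis by simp
  qed
  have Y0: "0 \<le> Y" using Y b v0 by (metis divide_pos_pos mult_pos_pos norm_ge_zero zero_less_one zero_le_mult_iff not_less)
  define M where "M = norm (m r)"
  have M: "M = Y * n" using Y by (simp add: M_def n_def)
  have Mg: "M \<le> C * g" using H3 by (simp add: M_def g_def)
  define et where "et = norm S.eta"
  have et0: "0 \<le> et" by (simp add: et_def)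
  have x0e: "S.x0 = 1 - (norm (a (Suc r) - th))\<^sup>2 / 2"
    using S.norm_a norm_th_one
    by (simp add: S.x0_def power2_norm_eq_inner inner_diff_left inner_diff_right inner_commute norm_eq_1
        diff_divide_distrib)
  have ad2: "(norm (a (Suc r) - th))\<^sup>2 \<le> C^2 * (g * g)"
  proof -
    have "(norm (a (Suc r) - th))\<^sup>2 \<le> (C * g)\<^sup>2" using H2 by (intro power_mono) (auto simp: g_def)
    then show ?thesis by (simp add: power_mult_distrib power2_eq_square[of g])
  qed
  have Cg: "C^2 * (g * g) \<le> 1 / 256"
  proof -
    have "(8 * C^2 * g) * g \<le> 1 * (1 / 32)" using g8 g32 pos by (intro mult_mono) auto
    then show ?thesis by simp
  qed
  have x0a: "1 - C^2 * (g * g) / 2 \<le> S.x0" using x0e ad2 by linarith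
  have x0b: "S.x0 \<le> 1" unfolding x0e by simp
  have x0c: "9 / 10 \<le> S.x0" using x0a Cg by linarith
  note x0 = x0a x0b x0c
  have etg: "et \<le> 2 * C * g"
  proof -
    have "et \<le> norm S.yy + norm (S.x0 *\<^sub>R m r)"
      unfolding et_def S.eta_def by (rule norm_triangle_ineq4)
    also have "norm (S.x0 *\<^sub>R m r) \<le> 1 * M" using x0 by (simp add: M_def mult_left_le_one_le)
    also have "norm S.yy \<le> C * g"
      using y_le_dist[of "Suc r"] H2 by (simp add: S.yy_def g_def)
    finally show ?thesis using Mg by simp
  qed
  have el: "1 / el r \<le> C * (n * n)"
    using D.tau_ge[of r] H1 by (simp add: n_def power2_eq_square)
  have el0: "0 < el r" by (rule D.ell_pos)
  have w: "S.w \<le> 3 * C^2 * q"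
  proof -
    have "S.x0\<^sup>2 \<le> 1" using x0 by (intro power_le_one) auto
    then have "S.x0\<^sup>2 / p r \<le> 1 / (real r / 2)" using H4 r0 r(2) by (intro frac_le) auto
    also have "... = 2 * (q * q)" using rq by simp
    finally have w1: "S.x0\<^sup>2 / p r \<le> 2 * (q * q)" .
    have "S.eta \<bullet> (G r *v S.eta) \<le> et^2 * (1 / el r)"
      using D.Gm_quad_le[of S.eta r] by (simp add: et_def)
    also have "... \<le> (2 * C * g)\<^sup>2 * (C * (n * n))"
      using etg et0 el el0 by (intro mult_mono power_mono) auto
    also have "... = 4 * C^3 * (q * q)" by (simp add: gn[symmetric] power2_eq_square power3_eq_cube)
    finally have "S.w\<^sup>2 \<le> (2 + 4 * C^3) * (q * q)" using w1 S.w_sq_decomp by (simp add: algebra_simps)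
    also have "... \<le> (9 * C^4) * (q * q)"
    proof (rule mult_right_mono)
      have "C^4 = C * C^3" by (simp add: power4_eq_xxxx power3_eq_cube)
      moreover have "2 * C^3 \<le> C * C^3" using C by (intro mult_right_mono) auto
      moreover have "1 \<le> C^3" using C by (intro one_le_power) auto
      ultimately show "2 + 4 * C^3 \<le> 9 * C^4" by linarith
    qed (use pos in simp)
    also have "... = (3 * C^2 * q)\<^sup>2" by (simp add: power2_eq_square power4_eq_xxxx)
    finally show ?thesis using pos by (rule_tac power2_le_imp_le) auto
  qed
  have bw: "\<beta> * S.w \<le> 3 * C^2 * (g * g)"
  proof -
    have "\<beta> * S.w \<le> \<beta> * (3 * C^2 * q)" using w b_pos by (intro mult_left_mono) auto
    also have "... = 3 * C^2 * (\<beta> * q)" by simp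
    finally show ?thesis unfolding bq .
  qed
  have mu: "1 \<le> S.mu" "S.mu \<le> 1 + 3 * C^2 * (g * g)" using S.mu_ge_one S.mu_le bw by auto
  have mu': "S.mu \<le> 1 + 3 / 256" using mu(2) Cg by linarith
  have mx: "\<bar>1 - S.mu * S.x0\<bar> \<le> 4 * C^2 * (g * g)"
  proof -
    define t where "t = (S.mu - 1) * S.x0"
    define X where "X = C^2 * (g * g)"
    have e: "1 - S.mu * S.x0 = (1 - S.x0) - t" by (simp add: t_def algebra_simps)
    have "0 \<le> t" "t \<le> (S.mu - 1) * 1"
      unfolding t_def using mu(1) x0 by (intro mult_nonneg_nonneg mult_left_mono; simp)+
    moreover have "0 \<le> X" using pos by (simp add: X_def)
    moreover have "1 - X / 2 \<le> S.x0" "S.mu \<le> 1 + 3 * X" using x0(1) mu(2) by (simp_all add: X_def)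
    ultimately have "(1 - S.x0) - t \<le> 4 * X" "- ((1 - S.x0) - t) \<le> 4 * X" using x0(2) by argo+
    then have "\<bar>1 - S.mu * S.x0\<bar> \<le> 4 * X" unfolding e by (rule abs_leI)
    then show ?thesis by (simp add: X_def)
  qed
  define E where "E = C * L * n"
  have E0: "0 \<le> E" using C L pos by (simp add: E_def)
  have Eg: "E \<le> C^2 * g"
  proof -
    have "E \<le> C * (C * \<beta>) * n" unfolding E_def using L C pos by (intro mult_right_mono mult_left_mono) auto
    also have "... = C^2 * g" by (simp add: bn[symmetric] power2_eq_square)
    finally show ?thesis .
  qed
  have rdE: "norm (rd e r - th) \<le> E" using H6 by (simp add: E_def n_def)
  have E2: "norm (rd e r - th) \<le> 1 / 2" using rdE Eg g8 by linarith
  define h where "h = proj_orth th (hh r)"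
  define h0 where "h0 = proj_orth th (rd e r)"
  define \<rho> where "\<rho> = norm (rd e r)"
  have rho: "\<rho> > 0" "\<bar>1 - \<rho>\<bar> \<le> E"
    using normalise_dist(1,3)[OF E2] rdE by (auto simp: \<rho>_def)
  have h_h0: "h0 = \<rho> *\<^sub>R h" using rho H7 by (simp add: h_def h0_def proj_orth_scaleR \<rho>_def)
  have hE: "norm h \<le> 2 * E"
  proof -
    have "h = proj_orth th (hh r - th)" by (simp add: h_def proj_orth_diff norm_th_one)
    then have "norm h \<le> norm (hh r - th)" using norm_proj_orth_le[OF norm_th_one] by metis
    then show ?thesis using normalise_dist(2)[OF E2] rdE H7 by simp
  qed
  \<comment> \<open>DD differs from h0 - m in two ways: hh is the normalised estimator, giving a
    term quadratic in the estimation error, and mu x0 is not exactly 1, giving a term of relative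
    size g^2.\<close>
  define del where "del = S.DD - (h0 - m r)"
  have del_eq: "del = (1 - \<rho>) *\<^sub>R h + (1 - S.mu * S.x0) *\<^sub>R m r"
    by (simp add: del_def S.DD_def h_h0 h_def scaleR_diff_left)
  have del1: "norm del \<le> 2 * E^2 + 4 * C^2 * (g * g) * M"
  proof -
    have "norm del \<le> \<bar>1 - \<rho>\<bar> * norm h + \<bar>1 - S.mu * S.x0\<bar> * M"
      unfolding del_eq M_def using norm_triangle_ineq[of "(1 - \<rho>) *\<^sub>R h"] by (metis norm_scaleR real_norm_def)
    also have "\<bar>1 - \<rho>\<bar> * norm h \<le> E * (2 * E)" using rho hE E0 by (intro mult_mono) auto
    also have "\<bar>1 - S.mu * S.x0\<bar> * M \<le> 4 * C^2 * (g * g) * M" using mx by (intro mult_right_mono) (auto simp: M_def)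
    finally show ?thesis by (simp add: power2_eq_square)
  qed
  define dl where "dl = norm del"
  have dl0: "0 \<le> dl" by (simp add: dl_def)
  have C34: "4 * C^3 \<le> 2 * C^4"
  proof -
    have "2 * C^3 \<le> C * C^3" using C by (intro mult_right_mono) auto
    then show ?thesis by (simp add: power4_eq_xxxx power3_eq_cube)
  qed
  have gle1: "g \<le> 1" using g32 by simp
  have dl2: "dl \<le> 4 * C^4 * g"
  proof -
    have "2 * E^2 \<le> 2 * (C^2 * g)\<^sup>2" using Eg E0 by (intro mult_left_mono power_mono) auto
    also have "... = (2 * C^4 * g) * g" by (simp add: power2_eq_square power4_eq_xxxx)
    also have "... \<le> (2 * C^4 * g) * 1" using gle1 pos C by (intro mult_left_mono) auto
    finally have a1: "2 * E^2 \<le> 2 * C^4 * g" by simp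
    have "4 * C^2 * (g * g) * M \<le> 4 * C^2 * (g * g) * (C * g)" using Mg pos by (intro mult_left_mono) auto
    also have "... = (4 * C^3 * g) * (g * g)" by (simp add: power2_eq_square power3_eq_cube)
    also have "... \<le> (4 * C^3 * g) * 1" using gle1 pos C by (intro mult_left_mono) (auto simp: mult_le_one)
    also have "... \<le> 2 * C^4 * g" using C34 pos by (simp add: mult_right_mono)
    finally show ?thesis using a1 del1 unfolding dl_def by linarith
  qed
  have gdl: "g * dl \<le> 6 * C^2 * (L^2 + Y) * (n * n)"
  proof -
    have "g * dl \<le> g * (2 * E^2 + 4 * C^2 * (g * g) * M)" using del1 pos by (intro mult_left_mono) (auto simp: dl_def)
    also have "... = g * (2 * E^2) + 4 * C^2 * Y * n * (g * g * g)" by (simp add: M algebra_simps)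
    also have "g * (2 * E^2) \<le> 1 * (2 * E^2)" using gle1 by (intro mult_right_mono) auto
    also have "4 * C^2 * Y * n * (g * g * g) \<le> 4 * C^2 * Y * n * n" using g3 Y0 pos by (intro mult_left_mono) auto
    also have "1 * (2 * E^2) + 4 * C^2 * Y * n * n = (2 * C^2 * L^2 + 4 * C^2 * Y) * (n * n)"
      by (simp add: E_def power2_eq_square algebra_simps)
    also have "... \<le> (6 * C^2 * (L^2 + Y)) * (n * n)"
      using Y0 by (intro mult_right_mono) (auto simp: algebra_simps)
    finally show ?thesis by simp
  qed
  have L1: "1 \<le> L^2" using L by (intro one_le_power) auto
  have YL: "Y \<le> L * Y" using L Y0 by (simp add: mult_le_cancel_right1)
  have err: "16 * dl^2 + 8 * dl * et + 8 * et^2 / real r \<le> 398 * C^6 * (L^2 + L * Y) * (n * n)"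
  proof -
    have "16 * dl^2 \<le> 16 * (dl * (4 * C^4 * g))"
      using mult_left_mono[OF dl2 dl0] unfolding power2_eq_square by linarith
    moreover have "8 * dl * et \<le> 8 * dl * (2 * C * g)" using etg dl0 by (intro mult_left_mono) auto
    moreover have "16 * C \<le> 2 * C^4"
    proof -
      have "2^3 \<le> C^3" using C by (intro power_mono) auto
      then have "C * 8 \<le> C * C^3" using C by (intro mult_left_mono) auto
      then show ?thesis by (simp add: power4_eq_xxxx power3_eq_cube)
    qed
    then have "8 * dl * (2 * C * g) \<le> 2 * C^4 * (dl * g)"
      using mult_right_mono[of "16 * C" "2 * C^4" "dl * g"] dl0 pos by (simp add: mult_ac)
    ultimately have a1: "16 * dl^2 + 8 * dl * et \<le> 66 * C^4 * (g * dl)" by (simp add: algebra_simps)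
    also have "... \<le> 66 * C^4 * (6 * C^2 * (L^2 + Y) * (n * n))" using gdl C by (intro mult_left_mono) auto
    also have "... = 396 * C^6 * (L^2 + Y) * (n * n)" by (simp add: power_numeral_reduce mult_ac)
    also have "... \<le> 396 * C^6 * (L^2 + L * Y) * (n * n)"
      using YL C by (intro mult_right_mono mult_left_mono) auto
    finally have a2: "16 * dl^2 + 8 * dl * et \<le> 396 * C^6 * (L^2 + L * Y) * (n * n)" .
    have "8 * et^2 / real r = 8 * et^2 * (q * q)" using rq by (simp add: divide_inverse)
    also have "... \<le> 8 * (2 * C * g)\<^sup>2 * (q * q)" using etg et0 by (intro mult_right_mono mult_left_mono power_mono) auto
    also have "... = 32 * C^2 * ((g * q) * (g * q))" by (simp add: power2_eq_square)
    also have "... \<le> 32 * C^2 * (n * n)" using gq pos by (intro mult_left_mono mult_mono) auto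
    also have "... \<le> 2 * C^6 * (L^2 + L * Y) * (n * n)"
    proof (rule mult_right_mono)
      have "2^4 \<le> C^4" using C by (intro power_mono) auto
      then have "C^2 * 16 \<le> C^2 * C^4" by (intro mult_left_mono) auto
      then have "32 * C^2 \<le> 2 * C^6" by (simp add: power_add[symmetric])
      also have "... \<le> 2 * C^6 * (L^2 + L * Y)"
      proof -
        have "0 \<le> L * Y" using L Y0 by simp
        then have "1 \<le> L^2 + L * Y" using L1 by linarith
        then have "2 * C^6 * 1 \<le> 2 * C^6 * (L^2 + L * Y)" by (intro mult_left_mono) auto
        then show ?thesis by simp
      qed
      finally show "32 * C^2 \<le> 2 * C^6 * (L^2 + L * Y)" .
    qed simp
    finally show ?thesis using a2 by (simp add: algebra_simps)
  qed
  define kp where "kp = S.x0 / p (Suc r)"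
  have p': "real r / 2 \<le> p (Suc r)" "p (Suc r) \<le> real r + 2"
  proof -
    show "real r / 2 \<le> p (Suc r)" using H4 by (simp add: p_Suc r(2) add_increasing2)
    have "p (Suc r) \<le> 1 + real (Suc r)" using r(1) norm_a_one by (intro p_le) auto
    then show "p (Suc r) \<le> real r + 2" by simp
  qed
  have p'0: "0 < p (Suc r)" by (rule D.pp_pos)
  have kp0: "0 \<le> kp" using x0 p'0 by (simp add: kp_def)
  have kp2: "kp \<le> 2 / real r"
  proof -
    have "kp \<le> 1 / (real r / 2)" unfolding kp_def using x0 p' r0 by (intro frac_le) auto
    then show ?thesis by simp
  qed
  have kp2': "kp \<le> 2 * (q * q)" using kp2 rq by (simp add: divide_inverse)
  \<comment> \<open>The factor 4/3 is matched with the 3/2 in the comparison of q2 and D2 below, so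
    that twice the drift dominates q2 / r with coefficient exactly one.\<close>
  have kpmu: "1 / real r \<le> 4 / 3 * (kp / S.mu)"
  proof -
    have "p (Suc r) * S.mu \<le> (real r + 2) * (1 + 3 / 256)"
      using p' mu' mu(1) p'0 by (intro mult_mono) auto
    also have "... \<le> 4 / 3 * (9 / 10) * real r" using r16 by (simp add: algebra_simps)
    also have "... \<le> 4 / 3 * S.x0 * real r" using x0(3) by (intro mult_right_mono) auto
    finally have "p (Suc r) * S.mu \<le> 4 / 3 * S.x0 * real r" .
    then show ?thesis using p'0 mu(1) r0 by (simp add: kp_def field_simps)
  qed
  define dm where "dm = kp *\<^sub>R S.eta"
  have mS: "m (Suc r) = m r + dm"
    by (simp add: m_Suc dm_def kp_def S.x0_def S.eta_def S.yy_def)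
  define bias where "bias = a (Suc r) \<bullet> (th - rd e r)"
  define dh where "dh = (e (Suc r) + bias) *\<^sub>R proj_orth th (G (Suc r) *v a (Suc r))"
  have hS: "proj_orth th (rd e (Suc r)) = h0 + dh"
    by (simp add: rd_Suc h0_def dh_def bias_def proj_orth_add proj_orth_scaleR)
  define mG where "mG = m (Suc r) \<bullet> (G (Suc r) *v a (Suc r))"
  have mdh: "m (Suc r) \<bullet> dh = (e (Suc r) + bias) * mG"
    by (simp add: dh_def mG_def proj_orth_inner)
  have Psi': "Psi e (Suc r) = Psi e r - 2 * ((h0 - m r) \<bullet> dm) + (norm dm)\<^sup>2 - 2 * ((e (Suc r) + bias) * mG)"
  proof -
    have "Psi e (Suc r) = (norm (m r + dm))\<^sup>2 - 2 * ((m r + dm) \<bullet> h0) - 2 * (m (Suc r) \<bullet> dh)"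
      unfolding Psi_def hS by (simp add: mS inner_add_right)
    also have "(norm (m r + dm))\<^sup>2 = (norm (m r))\<^sup>2 + 2 * (m r \<bullet> dm) + (norm dm)\<^sup>2"
      unfolding power2_norm_eq_inner by (simp add: inner_add_left inner_add_right inner_commute[of dm "m r"])
    finally show ?thesis
      unfolding mdh Psi_def h0_def[symmetric]
      by (simp add: inner_add_left inner_diff_left inner_commute[of dm h0])
  qed
  define q2 where "q2 = (norm (h0 - m r))\<^sup>2"
  define D2 where "D2 = (norm S.DD)\<^sup>2"
  have q2D: "q2 \<le> 3 / 2 * D2 + 3 * dl^2"
  proof -
    have "h0 - m r = S.DD - del" by (simp add: del_def)
    then have "norm (h0 - m r) \<le> norm S.DD + dl" by (simp add: dl_def norm_triangle_ineq4)
    then have "q2 \<le> (norm S.DD + dl)\<^sup>2" unfolding q2_def by (intro power_mono) auto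
    also have "... \<le> 3 / 2 * D2 + 3 * dl^2"
    proof -
      have "0 \<le> (norm S.DD - 2 * dl)\<^sup>2" by simp
      then show ?thesis by (simp add: D2_def power2_eq_square algebra_simps)
    qed
    finally show ?thesis .
  qed
  have drift: "(h0 - m r) \<bullet> dm \<ge> kp * (D2 / S.mu) - kp * (dl * et)"
  proof -
    have "D2 / S.mu \<le> S.eta \<bullet> S.DD" using S.DD_monotone mu(1) by (simp add: D2_def field_simps)
    moreover have "S.eta \<bullet> del \<le> et * dl" unfolding et_def dl_def by (rule norm_cauchy_schwarz)
    moreover have "(h0 - m r) \<bullet> dm = kp * (S.eta \<bullet> S.DD - S.eta \<bullet> del)"
      by (simp add: dm_def del_def inner_diff_right inner_diff_left inner_commute algebra_simps)
    ultimately have "kp * (D2 / S.mu - et * dl) \<le> (h0 - m r) \<bullet> dm"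
      using kp0 by (simp add: mult_left_mono)
    then show ?thesis by (simp add: algebra_simps)
  qed
  have D2q: "2 * (kp * (D2 / S.mu)) \<ge> q2 / real r - 8 * dl^2 / real r"
  proof -
    let ?c = "kp / S.mu"
    have c0: "0 \<le> ?c" using kp0 mu(1) by simp
    have "q2 * (1 / real r) \<le> q2 * (4 / 3 * ?c)" using kpmu by (intro mult_left_mono) (auto simp: q2_def)
    also have "... = 4 / 3 * ?c * q2" by simp
    also have "... \<le> 4 / 3 * ?c * (3 / 2 * D2 + 3 * dl^2)" using q2D c0 by (intro mult_left_mono) auto
    also have "... = 2 * (kp * (D2 / S.mu)) + 4 * ?c * dl^2" using mu(1) by (simp add: field_simps)
    also have "4 * ?c * dl^2 \<le> 4 * (2 / real r) * dl^2"
    proof -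
      have "?c \<le> kp / 1" using kp0 mu(1) by (intro divide_left_mono) auto
      then show ?thesis using kp2 by (intro mult_right_mono mult_left_mono) auto
    qed
    finally show ?thesis by simp
  qed
  have dm2: "(norm dm)\<^sup>2 \<le> 4 * et^2 / (real r * real r)"
  proof -
    have "norm dm \<le> 2 / real r * et" using mult_right_mono[OF kp2 et0] kp0 by (simp add: dm_def et_def)
    then have "(norm dm)\<^sup>2 \<le> (2 / real r * et)\<^sup>2" by (intro power_mono) auto
    then show ?thesis by (simp add: power2_eq_square)
  qed
  have step1: "Psi e (Suc r) \<le> Psi e r - q2 / real r + (8 * dl^2 + 4 * (dl * et)) / real r
      + 4 * et^2 / (real r * real r) - 2 * ((e (Suc r) + bias) * mG)"
  proof -
    have "2 * (kp * (dl * et)) \<le> 2 * (2 / real r * (dl * et))"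
      using kp2 dl0 et0 by (intro mult_left_mono mult_right_mono) auto
    then have "2 * (kp * (dl * et)) \<le> 4 * (dl * et) / real r" by simp
    then show ?thesis using Psi' drift D2q dm2 by (simp add: add_divide_distrib)
  qed
  have q2P: "q2 = Psi e r + (norm h0)\<^sup>2"
    unfolding q2_def Psi_def h0_def[symmetric] power2_norm_eq_inner
    by (simp add: inner_diff_left inner_diff_right inner_commute[of h0 "m r"])
  \<comment> \<open>The heart of the contraction: q2 = Psi + |h0|^2 is at least Psi, so the gain q2
    / r pays for raising the multiplier from r to r + 1, whatever |h0| is.\<close>
  have step2: "real (Suc r) * (Psi e r - q2 / real r) \<le> real r * Psi e r"
  proof -
    have "real (Suc r) * (Psi e r - q2 / real r) = real r * Psi e r + (Psi e r - q2) - q2 / real r"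
      using r0 by (simp add: algebra_simps add_divide_distrib)
    moreover have "Psi e r - q2 \<le> 0" by (simp add: q2P)
    moreover have "0 \<le> q2 / real r" by (simp add: q2_def)
    ultimately show ?thesis by linarith
  qed
  have Sr: "real (Suc r) \<le> 2 * real r" using r16 by simp
  have step3: "real (Suc r) * ((8 * dl^2 + 4 * (dl * et)) / real r + 4 * et^2 / (real r * real r))
      \<le> 16 * dl^2 + 8 * dl * et + 8 * et^2 / real r"
  proof -
    have "real (Suc r) * ((8 * dl^2 + 4 * (dl * et)) / real r + 4 * et^2 / (real r * real r))
      \<le> (2 * real r) * ((8 * dl^2 + 4 * (dl * et)) / real r + 4 * et^2 / (real r * real r))"
      using Sr dl0 et0 r0 by (intro mult_right_mono) auto
    also have "... = 16 * dl^2 + 8 * dl * et + 8 * et^2 / real r" using r0 by (simp add: field_simps)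
    finally show ?thesis .
  qed
  have ccS: "cc (Suc r) = real (Suc r) * mG" by (simp add: cc_def mG_def)
  have mSn: "norm (m (Suc r)) \<le> (Y + 4 * C) * n"
  proof -
    have "norm (m (Suc r)) \<le> M + norm dm" unfolding mS M_def by (rule norm_triangle_ineq)
    also have "norm dm = kp * et" using kp0 by (simp add: dm_def et_def)
    also have "kp * et \<le> (2 * (q * q)) * (2 * C * g)" using kp2' etg kp0 et0 pos by (intro mult_mono) auto
    also have "... = 4 * C * (q * (g * q))" by simp
    also have "... \<le> 4 * C * (1 * n)" using q1 gq pos C by (intro mult_left_mono mult_mono) auto
    finally show ?thesis by (simp add: M algebra_simps)
  qed
  have mGb: "\<bar>mG\<bar> \<le> (Y + 4 * C) * n * (2 * C * g * (C * (n * n)))"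
  proof -
    have "mG = m (Suc r) \<bullet> proj_orth th (G (Suc r) *v a (Suc r))" by (simp add: mG_def proj_orth_inner)
    then have "\<bar>mG\<bar> \<le> norm (m (Suc r)) * norm (proj_orth th (G (Suc r) *v a (Suc r)))"
      using Cauchy_Schwarz_ineq2 by metis
    also have "... \<le> ((Y + 4 * C) * n) * (2 * C * g * (C * (n * n)))"
    proof (rule mult_mono[OF mSn])
      have "norm (proj_orth th (G (Suc r) *v a (Suc r))) \<le> norm (proj_orth th (G r *v a (Suc r)))"
        by (rule norm_G_Suc_a_le)
      also have "... \<le> norm (G r *v S.eta)" unfolding S.proj_Gm_a by (rule norm_proj_orth_le[OF norm_th_one])
      also have "... \<le> et * (1 / el r)" using D.Gm_norm[of r S.eta] by (simp add: et_def)
      also have "... \<le> (2 * C * g) * (C * (n * n))" using etg el et0 el0 by (intro mult_mono) auto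
      finally show "norm (proj_orth th (G (Suc r) *v a (Suc r))) \<le> 2 * C * g * (C * (n * n))" by simp
    qed (use Y0 C pos in auto)
    finally show ?thesis by simp
  qed
  have nq: "n * n = q / \<beta>" using b v0 by (simp add: n_def q_def b(2)[symmetric])
  have rn: "real r * (g * n) * (n * n) = n * n / q"
    using v0 pos by (simp add: r(2) gn q_def power4_eq_xxxx)
  have cb: "\<bar>cc (Suc r)\<bar> \<le> 4 * C^2 * (Y + 4 * C) * (n * n / q)"
  proof -
    have "\<bar>cc (Suc r)\<bar> = real (Suc r) * \<bar>mG\<bar>" by (simp add: ccS abs_mult)
    also have "... \<le> (2 * real r) * ((Y + 4 * C) * n * (2 * C * g * (C * (n * n))))"
      using Sr mGb by (intro mult_mono) auto
    also have "... = 4 * C^2 * (Y + 4 * C) * (real r * (g * n) * (n * n))" by (simp add: power2_eq_square)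
    finally show ?thesis unfolding rn .
  qed
  moreover have "n * n / q = 1 / \<beta>" using nq pos by simp
  ultimately show "\<bar>cc (Suc r)\<bar> \<le> 4 * C^2 * (Y + 4 * C) / \<beta>" by simp
  \<comment> \<open>The regression residual also contains the current estimation error along the new
    action. It is at most the bonus times the self-normalised noise, hence of order L / sqrt
    r.\<close>
  have bias: "\<bar>bias\<bar> \<le> 3 * C^2 * q * (C * L)"
  proof -
    have "bias = - (a (Suc r) \<bullet> (G r *v (SS e r - th)))"
    proof -
      have "th - rd e r = - (G r *v (SS e r - th))" using rd_eq[of e r] by (metis minus_diff_eq)
      then show ?thesis by (simp add: bias_def)
    qed
    then have "\<bar>bias\<bar> = \<bar>a (Suc r) \<bullet> (G r *v (SS e r - th))\<bar>" by simp
    also have "... \<le> seminorm_of (G r) (a (Suc r)) * seminorm_of (G r) (SS e r - th)" by (rule D.nG_cs)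
    also have "... \<le> (3 * C^2 * q) * (C * L)"
      using w H5 D.nG_nonneg[of r] pos unfolding S.w_def by (intro mult_mono) auto
    finally show ?thesis .
  qed
  have biast: "\<bar>2 * cc (Suc r) * bias\<bar> \<le> 96 * C^6 * (L^2 + L * Y) * (n * n)"
  proof -
    have "\<bar>2 * cc (Suc r) * bias\<bar> = 2 * (\<bar>cc (Suc r)\<bar> * \<bar>bias\<bar>)" by (simp add: abs_mult)
    also have "... \<le> 2 * ((4 * C^2 * (Y + 4 * C) * (n * n / q)) * (3 * C^2 * q * (C * L)))"
      using cb bias Y0 C pos by (intro mult_left_mono mult_mono) auto
    also have "... = 24 * C^5 * ((Y + 4 * C) * L) * (n * n)"
      using pos by (simp add: power2_eq_square power_numeral_reduce)
    also have "... \<le> 24 * C^5 * (4 * C * (L^2 + L * Y)) * (n * n)"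
    proof (intro mult_right_mono mult_left_mono)
      have "1 * (Y * L) \<le> (4 * C) * (Y * L)" using C Y0 L by (intro mult_right_mono) auto
      moreover have "4 * C * L \<le> 4 * C * L^2" using C L by (intro mult_left_mono) (auto simp: power2_eq_square)
      ultimately show "(Y + 4 * C) * L \<le> 4 * C * (L^2 + L * Y)" by (simp add: algebra_simps)
    qed (use C in auto)
    also have "... = 96 * C^6 * (L^2 + L * Y) * (n * n)" by (simp add: power_numeral_reduce)
    finally show ?thesis .
  qed
  define X where "X = (8 * dl^2 + 4 * (dl * et)) / real r + 4 * et^2 / (real r * real r)"
  have "real (Suc r) * Psi e (Suc r) \<le> real (Suc r) * ((Psi e r - q2 / real r) + X - 2 * ((e (Suc r) + bias) * mG))"
    using step1 unfolding X_def by (intro mult_left_mono) (auto simp: algebra_simps)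
  also have "... = real (Suc r) * (Psi e r - q2 / real r) + real (Suc r) * X
      - 2 * cc (Suc r) * e (Suc r) - 2 * cc (Suc r) * bias"
    by (simp only: ccS algebra_simps)
  also have "... \<le> real r * Psi e r + 398 * C^6 * (L^2 + L * Y) * (n * n)
      - 2 * cc (Suc r) * e (Suc r) + 96 * C^6 * (L^2 + L * Y) * (n * n)"
  proof -
    have "real (Suc r) * X \<le> 398 * C^6 * (L^2 + L * Y) * (n * n)"
      unfolding X_def using step3 err by linarith
    moreover have "- (2 * cc (Suc r) * bias) \<le> 96 * C^6 * (L^2 + L * Y) * (n * n)"
      by (rule order_trans[OF abs_ge_minus_self biast])
    ultimately show ?thesis using step2 by linarith
  qed
  also have "... \<le> real r * Psi e r + 500 * C^6 * (L^2 + L * Y) * (n * n) - 2 * cc (Suc r) * e (Suc r)"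
  proof -
    have "0 \<le> C^6 * (L^2 + L * Y) * (n * n)" using Y0 L by simp
    then show ?thesis by linarith
  qed
  finally show "real (Suc r) * Psi e (Suc r) \<le> real r * Psi e r + 500 * C^6 * (L^2 + L * Y) * (1 / (b * v))\<^sup>2
      - 2 * cc (Suc r) * e (Suc r)"
    by (simp add: n_def power2_eq_square)
qed

end

text \<open>For fourth roots of consecutive integers these are discrete derivatives of sqrt r and
  r^(1/4); summed, they bound the sums of r^(-1/2) and r^(-3/4).\<close>

lemma fourth_root_increments:
  fixes u v :: real
  assumes "1 \<le> v" "0 < u" "u^4 = v^4 + 1"
  shows "v \<le> u" "1 / (v * v) \<le> 4 * (u * u - v * v)" "1 / v^3 \<le> 12 * (u - v)"
proof -
  have v4: "1 \<le> v^4" using assms(1) by (rule one_le_power)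
  have "v^4 \<le> u^4" using assms(3) by simp
  then show vu: "v \<le> u" using assms by (rule_tac power_le_imp_le_base[of _ 3]) auto
  have u3: "u * u \<le> 3 * (v * v)"
  proof -
    have "(u * u)\<^sup>2 \<le> (3 * (v * v))\<^sup>2"
      using assms(3) v4 by (simp add: power2_eq_square power4_eq_xxxx)
    then show ?thesis by (rule_tac power2_le_imp_le) auto
  qed
  have u2: "u \<le> 2 * v"
  proof -
    have "0 \<le> v * v" by simp
    then have "u * u \<le> 4 * (v * v)" using u3 by argo
    then have "u * u \<le> (2 * v) * (2 * v)" by simp
    then have "u^2 \<le> (2 * v)\<^sup>2" by (simp only: power2_eq_square)
    then show ?thesis using assms by (rule_tac power2_le_imp_le) auto
  qed
  have fac: "(u - v) * (u + v) * (u * u + v * v) = 1"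
    using assms(3) by (simp add: power4_eq_xxxx algebra_simps)
  have "(u * u - v * v) * (u * u + v * v) = 1" using fac by (simp add: algebra_simps)
  moreover have "(u * u - v * v) * (u * u + v * v) \<le> (u * u - v * v) * (4 * (v * v))"
    using u3 vu assms by (intro mult_left_mono) (auto simp: mult_mono)
  ultimately have "1 \<le> (u * u - v * v) * (4 * (v * v))" by linarith
  then show "1 / (v * v) \<le> 4 * (u * u - v * v)" using assms(1) by (simp add: field_simps)
  have "(u + v) * (u * u + v * v) \<le> (3 * v) * (4 * (v * v))"
    using u2 u3 assms by (intro mult_mono) auto
  then have "(u - v) * ((u + v) * (u * u + v * v)) \<le> (u - v) * ((3 * v) * (4 * (v * v)))"
    using vu by (intro mult_left_mono) auto
  then have "1 \<le> (12 * (u - v)) * v^3" using fac by (simp add: power3_eq_cube mult_ac)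
  then show "1 / v^3 \<le> 12 * (u - v)" using assms(1) by (simp add: divide_le_eq)
qed

definition "root4 r = sqrt (sqrt (real r))"

lemma root4_pow: "(root4 r)^4 = real r"
  by (simp add: root4_def power4_eq_xxxx mult.assoc)

lemma root4_pos: "1 \<le> r \<Longrightarrow> 1 \<le> root4 r" by (simp add: root4_def)

lemma root4_mono: "r \<le> s \<Longrightarrow> root4 r \<le> root4 s" by (simp add: root4_def)

lemma sum_root4:
  assumes "1 \<le> s" "s \<le> t"
  shows "(\<Sum>r\<in>{s..<t}. 1 / (root4 r * root4 r)) \<le> 4 * (root4 t * root4 t)"
    and "(\<Sum>r\<in>{s..<t}. 1 / (root4 r)^3) \<le> 12 * root4 t"
proof -
  have inc: "1 / (root4 r * root4 r) \<le> 4 * (root4 (Suc r) * root4 (Suc r) - root4 r * root4 r)"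
    "1 / (root4 r)^3 \<le> 12 * (root4 (Suc r) - root4 r)" if "1 \<le> r" for r
    using fourth_root_increments(2,3)[of "root4 r" "root4 (Suc r)"] root4_pos[OF that] root4_pos[of "Suc r"]
    by (auto simp: root4_pow)
  have "(\<Sum>r\<in>{s..<t}. 1 / (root4 r * root4 r)) \<le> 4 * (root4 t * root4 t - root4 s * root4 s)"
    using assms(2)
  proof (induction t rule: nat_induct_at_least)
    case (Suc t)
    then show ?case using inc(1)[of t] assms(1) by (simp add: sum.atLeastLessThan_Suc)
  qed simp
  moreover have "0 \<le> root4 s * root4 s" by simp
  ultimately show "(\<Sum>r\<in>{s..<t}. 1 / (root4 r * root4 r)) \<le> 4 * (root4 t * root4 t)" by argo
  have "(\<Sum>r\<in>{s..<t}. 1 / (root4 r)^3) \<le> 12 * (root4 t - root4 s)"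
    using assms(2)
  proof (induction t rule: nat_induct_at_least)
    case (Suc t)
    then show ?case using inc(2)[of t] assms(1) by (simp add: sum.atLeastLessThan_Suc)
  qed simp
  moreover have "0 \<le> root4 s" by (simp add: root4_def)
  ultimately show "(\<Sum>r\<in>{s..<t}. 1 / (root4 r)^3) \<le> 12 * root4 t" by argo
qed

context ucb_path
begin

text \<open>Strong induction on t, since the error and variance of the telescoped
  \<open>psi_step\<close> involve |m| at all earlier times. The bound is the target L / sqrt el plus
  a decaying remainder of the initial value at s1; inserting it for earlier times reproduces it at t
  because the errors are only linear in it.\<close>

lemma m_bound:
  fixes C L :: real
  defines "b \<equiv> sqrt \<beta>"
  defines "CF \<equiv> 100000 * C^6"
  assumes C: "2 \<le> C" and L: "1 \<le> L" "L \<le> C * \<beta>"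
    and s1: "1 \<le> s1" "8 * C^2 * b \<le> root4 s1" "\<beta> \<le> root4 s1" "2 \<le> root4 s1"
    and H1: "\<And>r. s1 \<le> r \<Longrightarrow> r \<le> T \<Longrightarrow> ta r \<le> C * (1 / (b * root4 r))\<^sup>2"
    and H2: "\<And>r. s1 \<le> r \<Longrightarrow> r < T \<Longrightarrow> norm (a (Suc r) - th) \<le> C * (b / root4 r)"
    and H3: "\<And>r. s1 \<le> r \<Longrightarrow> r \<le> T \<Longrightarrow> norm (m r) \<le> C * (b / root4 r)"
    and H4: "\<And>r. s1 \<le> r \<Longrightarrow> r \<le> T \<Longrightarrow> real r / 2 \<le> p r"
    and H5: "\<And>r. s1 \<le> r \<Longrightarrow> r \<le> T \<Longrightarrow> seminorm_of (G r) (SS e r - th) \<le> C * L"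
    and H6: "\<And>r. s1 \<le> r \<Longrightarrow> r \<le> T \<Longrightarrow> norm (rd e r - th) \<le> C * L * (1 / (b * root4 r))"
    and H7: "\<And>r. s1 \<le> r \<Longrightarrow> r \<le> T \<Longrightarrow> hh r = (1 / norm (rd e r)) *\<^sub>R rd e r"
    and HN: "\<And>t. s1 \<le> t \<Longrightarrow> t \<le> T \<Longrightarrow> \<bar>\<Sum>r\<in>{s1..<t}. cc (Suc r) * e (Suc r)\<bar>
      \<le> C * (L * sqrt (\<Sum>r\<in>{s1..<t}. (cc (Suc r))\<^sup>2) + L^2)"
    and t: "s1 \<le> t" "t \<le> T"
  shows "norm (m t) \<le> CF * (L + \<beta> * root4 s1 / root4 t) * (1 / (b * root4 t))"
  using t
proof (induction t rule: less_induct)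
  case (less t)
  define V where "V = root4 t"
  define v1 where "v1 = root4 s1"
  define Y where "Y r = norm (m r) * (b * root4 r)" for r
  define u where "u r = L + \<beta> * v1 / root4 r" for r
  have b0: "0 < b" "b * b = \<beta>" using b_pos by (simp_all add: b_def)
  have beta: "0 < \<beta>" by (rule b_pos)
  have v1: "2 \<le> v1" "\<beta> \<le> v1" "8 * C^2 * b \<le> v1" using s1 by (simp_all add: v1_def)
  have vr: "v1 \<le> root4 r" if "s1 \<le> r" for r using root4_mono[OF that] by (simp add: v1_def)
  have vr0: "0 < root4 r" if "s1 \<le> r" for r using vr[OF that] v1 by linarith
  have V1: "v1 \<le> V" unfolding V_def by (rule vr[OF less.prems(1)])
  have V0: "0 < V" "2 \<le> V" "\<beta> \<le> V" using V1 v1 by linarith+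
  have V4: "V^4 = real t" by (simp add: V_def root4_pow)
  have C6: "64 \<le> C^6" using power_mono[OF C, of 6] by simp
  have CF1: "1 \<le> CF" using C6 by (simp add: CF_def)
  have Ym: "norm (m r) = Y r * (1 / (b * root4 r))" if "s1 \<le> r" for r
    using vr0[OF that] b0 by (simp add: Y_def)
  have IH: "Y r \<le> CF * u r" if "s1 \<le> r" "r < t" for r
  proof -
    have "norm (m r) \<le> CF * u r * (1 / (b * root4 r))"
      using less.IH[OF that(2,1)] that less.prems by (simp add: u_def v1_def)
    then have "Y r \<le> CF * u r * (1 / (b * root4 r)) * (b * root4 r)"
      unfolding Y_def using vr0[OF that(1)] b0 by (intro mult_right_mono) auto
    then show ?thesis using vr0[OF that(1)] b0 by simp
  qed
  have ps: "real (Suc r) * Psi e (Suc r) \<le> real r * Psi e r + 500 * C^6 * (L^2 + L * Y r) * (1 / (b * root4 r))\<^sup>2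
      - 2 * cc (Suc r) * e (Suc r)"
    "\<bar>cc (Suc r)\<bar> \<le> 4 * C^2 * (Y r + 4 * C) / \<beta>" if r: "s1 \<le> r" "r < T" for r
  proof -
    have g1: "8 * C^2 * b \<le> root4 r" "b * b \<le> root4 r" "2 \<le> root4 r" using vr[OF r(1)] v1 b0 by auto
    have g2: "(root4 r)^4 / 2 \<le> p r" using H4[of r] r by (simp add: root4_pow)
    note h = H1[of r] H2[of r] H3[of r] g2 H5[of r] H6[of r] H7[of r] Ym[OF r(1)]
    show "real (Suc r) * Psi e (Suc r) \<le> real r * Psi e r + 500 * C^6 * (L^2 + L * Y r) * (1 / (b * root4 r))\<^sup>2
      - 2 * cc (Suc r) * e (Suc r)"
      by (rule psi_step(1)[OF r(2) root4_pow[symmetric] b0 C L g1]) (use h r in simp_all)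
    show "\<bar>cc (Suc r)\<bar> \<le> 4 * C^2 * (Y r + 4 * C) / \<beta>"
      by (rule psi_step(2)[OF r(2) root4_pow[symmetric] b0 C L g1]) (use h r in simp_all)
  qed
  have tele: "real t * Psi e t \<le> real s1 * Psi e s1
      + (\<Sum>r\<in>{s1..<t}. 500 * C^6 * (L^2 + L * Y r) * (1 / (b * root4 r))\<^sup>2)
      - 2 * (\<Sum>r\<in>{s1..<t}. cc (Suc r) * e (Suc r))" if "s1 \<le> t" "t \<le> T" for t
    using that
  proof (induction t rule: nat_induct_at_least)
    case (Suc t)
    have "t < T" using Suc.prems by simp
    then show ?case using Suc.IH ps(1)[OF Suc.hyps] Suc.hyps by (simp add: sum.atLeastLessThan_Suc)
  qed simp
  \<comment> \<open>The share of the initial value still present at time t, in units of the target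
    scale of m.\<close>
  define x where "x = \<beta> * v1 / V"
  define U where "U = L + x"
  have x0: "0 \<le> x" using beta v1 V0 by (simp add: x_def)
  have U: "L \<le> U" "x \<le> U" "1 \<le> U" using x0 L by (simp_all add: U_def)
  have uL: "L \<le> u r" "1 \<le> u r" if "s1 \<le> r" for r
  proof -
    have "0 \<le> \<beta> * v1 / root4 r" using beta v1 vr0[OF that] by simp
    then show "L \<le> u r" "1 \<le> u r" using L by (simp_all add: u_def)
  qed
  have sum1: "(\<Sum>r\<in>{s1..<t}. 1 / (root4 r * root4 r)) \<le> 4 * (V * V)"
    and sum2: "(\<Sum>r\<in>{s1..<t}. 1 / (root4 r)^3) \<le> 12 * V"
    using sum_root4[OF s1(1) less.prems(1)] by (simp_all add: V_def)
  \<comment> \<open>By the induction hypothesis Y splits into a constant part, summed against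
    r^(-1/2), and the decaying part, summed against r^(-3/4); both sums are dominated by the value
    at t.\<close>
  have err: "(\<Sum>r\<in>{s1..<t}. 500 * C^6 * (L^2 + L * Y r) * (1 / (b * root4 r))\<^sup>2)
      \<le> 500 * C^6 * (12 * CF * (L * U)) * (V * V / \<beta>)"
  proof -
    have "(\<Sum>r\<in>{s1..<t}. 500 * C^6 * (L^2 + L * Y r) * (1 / (b * root4 r))\<^sup>2)
        \<le> (\<Sum>r\<in>{s1..<t}. 500 * C^6 * ((2 * CF * L^2 / \<beta>) * (1 / (root4 r * root4 r)) + (CF * L * v1) * (1 / (root4 r)^3)))"
    proof (rule sum_mono)
      fix r assume "r \<in> {s1..<t}"
      then have r: "s1 \<le> r" "r < t" by auto
      have n2: "(1 / (b * root4 r))\<^sup>2 = (1 / \<beta>) * (1 / (root4 r * root4 r))"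
        by (simp add: power2_eq_square b0(2)[symmetric] mult_ac)
      have "L^2 + L * Y r \<le> CF * L^2 + L * (CF * u r)"
        using IH[OF r] L CF1 by (intro add_mono mult_left_mono) (auto simp: mult_le_cancel_right1)
      also have "... = 2 * CF * L^2 + CF * L * (\<beta> * v1 / root4 r)"
        by (simp add: u_def power2_eq_square algebra_simps)
      finally have "500 * C^6 * ((L^2 + L * Y r) * (1 / (b * root4 r))\<^sup>2)
          \<le> 500 * C^6 * ((2 * CF * L^2 + CF * L * (\<beta> * v1 / root4 r)) * (1 / (b * root4 r))\<^sup>2)"
        using C by (intro mult_left_mono mult_right_mono) auto
      also have "(2 * CF * L^2 + CF * L * (\<beta> * v1 / root4 r)) * (1 / (b * root4 r))\<^sup>2
          = (2 * CF * L^2 / \<beta>) * (1 / (root4 r * root4 r)) + (CF * L * v1) * (1 / (root4 r)^3)"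
        using beta vr0[OF r(1)] unfolding n2 by (simp add: power3_eq_cube field_simps)
      finally show "500 * C^6 * (L^2 + L * Y r) * (1 / (b * root4 r))\<^sup>2
          \<le> 500 * C^6 * ((2 * CF * L^2 / \<beta>) * (1 / (root4 r * root4 r)) + (CF * L * v1) * (1 / (root4 r)^3))"
        by (simp only: mult.assoc)
    qed
    also have "... = 500 * C^6 * ((2 * CF * L^2 / \<beta>) * (\<Sum>r\<in>{s1..<t}. 1 / (root4 r * root4 r))
        + (CF * L * v1) * (\<Sum>r\<in>{s1..<t}. 1 / (root4 r)^3))"
      by (simp only: sum_distrib_left[symmetric] sum.distrib)
    also have "... \<le> 500 * C^6 * ((2 * CF * L^2 / \<beta>) * (4 * (V * V)) + (CF * L * v1) * (12 * V))"
      using sum1 sum2 CF1 L beta v1 C by (intro mult_left_mono add_mono) auto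
    also have "(2 * CF * L^2 / \<beta>) * (4 * (V * V)) + (CF * L * v1) * (12 * V)
        = (8 * CF * L^2 + 12 * CF * L * x) * (V * V / \<beta>)"
      using beta V0 by (simp add: x_def field_simps)
    also have "500 * C^6 * ((8 * CF * L^2 + 12 * CF * L * x) * (V * V / \<beta>))
        \<le> 500 * C^6 * ((12 * CF * (L * U)) * (V * V / \<beta>))"
    proof (intro mult_left_mono mult_right_mono)
      have "8 * (CF * L^2) \<le> 12 * (CF * L^2)" using CF1 by (intro mult_right_mono) auto
      then show "8 * CF * L^2 + 12 * CF * L * x \<le> 12 * CF * (L * U)"
        by (simp add: U_def power2_eq_square algebra_simps)
    qed (use beta C in auto)
    finally show ?thesis by (simp only: mult.assoc)
  qed
  \<comment> \<open>W = sqrt t / \<beta> is t times the square of the target scale, the natural unit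
    of t Psi.\<close>
  define W where "W = V * V / \<beta>"
  have W0: "0 < W" using V0 beta by (simp add: W_def)
  have W1: "1 \<le> W"
  proof -
    have "1 * \<beta> \<le> V * V" using V0 beta by (intro mult_mono) auto
    then show ?thesis using beta by (simp add: W_def)
  qed
  define N where "N = (\<Sum>r\<in>{s1..<t}. cc (Suc r) * e (Suc r))"
  have Vsum: "sqrt (\<Sum>r\<in>{s1..<t}. (cc (Suc r))\<^sup>2) \<le> 12 * C^2 * (CF + 4 * C) * (W * U)"
  proof -
    let ?k = "4 * C^2 * (CF + 4 * C) / \<beta>"
    have "(\<Sum>r\<in>{s1..<t}. (cc (Suc r))\<^sup>2) \<le> (\<Sum>r\<in>{s1..<t}. ?k\<^sup>2 * (2 * L^2 + (2 * (\<beta> * v1)\<^sup>2) * (1 / (root4 r * root4 r))))"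
    proof (rule sum_mono)
      fix r assume "r \<in> {s1..<t}"
      then have r: "s1 \<le> r" "r < t" "r < T" using less.prems by auto
      have "Y r + 4 * C \<le> CF * u r + 4 * C * u r"
        using IH[OF r(1,2)] uL(2)[OF r(1)] C by (intro add_mono) (auto simp: mult_le_cancel_left1)
      then have "4 * C^2 * (Y r + 4 * C) / \<beta> \<le> 4 * C^2 * ((CF + 4 * C) * u r) / \<beta>"
        using beta by (intro divide_right_mono mult_left_mono) (auto simp: algebra_simps)
      then have "\<bar>cc (Suc r)\<bar> \<le> ?k * u r" using ps(2)[OF r(1,3)] by simp
      then have "\<bar>cc (Suc r)\<bar>\<^sup>2 \<le> (?k * u r)\<^sup>2" by (intro power_mono) auto
      then have "(cc (Suc r))\<^sup>2 \<le> ?k\<^sup>2 * (u r)\<^sup>2" by (simp add: power_mult_distrib power_divide)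
      also have "(u r)\<^sup>2 \<le> 2 * L^2 + (2 * (\<beta> * v1)\<^sup>2) * (1 / (root4 r * root4 r))"
      proof -
        have "0 \<le> (L - \<beta> * v1 / root4 r)\<^sup>2" by simp
        then have "(u r)\<^sup>2 \<le> 2 * L^2 + 2 * (\<beta> * v1 / root4 r)\<^sup>2"
          unfolding u_def power2_diff power2_sum by linarith
        then show ?thesis by (simp add: power_divide power2_eq_square)
      qed
      finally show "(cc (Suc r))\<^sup>2 \<le> ?k\<^sup>2 * (2 * L^2 + (2 * (\<beta> * v1)\<^sup>2) * (1 / (root4 r * root4 r)))"
        by (simp add: mult_left_mono)
    qed
    also have "... = ?k\<^sup>2 * (real (t - s1) * (2 * L^2) + (2 * (\<beta> * v1)\<^sup>2) * (\<Sum>r\<in>{s1..<t}. 1 / (root4 r * root4 r)))"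
      by (simp only: sum_distrib_left[symmetric] sum.distrib sum_constant card_atLeastLessThan)
        (simp add: mult.left_commute)
    also have "... \<le> ?k\<^sup>2 * (V^4 * (2 * L^2) + (2 * (\<beta> * v1)\<^sup>2) * (4 * (V * V)))"
      using sum1 unfolding V4 by (intro mult_left_mono add_mono mult_right_mono) auto
    also have "V^4 * (2 * L^2) + (2 * (\<beta> * v1)\<^sup>2) * (4 * (V * V)) = V^4 * (2 * L^2 + 8 * x^2)"
      using V0 by (simp add: x_def power_divide power2_eq_square power4_eq_xxxx field_simps)
    also have "?k\<^sup>2 * (V^4 * (2 * L^2 + 8 * x^2)) \<le> ?k\<^sup>2 * (V^4 * (9 * U^2))"
    proof (intro mult_left_mono)
      have "0 \<le> 2 * L * x" using L x0 by simp
      moreover have "0 \<le> x^2" "0 \<le> L^2" by simp_all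
      ultimately show "2 * L^2 + 8 * x^2 \<le> 9 * U^2" unfolding U_def power2_sum by argo
    qed auto
    also have "... = (12 * C^2 * (CF + 4 * C) * (W * U))\<^sup>2"
      by (simp add: W_def power_mult_distrib power_divide power2_eq_square power4_eq_xxxx)
    finally have "(\<Sum>r\<in>{s1..<t}. (cc (Suc r))\<^sup>2) \<le> (12 * C^2 * (CF + 4 * C) * (W * U))\<^sup>2" .
    then show ?thesis using C CF1 W0 U by (intro real_le_lsqrt) auto
  qed
  have Nb: "\<bar>N\<bar> \<le> (12 * C^3 * CF + 49 * C^4) * (L * U * W)"
  proof -
    have "\<bar>N\<bar> \<le> C * (L * sqrt (\<Sum>r\<in>{s1..<t}. (cc (Suc r))\<^sup>2) + L^2)"
      unfolding N_def by (rule HN[OF less.prems])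
    also have "... \<le> C * (L * (12 * C^2 * (CF + 4 * C) * (W * U)) + L * U * W)"
    proof (intro mult_left_mono add_mono)
      have "L * L * 1 \<le> L * U * W" using L U W1 by (intro mult_mono) auto
      then show "L^2 \<le> L * U * W" by (simp add: power2_eq_square)
    qed (use Vsum L C in auto)
    also have "... = (12 * C^3 * CF + 48 * C^4 + C) * (L * U * W)"
      by (simp add: power2_eq_square power3_eq_cube power4_eq_xxxx algebra_simps)
    also have "... \<le> (12 * C^3 * CF + 49 * C^4) * (L * U * W)"
    proof (intro mult_right_mono)
      have "C * 1 \<le> C * C^3" using C by (intro mult_left_mono one_le_power) auto
      then show "12 * C^3 * CF + 48 * C^4 + C \<le> 12 * C^3 * CF + 49 * C^4"
        by (simp add: power3_eq_cube power4_eq_xxxx)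
    qed (use L U W0 in auto)
    finally show ?thesis .
  qed
  have h0: "norm (proj_orth th (rd e r)) \<le> C * L * (1 / (b * root4 r))" if "s1 \<le> r" "r \<le> T" for r
  proof -
    have "proj_orth th (rd e r) = proj_orth th (rd e r - th)" by (simp add: proj_orth_diff norm_th_one)
    then have "norm (proj_orth th (rd e r)) \<le> norm (rd e r - th)" using norm_proj_orth_le[OF norm_th_one] by metis
    then show ?thesis using H6[OF that] by linarith
  qed
  have init: "real s1 * Psi e s1 \<le> 3 * C^3 * (U * U * W)"
  proof -
    have s1T: "s1 \<le> T" using less.prems by simp
    define g where "g = b / v1"
    have g0: "0 < g" using b0 v1 by (simp add: g_def)
    have m1: "norm (m s1) \<le> C * g" using H3[OF order_refl s1T] by (simp add: g_def v1_def)
    have "C * L * (1 / (b * v1)) \<le> C * (C * \<beta>) * (1 / (b * v1))"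
      using L C b0 v1 by (intro mult_right_mono mult_left_mono) auto
    also have "... = C^2 * g" using b0(1) v1 by (simp add: g_def b0(2)[symmetric] power2_eq_square)
    finally have h1: "norm (proj_orth th (rd e s1)) \<le> C^2 * g"
      using h0[OF order_refl s1T] by (simp add: v1_def)
    have "Psi e s1 \<le> (norm (m s1))\<^sup>2 + 2 * (norm (m s1) * norm (proj_orth th (rd e s1)))"
      unfolding Psi_def using Cauchy_Schwarz_ineq2[of "m s1" "proj_orth th (rd e s1)"] by linarith
    also have "... \<le> (C * g)\<^sup>2 + 2 * ((C * g) * (C^2 * g))"
      using m1 h1 C g0 by (intro add_mono power_mono mult_left_mono mult_mono) auto
    also have "... = (C^2 + 2 * C^3) * (g * g)" by (simp add: power2_eq_square power3_eq_cube algebra_simps)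
    also have "... \<le> (3 * C^3) * (g * g)"
    proof (rule mult_right_mono)
      have "C^2 * 1 \<le> C^2 * C" using C by (intro mult_left_mono) auto
      then show "C^2 + 2 * C^3 \<le> 3 * C^3" by (simp add: power2_eq_square power3_eq_cube)
    qed simp
    finally have "real s1 * Psi e s1 \<le> real s1 * ((3 * C^3) * (g * g))" by (intro mult_left_mono) auto
    also have "... = 3 * C^3 * (v1^4 * (g * g))" by (simp add: v1_def root4_pow)
    also have "v1^4 * (g * g) = x * x * W"
      using v1 V0 beta b0(1) by (simp add: g_def x_def W_def b0(2)[symmetric] power4_eq_xxxx field_simps)
    also have "3 * C^3 * (x * x * W) \<le> 3 * C^3 * (U * U * W)"
      using U x0 W0 C by (intro mult_left_mono mult_right_mono mult_mono) auto
    finally show ?thesis .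
  qed
  have tP: "real t * Psi e t \<le> 6030 * C^6 * CF * (U * U * W)"
  proof -
    have LU: "L * U * W \<le> U * U * W" using U W0 by (intro mult_right_mono) auto
    have "500 * C^6 * (12 * CF * (L * U)) * (V * V / \<beta>) = 6000 * C^6 * CF * (L * U * W)"
      by (simp add: W_def)
    also have "... \<le> 6000 * C^6 * CF * (U * U * W)" using LU C CF1 by (intro mult_left_mono) auto
    finally have e1: "(\<Sum>r\<in>{s1..<t}. 500 * C^6 * (L^2 + L * Y r) * (1 / (b * root4 r))\<^sup>2) \<le> 6000 * C^6 * CF * (U * U * W)"
      using err by linarith
    have "- (2 * N) \<le> 2 * \<bar>N\<bar>" by simp
    also have "... \<le> 2 * ((12 * C^3 * CF + 49 * C^4) * (L * U * W))" using Nb by simp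
    also have "... \<le> 2 * ((12 * C^3 * CF + 49 * C^4) * (U * U * W))"
      using LU C CF1 by (intro mult_left_mono) auto
    finally have e2: "- (2 * N) \<le> (24 * C^3 * CF + 98 * C^4) * (U * U * W)" by (simp add: algebra_simps)
    have "real t * Psi e t \<le> 3 * C^3 * (U * U * W) + 6000 * C^6 * CF * (U * U * W) + (24 * C^3 * CF + 98 * C^4) * (U * U * W)"
      using tele[OF less.prems] init e1 e2 unfolding N_def by linarith
    also have "... = (3 * C^3 + 6000 * C^6 * CF + 24 * C^3 * CF + 98 * C^4) * (U * U * W)" by (simp add: algebra_simps)
    also have "... \<le> (6030 * C^6 * CF) * (U * U * W)"
    proof (rule mult_right_mono)
      have c3: "8 * C^3 \<le> C^6"
      proof -
        have "2^3 * C^3 \<le> C^3 * C^3" using C by (intro mult_right_mono power_mono) auto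
        then show ?thesis by (simp add: power_add[symmetric])
      qed
      have c4: "4 * C^4 \<le> C^6"
      proof -
        have "2\<^sup>2 * C^4 \<le> C^2 * C^4" using C by (intro mult_right_mono power_mono) auto
        then show ?thesis by (simp add: power_add[symmetric])
      qed
      have "C^6 * 1 \<le> C^6 * CF" using CF1 by (intro mult_left_mono) auto
      moreover have "8 * C^3 * CF \<le> C^6 * CF" using c3 CF1 by (intro mult_right_mono) auto
      ultimately show "3 * C^3 + 6000 * C^6 * CF + 24 * C^3 * CF + 98 * C^4 \<le> 6030 * C^6 * CF"
        using c3 c4 C6 by linarith
    qed (use U W0 in auto)
    finally show ?thesis .
  qed
  have PsiV: "Psi e t * (\<beta> * (V * V)) \<le> 6030 * C^6 * CF * (U * U)"
  proof -
    have "(Psi e t * (\<beta> * (V * V))) * W = real t * Psi e t"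
      using beta by (simp add: W_def V4[symmetric] power4_eq_xxxx)
    also have "... \<le> 6030 * C^6 * CF * (U * U * W)" by (rule tP)
    also have "... = (6030 * C^6 * CF * (U * U)) * W" by simp
    finally have "(Psi e t * (\<beta> * (V * V))) * W \<le> (6030 * C^6 * CF * (U * U)) * W" .
    then show ?thesis using W0 by (rule mult_right_le_imp_le)
  qed
  define hn where "hn = norm (proj_orth th (rd e t))"
  have hn: "hn * (b * V) \<le> C * L"
  proof -
    have "hn * (b * V) \<le> C * L * (1 / (b * V)) * (b * V)"
      unfolding hn_def using h0[OF less.prems] b0 V0 by (intro mult_right_mono) (auto simp: V_def)
    then show ?thesis using b0 V0 by simp
  qed
  \<comment> \<open>Psi is not a square, but |m - 2 h|^2 \<ge> 0 recovers |m|^2 from it at the cost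
    of the squared estimation error at time t alone.\<close>
  have m2: "(norm (m t))\<^sup>2 \<le> 2 * Psi e t + 4 * hn^2"
  proof -
    let ?h = "proj_orth th (rd e t)"
    have "0 \<le> (norm (m t - 2 *\<^sub>R ?h))\<^sup>2" by simp
    also have "... = (norm (m t))\<^sup>2 - 4 * (m t \<bullet> ?h) + 4 * hn^2"
      unfolding hn_def power2_norm_eq_inner
      by (simp add: inner_diff_left inner_diff_right inner_commute[of ?h "m t"])
    finally show ?thesis by (simp add: Psi_def)
  qed
  have "(Y t)\<^sup>2 \<le> (CF * U)\<^sup>2"
  proof -
    have "(Y t)\<^sup>2 = (norm (m t))\<^sup>2 * (\<beta> * (V * V))"
      by (simp add: Y_def V_def power2_eq_square b0(2)[symmetric])
    also have "... \<le> (2 * Psi e t + 4 * hn^2) * (\<beta> * (V * V))"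
      using m2 beta by (intro mult_right_mono) auto
    also have "... = 2 * (Psi e t * (\<beta> * (V * V))) + 4 * (hn * (b * V))\<^sup>2"
      by (simp add: power2_eq_square b0(2)[symmetric] algebra_simps)
    also have "... \<le> 2 * (6030 * C^6 * CF * (U * U)) + 4 * (C * U)\<^sup>2"
    proof (intro add_mono mult_left_mono power_mono)
      have "C * L \<le> C * U" using C U by simp
      then show "hn * (b * V) \<le> C * U" using hn by linarith
      show "0 \<le> hn * (b * V)" using b0 V0 by (simp add: hn_def)
    qed (use PsiV in auto)
    also have "... = (12060 * C^6 * CF + 4 * C^2) * (U * U)" by (simp add: power2_eq_square algebra_simps)
    \<comment> \<open>This closes the induction: the right-hand side is linear in CF and the left
      quadratic, so CF = 100000 C^6 is more than enough.\<close>
    also have "... \<le> (CF * CF) * (U * U)"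
    proof (rule mult_right_mono)
      have "C^2 \<le> C^6" using C by (intro power_increasing) auto
      moreover have "C^6 * 1 \<le> C^6 * CF" using CF1 by (intro mult_left_mono) auto
      moreover have "CF * CF = 100000 * (C^6 * CF)" by (simp add: CF_def)
      ultimately show "12060 * C^6 * CF + 4 * C^2 \<le> CF * CF" using C6 CF1 by linarith
    qed simp
    also have "... = (CF * U)\<^sup>2" by (simp add: power2_eq_square)
    finally show ?thesis .
  qed
  then have "Y t \<le> CF * U" using CF1 U by (rule_tac power2_le_imp_le) auto
  then have "Y t * (1 / (b * V)) \<le> CF * U * (1 / (b * V))" using b0 V0 by (intro mult_right_mono) auto
  then show ?case using Ym[OF less.prems(1)] by (simp add: U_def x_def V_def v1_def)
qed

end

section \<open>From the slope m to the leading eigenvector\<close>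

context design
begin

text \<open>The top eigenvalue is at least p while the form on the orthogonal complement of th is at
  most B \<le> p/2. This gap of p/2 bounds the orthogonal part of v by 2 |z| / p = 2 |m|.\<close>

lemma leading_eigenvector_dist:
  assumes lead: "unit_leading_eigenvector (Lam t) v" and v: "0 \<le> v \<bullet> th" and Bp: "B t \<le> p t / 2"
  shows "norm (v - th) \<le> 3 * norm (m t)"
proof -
  note L = unit_leading_eigenvector_symmetric[OF design_matrix_symmetric lead]
  define la where "la = max_eigenvalue (Lam t)"
  have lap: "p t \<le> la" using L(3)[of th] norm_th_one by (simp add: D.pp_def la_def)
  define v0 where "v0 = v \<bullet> th"
  define vp where "vp = proj_orth th v"
  have dec: "v = v0 *\<^sub>R th + vp" using proj_orth_decomp[of v th] by (simp add: v0_def vp_def)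
  have vpth: "vp \<bullet> th = 0" by (simp add: vp_def norm_th_one)
  have n2: "(norm vp)\<^sup>2 = 1 - v0^2"
    using norm_proj_orth_sq[OF norm_th_one, of v] L(1) by (simp add: vp_def v0_def)
  have v01: "v0 \<le> 1" using norm_cauchy_schwarz[of v th] L(1) norm_th_one by (simp add: v0_def)
  have v00: "0 \<le> v0" using v by (simp add: v0_def)
  have "la * (norm vp)\<^sup>2 = vp \<bullet> (Lam t *v v)"
  proof -
    have "vp \<bullet> v = (norm vp)\<^sup>2" using vpth by (subst dec) (simp add: inner_add_right power2_norm_eq_inner)
    then show ?thesis by (simp add: L(2) la_def)
  qed
  also have "... = v0 * (vp \<bullet> (Lam t *v th)) + vp \<bullet> (Lam t *v vp)"
    by (subst dec) (simp add: matrix_vector_right_distrib matrix_vector_mult_scaleR inner_add_right)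
  also have "vp \<bullet> (Lam t *v th) = vp \<bullet> z t"
    unfolding D.zz_def using proj_orth_inner[OF vpth] by simp
  also have "v0 * (vp \<bullet> z t) \<le> 1 * (norm vp * norm (z t))"
  proof -
    have "v0 * (vp \<bullet> z t) \<le> v0 * (norm vp * norm (z t))" using v00 norm_cauchy_schwarz by (intro mult_left_mono)
    also have "... \<le> 1 * (norm vp * norm (z t))" using v01 by (intro mult_right_mono) auto
    finally show ?thesis .
  qed
  also have "vp \<bullet> (Lam t *v vp) \<le> (p t / 2) * (norm vp)\<^sup>2"
    using quad_le_B[OF vpth, of t] mult_right_mono[OF Bp, of "(norm vp)\<^sup>2"] by simp
  finally have "la * (norm vp)\<^sup>2 \<le> norm vp * norm (z t) + (p t / 2) * (norm vp)\<^sup>2" by simp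
  moreover have "p t * (norm vp)\<^sup>2 \<le> la * (norm vp)\<^sup>2" using lap by (intro mult_right_mono) auto
  ultimately have "p t / 2 * (norm vp)\<^sup>2 \<le> norm vp * norm (z t)" by simp
  then have vpz: "norm vp * (p t / 2 * norm vp) \<le> norm vp * norm (z t)" by (simp add: power2_eq_square mult.left_commute)
  have p0: "0 < p t" by (rule D.pp_pos)
  have vpm: "norm vp \<le> 2 * norm (m t)"
  proof (cases "norm vp = 0")
    case False
    then have "p t / 2 * norm vp \<le> norm (z t)" using vpz by simp
    also have "norm (z t) = p t * norm (m t)" using p0 by (simp add: z_m)
    finally have "p t * norm vp \<le> p t * (2 * norm (m t))" by simp
    then show ?thesis using p0 by simp
  qed (use norm_ge_zero in simp)
  have "(norm (v - th))\<^sup>2 = 2 - 2 * v0"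
    using L(1) norm_th_one
    by (simp add: power2_norm_eq_inner inner_diff_left inner_diff_right inner_commute norm_eq_1 v0_def)
  also have "... \<le> 2 * (norm vp)\<^sup>2"
  proof -
    have "v0 * v0 \<le> 1 * v0" using v00 v01 by (intro mult_right_mono) auto
    then show ?thesis unfolding n2 by (simp add: power2_eq_square)
  qed
  also have "... \<le> 2 * (2 * norm (m t))\<^sup>2" using vpm by (intro mult_left_mono power_mono) auto
  \<comment> \<open>The factor 3 rounds up 2 sqrt 2: one 2 from the gap, sqrt 2 from passing from
    the orthogonal part to the distance of unit vectors with v0 \<ge> 0.\<close>
  also have "... \<le> (3 * norm (m t))\<^sup>2" by (simp add: power_mult_distrib)
  finally show ?thesis by (rule_tac power2_le_imp_le) auto
qed

end

section \<open>The noise event\<close>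

text \<open>The maximal inequality asks for weights bounded at every point of the type, while
  actions have norm one only on the sample space. Clipping changes nothing in the rounds and
  outcomes that matter.\<close>

definition clip :: "real \<Rightarrow> real \<Rightarrow> real" where "clip c x = max (- c) (min c x)"

lemma clip_id: "\<bar>x\<bar> \<le> c \<Longrightarrow> clip c x = x" by (auto simp: clip_def)

lemma abs_clip_le: "0 \<le> c \<Longrightarrow> \<bar>clip c x\<bar> \<le> c" by (auto simp: clip_def)

lemma measurable_clip [measurable]: "f \<in> borel_measurable N \<Longrightarrow> (\<lambda>w. clip c (f w)) \<in> borel_measurable N"
  unfolding clip_def by (intro borel_measurable_max borel_measurable_min borel_measurable_const)

text \<open>The exponential bound reads N \<le> \<sigma>^2 l V / 2 + \<Gamma>^2 / l, whose best l is
  about \<Gamma> / sqrt V. As V is random, l is taken from a dyadic family, with l = 1 when V is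
  small.\<close>

lemma dyadic_linear_bound:
  fixes N V \<Gamma> \<sigma> :: real
  assumes G: "1 \<le> \<Gamma>" and V: "0 \<le> V" "sqrt V < 2 ^ Suc J"
    and le: "\<And>j. j \<le> J \<Longrightarrow> (1 / 2 ^ j) * N \<le> \<sigma>^2 / 2 * ((1 / 2 ^ j)\<^sup>2 * V) + \<Gamma>^2"
  shows "N \<le> (\<sigma>^2 + 1) * (\<Gamma> * sqrt V + \<Gamma>^2)"
proof (cases "sqrt V \<le> \<Gamma>")
  case True
  have "V = (sqrt V)\<^sup>2" using V by simp
  also have "... \<le> \<Gamma>^2" using True V by (intro power_mono) auto
  finally have VG: "V \<le> \<Gamma>^2" .
  have "N \<le> \<sigma>^2 / 2 * V + \<Gamma>^2" using le[of 0] by simp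
  also have "\<sigma>^2 / 2 * V \<le> \<sigma>^2 * \<Gamma>^2" using VG V by (intro mult_mono) auto
  finally have "N \<le> (\<sigma>^2 + 1) * (0 + \<Gamma>^2)" by (simp add: algebra_simps)
  also have "... \<le> (\<sigma>^2 + 1) * (\<Gamma> * sqrt V + \<Gamma>^2)" using G V by (intro mult_left_mono add_mono) auto
  finally show ?thesis .
next
  case False
  define x where "x = sqrt V / \<Gamma>"
  have x1: "1 \<le> x" using False G by (simp add: x_def)
  have "x \<le> sqrt V / 1" unfolding x_def using G V by (intro divide_left_mono) auto
  then have "x < 2 ^ Suc J" using V(2) by simp
  from dyadic_scale[OF x1 this] obtain j where j: "j \<le> J" "2 ^ j \<le> x" "x < 2 ^ Suc j" .
  define l :: real where "l = 1 / 2 ^ j"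
  have l0: "0 < l" by (simp add: l_def)
  have lx: "l * sqrt V \<le> 2 * \<Gamma>"
  proof -
    have "sqrt V \<le> 2 ^ Suc j * \<Gamma>" using j(3) G by (simp add: x_def divide_less_eq)
    then have "l * sqrt V \<le> l * (2 ^ Suc j * \<Gamma>)" using l0 by (intro mult_left_mono) auto
    then show ?thesis by (simp add: l_def)
  qed
  have gl: "\<Gamma> / l \<le> sqrt V"
    using j(2) G by (simp add: x_def l_def le_divide_eq mult.commute)
  have "l * N \<le> \<sigma>^2 / 2 * (l^2 * V) + \<Gamma>^2" using le[OF j(1)] by (simp add: l_def)
  also have "... = l * (\<sigma>^2 / 2 * (l * sqrt V * sqrt V) + \<Gamma> * (\<Gamma> / l))"
    using l0 V by (simp add: power2_eq_square algebra_simps)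
  finally have "N \<le> \<sigma>^2 / 2 * (l * sqrt V * sqrt V) + \<Gamma> * (\<Gamma> / l)" using l0 by simp
  also have "... \<le> \<sigma>^2 / 2 * ((2 * \<Gamma>) * sqrt V) + \<Gamma> * sqrt V"
    using lx gl G V by (intro add_mono mult_left_mono mult_right_mono) auto
  also have "... = (\<sigma>^2 + 1) * (\<Gamma> * sqrt V + 0)" by (simp add: algebra_simps)
  also have "... \<le> (\<sigma>^2 + 1) * (\<Gamma> * sqrt V + \<Gamma>^2)" using G by (intro mult_left_mono add_mono) auto
  finally show ?thesis .
qed

text \<open>40 (2 N + 1)^(d+1) (ln T)^2 bounds the number of exponential inequalities used at once.
  The summand 3 lets exp (- \<Gamma>^2) also cancel (ln T)^2 and leave the failure level 1 / ln
  T.\<close>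

definition gamma_const :: "nat \<Rightarrow> nat \<Rightarrow> real" where
  "gamma_const d N = sqrt (ln (40 * real (2 * N + 1) ^ Suc d) + 3)"

lemma ln_40_ge: "1 \<le> ln (40 * real (2 * N + 1) ^ Suc d)"
proof -
  have "1 \<le> real (2 * N + 1) ^ Suc d" by (intro one_le_power) simp
  then have "exp 1 \<le> 40 * real (2 * N + 1) ^ Suc d" using exp_le by linarith
  then show ?thesis by (subst ln_ge_iff) (auto intro: mult_pos_pos zero_less_power)
qed

lemma gamma_const_ge_one: "1 \<le> gamma_const d N"
  using ln_40_ge[of N d] by (simp add: gamma_const_def)

locale linucb_unit = linucb_run M \<theta> \<sigma> \<beta> T a \<epsilon> \<theta>h
  for M :: "'w measure" and \<theta> :: "real^'d" and \<sigma> \<beta> :: real and T :: nat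
    and a :: "nat \<Rightarrow> 'w \<Rightarrow> real^'d" and \<epsilon> :: "nat \<Rightarrow> 'w \<Rightarrow> real" and \<theta>h :: "nat \<Rightarrow> 'w \<Rightarrow> real^'d" +
  assumes norm_theta: "norm \<theta> = 1" and beta_gt_0: "\<beta> > 0" and T3: "3 \<le> T"
begin

lemma path_at: "w \<in> space M \<Longrightarrow> ucb_path (\<lambda>s. a s w) \<theta> (\<lambda>t. \<theta>h t w) \<beta> T"
proof
  fix t assume w: "w \<in> space M"
  show "norm \<theta> = 1" by (rule norm_theta)
  show "\<beta> > 0" by (rule beta_gt_0)
  show "norm (\<theta>h t w) = 1" if "t \<le> T"
    using estimator[of t w] w that by (auto simp: Let_def split: if_splits)
  show "is_arg_max (ucb_score \<beta> (design_matrix (\<lambda>s. a s w) t) (\<theta>h t w)) (\<lambda>x. x \<in> cball 0 1) (a (Suc t) w)"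
    if "t < T"
    using action[of "Suc t" w] w that by simp
qed

lemma normalised_at:
  assumes "w \<in> space M"
  shows "ucb_path.normalised (\<lambda>s. a s w) \<theta> (\<lambda>t. \<theta>h t w) T (\<lambda>s. \<epsilon> s w)"
proof -
  interpret P: ucb_path "\<lambda>s. a s w" \<theta> "\<lambda>t. \<theta>h t w" \<beta> T by (rule path_at[OF assms])
  have "P.rd (\<lambda>s. \<epsilon> s w) t = ridge (\<lambda>s. a s w) (\<lambda>s. reward \<theta> a \<epsilon> s w) t" for t
    by (simp add: P.rd_def reward_def)
  then show ?thesis
    using estimator[OF _ assms] by (auto simp: P.normalised_def Let_def split: if_splits)
qed

abbreviation "ell_at w t \<equiv> min_eigenvalue (design_matrix (\<lambda>s. a s w) t)"
abbreviation "SS_at w t \<equiv> design.SS (\<lambda>s. a s w) (\<lambda>s. \<epsilon> s w) t"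
abbreviation "cc_at w t \<equiv> ucb_path.cc (\<lambda>s. a s w) \<theta> t"

lemma ln_T_ge_one: "1 \<le> ln (real T)"
proof -
  have "3 \<le> real T" using T3 by simp
  then have "exp 1 \<le> real T" using exp_le by linarith
  then show ?thesis using T3 by (subst ln_ge_iff) auto
qed

lemma cc_at_measurable:
  assumes "s \<in> {1..T}"
  shows "(\<lambda>w. cc_at w s) \<in> borel_measurable (F (s - 1))"
proof -
  have am: "a r \<in> borel_measurable (F (s - 1))" if "1 \<le> r" "r \<le> s" for r
    using that assms by (intro a_measurable_F) auto
  have [measurable]: "(\<lambda>w. posdef_dir.mm (design_matrix (\<lambda>s. a s w) s) \<theta>) \<in> borel_measurable (F (s - 1))"
    by (rule measurable_mm_design[OF norm_theta am])
  have [measurable]: "(\<lambda>w. posdef.Gm (design_matrix (\<lambda>s. a s w) s) *v a s w) \<in> borel_measurable (F (s - 1))"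
    using assms by (intro measurable_Gm_design am) auto
  have "cc_at w s = real s * (posdef_dir.mm (design_matrix (\<lambda>s. a s w) s) \<theta> \<bullet>
      (posdef.Gm (design_matrix (\<lambda>s. a s w) s) *v a s w))" if "w \<in> space M" for w
  proof -
    interpret P: ucb_path "\<lambda>s. a s w" \<theta> "\<lambda>t. \<theta>h t w" \<beta> T by (rule path_at[OF that])
    show ?thesis by (simp add: P.cc_def)
  qed
  moreover have "(\<lambda>w. real s * (posdef_dir.mm (design_matrix (\<lambda>s. a s w) s) \<theta> \<bullet>
      (posdef.Gm (design_matrix (\<lambda>s. a s w) s) *v a s w))) \<in> borel_measurable (F (s - 1))" by measurable
  ultimately show ?thesis using measurable_cong[of "F (s - 1)" "\<lambda>w. cc_at w s"] by (simp only: space_F)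
qed

lemma cc_at_le:
  assumes "w \<in> space M" "s \<in> {1..T}"
  shows "\<bar>cc_at w s\<bar> \<le> (real T + 1)\<^sup>2"
proof -
  interpret P: ucb_path "\<lambda>s. a s w" \<theta> "\<lambda>t. \<theta>h t w" \<beta> T by (rule path_at[OF assms(1)])
  have as: "norm (a r w) \<le> 1" if "1 \<le> r" "r \<le> s" for r using P.norm_a_one[of r] that assms(2) by simp
  have "norm (P.m s) \<le> sqrt (P.B s)" by (rule P.norm_m_le_one_B)
  also have "... \<le> sqrt (1 + real s)" using P.B_le[OF as] by simp
  also have "... \<le> 1 + real s" by (intro real_le_lsqrt) (auto simp: power2_eq_square algebra_simps)
  also have "... \<le> real T + 1" using assms by simp
  finally have m: "norm (P.m s) \<le> real T + 1" .
  have "norm (P.G s *v a s w) \<le> norm (a s w) / P.el s" by (rule P.D.Gm_norm)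
  also have "... \<le> 1 / 1" using as[of s] assms(2) P.D.ell_ge_one[of s] by (intro frac_le) auto
  finally have g: "norm (P.G s *v a s w) \<le> 1" by simp
  have "\<bar>cc_at w s\<bar> \<le> real s * (norm (P.m s) * norm (P.G s *v a s w))"
    using mult_left_mono[OF Cauchy_Schwarz_ineq2[of "P.m s" "P.G s *v a s w"], of "real s"]
    by (simp add: P.cc_def abs_mult)
  also have "... \<le> (real T + 1) * ((real T + 1) * 1)" using assms m g by (intro mult_mono) auto
  finally show ?thesis by (simp add: power2_eq_square)
qed

text \<open>Two families share one union bound: the grid directions for the self-normalised noise,
  and both signs and dyadic multiples of the predictable weights \<open>cc\<close> for the
  martingale in the Lyapunov argument.\<close>

lemma noise_event:
  fixes N s1 :: nat
  defines "L \<equiv> sqrt (real CARD('d) + ln (ln (real T)))"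
  defines "\<Gamma> \<equiv> gamma_const CARD('d) N * L"
  shows "\<exists>E\<in>sets M. 1 - 1 / ln (real T) \<le> measure M E \<and> (\<forall>w\<in>E. w \<in> space M \<and>
    (\<forall>t J. t \<le> T \<longrightarrow> 1 \<le> J \<longrightarrow> design.B (\<lambda>s. a s w) \<theta> t \<le> J * ell_at w t \<longrightarrow>
       12 * sqrt (real CARD('d)) * (2 + sqrt J) + 1 \<le> real N \<longrightarrow>
       seminorm_of (posdef.Gm (design_matrix (\<lambda>s. a s w) t)) (SS_at w t) \<le> 2 * (1 + \<sigma>^2) * \<Gamma>) \<and>
    (\<forall>t. s1 \<le> t \<longrightarrow> t \<le> T \<longrightarrow> \<bar>\<Sum>r\<in>{s1..<t}. cc_at w (Suc r) * \<epsilon> (Suc r) w\<bar>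
       \<le> (\<sigma>^2 + 1) * (\<Gamma> * sqrt (\<Sum>r\<in>{s1..<t}. (cc_at w (Suc r))\<^sup>2) + \<Gamma>^2)))"
proof -
  define d where "d = CARD('d)"
  have d1: "1 \<le> real d" by (simp add: d_def)
  have l1: "1 \<le> ln (real T)" by (rule ln_T_ge_one)
  have ll0: "0 \<le> ln (ln (real T))" using l1 by simp
  have L2: "L^2 = real d + ln (ln (real T))" using ll0 by (simp add: L_def d_def)
  have "1 \<le> real d + ln (ln (real T))" using d1 ll0 by linarith
  then have L1: "1 \<le> L" unfolding L_def d_def[symmetric] by simp
  have G1: "1 \<le> \<Gamma>" using mult_mono[OF gamma_const_ge_one[of d N] L1] gamma_const_ge_one[of d N]
    by (simp add: \<Gamma>_def d_def)
  \<comment> \<open>Both p and B lie between 1 and T + 1, so I + 1 dyadic scales cover them, of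
    order ln T in number.\<close>
  define I where "I = nat \<lfloor>log 2 (real T + 1)\<rfloor>"
  have lg0: "0 \<le> log 2 (real T + 1)" by (subst zero_le_log_cancel_iff) auto
  have I1: "real T + 1 < 2 ^ Suc I"
  proof -
    have "log 2 (real T + 1) < real (Suc I)" using lg0 unfolding I_def by linarith
    then have "2 powr log 2 (real T + 1) < 2 powr real (Suc I)" by (intro powr_less_mono) auto
    then show ?thesis by (simp add: powr_realpow[symmetric] powr_add)
  qed
  have I2: "real I + 1 \<le> 4 * ln (real T)"
  proof -
    have "real I \<le> log 2 (real T + 1)" using lg0 unfolding I_def by linarith
    also have "log 2 (real T + 1) = ln (real T + 1) / ln 2" by (simp add: log_def)
    also have "... \<le> (2 * ln (real T)) / (2 / 3)"
    proof (rule frac_le)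
      have "real T + 1 \<le> (real T)\<^sup>2"
      proof -
        have t3: "3 \<le> real T" using T3 by simp
        then have "real T * 3 \<le> real T * real T" by (intro mult_left_mono) auto
        then have "real T + 1 \<le> real T * real T" using t3 by linarith
        then show ?thesis by (simp only: power2_eq_square)
      qed
      then have "ln (real T + 1) \<le> ln ((real T)\<^sup>2)" using T3 by (subst ln_le_cancel_iff) auto
      then show "ln (real T + 1) \<le> 2 * ln (real T)" using T3 by (simp add: ln_realpow)
      show "2 / 3 \<le> ln (2::real)" by (rule ln2_ge_two_thirds)
    qed (use l1 in auto)
    finally show ?thesis using l1 by simp
  qed
  \<comment> \<open>The root of the quadratic variation is at most (T + 1)^3 < 2^(3 (I + 1)), and 3
    (I + 1) = J0 + 1.\<close>
  define J0 where "J0 = 3 * I + 2"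
  define gi :: "(nat \<times> nat \<times> int \<times> ('d \<Rightarrow> int)) set" where "gi = grid_indices I N"
  define Idx :: "((nat \<times> nat \<times> int \<times> ('d \<Rightarrow> int)) + real \<times> nat) set" where "Idx = gi <+> ({1, -1} \<times> {..J0})"
  have finI: "finite Idx" unfolding Idx_def gi_def by (intro finite_Plus finite_grid_indices finite_cartesian_product) auto
  have cardI: "real (card Idx) * exp (- (\<Gamma>^2)) \<le> 1 / ln (real T)"
  proof -
    define Q where "Q = real (2 * N + 1) ^ Suc d"
    have Q1: "1 \<le> Q" unfolding Q_def by (intro one_le_power) simp
    have fin: "finite gi" unfolding gi_def by (rule finite_grid_indices)
    have "card Idx = card gi + 2 * Suc J0"
      unfolding Idx_def using fin by (simp add: card_Plus card_cartesian_product)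
    moreover have "real (card gi) = (real I + 1)\<^sup>2 * Q"
      unfolding gi_def card_grid_indices Q_def d_def by (simp add: algebra_simps)
    ultimately have "real (card Idx) = (real I + 1)\<^sup>2 * Q + 6 * (real I + 1)" by (simp add: J0_def)
    also have "... \<le> (4 * ln (real T))\<^sup>2 * Q + 6 * (4 * ln (real T))"
      using I2 Q1 by (intro add_mono mult_right_mono mult_left_mono power_mono) auto
    also have "... \<le> (4 * ln (real T))\<^sup>2 * Q + 24 * ((ln (real T))\<^sup>2 * Q)"
    proof -
      have "ln (real T) * 1 \<le> ln (real T) * (ln (real T) * Q)"
        using l1 Q1 mult_mono[OF l1 Q1] by (intro mult_left_mono) auto
      then show ?thesis by (simp add: power2_eq_square mult_ac)
    qed
    also have "... = 40 * Q * (ln (real T))\<^sup>2" by (simp add: power_mult_distrib)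
    finally have c: "real (card Idx) \<le> 40 * Q * (ln (real T))\<^sup>2" .
    have "ln (40 * Q) + 3 * ln (ln (real T)) \<le> \<Gamma>^2"
    proof -
      have q: "1 \<le> ln (40 * Q)" unfolding Q_def by (rule ln_40_ge)
      have "\<Gamma>^2 = (ln (40 * Q) + 3) * L^2"
        using q by (simp add: \<Gamma>_def gamma_const_def power_mult_distrib Q_def d_def)
      also have "... = ln (40 * Q) * (real d + ln (ln (real T))) + 3 * (real d + ln (ln (real T)))"
        unfolding L2 by (simp add: algebra_simps)
      also have "... \<ge> ln (40 * Q) * 1 + 3 * ln (ln (real T))"
        using q d1 ll0 by (intro add_mono mult_left_mono) auto
      finally show ?thesis by simp
    qed
    then have "exp (- (\<Gamma>^2)) \<le> exp (- (ln (40 * Q) + 3 * ln (ln (real T))))" by simp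
    also have "... = 1 / (40 * Q * (ln (real T))^3)"
    proof -
      have "exp (ln (40 * Q) + 3 * ln (ln (real T))) = 40 * Q * (ln (real T))^3"
        using Q1 l1 by (simp add: exp_add exp_of_nat_mult[of 3, simplified] )
      then show ?thesis by (simp only: exp_minus inverse_eq_divide)
    qed
    finally have "real (card Idx) * exp (- (\<Gamma>^2)) \<le> (40 * Q * (ln (real T))\<^sup>2) * (1 / (40 * Q * (ln (real T))^3))"
      using c Q1 l1 by (intro mult_mono) auto
    also have "... = 1 / ln (real T)" using Q1 l1 by (simp add: power2_eq_square power3_eq_cube)
    finally show ?thesis .
  qed
  define c where "c i = (case i of Inl g \<Rightarrow> norm (grid_vector \<theta> \<Gamma> g) | Inr _ \<Rightarrow> (real T + 1)\<^sup>2)"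
    for i :: "(nat \<times> nat \<times> int \<times> ('d \<Rightarrow> int)) + real \<times> nat"
  \<comment> \<open>For the second kind of index the weights are switched on only after s1, since
    the Lyapunov argument starts there.\<close>
  define k where "k i s w = clip (c i) (case i of Inl g \<Rightarrow> grid_vector \<theta> \<Gamma> g \<bullet> a s w
      | Inr (sg, j) \<Rightarrow> sg * (1 / 2 ^ j) * (if s \<le> s1 then 0 else cc_at w s))"
    for i :: "(nat \<times> nat \<times> int \<times> ('d \<Rightarrow> int)) + real \<times> nat" and s w
  have c0: "0 \<le> c i" for i by (simp add: c_def split: sum.splits)
  have kmeas: "k i s \<in> borel_measurable (F (s - 1))" if "s \<in> {1..T}" for i s
  proof -
    have [measurable]: "a s \<in> borel_measurable (F (s - 1))" using that by (intro action_predictable)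
    have [measurable]: "(\<lambda>w. cc_at w s) \<in> borel_measurable (F (s - 1))" by (rule cc_at_measurable[OF that])
    show ?thesis
    proof (cases i)
      case (Inl g)
      have "(\<lambda>w. clip (c i) (grid_vector \<theta> \<Gamma> g \<bullet> a s w)) \<in> borel_measurable (F (s - 1))" by measurable
      then show ?thesis unfolding k_def Inl sum.case .
    next
      case (Inr q)
      then obtain sg j where ij: "i = Inr (sg, j)" by (cases q) auto
      have "(\<lambda>w. clip (c i) (sg * (1 / 2 ^ j) * (if s \<le> s1 then 0 else cc_at w s))) \<in> borel_measurable (F (s - 1))"
        by (cases "s \<le> s1") (simp_all only: if_True if_False, measurable)
      then show ?thesis unfolding k_def ij sum.case prod.case .
    qed
  qed
  have kc: "\<bar>k i s w\<bar> \<le> c i" for i s w unfolding k_def by (rule abs_clip_le[OF c0])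
  have ev: "\<exists>E\<in>sets M. 1 - real (card Idx) * exp (- (\<Gamma>^2)) \<le> measure M E \<and>
    (\<forall>w\<in>E. w \<in> space M \<and> (\<forall>i\<in>Idx. \<forall>n\<le>T. expo (k i) n w < \<Gamma>\<^sup>2))"
    by (rule family_event[OF finI, of k c]) (auto intro: kmeas kc simp del: One_nat_def)
  obtain E where E: "E \<in> sets M" "1 - real (card Idx) * exp (- (\<Gamma>^2)) \<le> measure M E"
    "\<And>w. w \<in> E \<Longrightarrow> w \<in> space M"
    "\<And>w i n. w \<in> E \<Longrightarrow> i \<in> Idx \<Longrightarrow> n \<le> T \<Longrightarrow> expo (k i) n w < \<Gamma>\<^sup>2"
    using ev by (elim bexE conjE) auto
  show ?thesis
  proof (intro bexI[OF _ E(1)] conjI ballI allI impI)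
    show "1 - 1 / ln (real T) \<le> measure M E" using E(2) cardI by linarith
    fix w assume w: "w \<in> E"
    show ws: "w \<in> space M" by (rule E(3)[OF w])
    interpret P: ucb_path "\<lambda>s. a s w" \<theta> "\<lambda>t. \<theta>h t w" \<beta> T by (rule path_at[OF ws])
    show "seminorm_of (P.G t) (SS_at w t) \<le> 2 * (1 + \<sigma>^2) * \<Gamma>"
      if "t \<le> T" "1 \<le> J" "P.B t \<le> J * ell_at w t" "12 * sqrt (real CARD('d)) * (2 + sqrt J) + 1 \<le> real N" for t J
    proof (rule P.self_normalised_bound[where I = I and N = N and J = J])
      show "norm (a s w) \<le> 1" if "1 \<le> s" "s \<le> t" for s using P.norm_a_one[of s] that \<open>t \<le> T\<close> by simp
      show "real t + 1 < 2 ^ Suc I" using I1 that(1) by linarith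
      show "P.B t \<le> J * P.el t" using that(3) by (simp add: P.D.ell_def)
      fix g assume "g \<in> grid_vector \<theta> \<Gamma> ` grid_indices I N"
      then obtain i where i: "i \<in> gi" "g = grid_vector \<theta> \<Gamma> i" by (auto simp: gi_def)
      have kk: "k (Inl i) s w = g \<bullet> a s w" if "s \<in> {1..t}" for s
      proof -
        have "\<bar>g \<bullet> a s w\<bar> \<le> norm g * norm (a s w)" by (rule Cauchy_Schwarz_ineq2)
        then have "\<bar>g \<bullet> a s w\<bar> \<le> norm g" using P.norm_a_one[of s] that \<open>t \<le> T\<close> by simp
        then show ?thesis by (simp add: k_def c_def i(2)[symmetric] clip_id)
      qed
      have "expo (k (Inl i)) t w < \<Gamma>\<^sup>2" using i(1) \<open>t \<le> T\<close> by (intro E(4)[OF w]) (auto simp: Idx_def)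
      also have "expo (k (Inl i)) t w = (\<Sum>s=1..t. (g \<bullet> a s w) * \<epsilon> s w - \<sigma>^2 * (g \<bullet> a s w)\<^sup>2 / 2)"
        unfolding expo_def using kk by (intro sum.cong) auto
      also have "... = g \<bullet> SS_at w t - \<sigma>^2 / 2 * (\<Sum>s=1..t. (g \<bullet> a s w)\<^sup>2)"
        by (simp add: P.SS_def inner_sum_right sum_subtractf sum_distrib_left mult.commute)
      finally have "g \<bullet> SS_at w t \<le> \<sigma>^2 / 2 * (\<Sum>s=1..t. (g \<bullet> a s w)\<^sup>2) + \<Gamma>^2" by simp
      also have "(\<Sum>s=1..t. (g \<bullet> a s w)\<^sup>2) \<le> g \<bullet> (P.Lam t *v g)"
        by (simp add: design_matrix_quadratic power2_eq_square inner_commute)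
      finally show "g \<bullet> SS_at w t \<le> \<sigma>^2 / 2 * (g \<bullet> (P.Lam t *v g)) + \<Gamma>^2"
        by (simp add: mult_left_mono)
    qed (use that G1 in auto)
    fix t assume t: "s1 \<le> t" "t \<le> T"
    define NN where "NN = (\<Sum>r\<in>{s1..<t}. cc_at w (Suc r) * \<epsilon> (Suc r) w)"
    define VV where "VV = (\<Sum>r\<in>{s1..<t}. (cc_at w (Suc r))\<^sup>2)"
    have cut: "(\<Sum>s=1..t. if s \<le> s1 then 0 else f s) = (\<Sum>r\<in>{s1..<t}. f (Suc r))" for f :: "nat \<Rightarrow> real"
    proof -
      have "(\<Sum>s=1..t. if s \<le> s1 then 0 else f s) = (\<Sum>s\<in>{Suc s1..t}. f s)"
        by (intro sum.mono_neutral_cong_right) auto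
      also have "... = (\<Sum>s\<in>{Suc s1..<Suc t}. f s)" by (simp add: atLeastLessThanSuc_atLeastAtMost)
      also have "... = (\<Sum>r\<in>{s1..<t}. f (Suc r))" by (rule sum.shift_bounds_Suc_ivl)
      finally show ?thesis .
    qed
    have lin: "sg * ((1 / 2 ^ j) * NN) \<le> \<sigma>^2 / 2 * ((1 / 2 ^ j)\<^sup>2 * VV) + \<Gamma>^2" if "sg \<in> {1, -1}" "j \<le> J0" for sg :: real and j
    proof -
      define l :: real where "l = 1 / 2 ^ j"
      have l: "0 \<le> l" "l \<le> 1" by (simp_all add: l_def)
      have kk: "k (Inr (sg, j)) s w = sg * l * (if s \<le> s1 then 0 else cc_at w s)" if "s \<in> {1..t}" for s
      proof -
        have "\<bar>sg * l * (if s \<le> s1 then 0 else cc_at w s)\<bar> \<le> 1 * (real T + 1)\<^sup>2"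
          unfolding abs_mult using l \<open>sg \<in> _\<close> cc_at_le[OF ws, of s] that t by (intro mult_mono) auto
        then show ?thesis by (simp add: k_def c_def l_def clip_id)
      qed
      have sg2: "sg^2 = 1" using \<open>sg \<in> _\<close> by auto
      have "expo (k (Inr (sg, j))) t w < \<Gamma>\<^sup>2" using that t by (intro E(4)[OF w]) (auto simp: Idx_def)
      also have "expo (k (Inr (sg, j))) t w = (\<Sum>s=1..t. if s \<le> s1 then 0 else
          sg * l * (cc_at w s * \<epsilon> s w) - \<sigma>^2 / 2 * (l^2 * (cc_at w s)\<^sup>2))"
        unfolding expo_def using kk sg2 by (intro sum.cong) (auto simp: power_mult_distrib)
      also have "... = sg * (l * NN) - \<sigma>^2 / 2 * (l^2 * VV)"
        unfolding cut NN_def VV_def by (simp add: sum_subtractf sum_distrib_left mult.assoc)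
      finally show ?thesis by (simp add: l_def)
    qed
    have VV0: "0 \<le> VV" by (simp add: VV_def sum_nonneg)
    have "VV \<le> (\<Sum>r\<in>{s1..<t}. ((real T + 1)\<^sup>2)\<^sup>2)"
      unfolding VV_def
    proof (rule sum_mono)
      fix r assume "r \<in> {s1..<t}"
      then have "\<bar>cc_at w (Suc r)\<bar> \<le> (real T + 1)\<^sup>2" using t by (intro cc_at_le[OF ws]) auto
      then have "\<bar>cc_at w (Suc r)\<bar>\<^sup>2 \<le> ((real T + 1)\<^sup>2)\<^sup>2" by (intro power_mono) auto
      then show "(cc_at w (Suc r))\<^sup>2 \<le> ((real T + 1)\<^sup>2)\<^sup>2" by simp
    qed
    also have "... = real (t - s1) * (real T + 1)^4" by (simp add: power_mult[symmetric])
    also have "... \<le> (real T + 1)\<^sup>2 * (real T + 1)^4"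
    proof (rule mult_right_mono)
      have "real (t - s1) \<le> (real T + 1) * 1" using t by simp
      also have "... \<le> (real T + 1) * (real T + 1)" by (intro mult_left_mono) auto
      finally show "real (t - s1) \<le> (real T + 1)\<^sup>2" by (simp add: power2_eq_square)
    qed simp
    also have "... = ((real T + 1)^3)\<^sup>2" by (simp add: power_add[symmetric] power_mult[symmetric])
    finally have "sqrt VV \<le> (real T + 1)^3" by (intro real_le_lsqrt) auto
    also have "... < (2 ^ Suc I)^3" using I1 by (intro power_strict_mono) auto
    also have "... = 2 ^ Suc J0"
    proof -
      have "(2 ^ Suc I)^3 = (2::real) ^ (Suc I * 3)" by (rule power_mult[symmetric])
      also have "Suc I * 3 = Suc J0" by (simp add: J0_def)
      finally show ?thesis .
    qed
    finally have sV: "sqrt VV < 2 ^ Suc J0" .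
    have "NN \<le> (\<sigma>^2 + 1) * (\<Gamma> * sqrt VV + \<Gamma>^2)"
      by (rule dyadic_linear_bound[OF G1 VV0 sV]) (use lin[of 1] in simp)
    moreover have "- NN \<le> (\<sigma>^2 + 1) * (\<Gamma> * sqrt VV + \<Gamma>^2)"
      by (rule dyadic_linear_bound[OF G1 VV0 sV]) (use lin[of "-1"] in simp)
    ultimately show "\<bar>\<Sum>r\<in>{s1..<t}. cc_at w (Suc r) * \<epsilon> (Suc r) w\<bar>
       \<le> (\<sigma>^2 + 1) * (\<Gamma> * sqrt (\<Sum>r\<in>{s1..<t}. (cc_at w (Suc r))\<^sup>2) + \<Gamma>^2)"
      unfolding NN_def VV_def by (rule abs_leI)
  qed
qed

end

section \<open>Large exploration parameter\<close>

lemma root4_ge_iff: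
  assumes "0 \<le> x" "x^4 \<le> real n" shows "x \<le> root4 n"
proof (rule power_le_imp_le_base)
  show "x ^ Suc 3 \<le> (root4 n) ^ Suc 3" using assms(2) root4_pow[of n] by (simp add: eval_nat_numeral)
qed (simp add: root4_def)

text \<open>This many multiples of \<beta>^2 rounds suffice in \<open>el_crude\<close> to reach the
  level 4 d K^2 \<beta>^2. The summand 1 / \<kappa>^2 guarantees that for \<beta> \<ge> \<kappa> the
  product with \<beta>^2 is at least 1, so rounding up costs at most a factor 2.\<close>

definition crude_const :: "real \<Rightarrow> real \<Rightarrow> real \<Rightarrow> real" where
  "crude_const d \<kappa> K = 2 * d^2 * (4 * d * K^2) * (1 + sqrt (4 * d * K^2))^4 + 1 / \<kappa>^2"

definition trace_const :: "real \<Rightarrow> real \<Rightarrow> real \<Rightarrow> real" where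
  "trace_const d \<kappa> K = 320 * d^2 * K + 6 * sqrt (crude_const d \<kappa> K)"

text \<open>The first summand plays the role of D1 in \<open>growth_after\<close>. The product with
  \<open>trace_const\<close> bounds B / el.\<close>

definition B_const :: "real \<Rightarrow> real \<Rightarrow> real \<Rightarrow> real" where
  "B_const d \<kappa> K = 3 * sqrt (2 * crude_const d \<kappa> K) + 4 * K^2 * trace_const d \<kappa> K"

lemma crude_const_pos: "0 \<le> d \<Longrightarrow> 0 < \<kappa> \<Longrightarrow> 1 / \<kappa>^2 \<le> crude_const d \<kappa> K"
  by (simp add: crude_const_def)

text \<open>Only polynomial growth in K matters: K depends on the net and hence logarithmically on
  J, and the comparison ratio must come out at most J.\<close>

lemma B_const_polynomial:
  assumes d: "1 \<le> d" and k: "0 < \<kappa>"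
  shows "\<exists>q>0. \<forall>K\<ge>1. B_const d \<kappa> K * trace_const d \<kappa> K \<le> q * K^8"
proof -
  define c where "c = sqrt (648 * d^7 + 1 / \<kappa>^2)"
  have c0: "0 \<le> c" using d by (simp add: c_def)
  have cc: "c^2 = 648 * d^7 + 1 / \<kappa>^2" using d by (simp add: c_def)
  define q where "q = (5 * c + 4 * (320 * d^2 + 6 * c)) * (320 * d^2 + 6 * c)"
  have d2: "1 \<le> d^2" using d by simp
  have q0: "0 < q" proof -
    have "0 < 320 * d^2 + 6 * c" using c0 d2 by argo
    moreover have "0 < 5 * c + 4 * (320 * d^2 + 6 * c)" using c0 d2 by argo
    ultimately show ?thesis unfolding q_def by (rule mult_pos_pos[rotated])
  qed
  have "B_const d \<kappa> K * trace_const d \<kappa> K \<le> q * K^8" if K: "1 \<le> K" for K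
  proof -
    have sd: "sqrt d \<le> d" using d real_le_lsqrt[of d d] by (simp add: power2_eq_square)
    have "sqrt (4 * d * K^2) = 2 * sqrt d * K" using K d by (simp add: real_sqrt_mult)
    also have "... \<le> 2 * d * K" using sd K by (intro mult_right_mono) auto
    finally have "1 + sqrt (4 * d * K^2) \<le> 3 * d * K" using mult_mono[OF d K] d by simp
    then have "(1 + sqrt (4 * d * K^2))^4 \<le> (3 * d * K)^4" using d by (intro power_mono) auto
    then have "crude_const d \<kappa> K \<le> 2 * d^2 * (4 * d * K^2) * (3 * d * K)^4 + 1 / \<kappa>^2"
      unfolding crude_const_def using d by (intro add_mono mult_left_mono) auto
    also have "... = 648 * d^7 * K^6 + 1 / \<kappa>^2 * 1" by (simp add: power_mult_distrib eval_nat_numeral)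
    also have "... \<le> 648 * d^7 * K^6 + 1 / \<kappa>^2 * K^6" using K k d by (intro add_mono mult_left_mono one_le_power) auto
    also have "... = (c * K^3)\<^sup>2" unfolding power_mult_distrib cc by (simp add: algebra_simps flip: power_mult)
    finally have cr: "crude_const d \<kappa> K \<le> (c * K^3)\<^sup>2" .
    have sq: "sqrt (crude_const d \<kappa> K) \<le> c * K^3" using cr c0 K by (intro real_le_lsqrt) auto
    have cp: "0 \<le> crude_const d \<kappa> K" using d by (simp add: crude_const_def)
    have s2: "3 * sqrt (2 * crude_const d \<kappa> K) \<le> 5 * (c * K^3)"
    proof -
      have "sqrt 2 \<le> 5 / (3::real)" by (intro real_le_lsqrt) (auto simp: power2_eq_square)
      then have "sqrt 2 * sqrt (crude_const d \<kappa> K) \<le> 5 / 3 * (c * K^3)" using sq cp c0 by (intro mult_mono) auto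
      then show ?thesis by (simp add: real_sqrt_mult)
    qed
    have K13: "K \<le> K^3" using K power_increasing[of 1 3 K] by simp
    have "320 * d^2 * K \<le> 320 * d^2 * K^3" using K13 by (intro mult_left_mono) auto
    then have A: "trace_const d \<kappa> K \<le> (320 * d^2 + 6 * c) * K^3"
      unfolding trace_const_def using sq by (simp add: algebra_simps)
    have A0: "0 \<le> trace_const d \<kappa> K" unfolding trace_const_def using cp K by simp
    have B0: "0 \<le> B_const d \<kappa> K" unfolding B_const_def using A0 cp by simp
    have "4 * K^2 * trace_const d \<kappa> K \<le> 4 * K^2 * ((320 * d^2 + 6 * c) * K^3)"
      using A by (intro mult_left_mono) auto
    moreover have "5 * (c * K^3) \<le> 5 * (c * K^5)" using c0 K by (intro mult_left_mono power_increasing) auto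
    ultimately have B: "B_const d \<kappa> K \<le> (5 * c + 4 * (320 * d^2 + 6 * c)) * K^5"
      unfolding B_const_def using s2 by (simp add: algebra_simps eval_nat_numeral)
    have "B_const d \<kappa> K * trace_const d \<kappa> K
        \<le> ((5 * c + 4 * (320 * d^2 + 6 * c)) * K^5) * ((320 * d^2 + 6 * c) * K^3)"
      using A B A0 B0 by (intro mult_mono) auto
    also have "... = q * K^8" by (simp add: q_def mult_ac flip: power_add)
    finally show ?thesis .
  qed
  then show ?thesis using q0 by blast
qed

text \<open>J determines the net size N, N the noise constant, this K, and K the ratio B / el, which
  must not exceed J. Since the noise constant is at most affine in ln J, the loop closes once J
  beats an eighth power of ln J.\<close>

lemma net_size_exists:
  fixes d :: nat and \<kappa> \<sigma> :: real
  assumes d: "1 \<le> d" and k: "0 < \<kappa>"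
  shows "\<exists>J\<ge>1. \<exists>N. 12 * sqrt (real d) * (2 + sqrt J) + 1 \<le> real N \<and>
    (let K = 2 + 2 * (2 * (1 + \<sigma>^2) * gamma_const d N + 1) / \<kappa>
     in B_const (real d) \<kappa> K * trace_const (real d) \<kappa> K \<le> J)"
proof -
  obtain q where q: "0 < q" "\<And>K. 1 \<le> K \<Longrightarrow> B_const (real d) \<kappa> K * trace_const (real d) \<kappa> K \<le> q * K^8"
    using B_const_polynomial[of "real d" \<kappa>] d k by auto
  define g where "g = ln 40 + 3 + (real d + 1) * ln (77 * real d)"
  define k1 where "k1 = 2 + 2 * (2 * (1 + \<sigma>^2) * g + 1) / \<kappa>"
  define k2 where "k2 = 2 * (2 * (1 + \<sigma>^2) * (real d + 1)) / \<kappa>"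
  have g0: "0 < g" using d by (simp add: g_def add_pos_nonneg)
  have k10: "0 < k1" "0 < k2" using g0 k d by (simp_all add: k1_def k2_def add_pos_nonneg add_nonneg_pos)
  have "\<forall>\<^sub>F J in at_top. q * (k1 + k2 * ln J)^8 \<le> (J::real)" using q(1) k10 by real_asymp
  then obtain J where J: "1 \<le> J" "q * (k1 + k2 * ln J)^8 \<le> J"
    using eventually_happens'[OF trivial_limit_at_top_linorder eventually_conj[OF eventually_ge_at_top[of "1::real"]]] by blast
  define N where "N = nat \<lceil>12 * sqrt (real d) * (2 + sqrt J) + 1\<rceil>"
  have N1: "12 * sqrt (real d) * (2 + sqrt J) + 1 \<le> real N" unfolding N_def by linarith
  have sJ: "1 \<le> sqrt J" "sqrt J \<le> J" using J(1) real_le_lsqrt[of J J] by (auto simp: power2_eq_square)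
  have sd: "1 \<le> sqrt (real d)" "sqrt (real d) \<le> real d" using d real_le_lsqrt[of "real d" "real d"] by (auto simp: power2_eq_square)
  \<comment> \<open>N \<le> 36 d J + 2, so 2 N + 1 \<le> 72 d J + 5, and d J \<ge> 1 absorbs the
    5.\<close>
  have N2: "2 * real N + 1 \<le> 77 * real d * J"
  proof -
    have "0 \<le> 12 * sqrt (real d) * (2 + sqrt J)" using sd sJ by simp
    then have "real N \<le> 12 * sqrt (real d) * (2 + sqrt J) + 2" unfolding N_def by linarith
    also have "12 * sqrt (real d) * (2 + sqrt J) \<le> 12 * real d * (3 * J)" using sd sJ J(1) by (intro mult_mono) auto
    finally have "real N \<le> 36 * (real d * J) + 2" by simp
    moreover have "1 \<le> real d * J" using mult_mono[of 1 "real d" 1 J] d J(1) by simp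
    ultimately show ?thesis by simp
  qed
  have gam: "gamma_const d N \<le> g + (real d + 1) * ln J"
  proof -
    have lnN: "ln (2 * real N + 1) \<le> ln (77 * real d) + ln J"
    proof -
      have "ln (2 * real N + 1) \<le> ln (77 * real d * J)" using N2 by (subst ln_le_cancel_iff) (use d J in auto)
      also have "... = ln (77 * real d) + ln J" using d J by (intro ln_mult_pos) auto
      finally show ?thesis .
    qed
    \<comment> \<open>Being at least 1, the constant is below its square, which removes the square
      root at no relevant cost.\<close>
    have "gamma_const d N \<le> gamma_const d N * gamma_const d N"
      using mult_right_mono[OF gamma_const_ge_one[of d N], of "gamma_const d N"] gamma_const_ge_one[of d N] by simp
    also have "... = ln (40 * real (2 * N + 1) ^ Suc d) + 3"
      using ln_40_ge[of N d] by (simp add: gamma_const_def)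
    also have "ln (40 * real (2 * N + 1) ^ Suc d) = ln 40 + real (Suc d) * ln (real (2 * N + 1))"
      by (subst ln_mult_pos) (auto intro: zero_less_power simp del: power_Suc simp: ln_realpow)
    also have "real (Suc d) * ln (real (2 * N + 1)) \<le> (real d + 1) * (ln (77 * real d) + ln J)"
    proof -
      have "real (Suc d) = real d + 1" "real (2 * N + 1) = 2 * real N + 1" by simp_all
      then show ?thesis using mult_left_mono[OF lnN, of "real d + 1"] by (simp only:)
    qed
    finally show ?thesis by (simp add: g_def algebra_simps)
  qed
  define K where "K = 2 + 2 * (2 * (1 + \<sigma>^2) * gamma_const d N + 1) / \<kappa>"
  have K1: "1 \<le> K" using gamma_const_ge_one[of d N] k by (simp add: K_def)
  have "K \<le> 2 + 2 * (2 * (1 + \<sigma>^2) * (g + (real d + 1) * ln J) + 1) / \<kappa>"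
    unfolding K_def using gam k by (intro add_left_mono divide_right_mono mult_left_mono add_right_mono) auto
  also have "... = k1 + k2 * ln J" using k by (simp add: k1_def k2_def field_simps)
  finally have "K^8 \<le> (k1 + k2 * ln J)^8" using K1 by (intro power_mono) auto
  then have "q * K^8 \<le> J" using J(2) mult_left_mono[of "K^8" "(k1 + k2 * ln J)^8" q] q(1) by linarith
  then have "B_const (real d) \<kappa> K * trace_const (real d) \<kappa> K \<le> J" using q(2)[OF K1] by linarith
  then show ?thesis using J(1) N1 unfolding K_def Let_def by blast
qed

context ucb_path
begin

text \<open>Checks the start conditions of \<open>growth_after\<close> at s0 of order \<beta>^2.
  They fit together because sqrt s0 is then comparable to \<beta>, and \<open>trace_const\<close>
  contains a multiple of the root of \<open>crude_const\<close>.\<close>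

lemma crude_start:
  fixes \<kappa> K :: real
  defines "d \<equiv> real CARD('d)"
  defines "C0 \<equiv> crude_const d \<kappa> K" and "A \<equiv> trace_const d \<kappa> K"
  defines "s0 \<equiv> nat \<lceil>C0 * \<beta>^2\<rceil>"
  assumes k0: "0 < \<kappa>" and kb: "\<kappa> \<le> \<beta>" and K2: "2 \<le> K"
  shows "C0 * \<beta>^2 \<le> real s0" "real s0 \<le> 2 * C0 * \<beta>^2" "1 \<le> s0"
    "s0 \<le> T \<Longrightarrow> 4 * real CARD('d) * K^2 * \<beta>^2 \<le> el s0"
    "2 + real s0 \<le> 3 * sqrt (2 * C0) * \<beta> * sqrt (real s0)"
    "sqrt (3 * real s0) \<le> 4 * K^2 * \<beta> * A"
    "real s0 + 1 \<le> sqrt (A * \<beta>) * (sqrt (real s0) * sqrt (sqrt (real s0)))"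
    "8 * real CARD('d) \<le> A" "320 * (real CARD('d))\<^sup>2 * K \<le> A"
proof -
  have d1: "1 \<le> d" by (simp add: d_def)
  have C0k: "1 / \<kappa>^2 \<le> C0" unfolding C0_def using d1 k0 by (intro crude_const_pos) auto
  have C0p: "0 < C0" using C0k k0 by (smt (verit) zero_less_divide_1_iff zero_less_power)
  have A0: "0 < A" unfolding A_def trace_const_def using d1 K2 C0p by (simp add: C0_def add_pos_nonneg)
  have b0: "0 < \<beta>" by (rule b_pos)
  have kb2: "\<kappa>^2 \<le> \<beta>^2" using kb k0 by (intro power_mono) auto
  have C0b: "1 \<le> C0 * \<beta>^2"
  proof -
    have "1 = 1 / \<kappa>^2 * \<kappa>^2" using k0 by simp
    also have "... \<le> C0 * \<beta>^2" using C0k kb2 C0p by (intro mult_mono) auto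
    finally show ?thesis .
  qed
  have s0ge: "C0 * \<beta>^2 \<le> real s0" unfolding s0_def by linarith
  have s0le: "real s0 \<le> 2 * C0 * \<beta>^2" using C0b unfolding s0_def by linarith
  have s01: "1 \<le> s0" using C0b s0ge by linarith
  have A1: "8 * real CARD('d) \<le> A" "320 * (real CARD('d))\<^sup>2 * K \<le> A"
  proof -
    show "320 * (real CARD('d))\<^sup>2 * K \<le> A"
      using C0p unfolding A_def trace_const_def C0_def d_def by simp
    moreover have "8 * d * 1 \<le> 320 * d^2 * K"
      using d1 K2 by (intro mult_mono) (auto simp: power2_eq_square)
    ultimately show "8 * real CARD('d) \<le> A" unfolding d_def by linarith
  qed
  have rs0: "sqrt (real s0) \<le> sqrt (2 * C0) * \<beta>"
  proof -
    have "sqrt (real s0) \<le> sqrt (2 * C0 * \<beta>^2)" using s0le by simp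
    then show ?thesis using b0 by (simp add: real_sqrt_mult)
  qed
  have s0c: "4 * real CARD('d) * K^2 * \<beta>^2 \<le> el s0" if "s0 \<le> T"
  proof (rule el_crude[OF _ that])
    have "1 * 1 \<le> (4 * d) * K^2" using d1 K2 by (intro mult_mono one_le_power) auto
    then show "1 \<le> 4 * real CARD('d) * K^2" by (simp add: d_def)
    have "2 * (real CARD('d))\<^sup>2 * (4 * real CARD('d) * K^2) * (1 + sqrt (4 * real CARD('d) * K^2)) ^ 4 * \<beta>^2
        \<le> C0 * \<beta>^2" by (intro mult_right_mono) (simp_all add: C0_def crude_const_def d_def)
    then show "2 * (real CARD('d))\<^sup>2 * (4 * real CARD('d) * K^2) * (1 + sqrt (4 * real CARD('d) * K^2)) ^ 4 * \<beta>^2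
        \<le> real s0" using s0ge by linarith
  qed
  have s0d: "2 + real s0 \<le> 3 * sqrt (2 * C0) * \<beta> * sqrt (real s0)"
  proof -
    have "2 + real s0 \<le> 3 * (sqrt (real s0) * sqrt (real s0))" using s01 by simp
    also have "... \<le> 3 * ((sqrt (2 * C0) * \<beta>) * sqrt (real s0))" using rs0 by (intro mult_left_mono mult_right_mono) auto
    finally show ?thesis by simp
  qed
  have A6: "6 * sqrt C0 \<le> A" using d1 K2 unfolding A_def trace_const_def C0_def by simp
  have s0e: "sqrt (3 * real s0) \<le> 4 * K^2 * \<beta> * A"
  proof -
    have "sqrt (3 * real s0) \<le> sqrt (36 * C0 * \<beta>^2)" using s0le C0p b0 by simp
    also have "... = 6 * sqrt C0 * \<beta>" using b0 by (simp add: real_sqrt_mult)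
    also have "... \<le> (4 * K^2) * (A * \<beta>)"
    proof -
      have "1 * (6 * sqrt C0 * \<beta>) \<le> (4 * K^2) * (A * \<beta>)"
      proof (intro mult_mono)
        have "1 \<le> K^2" using K2 by (intro one_le_power) simp
        then show "1 \<le> 4 * K^2" by simp
      qed (use A0 A6 b0 C0p in auto)
      then show ?thesis by simp
    qed
    finally show ?thesis by (simp add: mult_ac)
  qed
  have s0f: "real s0 + 1 \<le> sqrt (A * \<beta>) * (sqrt (real s0) * sqrt (sqrt (real s0)))"
  proof -
    have "2 * root4 s0 \<le> sqrt (A * \<beta>)"
    proof (rule real_le_rsqrt)
      have r4: "(root4 s0)\<^sup>2 = sqrt (real s0)" by (simp add: root4_def)
      have "sqrt 2 \<le> 3 / (2::real)" by (intro real_le_lsqrt) (auto simp: power2_eq_square)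
      then have "sqrt 2 * sqrt C0 \<le> 3 / 2 * sqrt C0" using C0p by (intro mult_right_mono) auto
      then have "4 * sqrt (2 * C0) \<le> A" using A6 by (simp add: real_sqrt_mult)
      then have "4 * sqrt (2 * C0) * \<beta> \<le> A * \<beta>" using b0 by (intro mult_right_mono) auto
      then have "4 * sqrt (real s0) \<le> A * \<beta>" using rs0 by simp
      then show "(2 * root4 s0)\<^sup>2 \<le> A * \<beta>" by (simp add: power_mult_distrib r4)
    qed
    then have "2 * root4 s0 * (sqrt (real s0) * root4 s0) \<le> sqrt (A * \<beta>) * (sqrt (real s0) * root4 s0)"
      by (intro mult_right_mono) (auto simp: root4_def)
    moreover have "2 * root4 s0 * (sqrt (real s0) * root4 s0) = 2 * real s0"
      by (simp add: root4_def power2_eq_square[symmetric] mult_ac)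
    moreover have "1 \<le> real s0" using s01 by simp
    ultimately show ?thesis unfolding root4_def by linarith
  qed
  show "C0 * \<beta>^2 \<le> real s0" "real s0 \<le> 2 * C0 * \<beta>^2" "1 \<le> s0"
    "s0 \<le> T \<Longrightarrow> 4 * real CARD('d) * K^2 * \<beta>^2 \<le> el s0"
    "2 + real s0 \<le> 3 * sqrt (2 * C0) * \<beta> * sqrt (real s0)"
    "sqrt (3 * real s0) \<le> 4 * K^2 * \<beta> * A"
    "real s0 + 1 \<le> sqrt (A * \<beta>) * (sqrt (real s0) * sqrt (sqrt (real s0)))"
    "8 * real CARD('d) \<le> A" "320 * (real CARD('d))\<^sup>2 * K \<le> A"
    by (rule s0ge s0le s01 s0c s0d s0e s0f A1; assumption?)+
qed

text \<open>Three times: s0 of order \<beta>^2 starts the growth estimates, s1 of order \<beta>^4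
  the Lyapunov argument, and t of order \<beta>^8 is where the initial value has died out. Lower
  powers of \<beta> are raised to higher ones by \<kappa> \<le> \<beta>.\<close>

lemma noise_regime_path:
  fixes S Cn \<kappa> L J :: real
  defines "d \<equiv> real CARD('d)"
  defines "K \<equiv> 2 + 2 * (S + 1) / \<kappa>"
  defines "A \<equiv> trace_const d \<kappa> K" and "D \<equiv> B_const d \<kappa> K" and "C0 \<equiv> crude_const d \<kappa> K"
  defines "C \<equiv> 2 + A + K * sqrt A + (2 + 8 * K) * sqrt A + (S + 1) + (S + 1) * sqrt A + 1 / \<kappa> + Cn"
  defines "C1 \<equiv> (8 * C^2 / sqrt \<kappa> + 1 + 2 / \<kappa>)^4 + 6 * C0 / \<kappa>^2"
  defines "s1 \<equiv> nat \<lceil>C1 * \<beta>^4\<rceil>"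
  assumes d2: "2 \<le> CARD('d)" and nrm: "normalised e" and k0: "0 < \<kappa>" and S0: "0 \<le> S" and Cn0: "0 \<le> Cn"
    and L: "1 \<le> L" "\<kappa> * L \<le> \<beta>" and J: "D * A \<le> J"
    and noise: "\<And>r. r \<le> T \<Longrightarrow> B r \<le> J * el r \<Longrightarrow> seminorm_of (G r) (SS e r) \<le> S * L"
    and HN: "\<And>t. s1 \<le> t \<Longrightarrow> t \<le> T \<Longrightarrow> \<bar>\<Sum>r\<in>{s1..<t}. cc (Suc r) * e (Suc r)\<bar>
      \<le> Cn * (L * sqrt (\<Sum>r\<in>{s1..<t}. (cc (Suc r))\<^sup>2) + L^2)"
    and t: "t \<le> T" "(2 * C1 * (1 + 1 / \<kappa>^4) + 16 * D^2 / \<kappa>^6) * \<beta>^8 \<le> real t"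
    and lead: "unit_leading_eigenvector (Lam t) v" and v: "0 \<le> v \<bullet> th"
  shows "norm (v - th) \<le> (600000 * C^6 * sqrt D + 2 * (S + 1)) * L / sqrt (el t)"
    and "norm (v - hh t) \<le> (600000 * C^6 * sqrt D + 2 * (S + 1)) * L / sqrt (el t)"
proof -
  define b where "b = sqrt \<beta>"
  have d1: "1 \<le> d" by (simp add: d_def)
  have K2: "2 \<le> K" using S0 k0 by (simp add: K_def)
  have C0k: "1 / \<kappa>^2 \<le> C0" unfolding C0_def using d1 k0 by (intro crude_const_pos) auto
  have C0p: "0 < C0" using C0k k0 by (smt (verit) zero_less_divide_1_iff zero_less_power)
  have A0: "0 < A" unfolding A_def trace_const_def using d1 K2 C0p by (simp add: C0_def add_pos_nonneg)
  have kb: "\<kappa> \<le> \<beta>" using mult_left_mono[OF L(1), of \<kappa>] k0 L(2) by linarith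
  have b0: "0 < \<beta>" using kb k0 by simp
  have bb: "0 < b" "b^2 = \<beta>" using b0 by (simp_all add: b_def)
  have one_bk: "1 \<le> \<beta> / \<kappa>" using kb k0 by simp
  have C2: "2 \<le> C" unfolding C_def using A0 K2 S0 Cn0 k0 by simp
  \<comment> \<open>Its three summands, multiplied by \<beta>, dominate the three lower bounds that
    \<open>m_bound\<close> puts on the fourth root of s1.\<close>
  define q1 where "q1 = 8 * C^2 / sqrt \<kappa> + 1 + 2 / \<kappa>"
  have q10: "0 < q1" unfolding q1_def using k0 by (intro add_pos_pos add_nonneg_pos) auto
  have C1': "C1 = q1^4 + 6 * C0 / \<kappa>^2" by (simp add: C1_def q1_def)
  have C1p: "0 < C1" unfolding C1' using q10 C0p k0 by (intro add_pos_pos) auto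
  have s1ge: "C1 * \<beta>^4 \<le> real s1" unfolding s1_def by linarith
  have s1q: "q1 * \<beta> \<le> root4 s1"
  proof (rule root4_ge_iff)
    have "(q1 * \<beta>)^4 \<le> C1 * \<beta>^4" unfolding C1' using C0p k0 by (simp add: power_mult_distrib distrib_right)
    then show "(q1 * \<beta>)^4 \<le> real s1" using s1ge by linarith
  qed (use q10 b0 in auto)
  have q1b: "q1 * \<beta> = 8 * C^2 * (\<beta> / sqrt \<kappa>) + \<beta> + 2 * (\<beta> / \<kappa>)" by (simp add: q1_def algebra_simps)
  have bk: "b \<le> \<beta> / sqrt \<kappa>"
  proof -
    have "b * sqrt \<kappa> \<le> b * b" using kb bb by (intro mult_left_mono) (auto simp: b_def)
    then show ?thesis using bb k0 by (simp add: power2_eq_square[symmetric] le_divide_eq)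
  qed
  have s1a: "8 * C^2 * b \<le> root4 s1"
  proof -
    have "8 * C^2 * b \<le> 8 * C^2 * (\<beta> / sqrt \<kappa>)" using bk by (intro mult_left_mono) auto
    then show ?thesis using s1q one_bk b0 unfolding q1b by linarith
  qed
  have s1bc: "\<beta> \<le> root4 s1" "2 \<le> root4 s1"
  proof -
    have "0 \<le> 8 * C^2 * (\<beta> / sqrt \<kappa>)" using b0 k0 by simp
    then show "\<beta> \<le> root4 s1" "2 \<le> root4 s1" using s1q one_bk b0 unfolding q1b by linarith+
  qed
  have s11: "1 \<le> s1" using s1bc(2) by (cases s1) (auto simp: root4_def)
  have s1le: "real s1 \<le> 2 * C1 * \<beta>^4"
  proof -
    have "1 \<le> (q1 * \<beta>)^4"
    proof (rule one_le_power)
      have "0 \<le> 8 * C^2 * (\<beta> / sqrt \<kappa>)" using b0 k0 by simp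
      then show "1 \<le> q1 * \<beta>" unfolding q1b using one_bk b0 by linarith
    qed
    also have "... \<le> C1 * \<beta>^4" unfolding C1' using C0p k0 by (simp add: power_mult_distrib distrib_right)
    finally have "1 \<le> C1 * \<beta>^4" .
    then have "real s1 \<le> C1 * \<beta>^4 + 1" unfolding s1_def by linarith
    then show ?thesis using \<open>1 \<le> C1 * \<beta>^4\<close> by simp
  qed
  define s0 where "s0 = nat \<lceil>C0 * \<beta>^2\<rceil>"
  have kb2: "\<kappa>^2 \<le> \<beta>^2" using kb k0 by (intro power_mono) auto
  have cs: "C0 * \<beta>^2 \<le> real s0" "real s0 \<le> 2 * C0 * \<beta>^2" "1 \<le> s0"
    "s0 \<le> T \<Longrightarrow> 4 * real CARD('d) * K^2 * \<beta>^2 \<le> el s0"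
    "2 + real s0 \<le> 3 * sqrt (2 * C0) * \<beta> * sqrt (real s0)"
    "sqrt (3 * real s0) \<le> 4 * K^2 * \<beta> * A"
    "real s0 + 1 \<le> sqrt (A * \<beta>) * (sqrt (real s0) * sqrt (sqrt (real s0)))"
    "8 * real CARD('d) \<le> A" "320 * (real CARD('d))\<^sup>2 * K \<le> A"
    unfolding s0_def C0_def A_def d_def by (rule crude_start[OF k0 kb K2]; assumption?)+
  note s0le = cs(2) and s01 = cs(3)
  have s0s1: "3 * s0 \<le> s1"
  proof -
    have "3 * real s0 \<le> 6 * C0 * \<beta>^2" using s0le by simp
    also have "... = 6 * C0 / \<kappa>^2 * (\<kappa>^2 * \<beta>^2)" using k0 by simp
    also have "... \<le> 6 * C0 / \<kappa>^2 * (\<beta>^2 * \<beta>^2)" using kb2 C0p by (intro mult_left_mono mult_right_mono) auto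
    also have "... \<le> C1 * \<beta>^4" unfolding C1' using q10 by (simp add: distrib_right flip: power_add)
    also have "... \<le> real s1" by (rule s1ge)
    finally show ?thesis by linarith
  qed
  have k8: "\<kappa>^4 * \<beta>^4 \<le> \<beta>^8" "\<kappa>^6 * \<beta>^2 \<le> \<beta>^8"
  proof -
    have "\<kappa>^4 * \<beta>^4 \<le> \<beta>^4 * \<beta>^4" "\<kappa>^6 * \<beta>^2 \<le> \<beta>^6 * \<beta>^2"
      using kb k0 b0 by (intro mult_right_mono power_mono; simp)+
    then show "\<kappa>^4 * \<beta>^4 \<le> \<beta>^8" "\<kappa>^6 * \<beta>^2 \<le> \<beta>^8" by (simp_all flip: power_add)
  qed
  \<comment> \<open>In order, the summands secure \<beta>^4 s1 \<le> t, s1 \<le> t, and 4 D \<beta>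
    \<le> sqrt t. The last one makes B at most p/2.\<close>
  have tb: "2 * C1 * \<beta>^8 + 2 * C1 / \<kappa>^4 * \<beta>^8 + 16 * D^2 / \<kappa>^6 * \<beta>^8 \<le> real t"
    using t(2) by (simp add: algebra_simps add_divide_distrib)
  have tpos: "0 \<le> 2 * C1 * \<beta>^8" "0 \<le> 2 * C1 / \<kappa>^4 * \<beta>^8" "0 \<le> 16 * D^2 / \<kappa>^6 * \<beta>^8"
    using C1p k0 b0 by simp_all
  have ts1: "s1 \<le> t"
  proof -
    have "real s1 \<le> 2 * C1 / \<kappa>^4 * (\<kappa>^4 * \<beta>^4)" using s1le k0 by simp
    also have "... \<le> 2 * C1 / \<kappa>^4 * \<beta>^8" using k8(1) C1p by (intro mult_left_mono) auto
    finally show ?thesis using tb tpos by linarith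
  qed
  have t8: "\<beta>^4 * real s1 \<le> real t"
  proof -
    have "\<beta>^4 * real s1 \<le> \<beta>^4 * (2 * C1 * \<beta>^4)" using s1le b0 by (intro mult_left_mono) auto
    also have "... = 2 * C1 * \<beta>^8" by (simp flip: power_add)
    finally show ?thesis using tb tpos by linarith
  qed
  have tD: "4 * D * \<beta> \<le> sqrt (real t)"
  proof (rule real_le_rsqrt)
    have "(4 * D * \<beta>)\<^sup>2 = 16 * D^2 / \<kappa>^6 * (\<kappa>^6 * \<beta>^2)" using k0 by (simp add: power_mult_distrib)
    also have "... \<le> 16 * D^2 / \<kappa>^6 * \<beta>^8" using k8(2) by (intro mult_left_mono) auto
    finally show "(4 * D * \<beta>)\<^sup>2 \<le> real t" using tb tpos by linarith
  qed
  have sL: "S * L + 1 \<le> (S + 1) * L" using L(1) by (simp add: algebra_simps)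
  have Cs: "0 \<le> S * L" "2 * (S * L + 1) \<le> (K - 2) * \<beta>"
  proof -
    have "(S + 1) * L \<le> (S + 1) * (\<beta> / \<kappa>)" using L(2) k0 S0 by (intro mult_left_mono) (auto simp: le_divide_eq mult.commute)
    moreover have "(K - 2) * \<beta> = 2 * ((S + 1) * (\<beta> / \<kappa>))" by (simp add: K_def)
    ultimately show "2 * (S * L + 1) \<le> (K - 2) * \<beta>" using sL by argo
  qed (use S0 L in auto)
  have D': "3 * sqrt (2 * C0) + 4 * K^2 * A = D" by (simp add: D_def B_const_def C0_def A_def)
  have s0T: "s0 \<le> T" using s0s1 ts1 t(1) by linarith
  note ng = noise_growth[OF nrm noise Cs K2 cs(8,9) s01 cs(4)[OF s0T] cs(5,6,7) J[folded D'], unfolded D', simplified True_implies_equals implies_True_equals triv_forall_equality]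
  have r1: "1 / (b * root4 r) = 1 / sqrt (\<beta> * sqrt (real r))" for r by (simp add: b_def root4_def real_sqrt_mult)
  have tau: "ta r \<le> A * (1 / (b * root4 r))\<^sup>2" if "s1 \<le> r" "r \<le> T" for r
  proof -
    have "ta r * \<beta> * sqrt (real r) \<le> A" using ng(1)[of r] that s0s1 by simp
    moreover have "0 < \<beta> * sqrt (real r)" using b0 that s11 by simp
    ultimately have "ta r \<le> A / (\<beta> * sqrt (real r))" by (simp add: le_divide_eq mult.assoc)
    then show ?thesis using b0 by (simp add: r1 power_divide)
  qed
  have rp: "0 < b * root4 r" if "s1 \<le> r" for r using bb root4_pos[of r] that s11 by simp
  have stau: "sqrt (ta r) \<le> sqrt A * (1 / (b * root4 r))" if "s1 \<le> r" "r \<le> T" for r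
    using real_sqrt_le_mono[OF tau[OF that]] rp[OF that(1)] A0 by (simp add: real_sqrt_mult real_sqrt_divide)
  have bob: "\<beta> * (1 / (b * root4 r)) = b / root4 r" for r using bb by (simp add: bb(2)[symmetric] power2_eq_square)
  have CC: "A \<le> C" "K * sqrt A \<le> C" "(2 + 8 * K) * sqrt A \<le> C" "S + 1 \<le> C" "(S + 1) * sqrt A \<le> C" "1 / \<kappa> \<le> C" "Cn \<le> C"
  proof -
    have "0 \<le> A" "0 \<le> K * sqrt A" "0 \<le> (2 + 8 * K) * sqrt A" "0 \<le> S + 1" "0 \<le> (S + 1) * sqrt A" "0 \<le> 1 / \<kappa>"
      using A0 K2 S0 k0 by simp_all
    then show "A \<le> C" "K * sqrt A \<le> C" "(2 + 8 * K) * sqrt A \<le> C" "S + 1 \<le> C" "(S + 1) * sqrt A \<le> C" "1 / \<kappa> \<le> C" "Cn \<le> C"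
      unfolding C_def using Cn0 by linarith+
  qed
  have sn: "seminorm_of (G r) (SS e r) \<le> S * L" if "s0 \<le> r" "r \<le> T" for r
    using noise[OF that(2) ng(3)[OF that]] .
  have hd: "norm (rd e r - th) \<le> (S * L + 1) / sqrt (el r)" "norm (hh r - th) \<le> 2 * (S * L + 1) / sqrt (el r)"
    "hh r = (1 / norm (rd e r)) *\<^sub>R rd e r" if "s0 \<le> r" "r \<le> T" for r
    using hh_dist[OF nrm that(2) sn[OF that] ng(4)[OF that] Cs(1)] by blast+
  have m_t: "norm (m t) \<le> 100000 * C^6 * (L + \<beta> * root4 s1 / root4 t) * (1 / (sqrt \<beta> * root4 t))"
  proof (rule m_bound[OF C2 L(1) _ s11 s1a[unfolded b_def] s1bc, of e])
    have "L \<le> 1 / \<kappa> * \<beta>" using L(2) k0 by (simp add: le_divide_eq mult.commute)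
    also have "... \<le> C * \<beta>" using CC(6) b0 by (intro mult_right_mono) auto
    finally show "L \<le> C * \<beta>" .
    fix r assume r: "s1 \<le> r"
    have s0r: "s0 \<le> r" "3 * s0 \<le> r" using r s0s1 by linarith+
    have b4: "0 \<le> b / root4 r" "0 \<le> 1 / (b * root4 r)" using bb root4_pos[of r] r s11 by simp_all
    { assume rT: "r \<le> T"
      show "ta r \<le> C * (1 / (sqrt \<beta> * root4 r))\<^sup>2"
        using tau[OF r rT] mult_right_mono[OF CC(1), of "(1 / (b * root4 r))\<^sup>2"] by (simp add: b_def)
      show "norm (m r) \<le> C * (sqrt \<beta> / root4 r)"
      proof -
        have "norm (m r) \<le> (2 + 8 * K) * sqrt (A * \<beta>) / sqrt (sqrt (real r))"
          using ng(7)[of r] s0r rT by simp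
        also have "... = ((2 + 8 * K) * sqrt A) * (b / root4 r)" by (simp add: b_def root4_def real_sqrt_mult)
        also have "... \<le> C * (b / root4 r)" using CC(3) b4 by (intro mult_right_mono) auto
        finally show ?thesis by (simp add: b_def)
      qed
      show "real r / 2 \<le> p r" using ng(6)[of r] s0r rT by simp
      show "seminorm_of (G r) (SS e r - th) \<le> C * L"
        using nG_SS_th[of r e] sn[OF s0r(1) rT] sL mult_right_mono[OF CC(4), of L] L(1) by linarith
      show "norm (rd e r - th) \<le> C * L * (1 / (sqrt \<beta> * root4 r))"
      proof -
        have "norm (rd e r - th) \<le> (S * L + 1) * (1 / sqrt (el r))" using hd(1)[OF s0r(1) rT] by simp
        also have "... \<le> ((S + 1) * L) * (sqrt A * (1 / (b * root4 r)))"
          using sL Cs(1) inverse_sqrt_el_le[of r] stau[OF r rT] D.ell_pos[of r] S0 L(1) by (intro mult_mono) auto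
        also have "... = ((S + 1) * sqrt A) * (L * (1 / (b * root4 r)))" by simp
        also have "... \<le> C * (L * (1 / (b * root4 r)))" using CC(5) b4 L(1) by (intro mult_right_mono mult_nonneg_nonneg) auto
        finally show ?thesis by (simp add: b_def)
      qed
      show "hh r = (1 / norm (rd e r)) *\<^sub>R rd e r" by (rule hd(3)[OF s0r(1) rT])
      show "\<bar>\<Sum>r\<in>{s1..<r}. cc (Suc r) * e (Suc r)\<bar> \<le> C * (L * sqrt (\<Sum>r\<in>{s1..<r}. (cc (Suc r))\<^sup>2) + L^2)"
      proof -
        have "Cn * (L * sqrt (\<Sum>r\<in>{s1..<r}. (cc (Suc r))\<^sup>2) + L^2) \<le> C * (L * sqrt (\<Sum>r\<in>{s1..<r}. (cc (Suc r))\<^sup>2) + L^2)"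
          using CC(7) L(1) by (intro mult_right_mono add_nonneg_nonneg mult_nonneg_nonneg) (auto intro: sum_nonneg)
        then show ?thesis using HN[OF r rT] by linarith
      qed
    }
    show "norm (a (Suc r) - th) \<le> C * (sqrt \<beta> / root4 r)" if "r < T"
    proof -
      have "norm (a (Suc r) - th) \<le> K * \<beta> * sqrt (ta r)" using ng(5)[of r] s0r that by simp
      also have "... \<le> K * \<beta> * (sqrt A * (1 / (b * root4 r)))" using stau[OF r] that K2 b0 by (intro mult_left_mono) auto
      also have "... = (K * sqrt A) * (\<beta> * (1 / (b * root4 r)))" by (simp only: mult_ac)
      also have "... = (K * sqrt A) * (b / root4 r)" unfolding bob ..
      also have "... \<le> C * (b / root4 r)" using CC(2) b4 by (intro mult_right_mono) auto
      finally show ?thesis by (simp add: b_def)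
    qed
  qed (use ts1 t(1) in auto)
  have r4t: "1 \<le> root4 t" using root4_pos[of t] s11 ts1 by simp
  have "\<beta> * root4 s1 \<le> root4 t"
  proof (rule root4_ge_iff)
    show "(\<beta> * root4 s1)^4 \<le> real t" using t8 by (simp add: power_mult_distrib root4_pow)
  qed (use b0 s1bc in auto)
  then have "\<beta> * root4 s1 / root4 t \<le> 1" using r4t by (simp add: divide_le_eq)
  then have Lb: "L + \<beta> * root4 s1 / root4 t \<le> 2 * L" using L(1) by linarith
  have tT: "s0 \<le> t" "3 * s0 \<le> t" using s0s1 ts1 by linarith+
  have Bt: "B t \<le> D * \<beta> * sqrt (real t)" using ng(2)[OF tT(1) t(1)] by simp
  have Bp: "B t \<le> p t / 2"
  proof -
    have "4 * D * \<beta> * sqrt (real t) \<le> sqrt (real t) * sqrt (real t)" using tD by (intro mult_right_mono) auto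
    then have "4 * (D * \<beta> * sqrt (real t)) \<le> real t" by simp
    moreover have "real t / 2 \<le> p t" using ng(6)[of t] tT t(1) by simp
    ultimately show ?thesis using Bt by linarith
  qed
  \<comment> \<open>The claim is stated with the actual least eigenvalue; the upper bound on B,
    which dominates el, converts the deterministic scale into it.\<close>
  have elb: "1 / (sqrt \<beta> * root4 t) \<le> sqrt D / sqrt (el t)"
  proof -
    have "el t \<le> D * \<beta> * sqrt (real t)" using el_le_B[OF d2, of t] Bt by linarith
    then have "sqrt (el t) \<le> sqrt D * (sqrt \<beta> * root4 t)"
      using real_sqrt_le_mono by (fastforce simp: real_sqrt_mult root4_def mult.assoc)
    moreover have "0 < sqrt \<beta> * root4 t" "0 < sqrt (el t)" using b0 r4t D.ell_pos[of t] by simp_all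
    ultimately show ?thesis by (simp add: field_simps)
  qed
  have "norm (m t) \<le> 100000 * C^6 * (2 * L) * (sqrt D / sqrt (el t))"
  proof (rule order_trans[OF m_t], rule mult_mono)
    show "100000 * C^6 * (L + \<beta> * root4 s1 / root4 t) \<le> 100000 * C^6 * (2 * L)"
      using Lb C2 by (intro mult_left_mono) auto
  qed (use elb C2 L(1) r4t b0 in auto)
  moreover have "3 * (100000 * C^6 * (2 * L) * (sqrt D / sqrt (el t))) = (600000 * C^6 * sqrt D) * L / sqrt (el t)"
    by (simp add: mult_ac)
  ultimately have mt: "3 * norm (m t) \<le> (600000 * C^6 * sqrt D) * L / sqrt (el t)" by linarith
  have v1: "norm (v - th) \<le> (600000 * C^6 * sqrt D) * L / sqrt (el t)"
    using leading_eigenvector_dist[OF lead v Bp] mt by linarith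
  have "2 * (S * L + 1) / sqrt (el t) \<le> 2 * ((S + 1) * L) / sqrt (el t)"
    using sL D.ell_pos[of t] by (intro divide_right_mono mult_left_mono) auto
  then have h1: "norm (hh t - th) \<le> (2 * (S + 1)) * L / sqrt (el t)"
    using order_trans[OF hd(2)[OF tT(1) t(1)]] by (simp only: mult.assoc)
  have eq: "(600000 * C^6 * sqrt D + 2 * (S + 1)) * L / sqrt (el t) =
     (600000 * C^6 * sqrt D) * L / sqrt (el t) + (2 * (S + 1)) * L / sqrt (el t)"
    by (simp add: distrib_right add_divide_distrib)
  have "0 \<le> (2 * (S + 1)) * L / sqrt (el t)" using S0 L(1) D.ell_pos[of t] by simp
  then show "norm (v - th) \<le> (600000 * C^6 * sqrt D + 2 * (S + 1)) * L / sqrt (el t)"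
    unfolding eq using v1 by linarith
  have "norm (v - hh t) \<le> norm (v - th) + norm (hh t - th)"
    using norm_triangle_ineq4[of "v - th" "hh t - th"] by simp
  then show "norm (v - hh t) \<le> (600000 * C^6 * sqrt D + 2 * (S + 1)) * L / sqrt (el t)"
    unfolding eq using v1 h1 by linarith
qed

end

text \<open>Fixes every constant from \<sigma>, \<kappa> and the dimension before the run is chosen,
  then combines the noise event with the pathwise bound.\<close>

lemma noise_regime:
  fixes \<sigma> \<kappa> :: real
  assumes d2: "2 \<le> CARD('d::finite)" and k0: "0 < \<kappa>"
  shows "\<exists>c'>0. \<exists>c>0. \<forall>(M::'w measure) (\<theta>::real^'d) \<beta> T a \<epsilon> \<theta>h.
    linucb_unit M \<theta> \<sigma> \<beta> T a \<epsilon> \<theta>h \<and> \<kappa> * sqrt (real CARD('d) + ln (ln (real T))) \<le> \<beta> \<longrightarrow>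
    with_prob_at_least M (1 - 1 / ln (real T)) (\<lambda>w. \<forall>t v.
      let \<Lambda> = design_matrix (\<lambda>s. a s w) t;
          b = c * sqrt (real CARD('d) + ln (ln (real T))) / sqrt (min_eigenvalue \<Lambda>)
      in c' * \<beta>^8 \<le> real t \<and> t \<le> T \<and> unit_leading_eigenvector \<Lambda> v \<and> 0 \<le> v \<bullet> \<theta> \<longrightarrow>
         norm (v - \<theta>) \<le> b \<and> norm (v - \<theta>h t w) \<le> b)"
proof -
  define d where "d = real CARD('d)"
  have d1: "1 \<le> d" by (simp add: d_def)
  obtain J N where J: "1 \<le> J" "12 * sqrt d * (2 + sqrt J) + 1 \<le> real N"
    "let K = 2 + 2 * (2 * (1 + \<sigma>^2) * gamma_const CARD('d) N + 1) / \<kappa>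
     in B_const d \<kappa> K * trace_const d \<kappa> K \<le> J"
    using net_size_exists[of "CARD('d)" \<kappa> \<sigma>] k0 unfolding d_def by (auto simp: Suc_le_eq)
  define g where "g = gamma_const CARD('d) N"
  have g1: "1 \<le> g" unfolding g_def by (rule gamma_const_ge_one)
  define S where "S = 2 * (1 + \<sigma>^2) * g"
  define Cn where "Cn = (\<sigma>^2 + 1) * g^2"
  define K where "K = 2 + 2 * (S + 1) / \<kappa>"
  define A where "A = trace_const d \<kappa> K"
  define D where "D = B_const d \<kappa> K"
  define C0 where "C0 = crude_const d \<kappa> K"
  define C where "C = 2 + A + K * sqrt A + (2 + 8 * K) * sqrt A + (S + 1) + (S + 1) * sqrt A + 1 / \<kappa> + Cn"
  define C1 where "C1 = (8 * C^2 / sqrt \<kappa> + 1 + 2 / \<kappa>)^4 + 6 * C0 / \<kappa>^2"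
  define c' where "c' = 2 * C1 * (1 + 1 / \<kappa>^4) + 16 * D^2 / \<kappa>^6"
  define c where "c = 600000 * C^6 * sqrt D + 2 * (S + 1)"
  have S0: "0 \<le> S" and Cn0: "0 \<le> Cn" using g1 by (simp_all add: S_def Cn_def)
  have JD: "D * A \<le> J" using J(3) by (simp add: D_def A_def K_def S_def g_def Let_def)
  have C0p: "0 < C0" using crude_const_pos[of d \<kappa> K] d1 k0 unfolding C0_def by (smt (verit) zero_less_divide_1_iff zero_less_power)
  have C1p: "0 < C1" unfolding C1_def using C0p k0 by (intro add_nonneg_pos) auto
  have D0: "0 \<le> D"
    using C0p d1 S0 k0 unfolding D_def B_const_def trace_const_def C0_def K_def by (intro add_nonneg_nonneg mult_nonneg_nonneg) auto
  have c'0: "0 < c'" unfolding c'_def using C1p k0 by (intro add_pos_nonneg mult_pos_pos) (auto simp: add_pos_nonneg)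
  have c0: "0 < c" unfolding c_def using S0 D0 by (intro add_nonneg_pos) auto
  show ?thesis
  proof (rule exI[of _ c'], rule conjI[OF c'0], rule exI[of _ c], rule conjI[OF c0], intro allI impI)
    fix M :: "'w measure" and \<theta> :: "real^'d" and \<beta> T a \<epsilon> \<theta>h
    assume H: "linucb_unit M \<theta> \<sigma> \<beta> T a \<epsilon> \<theta>h \<and> \<kappa> * sqrt (real CARD('d) + ln (ln (real T))) \<le> \<beta>"
    interpret U: linucb_unit M \<theta> \<sigma> \<beta> T a \<epsilon> \<theta>h using H by blast
    define L where "L = sqrt (real CARD('d) + ln (ln (real T)))"
    have "0 \<le> ln (ln (real T))" using U.ln_T_ge_one by simp
    then have "1 \<le> real CARD('d) + ln (ln (real T))" using d1 unfolding d_def by linarith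
    then have L1: "1 \<le> L" unfolding L_def by simp
    define s1 where "s1 = nat \<lceil>C1 * \<beta>^4\<rceil>"
    obtain E where E: "E \<in> sets M" "1 - 1 / ln (real T) \<le> measure M E"
      "\<And>w. w \<in> E \<Longrightarrow> w \<in> space M"
      "\<And>w t J. w \<in> E \<Longrightarrow> t \<le> T \<Longrightarrow> 1 \<le> J \<Longrightarrow> design.B (\<lambda>s. a s w) \<theta> t \<le> J * min_eigenvalue (design_matrix (\<lambda>s. a s w) t) \<Longrightarrow>
       12 * sqrt (real CARD('d)) * (2 + sqrt J) + 1 \<le> real N \<Longrightarrow>
       seminorm_of (posdef.Gm (design_matrix (\<lambda>s. a s w) t)) (design.SS (\<lambda>s. a s w) (\<lambda>s. \<epsilon> s w) t) \<le> 2 * (1 + \<sigma>^2) * (g * L)"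
      "\<And>w t. w \<in> E \<Longrightarrow> s1 \<le> t \<Longrightarrow> t \<le> T \<Longrightarrow> \<bar>\<Sum>r\<in>{s1..<t}. ucb_path.cc (\<lambda>s. a s w) \<theta> (Suc r) * \<epsilon> (Suc r) w\<bar>
       \<le> (\<sigma>^2 + 1) * (g * L * sqrt (\<Sum>r\<in>{s1..<t}. (ucb_path.cc (\<lambda>s. a s w) \<theta> (Suc r))\<^sup>2) + (g * L)\<^sup>2)"
      using U.noise_event[of N s1, folded g_def L_def] by (elim bexE conjE) auto
    show "with_prob_at_least M (1 - 1 / ln (real T)) (\<lambda>w. \<forall>t v.
      let \<Lambda> = design_matrix (\<lambda>s. a s w) t;
          b = c * sqrt (real CARD('d) + ln (ln (real T))) / sqrt (min_eigenvalue \<Lambda>)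
      in c' * \<beta>^8 \<le> real t \<and> t \<le> T \<and> unit_leading_eigenvector \<Lambda> v \<and> 0 \<le> v \<bullet> \<theta> \<longrightarrow>
         norm (v - \<theta>) \<le> b \<and> norm (v - \<theta>h t w) \<le> b)"
      unfolding with_prob_at_least_def Let_def L_def[symmetric]
    proof (intro bexI[OF _ E(1)] conjI E(2) ballI allI impI)
      fix w t v assume w: "w \<in> E"
        and h: "c' * \<beta>^8 \<le> real t \<and> t \<le> T \<and> unit_leading_eigenvector (design_matrix (\<lambda>s. a s w) t) v \<and> 0 \<le> v \<bullet> \<theta>"
      have ws: "w \<in> space M" by (rule E(3)[OF w])
      interpret P: ucb_path "\<lambda>s. a s w" \<theta> "\<lambda>t. \<theta>h t w" \<beta> T by (rule U.path_at[OF ws])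
      have kL: "\<kappa> * L \<le> \<beta>" using H by (simp add: L_def)
      have noise: "seminorm_of (P.G r) (P.SS (\<lambda>s. \<epsilon> s w) r) \<le> S * L" if "r \<le> T" "P.B r \<le> J * P.el r" for r
        using E(4)[OF w that(1) J(1)] that(2) J(2) by (simp add: S_def d_def P.D.ell_def mult.assoc)
      have HN: "\<bar>\<Sum>r\<in>{s1..<t}. P.cc (Suc r) * \<epsilon> (Suc r) w\<bar>
          \<le> Cn * (L * sqrt (\<Sum>r\<in>{s1..<t}. (P.cc (Suc r))\<^sup>2) + L^2)" if "s1 \<le> t" "t \<le> T" for t
      proof (rule order_trans[OF E(5)[OF w that]])
        define V where "V = (\<Sum>r\<in>{s1..<t}. (P.cc (Suc r))\<^sup>2)"
        have "0 \<le> V" by (simp add: V_def sum_nonneg)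
        moreover have "g * 1 \<le> g * g" using g1 by (intro mult_left_mono) auto
        ultimately have "g * (L * sqrt V) \<le> g^2 * (L * sqrt V)" using L1
          by (intro mult_right_mono) (auto simp: power2_eq_square)
        then have "(\<sigma>^2 + 1) * (g * L * sqrt V + (g * L)\<^sup>2) \<le> (\<sigma>^2 + 1) * (g^2 * (L * sqrt V) + (g * L)\<^sup>2)"
          by (intro mult_left_mono) auto
        also have "... = Cn * (L * sqrt V + L^2)" by (simp add: Cn_def power_mult_distrib algebra_simps)
        finally show "(\<sigma>^2 + 1) * (g * L * sqrt V + (g * L)\<^sup>2) \<le> Cn * (L * sqrt V + L^2)" .
      qed
      note npath = P.noise_regime_path[of "\<lambda>s. \<epsilon> s w" \<kappa> S Cn L J t v, folded d_def, folded K_def,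
          folded A_def D_def C0_def, folded C_def, folded C1_def, folded s1_def c'_def c_def,
          OF d2 U.normalised_at[OF ws] k0 S0 Cn0 L1 kL JD noise HN]
      show "norm (v - \<theta>) \<le> c * L / sqrt (min_eigenvalue (design_matrix (\<lambda>s. a s w) t))"
        using npath(1) h by (simp add: P.D.ell_def)
      show "norm (v - \<theta>h t w) \<le> c * L / sqrt (min_eigenvalue (design_matrix (\<lambda>s. a s w) t))"
        using npath(2) h by (simp add: P.D.ell_def)
    qed
  qed
qed

section \<open>Tilting the noise\<close>

lemma abs_power_le_exp: "\<bar>x\<bar> ^ p \<le> fact p * (exp x + exp (- x))" for x :: real
proof -
  have "(\<Sum>n\<in>{p}. inverse (fact n) * \<bar>x\<bar> ^ n) \<le> (\<Sum>n. inverse (fact n) * \<bar>x\<bar> ^ n)"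
    by (rule sum_le_suminf[OF summable_exp]) auto
  then have "inverse (fact p) * \<bar>x\<bar> ^ p \<le> exp \<bar>x\<bar>" by (simp add: exp_def)
  then have "\<bar>x\<bar> ^ p \<le> fact p * exp \<bar>x\<bar>" by (simp add: field_simps)
  also have "... \<le> fact p * (exp x + exp (- x))" by (intro mult_left_mono) (auto simp: abs_if)
  finally show ?thesis .
qed

section \<open>Random variables with all moments\<close>

context prob_space
begin

text \<open>An algebra of functions, closed under sums and products, that contains the noise. It
  makes the integrability conditions in the following expansions automatic.\<close>

definition all_moments :: "('a \<Rightarrow> real) \<Rightarrow> bool" where
  "all_moments f \<longleftrightarrow> f \<in> borel_measurable M \<and> (\<forall>p. integrable M (\<lambda>x. \<bar>f x\<bar> ^ p))"

lemma all_moments_measurable: "all_moments f \<Longrightarrow> f \<in> borel_measurable M"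
  by (simp add: all_moments_def)

lemma all_moments_integrable: "all_moments f \<Longrightarrow> integrable M f"
proof -
  assume "all_moments f"
  then have "f \<in> borel_measurable M" "integrable M (\<lambda>x. \<bar>f x\<bar> ^ 1)" unfolding all_moments_def by blast+
  then show "integrable M f" by (simp add: integrable_abs_iff)
qed

lemma all_moments_bounded:
  assumes "f \<in> borel_measurable M" "\<And>x. x \<in> space M \<Longrightarrow> \<bar>f x\<bar> \<le> c"
  shows "all_moments f"
  unfolding all_moments_def
proof (intro conjI allI)
  fix p
  show "integrable M (\<lambda>x. \<bar>f x\<bar> ^ p)"
    by (rule integrable_const_bound[where B = "c ^ p"])
      (use assms in \<open>auto intro!: AE_I2 power_mono simp: power_abs\<close>)
qed (rule assms)

lemma all_moments_const [intro!]: "all_moments (\<lambda>_. c)"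
  by (rule all_moments_bounded[where c = "\<bar>c\<bar>"]) auto

lemma all_moments_mult [intro!]:
  assumes f: "all_moments f" and g: "all_moments g" shows "all_moments (\<lambda>x. f x * g x)"
  unfolding all_moments_def
proof (intro conjI allI)
  have [measurable]: "f \<in> borel_measurable M" "g \<in> borel_measurable M" using f g by (auto dest: all_moments_measurable)
  show "(\<lambda>x. f x * g x) \<in> borel_measurable M" by measurable
  fix p
  have "integrable M (\<lambda>x. \<bar>f x\<bar> ^ (2 * p) + \<bar>g x\<bar> ^ (2 * p))"
    using f g unfolding all_moments_def by (intro Bochner_Integration.integrable_add) auto
  then show "integrable M (\<lambda>x. \<bar>f x * g x\<bar> ^ p)"
  proof (rule Bochner_Integration.integrable_bound)
    show "AE x in M. norm (\<bar>f x * g x\<bar> ^ p) \<le> norm (\<bar>f x\<bar> ^ (2 * p) + \<bar>g x\<bar> ^ (2 * p))"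
    proof (rule AE_I2)
      fix x
      have "0 \<le> (\<bar>f x\<bar> ^ p - \<bar>g x\<bar> ^ p)\<^sup>2" "0 \<le> \<bar>f x\<bar> ^ p * \<bar>g x\<bar> ^ p" by simp_all
      then have "\<bar>f x\<bar> ^ p * \<bar>g x\<bar> ^ p \<le> (\<bar>f x\<bar> ^ p)\<^sup>2 + (\<bar>g x\<bar> ^ p)\<^sup>2"
        unfolding power2_diff by linarith
      then show "norm (\<bar>f x * g x\<bar> ^ p) \<le> norm (\<bar>f x\<bar> ^ (2 * p) + \<bar>g x\<bar> ^ (2 * p))"
        by (simp add: abs_mult power_mult_distrib power_mult[symmetric] mult.commute)
    qed
  qed measurable
qed

lemma all_moments_add [intro!]:
  assumes f: "all_moments f" and g: "all_moments g" shows "all_moments (\<lambda>x. f x + g x)"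
  unfolding all_moments_def
proof (intro conjI allI)
  have [measurable]: "f \<in> borel_measurable M" "g \<in> borel_measurable M" using f g by (auto dest: all_moments_measurable)
  show "(\<lambda>x. f x + g x) \<in> borel_measurable M" by measurable
  fix p
  have "integrable M (\<lambda>x. 2 ^ p * (\<bar>f x\<bar> ^ p + \<bar>g x\<bar> ^ p))"
    using f g unfolding all_moments_def by (intro integrable_mult_right Bochner_Integration.integrable_add) auto
  then show "integrable M (\<lambda>x. \<bar>f x + g x\<bar> ^ p)"
  proof (rule Bochner_Integration.integrable_bound)
    show "AE x in M. norm (\<bar>f x + g x\<bar> ^ p) \<le> norm (2 ^ p * (\<bar>f x\<bar> ^ p + \<bar>g x\<bar> ^ p))"
    proof (rule AE_I2)
      fix x
      have "\<bar>f x + g x\<bar> \<le> 2 * max \<bar>f x\<bar> \<bar>g x\<bar>" by linarith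
      then have "\<bar>f x + g x\<bar> ^ p \<le> (2 * max \<bar>f x\<bar> \<bar>g x\<bar>) ^ p" by (intro power_mono) auto
      also have "... = 2 ^ p * max \<bar>f x\<bar> \<bar>g x\<bar> ^ p" by (rule power_mult_distrib)
      also have "... \<le> 2 ^ p * (\<bar>f x\<bar> ^ p + \<bar>g x\<bar> ^ p)" by (intro mult_left_mono) (auto simp: max_def)
      finally show "norm (\<bar>f x + g x\<bar> ^ p) \<le> norm (2 ^ p * (\<bar>f x\<bar> ^ p + \<bar>g x\<bar> ^ p))" by simp
    qed
  qed measurable
qed

lemma all_moments_minus [intro!]: "all_moments f \<Longrightarrow> all_moments (\<lambda>x. - f x)"
  by (simp add: all_moments_def)

lemma all_moments_diff [intro!]: "all_moments f \<Longrightarrow> all_moments g \<Longrightarrow> all_moments (\<lambda>x. f x - g x)"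
  using all_moments_add[of f "\<lambda>x. - g x"] all_moments_minus[of g] by simp

lemma all_moments_divide [intro!]: "all_moments f \<Longrightarrow> all_moments (\<lambda>x. f x / c)"
  using all_moments_mult[OF _ all_moments_const[of "1 / c"], of f] by simp

lemma all_moments_power [intro!]: "all_moments f \<Longrightarrow> all_moments (\<lambda>x. f x ^ j)"
  by (induction j) auto

lemma expectation_add: "all_moments f \<Longrightarrow> all_moments g \<Longrightarrow>
    expectation (\<lambda>x. f x + g x) = expectation f + expectation g"
  by (intro Bochner_Integration.integral_add all_moments_integrable)

lemma expectation_diff: "all_moments f \<Longrightarrow> all_moments g \<Longrightarrow>
    expectation (\<lambda>x. f x - g x) = expectation f - expectation g"
  by (intro Bochner_Integration.integral_diff all_moments_integrable)

lemmas expectation_linear = expectation_add expectation_diff integral_mult_right_zero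
  all_moments_const all_moments_add all_moments_diff all_moments_mult all_moments_power

lemma all_moments_sum: "(\<And>i. i \<in> I \<Longrightarrow> all_moments (f i)) \<Longrightarrow> all_moments (\<lambda>x. \<Sum>i\<in>I. f i x)"
  by (induction I rule: infinite_finite_induct) auto

lemma all_moments_prod: "(\<And>i. i \<in> I \<Longrightarrow> all_moments (f i)) \<Longrightarrow> all_moments (\<lambda>x. \<Prod>i\<in>I. f i x)"
  by (induction I rule: infinite_finite_induct) auto

end

text \<open>2 * 3! and 2 * 4! times exp (\<sigma>^2 / 2) bound the conditional third and fourth
  absolute moments of the noise, through the sub-Gaussian bounds at l = 1 and l = -1. The next two
  constants arise by inserting them into \<open>tilt_square\<close> and
  \<open>tilt_variance\<close>.\<close>

definition cubic_const :: "real \<Rightarrow> real" where "cubic_const s = 12 * exp (s^2 / 2)"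
definition quartic_const :: "real \<Rightarrow> real" where "quartic_const s = 48 * exp (s^2 / 2)"
definition tilt_square_const :: "real \<Rightarrow> real" where
  "tilt_square_const s = 2 * s^2 + quartic_const s + s^4"
definition tilt_var_const :: "real \<Rightarrow> real" where
  "tilt_var_const s = (let c = 3 * s^4 + (cubic_const s)\<^sup>2 in 6 * s^2 + 2 * c + 3 * quartic_const s + c * s^2)"

lemma cubic_const_pos: "0 < cubic_const s" and quartic_const_pos: "0 < quartic_const s"
  by (simp_all add: cubic_const_def quartic_const_def)

lemma tilt_const_pos: "0 < tilt_square_const s" "0 < tilt_var_const s"
proof -
  show "0 < tilt_square_const s"
    unfolding tilt_square_const_def using quartic_const_pos[of s] by (intro add_pos_nonneg add_nonneg_pos) auto
  have "0 \<le> (3 * s ^ 4 + (cubic_const s)\<^sup>2) * s^2" "0 \<le> 3 * s ^ 4 + (cubic_const s)\<^sup>2" by simp_all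
  then show "0 < tilt_var_const s"
    unfolding tilt_var_const_def Let_def using quartic_const_pos[of s] by (intro add_pos_nonneg add_nonneg_pos) auto
qed

context linucb_run
begin

text \<open>The clipping only matters on a null set; it makes the bound on \<open>kap\<close> hold everywhere.\<close>

definition "kap s w = clip (cubic_const \<sigma>) (real_cond_exp M (F (s - 1)) (\<lambda>w. (\<epsilon> s w) ^ 3) w)"


lemma eps_moments: assumes s: "s \<in> {1..T}" shows "all_moments (\<epsilon> s)"
  unfolding all_moments_def
proof (intro conjI allI)
  show [measurable]: "\<epsilon> s \<in> borel_measurable M" by (rule eps_measurable[OF s])
  fix p
  have "integrable M (\<lambda>w. fact p * (exp (1 * \<epsilon> s w) + exp (- 1 * \<epsilon> s w)))"
    by (intro integrable_mult_right Bochner_Integration.integrable_add noise_integrable(3)[OF s])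
  then show "integrable M (\<lambda>w. \<bar>\<epsilon> s w\<bar> ^ p)"
  proof (rule Bochner_Integration.integrable_bound)
    show "AE w in M. norm (\<bar>\<epsilon> s w\<bar> ^ p) \<le> norm (fact p * (exp (1 * \<epsilon> s w) + exp (- 1 * \<epsilon> s w)))"
      using abs_power_le_exp[of "\<epsilon> s _" p] by (intro AE_I2) (simp add: abs_mult)
  qed measurable
qed

lemma cond_exp_power_le:
  assumes s: "s \<in> {1..T}"
  shows "AE w in M. real_cond_exp M (F (s - 1)) (\<lambda>w. \<bar>\<epsilon> s w\<bar> ^ p) w \<le> fact p * (2 * exp (\<sigma>^2 / 2))"
proof -
  interpret S: sigma_finite_subalgebra M "F (s - 1)" using s by (intro subalg) auto
  let ?E = "\<lambda>l w. exp (l * \<epsilon> s w)"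
  have i: "integrable M (?E l)" for l by (rule noise_integrable(3)[OF s])
  have ip: "integrable M (\<lambda>w. \<bar>\<epsilon> s w\<bar> ^ p)" using eps_moments[OF s] by (simp add: all_moments_def)
  have "AE w in M. real_cond_exp M (F (s - 1)) (\<lambda>w. \<bar>\<epsilon> s w\<bar> ^ p) w
      \<le> real_cond_exp M (F (s - 1)) (\<lambda>w. fact p * (?E 1 w + ?E (-1) w)) w"
    by (intro S.real_cond_exp_mono AE_I2 integrable_mult_right Bochner_Integration.integrable_add ip i)
      (use abs_power_le_exp[of "\<epsilon> s _" p] in simp)
  moreover have "AE w in M. real_cond_exp M (F (s - 1)) (\<lambda>w. fact p * (?E 1 w + ?E (-1) w)) w
      = fact p * real_cond_exp M (F (s - 1)) (\<lambda>w. ?E 1 w + ?E (-1) w) w"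
    using i by (intro S.real_cond_exp_cmult Bochner_Integration.integrable_add)
  moreover have "AE w in M. real_cond_exp M (F (s - 1)) (\<lambda>w. ?E 1 w + ?E (-1) w) w
      = real_cond_exp M (F (s - 1)) (?E 1) w + real_cond_exp M (F (s - 1)) (?E (-1)) w"
    using i by (intro S.real_cond_exp_add)
  ultimately show ?thesis using noise_subgaussian[OF s, of 1] noise_subgaussian[OF s, of "-1"]
  proof eventually_elim
    case (elim w)
    then have "real_cond_exp M (F (s - 1)) (?E 1) w + real_cond_exp M (F (s - 1)) (?E (-1)) w \<le> 2 * exp (\<sigma>^2 / 2)" by simp
    from order_trans[OF elim(1)[unfolded elim(2) elim(3)] mult_left_mono[OF this fact_ge_zero[of p]]] show ?case .
  qed
qed

lemma kap_eq: assumes s: "s \<in> {1..T}"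
  shows "AE w in M. real_cond_exp M (F (s - 1)) (\<lambda>w. (\<epsilon> s w) ^ 3) w = kap s w"
proof -
  interpret S: sigma_finite_subalgebra M "F (s - 1)" using s by (intro subalg) auto
  let ?R = "real_cond_exp M (F (s - 1))"
  have i: "integrable M (\<lambda>w. (\<epsilon> s w) ^ 3)" using eps_moments[OF s] by (intro all_moments_integrable) auto
  have ia: "integrable M (\<lambda>w. \<bar>\<epsilon> s w\<bar> ^ 3)" using eps_moments[OF s] by (simp add: all_moments_def)
  have "AE w in M. ?R (\<lambda>w. (\<epsilon> s w) ^ 3) w \<le> ?R (\<lambda>w. \<bar>\<epsilon> s w\<bar> ^ 3) w"
    by (intro S.real_cond_exp_mono AE_I2 i ia) (simp add: abs_ge_self flip: power_abs)
  moreover have "AE w in M. ?R (\<lambda>w. (-1) * \<bar>\<epsilon> s w\<bar> ^ 3) w \<le> ?R (\<lambda>w. (\<epsilon> s w) ^ 3) w"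
    by (intro S.real_cond_exp_mono AE_I2 integrable_mult_right i ia) (simp add: abs_ge_minus_self minus_le_iff flip: power_abs)
  moreover have "AE w in M. ?R (\<lambda>w. (-1) * \<bar>\<epsilon> s w\<bar> ^ 3) w = (-1) * ?R (\<lambda>w. \<bar>\<epsilon> s w\<bar> ^ 3) w"
    using ia by (rule S.real_cond_exp_cmult)
  moreover have "AE w in M. ?R (\<lambda>w. \<bar>\<epsilon> s w\<bar> ^ 3) w \<le> cubic_const \<sigma>"
    using cond_exp_power_le[OF s, of 3] by (simp add: cubic_const_def fact_numeral)
  ultimately show ?thesis
    by eventually_elim (simp add: kap_def clip_id abs_le_iff)
qed

lemma abs_kap_le: "\<bar>kap s w\<bar> \<le> cubic_const \<sigma>" unfolding kap_def using cubic_const_pos[of \<sigma>] by (intro abs_clip_le) simp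

lemma kap_measurable [measurable]: "kap s \<in> borel_measurable (F (s - 1))"
  unfolding kap_def by measurable

text \<open>The conditional variance is centred at the conditional mean, which vanishes almost
  everywhere.\<close>

lemma cond_exp_square: assumes s: "s \<in> {1..T}"
  shows "AE w in M. real_cond_exp M (F (s - 1)) (\<lambda>w. (\<epsilon> s w)\<^sup>2) w = \<sigma>^2"
proof -
  interpret S: sigma_finite_subalgebra M "F (s - 1)" using s by (intro subalg) auto
  have [measurable]: "\<epsilon> s \<in> borel_measurable M" by (rule eps_measurable[OF s])
  have sub: "subalgebra M (F (s - 1))" by (rule S.subalg)
  have [measurable]: "real_cond_exp M (F (s - 1)) (\<epsilon> s) \<in> borel_measurable M"
    by (rule measurable_from_subalg[OF sub]) simp
  have "AE w in M. real_cond_exp M (F (s - 1)) (\<lambda>w. (\<epsilon> s w - real_cond_exp M (F (s - 1)) (\<epsilon> s) w)\<^sup>2) w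
      = real_cond_exp M (F (s - 1)) (\<lambda>w. (\<epsilon> s w)\<^sup>2) w"
    by (rule S.real_cond_exp_cong) (use noise_mean[OF s] in \<open>auto elim!: eventually_mono\<close>)
  then show ?thesis using noise_variance[OF s] by eventually_elim (simp add: cond_variance_def)
qed

context
  fixes s and Z :: "'w \<Rightarrow> real"
  assumes s: "s \<in> {1..T}" and Z [measurable]: "Z \<in> borel_measurable (F (s - 1))" and Zm: "all_moments Z"
begin

interpretation S: sigma_finite_subalgebra M "F (s - 1)" using s by (intro subalg) auto

lemma pull_out:
  assumes "all_moments g" "AE w in M. real_cond_exp M (F (s - 1)) g w = h w" "h \<in> borel_measurable M"
  shows "expectation (\<lambda>w. Z w * g w) = expectation (\<lambda>w. Z w * h w)"
proof -
  have [measurable]: "Z \<in> borel_measurable M" "g \<in> borel_measurable M" "h \<in> borel_measurable M"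
    using Zm assms by (auto dest: all_moments_measurable)
  have [measurable]: "real_cond_exp M (F (s - 1)) g \<in> borel_measurable M"
    by (rule measurable_from_subalg[OF S.subalg]) simp
  have "expectation (\<lambda>w. Z w * g w) = expectation (\<lambda>w. Z w * real_cond_exp M (F (s - 1)) g w)"
    using assms(1) Zm by (intro S.real_cond_exp_intg(2)[symmetric] all_moments_integrable all_moments_mult Z) auto
  also have "... = expectation (\<lambda>w. Z w * h w)"
    using assms(2) by (intro integral_cong_AE) auto
  finally show ?thesis .
qed

lemma moment_1: "expectation (\<lambda>w. Z w * \<epsilon> s w) = 0"
  using pull_out[OF eps_moments[OF s] noise_mean[OF s]] by simp

lemma moment_2: "expectation (\<lambda>w. Z w * (\<epsilon> s w)\<^sup>2) = \<sigma>^2 * expectation Z"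
  using pull_out[OF _ cond_exp_square[OF s]] eps_moments[OF s] by (simp add: all_moments_power mult.commute)

lemma moment_3: "expectation (\<lambda>w. Z w * (\<epsilon> s w) ^ 3) = expectation (\<lambda>w. Z w * kap s w)"
  using pull_out[OF _ kap_eq[OF s]] eps_moments[OF s] measurable_from_subalg[OF S.subalg kap_measurable]
  by (simp add: all_moments_power)

lemma moment_4:
  assumes Z0: "\<And>w. w \<in> space M \<Longrightarrow> 0 \<le> Z w"
  shows "expectation (\<lambda>w. Z w * (\<epsilon> s w) ^ 4) \<le> quartic_const \<sigma> * expectation Z"
proof -
  have [measurable]: "Z \<in> borel_measurable M" "\<epsilon> s \<in> borel_measurable M"
    using Zm by (auto dest: all_moments_measurable intro: eps_measurable[OF s])
  have e4: "all_moments (\<lambda>w. (\<epsilon> s w) ^ 4)" using eps_moments[OF s] by auto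
  have i: "integrable M (\<lambda>w. Z w * (\<epsilon> s w) ^ 4)" using Zm e4 by (intro all_moments_integrable) auto
  have "AE w in M. real_cond_exp M (F (s - 1)) (\<lambda>w. (\<epsilon> s w) ^ 4) w \<le> quartic_const \<sigma>"
  proof -
    have "\<bar>\<epsilon> s w\<bar> ^ 4 = (\<epsilon> s w) ^ 4" for w by (rule power_even_abs_numeral) simp
    then show ?thesis using cond_exp_power_le[OF s, of 4] by (simp add: quartic_const_def fact_numeral)
  qed
  then have le: "AE w in M. Z w * real_cond_exp M (F (s - 1)) (\<lambda>w. (\<epsilon> s w) ^ 4) w \<le> Z w * quartic_const \<sigma>"
    using AE_space by eventually_elim (rule mult_left_mono[OF _ Z0])
  have "expectation (\<lambda>w. Z w * (\<epsilon> s w) ^ 4)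
      = expectation (\<lambda>w. Z w * real_cond_exp M (F (s - 1)) (\<lambda>w. (\<epsilon> s w) ^ 4) w)"
    using i by (intro S.real_cond_exp_intg(2)[symmetric] Z) auto
  also have "... \<le> expectation (\<lambda>w. Z w * quartic_const \<sigma>)"
    using i Zm le eps_moments[OF s] by (intro integral_mono_AE S.real_cond_exp_intg(1) all_moments_integrable Z) auto
  finally show ?thesis by (simp add: mult.commute)
qed

end

end

text \<open>Of the conditional law of the noise only the mean, the variance and bounds on higher
  moments are known. A factor polynomial in the noise has conditional mean 1 by these alone, so
  products of such factors are densities with no unknown normalisation. The price is a third-moment
  correction in the shifted mean.\<close>

locale tilted_run = linucb_run M \<theta> \<sigma> \<beta> T a \<epsilon> \<theta>h
  for M :: "'w measure" and \<theta> :: "real^'d" and \<sigma> \<beta> :: real and T :: nat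
    and a :: "nat \<Rightarrow> 'w \<Rightarrow> real^'d" and \<epsilon> :: "nat \<Rightarrow> 'w \<Rightarrow> real" and \<theta>h :: "nat \<Rightarrow> 'w \<Rightarrow> real^'d" +
  fixes k :: "nat \<Rightarrow> 'w \<Rightarrow> real"
  assumes k_measurable: "s \<in> {1..T} \<Longrightarrow> k s \<in> borel_measurable (F (s - 1))"
    and k_le_one: "s \<in> {1..T} \<Longrightarrow> w \<in> space M \<Longrightarrow> \<bar>k s w\<bar> \<le> 1"
    and sigma_k_le_one: "s \<in> {1..T} \<Longrightarrow> w \<in> space M \<Longrightarrow> \<sigma>\<^sup>2 * (k s w)\<^sup>2 \<le> 1"
begin

text \<open>The quadratic correction makes the factor nonnegative without changing its conditional mean.\<close>

definition "tf s w = 1 + k s w * \<epsilon> s w + (k s w)\<^sup>2 / 2 * ((\<epsilon> s w)\<^sup>2 - \<sigma>^2)"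
definition "td n w = (\<Prod>s=1..n. tf s w)"
text \<open>The noise minus its conditional mean under the tilted law: \<sigma>^2 k is the intended
  shift, and the term with \<open>kap\<close> is the correction caused by the quadratic part of the
  factor.\<close>

definition "te s w = \<epsilon> s w - (\<sigma>^2 * k s w + (k s w)\<^sup>2 / 2 * kap s w)"

lemma tf_nonneg: assumes "s \<in> {1..T}" "w \<in> space M" shows "0 \<le> tf s w"
proof -
  have "tf s w = (1 + k s w * \<epsilon> s w)\<^sup>2 / 2 + (1 - \<sigma>^2 * (k s w)\<^sup>2) / 2"
    by (simp add: tf_def power2_eq_square field_simps)
  then show ?thesis using sigma_k_le_one[OF assms] by simp
qed

lemma td_nonneg: "n \<le> T \<Longrightarrow> w \<in> space M \<Longrightarrow> 0 \<le> td n w"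
  unfolding td_def by (intro prod_nonneg tf_nonneg) auto

lemma td_Suc: "td (Suc n) w = td n w * tf (Suc n) w" by (simp add: td_def)

lemma k_moments: "s \<in> {1..T} \<Longrightarrow> all_moments (k s)"
  by (rule all_moments_bounded[OF measurable_F_M[OF k_measurable] k_le_one]) auto

lemma kap_moments: "s \<in> {1..T} \<Longrightarrow> all_moments (kap s)"
  by (rule all_moments_bounded[OF measurable_F_M[OF kap_measurable] abs_kap_le]) auto

lemma k_power:
  assumes "s \<in> {1..T}"
  shows "(\<lambda>w. k s w ^ j) \<in> borel_measurable (F (s - 1))" "all_moments (\<lambda>w. k s w ^ j)"
  using k_measurable[OF assms] k_moments[OF assms] by auto

lemma tf_moments: "s \<in> {1..T} \<Longrightarrow> all_moments (tf s)"
  unfolding tf_def using eps_moments[of s] k_moments[of s] by (intro all_moments_add all_moments_mult all_moments_diff all_moments_power all_moments_divide) auto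

lemma te_moments: "s \<in> {1..T} \<Longrightarrow> all_moments (te s)"
  unfolding te_def using eps_moments[of s] k_moments[of s] kap_moments[of s]
  by (intro all_moments_add all_moments_mult all_moments_diff all_moments_power all_moments_divide) auto

lemma td_moments: "n \<le> T \<Longrightarrow> all_moments (td n)"
  unfolding td_def by (intro all_moments_prod tf_moments) auto

lemma k_measurable': "s \<in> {1..T} \<Longrightarrow> s \<le> Suc t \<Longrightarrow> k s \<in> borel_measurable (F t)"
  by (rule measurable_F_mono[OF k_measurable]) auto

lemma tf_measurable: assumes "s \<in> {1..t}" "t \<le> T" shows "tf s \<in> borel_measurable (F t)"
proof -
  have [measurable]: "k s \<in> borel_measurable (F t)" "\<epsilon> s \<in> borel_measurable (F t)"
    using assms by (auto intro: k_measurable' eps_measurable_F)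
  show ?thesis unfolding tf_def by measurable
qed

lemma te_measurable: assumes "s \<in> {1..t}" "t \<le> T" shows "te s \<in> borel_measurable (F t)"
proof -
  have [measurable]: "k s \<in> borel_measurable (F t)" "\<epsilon> s \<in> borel_measurable (F t)"
    using assms by (auto intro: k_measurable' eps_measurable_F)
  have [measurable]: "kap s \<in> borel_measurable (F t)"
    using assms by (intro measurable_F_mono[OF kap_measurable]) auto
  show ?thesis unfolding te_def by measurable
qed

lemma td_measurable: "n \<le> t \<Longrightarrow> t \<le> T \<Longrightarrow> td n \<in> borel_measurable (F t)"
  unfolding td_def by (intro borel_measurable_prod tf_measurable) auto

context
  fixes s and Z :: "'w \<Rightarrow> real"
  assumes s: "s \<in> {1..T}" and Z [measurable]: "Z \<in> borel_measurable (F (s - 1))" and Zm: "all_moments Z"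
begin

lemma ZP:
  fixes j :: nat and h :: "'w \<Rightarrow> real"
  assumes "h \<in> borel_measurable (F (s - 1))" "all_moments h"
  shows "(\<lambda>w. Z w * h w) \<in> borel_measurable (F (s - 1))" "all_moments (\<lambda>w. Z w * h w)"
  using assms Z Zm by auto

lemma tilt_mean: "expectation (\<lambda>w. Z w * tf s w) = expectation Z"
proof -
  note k2 = ZP[OF k_power[OF s], of 2] and k1 = ZP[OF k_measurable[OF s] k_moments[OF s]] and e = eps_moments[OF s]
  have "expectation (\<lambda>w. Z w * tf s w) = expectation (\<lambda>w. Z w + (Z w * k s w) * \<epsilon> s w
      + 1 / 2 * ((Z w * (k s w)\<^sup>2) * (\<epsilon> s w)\<^sup>2) - \<sigma>^2 / 2 * (Z w * (k s w)\<^sup>2))"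
    by (simp add: tf_def algebra_simps)
  also have "... = expectation Z + expectation (\<lambda>w. (Z w * k s w) * \<epsilon> s w)
      + 1 / 2 * expectation (\<lambda>w. (Z w * (k s w)\<^sup>2) * (\<epsilon> s w)\<^sup>2) - \<sigma>^2 / 2 * expectation (\<lambda>w. Z w * (k s w)\<^sup>2)"
    using Zm k_moments[OF s] e
    by (simp only: expectation_linear)
  also have "... = expectation Z" using moment_1[OF s k1] moment_2[OF s k2] by simp
  finally show ?thesis .
qed

text \<open>Expanding tf times the noise against a predictable weight, the second moment produces
  \<sigma>^2 k and the third produces the \<open>kap\<close> term, which are exactly what
  \<open>te\<close> subtracts.\<close>

lemma tilt_centred: "expectation (\<lambda>w. Z w * (tf s w * te s w)) = 0"
proof -
  note k2 = ZP[OF k_power[OF s], of 2] and k1 = ZP[OF k_measurable[OF s] k_moments[OF s]] and e = eps_moments[OF s]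
  define mu where "mu w = \<sigma>^2 * k s w + (k s w)\<^sup>2 / 2 * kap s w" for w
  have [measurable]: "k s \<in> borel_measurable (F (s - 1))" by (rule k_measurable[OF s])
  have mu: "mu \<in> borel_measurable (F (s - 1))" unfolding mu_def by measurable
  have mum: "all_moments mu" unfolding mu_def using k_moments[OF s] kap_moments[OF s]
    by (intro all_moments_add all_moments_mult all_moments_power all_moments_divide) auto
  have Zmu: "(\<lambda>w. Z w * mu w) \<in> borel_measurable (F (s - 1))" "all_moments (\<lambda>w. Z w * mu w)"
    by (rule ZP[OF mu mum])+
  have "expectation (\<lambda>w. Z w * (tf s w * te s w)) = expectation (\<lambda>w. Z w * \<epsilon> s w
      + (Z w * k s w) * (\<epsilon> s w)\<^sup>2 + 1 / 2 * ((Z w * (k s w)\<^sup>2) * (\<epsilon> s w) ^ 3)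
      - \<sigma>^2 / 2 * ((Z w * (k s w)\<^sup>2) * \<epsilon> s w) - (Z w * mu w) * tf s w)"
    by (intro Bochner_Integration.integral_cong) (auto simp: tf_def te_def mu_def algebra_simps power2_eq_square power3_eq_cube add_divide_distrib diff_divide_distrib)
  also have "... = expectation (\<lambda>w. Z w * \<epsilon> s w)
      + expectation (\<lambda>w. (Z w * k s w) * (\<epsilon> s w)\<^sup>2) + 1 / 2 * expectation (\<lambda>w. (Z w * (k s w)\<^sup>2) * (\<epsilon> s w) ^ 3)
      - \<sigma>^2 / 2 * expectation (\<lambda>w. (Z w * (k s w)\<^sup>2) * \<epsilon> s w) - expectation (\<lambda>w. (Z w * mu w) * tf s w)"
    using Zm k_moments[OF s] e mum tf_moments[OF s]
    by (simp only: expectation_linear)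
  also have "... = \<sigma>^2 * expectation (\<lambda>w. Z w * k s w) + 1 / 2 * expectation (\<lambda>w. (Z w * (k s w)\<^sup>2) * kap s w)
      - expectation (\<lambda>w. (Z w * mu w) * tf s w)"
    using moment_1[OF s Z Zm] moment_2[OF s k1] moment_3[OF s k2] moment_1[OF s k2] by simp
  also have "expectation (\<lambda>w. (Z w * mu w) * tf s w) = expectation (\<lambda>w. Z w * mu w)"
  proof -
    have "expectation (\<lambda>w. (Z w * mu w) * tf s w) = expectation (\<lambda>w. (Z w * mu w)
        + (Z w * mu w * k s w) * \<epsilon> s w + 1 / 2 * ((Z w * mu w * (k s w)\<^sup>2) * (\<epsilon> s w)\<^sup>2) - \<sigma>^2 / 2 * (Z w * mu w * (k s w)\<^sup>2))"
      by (simp add: tf_def algebra_simps)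
    have q: "(\<lambda>w. Z w * mu w * k s w ^ j) \<in> borel_measurable (F (s - 1))"
      "all_moments (\<lambda>w. Z w * mu w * k s w ^ j)" for j
      using Zmu k_power[OF s, of j] by auto
    have "expectation (\<lambda>w. (Z w * mu w) * tf s w) = expectation (\<lambda>w. Z w * mu w)
        + expectation (\<lambda>w. (Z w * mu w * k s w ^ 1) * \<epsilon> s w)
        + 1 / 2 * expectation (\<lambda>w. (Z w * mu w * (k s w)\<^sup>2) * (\<epsilon> s w)\<^sup>2) - \<sigma>^2 / 2 * expectation (\<lambda>w. Z w * mu w * (k s w)\<^sup>2)"
      unfolding \<open>expectation (\<lambda>w. (Z w * mu w) * tf s w) = _\<close>
      using Zm mum k_moments[OF s] e
      by (simp only: expectation_linear power_one_right)
    then show ?thesis using moment_1[OF s q[of 1]] moment_2[OF s q[of 2]] by simp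
  qed
  also have "expectation (\<lambda>w. Z w * mu w)
      = expectation (\<lambda>w. \<sigma>\<^sup>2 * (Z w * k s w) + 1 / 2 * ((Z w * (k s w)\<^sup>2) * kap s w))"
    by (simp add: mu_def algebra_simps)
  also have "... = \<sigma>^2 * expectation (\<lambda>w. Z w * k s w) + 1 / 2 * expectation (\<lambda>w. (Z w * (k s w)\<^sup>2) * kap s w)"
    using Zm k_moments[OF s] kap_moments[OF s]
    by (simp only: expectation_linear)
  finally show ?thesis by simp
qed

end

context
  fixes s and Z :: "'w \<Rightarrow> real"
  assumes s: "s \<in> {1..T}" and Z [measurable]: "Z \<in> borel_measurable (F (s - 1))" and Zm: "all_moments Z"
    and Z0: "\<And>w. w \<in> space M \<Longrightarrow> 0 \<le> Z w"
begin

lemma tilt_square: "expectation (\<lambda>w. Z w * (tf s w)\<^sup>2) \<le> expectation (\<lambda>w. Z w * (1 + tilt_square_const \<sigma> * (k s w)\<^sup>2))"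
proof -
  note kj = ZP[OF s Z Zm k_power[OF s]] and e = eps_moments[OF s]
  define Y where "Y w = Z w * (2 * tf s w - 1) + 2 * ((Z w * k s w ^ 2) * (\<epsilon> s w)\<^sup>2)
      + (Z w * k s w ^ 4) * (\<epsilon> s w) ^ 4 + \<sigma>^4 * (Z w * k s w ^ 4)" for w
  have Ym: "all_moments Y" unfolding Y_def using k_moments[OF s] Zm e tf_moments[OF s]
    by (intro all_moments_add all_moments_mult all_moments_diff all_moments_power all_moments_divide) auto
  have "expectation (\<lambda>w. Z w * (tf s w)\<^sup>2) \<le> expectation Y"
  proof (rule integral_mono)
    show "integrable M (\<lambda>w. Z w * (tf s w)\<^sup>2)" using Zm tf_moments[OF s] by (intro all_moments_integrable) auto
    show "integrable M Y" by (rule all_moments_integrable[OF Ym])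
    fix w assume w: "w \<in> space M"
    define x where "x = k s w"
    define y where "y = \<epsilon> s w"
    have t: "tf s w = 1 + x * y + x^2 / 2 * (y^2 - \<sigma>^2)" by (simp add: tf_def x_def y_def)
    \<comment> \<open>Writing the square around 1 keeps the part of mean one separate from a
      remainder of order k^2; bounding tf^2 directly would lose the constant 1.\<close>
    have "(tf s w)\<^sup>2 = 2 * tf s w - 1 + (x * y + x^2 / 2 * (y^2 - \<sigma>^2))\<^sup>2"

    proof -
      have "(1 + u)\<^sup>2 = 2 * (1 + u) - 1 + u^2" for u :: real by (simp add: power2_eq_square algebra_simps)
      from this[of "x * y + x^2 / 2 * (y^2 - \<sigma>^2)"] show ?thesis unfolding t by (simp only: add.assoc)
    qed
    also have "(x * y + x^2 / 2 * (y^2 - \<sigma>^2))\<^sup>2 \<le> 2 * (x * y)\<^sup>2 + 2 * (x^2 / 2 * (y^2 - \<sigma>^2))\<^sup>2"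
      using sum_squares_bound[of "x * y" "x^2 / 2 * (y^2 - \<sigma>^2)"] by (simp add: power2_sum)
    also have "2 * (x^2 / 2 * (y^2 - \<sigma>^2))\<^sup>2 = x^4 / 2 * (y^2 - \<sigma>^2)\<^sup>2" by (simp add: power_mult_distrib power_divide flip: power_mult)
    also have "... \<le> x^4 / 2 * (2 * y^4 + 2 * \<sigma>^4)"
    proof (rule mult_left_mono)
      have "0 \<le> (y^2 + \<sigma>^2)\<^sup>2" by simp
      moreover have "(y^2 + \<sigma>^2)\<^sup>2 + (y^2 - \<sigma>^2)\<^sup>2 = 2 * y^4 + 2 * \<sigma>^4"
        by (simp add: power2_eq_square power4_eq_xxxx algebra_simps)
      ultimately show "(y^2 - \<sigma>^2)\<^sup>2 \<le> 2 * y^4 + 2 * \<sigma>^4" by linarith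
    qed simp
    finally have "(tf s w)\<^sup>2 \<le> 2 * tf s w - 1 + 2 * (x^2 * y^2) + x^4 * y^4 + \<sigma>^4 * x^4"
      by (simp add: power_mult_distrib algebra_simps)
    from mult_left_mono[OF this Z0[OF w]] show "Z w * (tf s w)\<^sup>2 \<le> Y w"
      by (simp add: Y_def x_def y_def algebra_simps)
  qed
  also have "expectation Y = expectation (\<lambda>w. Z w * (2 * tf s w - 1)) + 2 * expectation (\<lambda>w. (Z w * k s w ^ 2) * (\<epsilon> s w)\<^sup>2)
      + expectation (\<lambda>w. (Z w * k s w ^ 4) * (\<epsilon> s w) ^ 4) + \<sigma>^4 * expectation (\<lambda>w. Z w * k s w ^ 4)"
    unfolding Y_def using Zm k_moments[OF s] e tf_moments[OF s]
    by (simp only: expectation_linear)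
  also have "expectation (\<lambda>w. Z w * (2 * tf s w - 1)) = 2 * expectation (\<lambda>w. Z w * tf s w) - expectation Z"
  proof -
    have "expectation (\<lambda>w. Z w * (2 * tf s w - 1)) = expectation (\<lambda>w. 2 * (Z w * tf s w) - Z w)"
      by (simp add: algebra_simps)
    also have "... = 2 * expectation (\<lambda>w. Z w * tf s w) - expectation Z"
      using Zm tf_moments[OF s]
      by (simp only: expectation_linear)
    finally show ?thesis .
  qed
  also have "expectation (\<lambda>w. Z w * tf s w) = expectation Z" by (rule tilt_mean[OF s Z Zm])
  also have "expectation (\<lambda>w. (Z w * k s w ^ 2) * (\<epsilon> s w)\<^sup>2) = \<sigma>^2 * expectation (\<lambda>w. Z w * k s w ^ 2)"
    by (rule moment_2[OF s kj])
  also have "expectation (\<lambda>w. (Z w * k s w ^ 4) * (\<epsilon> s w) ^ 4) \<le> quartic_const \<sigma> * expectation (\<lambda>w. Z w * k s w ^ 4)"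
    using Z0 by (intro moment_4[OF s kj]) auto
  finally have a: "expectation (\<lambda>w. Z w * (tf s w)\<^sup>2) \<le> expectation Z + 2 * \<sigma>^2 * expectation (\<lambda>w. Z w * k s w ^ 2)
      + (quartic_const \<sigma> + \<sigma>^4) * expectation (\<lambda>w. Z w * k s w ^ 4)" by (simp add: algebra_simps)
  have "expectation (\<lambda>w. Z w * k s w ^ 4) \<le> expectation (\<lambda>w. Z w * k s w ^ 2)"
  proof (rule integral_mono)
    fix w assume w: "w \<in> space M"
    have "(k s w)\<^sup>2 \<le> 1" using k_le_one[OF s w] abs_square_le_1 by blast
    then have "k s w ^ 2 * k s w ^ 2 \<le> k s w ^ 2 * 1" by (intro mult_left_mono) auto
    then have "k s w ^ 4 \<le> k s w ^ 2" by (simp flip: power_add)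
    then show "Z w * k s w ^ 4 \<le> Z w * k s w ^ 2" using Z0[OF w] by (intro mult_left_mono) auto
  qed (use kj(2) in \<open>auto intro: all_moments_integrable\<close>)
  then have "(quartic_const \<sigma> + \<sigma>^4) * expectation (\<lambda>w. Z w * k s w ^ 4) \<le> (quartic_const \<sigma> + \<sigma>^4) * expectation (\<lambda>w. Z w * k s w ^ 2)"
    using quartic_const_pos[of \<sigma>] by (intro mult_left_mono) auto
  with a have "expectation (\<lambda>w. Z w * (tf s w)\<^sup>2) \<le> expectation Z + tilt_square_const \<sigma> * expectation (\<lambda>w. Z w * k s w ^ 2)"
    by (simp add: tilt_square_const_def algebra_simps)
  also have "... = expectation (\<lambda>w. Z w + tilt_square_const \<sigma> * (Z w * k s w ^ 2))"
    using Zm k_moments[OF s]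
    by (simp only: expectation_linear)
  finally show ?thesis by (simp add: algebra_simps)
qed

lemma tilt_variance: "expectation (\<lambda>w. Z w * (tf s w * (te s w)\<^sup>2)) \<le> tilt_var_const \<sigma> * expectation Z"
proof -
  note e = eps_moments[OF s]
  define c where "c = 3 * \<sigma>^4 + (cubic_const \<sigma>)\<^sup>2"
  have "expectation (\<lambda>w. Z w * (tf s w * (te s w)\<^sup>2))
      \<le> expectation (\<lambda>w. 2 * c * Z w + (6 + c) * (Z w * (\<epsilon> s w)\<^sup>2) + 3 * (Z w * (\<epsilon> s w) ^ 4))"
  proof (rule integral_mono)
    show "integrable M (\<lambda>w. Z w * (tf s w * (te s w)\<^sup>2))"
      using Zm tf_moments[OF s] te_moments[OF s] by (intro all_moments_integrable) auto
    show "integrable M (\<lambda>w. 2 * c * Z w + (6 + c) * (Z w * (\<epsilon> s w)\<^sup>2) + 3 * (Z w * (\<epsilon> s w) ^ 4))"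
      using Zm e by (intro all_moments_integrable) auto
    fix w assume w: "w \<in> space M"
    define x where "x = k s w"
    define y where "y = \<epsilon> s w"
    have x1: "\<bar>x\<bar> \<le> 1" using k_le_one[OF s w] by (simp add: x_def)
    have x2: "x^2 \<le> 1" using x1 abs_square_le_1 by blast
    have "tf s w = 1 + x * y + x^2 / 2 * (y^2 - \<sigma>^2)" by (simp add: tf_def x_def y_def)
    also have "... \<le> 2 + y^2"
    proof -
      have "0 \<le> (x - y)\<^sup>2" by simp
      then have "x * y \<le> (x^2 + y^2) / 2" by (simp add: power2_diff)
      moreover have "x^2 * y^2 \<le> 1 * y^2" using x2 by (intro mult_right_mono) auto
      moreover have "0 \<le> x^2 * \<sigma>^2" by simp
      moreover have "x^2 / 2 * (y^2 - \<sigma>^2) = (x^2 * y^2) / 2 - (x^2 * \<sigma>^2) / 2" by (simp add: algebra_simps diff_divide_distrib)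
      ultimately show ?thesis using x2 by argo
    qed
    finally have f: "tf s w \<le> 2 + y^2" .
    have "(te s w)\<^sup>2 \<le> 3 * y^2 + c"
    proof -
      define u where "u = \<sigma>^2 * x"
      define v where "v = x^2 / 2 * kap s w"
      have t: "te s w = y - (u + v)" by (simp add: te_def x_def y_def u_def v_def)
      \<comment> \<open>The three squares are the deficit in (y - u - v)^2 \<le> 3 (y^2 + u^2 +
        v^2).\<close>
      have "0 \<le> (y + u)\<^sup>2 + (y + v)\<^sup>2 + (u - v)\<^sup>2" by simp
      moreover have "(te s w)\<^sup>2 + ((y + u)\<^sup>2 + (y + v)\<^sup>2 + (u - v)\<^sup>2) = 3 * (y^2 + u^2 + v^2)"
        unfolding t by (simp add: power2_eq_square algebra_simps)
      ultimately have 1: "(te s w)\<^sup>2 \<le> 3 * (y^2 + u^2 + v^2)" by linarith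
      have "u^2 = \<sigma>^4 * x^2" by (simp add: u_def power_mult_distrib flip: power_mult)
      then have 2: "u^2 \<le> \<sigma>^4" using x2 mult_left_mono[OF x2, of "\<sigma>^4"] by simp
      have "\<bar>v\<bar> \<le> 1 / 2 * cubic_const \<sigma>" unfolding v_def abs_mult using x2 abs_kap_le[of s w] by (intro mult_mono) auto
      then have "\<bar>v\<bar>\<^sup>2 \<le> (1 / 2 * cubic_const \<sigma>)\<^sup>2" by (intro power_mono) auto
      then have "3 * v^2 \<le> (cubic_const \<sigma>)\<^sup>2" by (simp add: power_mult_distrib power_divide) (smt (verit) zero_le_power2)
      with 1 2 show ?thesis by (simp add: c_def)
    qed
    then have "tf s w * (te s w)\<^sup>2 \<le> (2 + y^2) * (3 * y^2 + c)"
      using f tf_nonneg[OF s w] by (intro mult_mono) auto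
    also have "... = 2 * c + (6 + c) * y^2 + 3 * y^4" by (simp add: algebra_simps flip: power_add)
    finally have "Z w * (tf s w * (te s w)\<^sup>2) \<le> Z w * (2 * c + (6 + c) * y^2 + 3 * y^4)"
      using Z0[OF w] by (intro mult_left_mono) auto
    then show "Z w * (tf s w * (te s w)\<^sup>2) \<le> 2 * c * Z w + (6 + c) * (Z w * (\<epsilon> s w)\<^sup>2) + 3 * (Z w * (\<epsilon> s w) ^ 4)"
      by (simp add: y_def algebra_simps)
  qed
  also have "... = 2 * c * expectation Z + (6 + c) * expectation (\<lambda>w. Z w * (\<epsilon> s w)\<^sup>2) + 3 * expectation (\<lambda>w. Z w * (\<epsilon> s w) ^ 4)"
    using Zm e
    by (simp only: expectation_linear)
  also have "... \<le> 2 * c * expectation Z + (6 + c) * (\<sigma>^2 * expectation Z) + 3 * (quartic_const \<sigma> * expectation Z)"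
    using moment_2[OF s Z Zm] moment_4[OF s Z Zm Z0] by simp
  also have "... = tilt_var_const \<sigma> * expectation Z" by (simp only: tilt_var_const_def c_def[symmetric] Let_def) (simp add: algebra_simps)
  finally show ?thesis .
qed

end

lemma expectation_td: "n \<le> T \<Longrightarrow> expectation (td n) = 1"
proof (induction n)
  case 0 show ?case by (simp add: td_def prob_space)
next
  case (Suc n)
  have "expectation (td (Suc n)) = expectation (\<lambda>w. td n w * tf (Suc n) w)"
    by (intro Bochner_Integration.integral_cong) (simp_all only: td_Suc)
  also have "... = expectation (td n)"
    using Suc.prems by (intro tilt_mean) (auto intro: td_measurable td_moments)
  finally show ?case using Suc by simp
qed

text \<open>The conditional second moment of each factor is at most exp of a multiple of k^2.
  Discounting by the accumulated k^2 gives a supermartingale, and the pathwise bound V undoes the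
  discount at the end.\<close>

lemma expectation_td_square:
  assumes n: "n \<le> T" and V: "\<And>w. w \<in> space M \<Longrightarrow> (\<Sum>s=1..n. (k s w)\<^sup>2) \<le> V"
  shows "expectation (\<lambda>w. (td n w)\<^sup>2) \<le> exp (tilt_square_const \<sigma> * V)"
proof -
  have C20: "0 \<le> tilt_square_const \<sigma>" using tilt_const_pos(1)[of \<sigma>] by simp
  define W where "W m w = exp (- (tilt_square_const \<sigma>) * (\<Sum>s=1..m. (k s w)\<^sup>2))" for m w
  have Wm: "W m \<in> borel_measurable (F t)" if "m \<le> Suc t" "t \<le> T" "m \<le> T" for m t
    unfolding W_def using that by (intro borel_measurable_exp[THEN measurable_compose[rotated]] borel_measurable_times borel_measurable_sum borel_measurable_power k_measurable') auto
  have Wa: "all_moments (W m)" if "m \<le> T" for m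
  proof (rule all_moments_bounded[where c = 1])
    show "W m \<in> borel_measurable M" by (rule measurable_F_M[OF Wm[of m T]]) (use that in auto)
    show "\<bar>W m w\<bar> \<le> 1" for w using C20 by (simp add: W_def sum_nonneg)
  qed
  have "expectation (\<lambda>w. W m w * (td m w)\<^sup>2) \<le> 1" if "m \<le> T" for m
    using that
  proof (induction m)
    case 0 show ?case by (simp add: td_def W_def prob_space)
  next
    case (Suc m)
    have s: "Suc m \<in> {1..T}" using Suc.prems by simp
    have mT: "m \<le> T" using Suc.prems by simp
    define Z where "Z w = W (Suc m) w * (td m w)\<^sup>2" for w
    have Z: "Z \<in> borel_measurable (F (Suc m - 1))" unfolding Z_def
      using Wm[of "Suc m" m] td_measurable[of m m] Suc.prems by (intro borel_measurable_times borel_measurable_power) auto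
    have Za: "all_moments Z" unfolding Z_def using Wa[of "Suc m"] td_moments[OF mT] Suc.prems by auto
    have "expectation (\<lambda>w. W (Suc m) w * (td (Suc m) w)\<^sup>2) = expectation (\<lambda>w. Z w * (tf (Suc m) w)\<^sup>2)"
      by (simp add: Z_def td_Suc power_mult_distrib mult.assoc)
    also have "... \<le> expectation (\<lambda>w. Z w * (1 + tilt_square_const \<sigma> * (k (Suc m) w)\<^sup>2))"
      by (rule tilt_square[OF s Z Za]) (simp add: Z_def W_def)
    also have "... \<le> expectation (\<lambda>w. W m w * (td m w)\<^sup>2)"
    proof (rule integral_mono)
      show "integrable M (\<lambda>w. Z w * (1 + tilt_square_const \<sigma> * (k (Suc m) w)\<^sup>2))"
        using Za k_moments[OF s] by (intro all_moments_integrable) auto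
      show "integrable M (\<lambda>w. W m w * (td m w)\<^sup>2)"
        using Wa[OF mT] td_moments[OF mT] by (intro all_moments_integrable) auto
      fix w
      define h where "h = tilt_square_const \<sigma> * (k (Suc m) w)\<^sup>2"
      have "W (Suc m) w = W m w * exp (- h)"
        by (simp add: W_def h_def algebra_simps flip: exp_add)
      moreover have "exp (- h) * (1 + h) \<le> 1"
        using exp_ge_add_one_self[of h] by (simp add: exp_minus field_simps)
      then have "(W m w * (td m w)\<^sup>2) * (exp (- h) * (1 + h)) \<le> (W m w * (td m w)\<^sup>2) * 1"
        by (intro mult_left_mono) (auto simp: W_def)
      ultimately show "Z w * (1 + tilt_square_const \<sigma> * (k (Suc m) w)\<^sup>2) \<le> W m w * (td m w)\<^sup>2"
        by (simp add: Z_def h_def[symmetric] mult_ac)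
    qed
    finally show ?case using Suc.IH[OF mT] by linarith
  qed
  from this[OF n] have 1: "expectation (\<lambda>w. W n w * (td n w)\<^sup>2) \<le> 1" .
  have "expectation (\<lambda>w. (td n w)\<^sup>2) \<le> expectation (\<lambda>w. exp (tilt_square_const \<sigma> * V) * (W n w * (td n w)\<^sup>2))"
  proof (rule integral_mono)
    fix w assume "w \<in> space M"
    then have "1 \<le> exp (tilt_square_const \<sigma> * V) * W n w"
      using mult_left_mono[OF V C20] by (simp add: W_def flip: exp_add)
    from mult_right_mono[OF this, of "(td n w)\<^sup>2"]
    show "(td n w)\<^sup>2 \<le> exp (tilt_square_const \<sigma> * V) * (W n w * (td n w)\<^sup>2)" by (simp add: mult.assoc)
  qed (use Wa[OF n] td_moments[OF n] in \<open>auto intro!: all_moments_integrable\<close>)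
  also have "... = exp (tilt_square_const \<sigma> * V) * expectation (\<lambda>w. W n w * (td n w)\<^sup>2)" by simp
  also have "... \<le> exp (tilt_square_const \<sigma> * V) * 1" using 1 by (intro mult_left_mono) auto
  finally show ?thesis by simp
qed

text \<open>Under the tilted law the recentred noise has orthogonal increments of bounded
  conditional variance: the cross term vanishes by \<open>tilt_centred\<close>, and the last factor
  is removed from or added to the other terms by \<open>tilt_mean\<close>.\<close>

lemma expectation_td_martingale:
  assumes n: "n \<le> T"
    and q: "\<And>s. s \<in> {1..T} \<Longrightarrow> q s \<in> borel_measurable (F (s - 1))"
    and qb: "\<And>s w. s \<in> {1..T} \<Longrightarrow> w \<in> space M \<Longrightarrow> \<bar>q s w\<bar> \<le> 1"
  shows "expectation (\<lambda>w. td n w * (\<Sum>s=1..n. q s w * te s w)\<^sup>2) \<le> tilt_var_const \<sigma> * expectation (\<lambda>w. td n w * (\<Sum>s=1..n. (q s w)\<^sup>2))"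
  using n
proof (induction n)
  case 0 show ?case by simp
next
  case (Suc n)
  have s: "Suc n \<in> {1..T}" and nT: "n \<le> T" using Suc.prems by auto
  have q': "q r \<in> borel_measurable (F n)" if "r \<in> {1..Suc n}" for r
    using that s by (intro measurable_F_mono[OF q]) auto
  have qm: "all_moments (q r)" if "r \<in> {1..Suc n}" for r
    using that s by (intro all_moments_bounded[OF measurable_F_M[OF q] qb]) auto
  define X where "X w = (\<Sum>s=1..n. q s w * te s w)" for w
  define Q where "Q w = (\<Sum>s=1..Suc n. (q s w)\<^sup>2)" for w
  have X: "X \<in> borel_measurable (F n)" unfolding X_def
    using q' nT by (intro borel_measurable_sum borel_measurable_times te_measurable) auto
  have Xm: "all_moments X" unfolding X_def
    using qm nT by (intro all_moments_sum all_moments_mult te_moments) auto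
  have Q: "Q \<in> borel_measurable (F n)" unfolding Q_def
    using q' by (intro borel_measurable_sum borel_measurable_power) auto
  have Qm: "all_moments Q" unfolding Q_def using qm by (intro all_moments_sum all_moments_power) auto
  let ?s = "Suc n"
  have td: "td n \<in> borel_measurable (F n)" "all_moments (td n)" using nT by (auto intro: td_measurable td_moments)
  have [measurable]: "X \<in> borel_measurable (F n)" "td n \<in> borel_measurable (F n)" "q ?s \<in> borel_measurable (F n)" "Q \<in> borel_measurable (F n)"
    using X td q' Q by auto
  have m: "all_moments (tf ?s)" "all_moments (te ?s)" "all_moments (q ?s)"
    using tf_moments[OF s] te_moments[OF s] qm by auto
  have e1: "expectation (\<lambda>w. td n w * (X w)\<^sup>2 * tf ?s w) = expectation (\<lambda>w. td n w * (X w)\<^sup>2)"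
    by (rule tilt_mean[OF s]) (use Xm td in auto)
  have e2: "expectation (\<lambda>w. td n w * X w * q ?s w * (tf ?s w * te ?s w)) = 0"
    by (rule tilt_centred[OF s]) (use Xm td m in auto)
  have e3: "expectation (\<lambda>w. td n w * (q ?s w)\<^sup>2 * (tf ?s w * (te ?s w)\<^sup>2)) \<le> tilt_var_const \<sigma> * expectation (\<lambda>w. td n w * (q ?s w)\<^sup>2)"
    by (rule tilt_variance[OF s]) (use td m td_nonneg[OF nT] in auto)
  have e4: "expectation (\<lambda>w. td n w * Q w * tf ?s w) = expectation (\<lambda>w. td n w * Q w)"
    by (rule tilt_mean[OF s]) (use Qm td in auto)
  have "expectation (\<lambda>w. td ?s w * (\<Sum>s=1..?s. q s w * te s w)\<^sup>2)
      = expectation (\<lambda>w. td n w * (X w)\<^sup>2 * tf ?s w + 2 * (td n w * X w * q ?s w * (tf ?s w * te ?s w))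
        + td n w * (q ?s w)\<^sup>2 * (tf ?s w * (te ?s w)\<^sup>2))"
    proof (intro Bochner_Integration.integral_cong refl)
    fix w
    have "(\<Sum>s=1..?s. q s w * te s w) = X w + q ?s w * te ?s w" by (simp add: X_def)
    show "td ?s w * (\<Sum>s=1..?s. q s w * te s w)\<^sup>2 = td n w * (X w)\<^sup>2 * tf ?s w
        + 2 * (td n w * X w * q ?s w * (tf ?s w * te ?s w)) + td n w * (q ?s w)\<^sup>2 * (tf ?s w * (te ?s w)\<^sup>2)"
      unfolding \<open>(\<Sum>s=1..?s. q s w * te s w) = _\<close> td_Suc by (simp add: power2_eq_square algebra_simps)
  qed
  also have "... = expectation (\<lambda>w. td n w * (X w)\<^sup>2 * tf ?s w)
      + 2 * expectation (\<lambda>w. td n w * X w * q ?s w * (tf ?s w * te ?s w))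
      + expectation (\<lambda>w. td n w * (q ?s w)\<^sup>2 * (tf ?s w * (te ?s w)\<^sup>2))"
    using Xm td(2) m
    by (simp only: expectation_linear)
  also have "... \<le> tilt_var_const \<sigma> * expectation (\<lambda>w. td n w * (\<Sum>s=1..n. (q s w)\<^sup>2)) + tilt_var_const \<sigma> * expectation (\<lambda>w. td n w * (q ?s w)\<^sup>2)"
    using e1 e2 e3 Suc.IH[OF nT] by (simp add: X_def)
  also have "... = tilt_var_const \<sigma> * expectation (\<lambda>w. td n w * (\<Sum>s=1..n. (q s w)\<^sup>2) + td n w * (q ?s w)\<^sup>2)"
  proof -
    have "all_moments (\<lambda>w. \<Sum>s=1..n. (q s w)\<^sup>2)" using qm by (intro all_moments_sum all_moments_power) auto
    then show ?thesis using td(2) m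
      by (subst Bochner_Integration.integral_add) (auto intro!: all_moments_integrable simp: algebra_simps)
  qed
  also have "... = tilt_var_const \<sigma> * expectation (\<lambda>w. td n w * Q w)" by (simp add: Q_def algebra_simps)
  also have "expectation (\<lambda>w. td n w * Q w) = expectation (\<lambda>w. td ?s w * Q w)"
    unfolding e4[symmetric] by (simp add: td_Suc mult_ac)
  finally show ?case by (simp add: Q_def)
qed

end

section \<open>Small exploration parameter\<close>

text \<open>Below this value 36 \<beta>^2 d \<le> 1, and growth can be started at time 0 with K = 3
  since the initial trace is at most d. Above it, the start-up phase applies with this value as
  \<kappa>.\<close>

definition small_beta :: "real \<Rightarrow> real" where "small_beta d = 1 / (6 * sqrt d)"

definition "optA d = trace_const d (small_beta d) 3"
definition "optD d = B_const d (small_beta d) 3"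
definition "optC d = crude_const d (small_beta d) 3"

lemma opt_consts:
  assumes d1: "1 \<le> d"
  shows "36 * d \<le> optC d" "8 * d \<le> optA d" "320 * d^2 * 3 \<le> optA d" "2 + 36 * optA d \<le> optD d"
proof -
  have sb: "1 / (small_beta d)\<^sup>2 = 36 * d" using d1 by (simp add: small_beta_def power_divide power_mult_distrib)
  show C: "36 * d \<le> optC d"
    unfolding optC_def crude_const_def sb using d1 by simp
  then have C0: "36 \<le> optC d" using d1 by linarith
  show A: "320 * d^2 * 3 \<le> optA d"
    unfolding optA_def trace_const_def using C0 by (simp add: optC_def)
  have "d * 1 \<le> d * d" using d1 by (intro mult_left_mono) auto
  then show "8 * d \<le> optA d" using A d1 unfolding power2_eq_square by linarith
  have "1 \<le> sqrt (2 * optC d)" using C0 by simp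
  then have "2 \<le> 3 * sqrt (2 * optC d)" by linarith
  then show "2 + 36 * optA d \<le> optD d" unfolding optD_def B_const_def by (simp add: optC_def optA_def)
qed

context ucb_path
begin

definition "opt_upto n \<longleftrightarrow> (\<forall>r\<le>n. seminorm_of (Lam r) (th - hh r) \<le> \<beta>)"

text \<open>Optimism tested at the normalised vector Lam (th - hh), the direction in which the
  linear deficit is largest relative to the bonus, gives membership of th in the confidence
  ellipsoid around hh.\<close>

lemma optimism_dist:
  assumes opt: "\<And>x. x \<in> cball 0 1 \<Longrightarrow> x \<bullet> th \<le> ucb_score \<beta> (Lam t) (hh t) x"
  shows "seminorm_of (Lam t) (th - hh t) \<le> \<beta>"
proof (cases "th - hh t = 0")
  case True then show ?thesis using b_pos by (simp add: seminorm_of_def)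
next
  case False
  define u where "u = th - hh t"
  have u0: "u \<noteq> 0" using False by (simp add: u_def)
  define s where "s = seminorm_of (Lam t) u"
  have "0 < sqrt (el t) * norm u" using u0 D.ell_pos[of t] by simp
  then have s0: "0 < s" using D.nL_ge[of t u] unfolding s_def by linarith
  have ss: "u \<bullet> (Lam t *v u) = s^2"
    unfolding s_def seminorm_of_def using D.Lam_psd[of u t] by simp
  have l0: "Lam t *v u \<noteq> 0" using ss s0 by auto
  define c where "c = 1 / norm (Lam t *v u)"
  have c0: "0 < c" using l0 by (simp add: c_def)
  define x where "x = c *\<^sub>R (Lam t *v u)"
  have "x \<in> cball 0 1" using l0 by (simp add: x_def c_def)
  from opt[OF this] have "x \<bullet> th \<le> x \<bullet> hh t + \<beta> * sqrt (x \<bullet> (G t *v x))" by (simp add: ucb_score_def D.Gm_def)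
  then have "x \<bullet> u \<le> \<beta> * sqrt (x \<bullet> (G t *v x))" by (simp add: u_def inner_diff_right)
  moreover have "x \<bullet> u = c * s^2" by (simp add: x_def ss inner_commute[of _ u])
  moreover have "x \<bullet> (G t *v x) = c^2 * s^2"
    by (simp add: x_def matrix_vector_mult_scaleR D.Gm_Lam inner_commute[of _ u] ss power2_eq_square)
  ultimately have "c * s^2 \<le> \<beta> * (c * s)" using c0 s0 by (simp add: real_sqrt_mult)
  then have "c * s * s \<le> c * s * \<beta>" by (simp add: power2_eq_square mult_ac)
  then show ?thesis using c0 s0 by (simp add: s_def u_def)
qed

lemma optimistic_y_le:
  assumes "seminorm_of (Lam r) (th - hh r) \<le> \<beta>" "r < T"
  shows "norm (y (Suc r)) \<le> 3 * \<beta> * sqrt (ta r)"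
proof -
  have "sqrt (el r) * norm (hh r - th) \<le> \<beta>"
    using D.nL_ge[of r "th - hh r"] assms(1) by (simp add: norm_minus_commute)
  then have "norm (hh r - th) \<le> (3 - 2) * \<beta> / sqrt (el r)" using D.ell_pos[of r] by (simp add: field_simps)
  from a_dist[OF assms(2) this] have "norm (a (Suc r) - th) \<le> 3 * \<beta> * (1 / sqrt (el r))" by simp
  also have "... \<le> 3 * \<beta> * sqrt (ta r)"
    using inverse_sqrt_el_le[of r] b_pos by (intro mult_left_mono) auto
  finally show ?thesis using y_le_dist[of "Suc r"] by linarith
qed

lemma optimistic_growth_large:
  assumes opt: "opt_upto n" "n < T" and b: "small_beta (real CARD('d)) \<le> \<beta>" and n: "6 * optC (real CARD('d)) * \<beta>^2 \<le> real n"
  shows "ta n * \<beta> * sqrt (real n) \<le> optA (real CARD('d))" "B n \<le> optD (real CARD('d)) * \<beta> * sqrt (real n)" "real n / 2 \<le> p n"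
proof -
  \<comment> \<open>Optimism is assumed only up to n, while the growth lemma asks for the bound on y
    in every round before its horizon; the path is therefore cut at n + 1.\<close>
  have T: "ucb_path a th hh \<beta> (Suc n)" by unfold_locales (use opt(2) b_pos norm_hh_one path_argmax norm_th_one in auto)
  interpret R: ucb_path a th hh \<beta> "Suc n" by (rule T)
  define k where "k = small_beta (real CARD('d))"
  have k0: "0 < k" by (simp add: k_def small_beta_def)
  define s0 where "s0 = nat \<lceil>crude_const (real CARD('d)) k 3 * \<beta>^2\<rceil>"
  have K2: "2 \<le> (3::real)" by simp
  note cs = R.crude_start[OF k0 b[folded k_def] K2, folded s0_def]
  have n3: "3 * s0 \<le> n" using cs(2) n unfolding optC_def k_def[symmetric] by linarith
  have yl: "norm (y (Suc r)) \<le> 3 * \<beta> * sqrt (ta r)" if "s0 \<le> r" "r < Suc n" for r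
    using opt(1) that opt(2) by (intro optimistic_y_le) (auto simp: opt_upto_def)
  have s0n: "s0 \<le> Suc n" "s0 \<le> n" "n \<le> Suc n" using n3 by simp_all
  note g = R.growth_after[OF K2 cs(8,9,3) cs(4)[OF s0n(1)] cs(5,6,7) yl s0n(2,3)]
  have D: "3 * sqrt (2 * crude_const (real CARD('d)) k 3) + 4 * 3\<^sup>2 * trace_const (real CARD('d)) k 3 = optD (real CARD('d))"
    by (simp add: optD_def B_const_def k_def)
  show "ta n * \<beta> * sqrt (real n) \<le> optA (real CARD('d))" unfolding optA_def k_def[symmetric] by (rule g(1); assumption)
  show "B n \<le> optD (real CARD('d)) * \<beta> * sqrt (real n)" unfolding D[symmetric] by (rule g(2); assumption)
  show "real n / 2 \<le> p n" using n3 by (intro g(5))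
qed

lemma optimistic_growth_small:
  assumes opt: "opt_upto n" "n < T" and b: "\<beta> < small_beta (real CARD('d))" and n: "1 \<le> \<beta> * sqrt (real n)"
  shows "ta n * \<beta> * sqrt (real n) \<le> optA (real CARD('d))" "B n \<le> optD (real CARD('d)) * \<beta> * sqrt (real n)" "real n / 2 \<le> p n"
proof -
  define d where "d = real CARD('d)"
  have d1: "1 \<le> d" by (simp add: d_def)
  have b0: "0 < \<beta>" by (rule b_pos)
  define A where "A = optA (real CARD('d))"
  have A8: "8 * d \<le> A" and A3: "320 * d^2 * 3 \<le> A" using opt_consts[of d] d1 unfolding A_def d_def by blast+
  have A0: "0 < A" using A8 d1 by linarith
  have T: "ucb_path a th hh \<beta> (Suc n)" by unfold_locales (use opt(2) b_pos norm_hh_one path_argmax norm_th_one in auto)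
  interpret R: ucb_path a th hh \<beta> "Suc n" by (rule T)
  have bd: "36 * \<beta>^2 * d \<le> 1"
  proof -
    have "\<beta>^2 \<le> (small_beta d)\<^sup>2" using b b0 unfolding d_def by (intro power_mono) auto
    also have "... = 1 / (36 * d)" using d1 by (simp add: small_beta_def power_divide power_mult_distrib)
    finally show ?thesis using d1 by (simp add: le_divide_eq mult_ac)
  qed
  have ta0: "ta 0 \<le> d"
  proof -
    have "ta 0 \<le> d / el 0" unfolding d_def by (rule D.tau_le)
    also have "... \<le> d / 1" using D.ell_ge_one[of 0] d1 by (intro divide_left_mono) auto
    finally show ?thesis by simp
  qed
  \<comment> \<open>Up to time x the crude bound ta \<le> d already keeps ta \<beta> sqrt r below
    A.\<close>
  define x where "x = (A / (d * \<beta>))\<^sup>2"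
  have xd: "64 / \<beta>^2 \<le> x"
  proof -
    have "8 / \<beta> \<le> A / (d * \<beta>)" using A8 d1 b0 by (simp add: field_simps)
    then have "(8 / \<beta>)\<^sup>2 \<le> x" unfolding x_def using b0 by (intro power_mono) auto
    then show ?thesis by (simp add: power_divide)
  qed
  have b1: "\<beta>^2 \<le> 1" using bd d1 mult_left_mono[OF d1, of "36 * \<beta>^2"] by simp
  have b64: "64 \<le> 64 / \<beta>^2" using b1 b0 by (simp add: le_divide_eq)
  define r1 where "r1 = nat \<lfloor>x\<rfloor>"
  have r1x: "real r1 \<le> x" "x < real r1 + 1" using xd b64 unfolding r1_def by linarith+
  have r11: "1 \<le> r1" using r1x xd b64 by linarith
  have r1b: "1 / \<beta>^2 \<le> real r1"
  proof -
    have "1 / \<beta>^2 = 1 / 64 * (64 / \<beta>^2)" by simp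
    then show ?thesis using r1x xd b64 by linarith
  qed
  have gr: "ta n * \<beta> * sqrt (real n) \<le> A \<and> B n \<le> B 0 + 1 + 4 * 3\<^sup>2 * A * \<beta> * sqrt (real n) \<and>
    norm (z n) \<le> real 0 + 1 + 4 * 3 * sqrt (A * \<beta>) * (sqrt (real n) * sqrt (sqrt (real n))) \<and>
    1 + 3 / 4 * (real n - real 0) \<le> p n"
  proof (rule R.growth[of 0 r1 n])
    show "norm (y (Suc r)) \<le> 3 * \<beta> * sqrt (ta r)" if "r < n" for r
      using opt that by (intro optimistic_y_le) (auto simp: opt_upto_def)
    show "ta r * \<beta> * sqrt (real r) \<le> A" if "r \<le> r1" for r
    proof -
      have "sqrt (real r) \<le> sqrt x" using that r1x by simp
      also have "... = A / (d * \<beta>)" using A0 d1 b0 by (simp add: x_def)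
      finally have s: "sqrt (real r) \<le> A / (d * \<beta>)" .
      have "ta r \<le> d" using ta_mono[of 0 r] ta0 by simp
      then have "ta r * \<beta> * sqrt (real r) \<le> d * \<beta> * (A / (d * \<beta>))"
        using s b0 d1 by (intro mult_mono) auto
      also have "... = A" using d1 b0 by simp
      finally show ?thesis .
    qed
    show "4 * 3\<^sup>2 * \<beta>^2 * ta 0 \<le> 1"
    proof -
      have "36 * \<beta>^2 * ta 0 \<le> 36 * \<beta>^2 * d" using ta0 by (intro mult_left_mono) auto
      then show ?thesis using bd by simp
    qed
    show "real 0 + 1 \<le> sqrt (A * \<beta>) * (sqrt (real s) * sqrt (sqrt (real s)))" if "r1 \<le> s" for s
    proof -
      have s1: "1 / \<beta>^2 \<le> real s" "1 \<le> real s" using that r1b r11 by linarith+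
      have "sqrt (1 / \<beta>^2) \<le> sqrt (real s)" using s1(1) by (rule real_sqrt_le_mono)
      then have bs: "1 \<le> \<beta> * sqrt (real s)" using b0 by (simp add: real_sqrt_divide divide_le_eq mult.commute)
      have "1 \<le> A" using A8 d1 by linarith
      then have "1 * 1 \<le> A * (\<beta> * sqrt (real s))" using bs by (intro mult_mono) auto
      then have "1 \<le> sqrt (A * \<beta> * sqrt (real s))" by (simp add: mult.assoc)
      also have "... = sqrt (A * \<beta>) * sqrt (sqrt (real s))" by (rule real_sqrt_mult)
      finally have 1: "1 \<le> sqrt (A * \<beta>) * sqrt (sqrt (real s))" .
      have "1 * 1 \<le> (sqrt (A * \<beta>) * sqrt (sqrt (real s))) * sqrt (real s)" using 1 s1 by (intro mult_mono) auto
      then show ?thesis by (simp add: mult_ac)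
    qed
  qed (use r11 A8 A3 in \<open>auto simp: d_def\<close>)
  show "ta n * \<beta> * sqrt (real n) \<le> optA (real CARD('d))" using gr by (simp add: A_def)
  have "B n \<le> 2 * 1 + 36 * A * (\<beta> * sqrt (real n))" using gr by (simp add: B_0 mult.assoc)
  also have "... \<le> 2 * (\<beta> * sqrt (real n)) + 36 * A * (\<beta> * sqrt (real n))" using n A0 b0 by (intro add_mono mult_left_mono mult_right_mono) auto
  also have "... = (2 + 36 * A) * (\<beta> * sqrt (real n))" by (simp add: distrib_right)
  also have "... \<le> optD (real CARD('d)) * (\<beta> * sqrt (real n))" using opt_consts(4)[of d] d1 n by (intro mult_right_mono) (auto simp: A_def d_def)
  finally show "B n \<le> optD (real CARD('d)) * \<beta> * sqrt (real n)" by (simp add: mult.assoc)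
  show "real n / 2 \<le> p n" using gr by simp
qed

text \<open>In the dual norm the component along th weighs like 1 / sqrt n and the orthogonal part
  like 1 / sqrt l. The comparability of B and el keeps the two from interacting by more than a
  factor 1 + sqrt J.\<close>

lemma seminorm_le_components:
  assumes J: "B n \<le> J * el n" and p2: "real n / 2 \<le> p n" and n1: "1 \<le> n" and l: "0 < l" "l \<le> el n"
  shows "seminorm_of (G n) s \<le> norm (proj_orth th s) / sqrt l + \<bar>s \<bullet> th\<bar> * (1 + sqrt J) / sqrt (real n / 2)"
proof -
  define x where "x = G n *v s"
  define X where "X = seminorm_of (Lam n) x"
  have XS: "X = seminorm_of (G n) s" by (simp add: X_def x_def D.nL_Gm)
  define al where "al = x \<bullet> th"
  define v where "v = proj_orth th x"
  have xd: "x = al *\<^sub>R th + v" by (simp add: v_def al_def proj_orth_def)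
  have vth: "v \<bullet> th = 0" by (simp add: v_def proj_orth_inner norm_th_one)
  have el0: "0 < el n" by (rule D.ell_pos)
  have nv: "norm v \<le> norm x" unfolding v_def by (rule norm_proj_orth_le[OF norm_th_one])
  have J0: "0 \<le> J" using J B_ge_one[of n] el0 by (smt (verit) mult_nonpos_nonneg)
  have X0: "0 \<le> X" by (simp add: X_def seminorm_of_def D.Lam_psd)
  have v1: "norm v \<le> X / sqrt (el n)"
  proof -
    have "sqrt (el n) * norm v \<le> sqrt (el n) * norm x" using nv el0 by (intro mult_left_mono) auto
    also have "... \<le> X" unfolding X_def by (rule D.nL_ge)
    finally show ?thesis using el0 by (simp add: field_simps)
  qed
  have vl: "norm v \<le> X / sqrt l"
  proof -
    have "X / sqrt (el n) \<le> X / sqrt l" using l X0 by (intro divide_left_mono) auto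
    then show ?thesis using v1 by linarith
  qed
  have Lv: "seminorm_of (Lam n) v \<le> sqrt J * X"
  proof -
    have "v \<bullet> (Lam n *v v) \<le> B n * (norm v)\<^sup>2" by (rule quad_le_B[OF vth])
    then have "seminorm_of (Lam n) v \<le> sqrt (B n * (norm v)\<^sup>2)" unfolding seminorm_of_def by (rule real_sqrt_le_mono)
    also have "... = sqrt (B n) * norm v" by (simp add: real_sqrt_mult)
    also have "... \<le> sqrt (J * el n) * (X / sqrt (el n))" using J v1 J0 el0 by (intro mult_mono) auto
    also have "... = sqrt J * X" using el0 by (simp add: real_sqrt_mult)
    finally show ?thesis .
  qed
  have pa: "sqrt (p n) * \<bar>al\<bar> = seminorm_of (Lam n) (al *\<^sub>R th)"
    by (simp add: seminorm_of_scaleR) (simp add: seminorm_of_def D.pp_def)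
  have "al *\<^sub>R th = x - v" using xd by simp
  then have "sqrt (p n) * \<bar>al\<bar> \<le> X + sqrt J * X"
    using D.nL_triangle[of n x "- v"] Lv unfolding pa X_def by (simp add: seminorm_of_minus)
  moreover have "sqrt (real n / 2) * \<bar>al\<bar> \<le> sqrt (p n) * \<bar>al\<bar>" using p2 by (intro mult_right_mono) auto
  ultimately have al1: "\<bar>al\<bar> \<le> X * (1 + sqrt J) / sqrt (real n / 2)"
    using n1 by (simp add: le_divide_eq algebra_simps)
  have "X^2 = s \<bullet> x" by (simp add: XS seminorm_of_def x_def D.Gm_psd)
  also have "... = (s \<bullet> th) * al + proj_orth th s \<bullet> v"
  proof -
    have "s = (s \<bullet> th) *\<^sub>R th + proj_orth th s" by (simp add: proj_orth_def)
    then have "s \<bullet> v = ((s \<bullet> th) *\<^sub>R th + proj_orth th s) \<bullet> v" by simp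
    then show ?thesis using vth by (subst xd) (simp add: inner_add_left inner_add_right inner_commute[of th])
  qed
  also have "... \<le> \<bar>s \<bullet> th\<bar> * \<bar>al\<bar> + norm (proj_orth th s) * norm v"
  proof (rule add_mono)
    show "(s \<bullet> th) * al \<le> \<bar>s \<bullet> th\<bar> * \<bar>al\<bar>" by (metis abs_ge_self abs_mult)
    show "proj_orth th s \<bullet> v \<le> norm (proj_orth th s) * norm v" by (rule norm_cauchy_schwarz)
  qed
  also have "... \<le> \<bar>s \<bullet> th\<bar> * (X * (1 + sqrt J) / sqrt (real n / 2)) + norm (proj_orth th s) * (X / sqrt l)"
    using al1 vl by (intro add_mono mult_left_mono) auto
  also have "... = X * (norm (proj_orth th s) / sqrt l + \<bar>s \<bullet> th\<bar> * (1 + sqrt J) / sqrt (real n / 2))"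
    by (simp add: algebra_simps)
  finally have XX: "X * X \<le> X * (norm (proj_orth th s) / sqrt l + \<bar>s \<bullet> th\<bar> * (1 + sqrt J) / sqrt (real n / 2))"
    by (simp add: power2_eq_square)
  show ?thesis
  proof (cases "X = 0")
    case True
    then show ?thesis unfolding XS[symmetric] using J0 l by simp
  next
    case False
    then show ?thesis unfolding XS[symmetric] using XX X0 by simp
  qed
qed

text \<open>If the estimator were close to \<open>th\<close>, it could not also absorb the shift \<open>\<nu>\<close> of the noise.\<close>

lemma shift_le:
  assumes nrm: "normalised e" and n: "n \<le> T" and opt: "seminorm_of (Lam n) (th - hh n) \<le> \<beta>"
    and l: "0 < l" "l \<le> el n" "2 * \<beta> \<le> sqrt l"
    and nu: "\<nu> \<bullet> th = 0" "norm \<nu> \<le> 1"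
    and X: "seminorm_of (G n) (SS e n - (Lam n *v \<nu> - \<nu>)) \<le> X"
  shows "sqrt l * norm \<nu> \<le> 2 * \<beta> + 2 * X + 4"
proof -
  define tb where "tb = rd e n"
  define \<rho> where "\<rho> = norm tb"
  have b0: "0 < \<beta>" by (rule b_pos)
  have tbh: "tb = \<rho> *\<^sub>R hh n" using nrm n by (cases "tb = 0") (auto simp: normalised_def tb_def \<rho>_def)
  define s where "s = SS e n - (Lam n *v \<nu> - \<nu>)"
  have tbe: "tb - th = G n *v (s - (th + \<nu>)) + \<nu>"
    unfolding tb_def rd_eq s_def by (simp add: matrix_vector_mult_diff_distrib D.Gm_Lam algebra_simps matrix_vector_right_distrib)
  have nth: "norm (th + \<nu>) \<le> 2" using norm_triangle_ineq[of th \<nu>] nu(2) norm_th_one by linarith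
  have Gth: "seminorm_of (G n) (th + \<nu>) \<le> 2"
  proof -
    have "(th + \<nu>) \<bullet> (G n *v (th + \<nu>)) \<le> (norm (th + \<nu>))\<^sup>2" by (rule D.Gm_quad_le_one)
    then have "seminorm_of (G n) (th + \<nu>) \<le> sqrt ((norm (th + \<nu>))\<^sup>2)" unfolding seminorm_of_def by (rule real_sqrt_le_mono)
    then show ?thesis using nth by simp
  qed
  \<comment> \<open>The estimator hh is normalised, so the length \<rho> of the ridge estimator is a
    further unknown. As \<nu> is orthogonal to th, the norm of u controls both |\<nu>| and |1 -
    \<rho>|, and 2 \<beta> \<le> sqrt l absorbs the latter.\<close>
  define u where "u = (1 - \<rho>) *\<^sub>R th + \<nu>"
  have ueq: "u = \<rho> *\<^sub>R (hh n - th) - G n *v (s - (th + \<nu>))"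
    using tbe unfolding tbh u_def by (simp add: algebra_simps)
  have \<rho>0: "0 \<le> \<rho>" by (simp add: \<rho>_def)
  have Lu: "seminorm_of (Lam n) u \<le> \<rho> * \<beta> + (X + 2)"
  proof -
    have "seminorm_of (Lam n) u \<le> seminorm_of (Lam n) (\<rho> *\<^sub>R (hh n - th)) + seminorm_of (Lam n) (- (G n *v (s - (th + \<nu>))))"
      unfolding ueq using D.nL_triangle[of n "\<rho> *\<^sub>R (hh n - th)" "- (G n *v (s - (th + \<nu>)))"] by simp
    also have "seminorm_of (Lam n) (- (G n *v (s - (th + \<nu>)))) = seminorm_of (G n) (s - (th + \<nu>))"
      by (simp add: seminorm_of_minus D.nL_Gm)
    also have "... \<le> seminorm_of (G n) s + seminorm_of (G n) (th + \<nu>)"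
      unfolding diff_conv_add_uminus[of s]
      using D.nG_triangle[of n s "- (th + \<nu>)"] seminorm_of_minus[of "G n" "th + \<nu>"] by linarith
    also have "... \<le> X + 2" using X Gth unfolding s_def by linarith
    also have "seminorm_of (Lam n) (\<rho> *\<^sub>R (hh n - th)) = \<rho> * seminorm_of (Lam n) (th - hh n)"
      using \<rho>0 seminorm_of_minus[of "Lam n" "th - hh n"] by (simp add: seminorm_of_scaleR)
    also have "... \<le> \<rho> * \<beta>" using opt \<rho>0 by (rule mult_left_mono)
    finally show ?thesis by simp
  qed
  have sl: "sqrt l * norm u \<le> \<rho> * \<beta> + (X + 2)"
  proof -
    have "sqrt l * norm u \<le> sqrt (el n) * norm u" using l by (intro mult_right_mono) auto
    then show ?thesis using D.nL_ge[of n u] Lu by linarith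
  qed
  have u2: "(norm u)\<^sup>2 = (1 - \<rho>)\<^sup>2 + (norm \<nu>)\<^sup>2"
  proof -
    have "orthogonal ((1 - \<rho>) *\<^sub>R th) \<nu>" using nu(1) by (simp add: orthogonal_def inner_commute)
    from norm_add_Pythagorean[OF this] show ?thesis by (simp add: u_def norm_th_one power_mult_distrib)
  qed
  have un: "norm \<nu> \<le> norm u" by (rule power2_le_imp_le) (simp_all add: u2)
  have ur: "\<bar>1 - \<rho>\<bar> \<le> norm u" by (rule power2_le_imp_le) (simp_all add: u2)
  define t where "t = \<bar>1 - \<rho>\<bar>"
  have l0: "0 \<le> sqrt l" using l(1) by simp
  have "sqrt l * t \<le> \<rho> * \<beta> + (X + 2)" using sl mult_left_mono[OF ur l0] unfolding t_def by linarith
  moreover have "\<rho> * \<beta> \<le> (1 + t) * \<beta>" using b0 unfolding t_def by (intro mult_right_mono) auto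
  moreover have "2 * \<beta> * t \<le> sqrt l * t" using l(3) by (intro mult_right_mono) (auto simp: t_def)
  ultimately have "\<rho> * \<beta> \<le> 2 * \<beta> + (X + 2)" by (simp add: distrib_right) argo
  moreover have "sqrt l * norm \<nu> \<le> sqrt l * norm u" using un l(1) by (intro mult_left_mono) auto
  ultimately show ?thesis using sl by linarith
qed

end

text \<open>The tilt needs its variance bound on every outcome, not just on the optimistic event. B
  at time s is determined by the actions up to s, hence predictable, and monotone, so dropping
  rounds with B > b caps the sum.\<close>

lemma (in design) truncated_sum_le:
  assumes "0 \<le> b"
  shows "(\<Sum>s=1..n. if B s \<le> b then (norm (y s))\<^sup>2 else 0) \<le> b"
proof -
  have "(\<Sum>s=1..n. if B s \<le> b then (norm (y s))\<^sup>2 else 0) \<le> b \<and>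
      (\<Sum>s=1..n. if B s \<le> b then (norm (y s))\<^sup>2 else 0) \<le> B n"
  proof (induction n)
    case 0 show ?case using assms by (simp add: B_0)
  next
    case (Suc n)
    show ?case
    proof (cases "B (Suc n) \<le> b")
      case True then show ?thesis using Suc B_Suc[of n] by simp
    next
      case False then show ?thesis using Suc B_mono[of n "Suc n"] by simp
    qed
  qed
  then show ?thesis ..
qed

lemma abs_component_le: "\<bar>x $ i\<bar> \<le> norm x" for x :: "real^'d" by (rule component_le_norm_cart)

lemma sum_components_sq: "(\<Sum>i\<in>UNIV. (x $ i)\<^sup>2) = (norm x)\<^sup>2" for x :: "real^'d"
  unfolding power2_norm_eq_inner inner_vec_def by (simp add: power2_eq_square)

text \<open>Eight times the variance constant: the statistic compared with it has tilted mean at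
  most twice that constant, so its contribution by Markov's inequality is 1/4.\<close>

definition thr_const :: "real \<Rightarrow> real" where "thr_const \<sigma> = 8 * tilt_var_const \<sigma>"

definition dev_const :: "real \<Rightarrow> real \<Rightarrow> real" where
  "dev_const \<sigma> J = sqrt (thr_const \<sigma> * J) + 1 + (1 + sqrt J) * (sqrt (2 * thr_const \<sigma>) + 1)"

text \<open>Chosen so that nu_const * bt exceeds 2 \<beta> + 2 dev_const + 4, the bound of
  \<open>shift_le\<close>, whenever bt is at least 1 and at least \<beta>.\<close>

definition nu_const :: "real \<Rightarrow> real \<Rightarrow> real" where "nu_const \<sigma> J = 2 * dev_const \<sigma> J + 7"

context linucb_unit
begin

text \<open>Under a tilt that shifts the noise by \<nu> . a, the recentred noise is typically small.
  On E this is impossible by \<open>shift_le\<close>, since there the estimator would have to stay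
  near \<theta> and also follow \<nu>. So the tilted law puts most of its mass off E, against the
  second moment of its density and the small probability of that complement.\<close>

lemma not_optimistic:
  fixes n :: nat and l b J bt V :: real
  assumes d2: "2 \<le> CARD('d)" and s0: "0 < \<sigma>" and n: "1 \<le> n" "n \<le> T"
    and E: "E \<in> sets M" "1 - 1 / ln (real T) \<le> prob E"
    and opt: "\<And>w. w \<in> E \<Longrightarrow> seminorm_of (design_matrix (\<lambda>s. a s w) n) (\<theta> - \<theta>h n w) \<le> \<beta>"
    and ell: "\<And>w. w \<in> E \<Longrightarrow> l \<le> ell_at w n"
    and Bb: "\<And>w. w \<in> E \<Longrightarrow> design.B (\<lambda>s. a s w) \<theta> n \<le> b"
    and pn: "\<And>w. w \<in> E \<Longrightarrow> real n / 2 \<le> posdef_dir.pp (design_matrix (\<lambda>s. a s w) n) \<theta>"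
    and l: "0 < l" "b = J * l" "1 \<le> J" and bt: "1 \<le> bt" "\<beta> \<le> bt"
    and V: "V = (nu_const \<sigma> J)\<^sup>2 * bt^2 * J / \<sigma>^4"
    and small: "nu_const \<sigma> J * bt \<le> sqrt l" "nu_const \<sigma> J * bt \<le> \<sigma>^2 * sqrt l" "nu_const \<sigma> J * bt \<le> \<sigma> * sqrt l"
      "cubic_const \<sigma> * V \<le> 2 * sqrt l" "cubic_const \<sigma> * V \<le> sqrt (real n)"
    and big: "exp (tilt_square_const \<sigma> * V) \<le> ln (real T) / 16"
  shows False
proof -
  define An where "An = nu_const \<sigma> J"
  define X0 where "X0 = dev_const \<sigma> J"
  define thr where "thr = thr_const \<sigma>"
  have thr0: "0 < thr" using tilt_const_pos(2)[of \<sigma>] by (simp add: thr_def thr_const_def)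
  have X00: "0 \<le> X0" using thr0 l by (simp add: X0_def dev_const_def thr_def)
  have An7: "7 \<le> An" using X00 by (simp add: An_def nu_const_def X0_def)
  have sl: "0 < sqrt l" using l by simp
  have b0: "0 < b" using l by simp
  have es: "0 < ln (real T)" using ln_T_ge_one by simp
  obtain u :: "real^'d" where u: "norm u = 1" "u \<bullet> \<theta> = 0" using exists_unit_orthogonal[OF d2] by blast
  \<comment> \<open>The length with sqrt l * r = An * bt. The three smallness assumptions then make
    |\<nu>| \<le> 1, |k| \<le> 1 and \<sigma>^2 k^2 \<le> 1.\<close>
  define r where "r = An * bt / sqrt l"
  have r0: "0 \<le> r" using An7 bt sl by (simp add: r_def)
  have r1: "r \<le> 1" "r \<le> \<sigma>^2" "r \<le> \<sigma>"
    using small(1-3) sl by (simp_all add: r_def An_def divide_le_eq)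
  have rV: "r^2 * b / \<sigma>^4 = V"
    using l sl by (simp add: V r_def An_def power_divide power_mult_distrib)
  define \<nu> where "\<nu> = r *\<^sub>R u"
  have nu: "norm \<nu> = r" "\<nu> \<bullet> \<theta> = 0" using u r0 by (simp_all add: \<nu>_def)
  have Des: "design \<theta>" by unfold_locales (rule norm_theta)
  define Bf where "Bf s w = design.B (\<lambda>s. a s w) \<theta> s" for s w
  \<comment> \<open>Division by \<sigma>^2 makes the induced shift of the noise equal to \<nu> . a;
    the truncation keeps the sum of k^2 below V everywhere.\<close>
  define k where "k s w = (if Bf s w \<le> b then (\<nu> \<bullet> a s w) / \<sigma>^2 else 0)" for s w
  have am: "a r \<in> borel_measurable (F (s - 1))" if "1 \<le> r" "r \<le> s" "s \<in> {1..T}" for r s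
    using that by (intro a_measurable_F) auto
  have Bm: "Bf s \<in> borel_measurable (F (s - 1))" if "s \<in> {1..T}" for s
  proof -
    have m: "(\<lambda>w. (norm (proj_orth \<theta> (a r w)))\<^sup>2) \<in> borel_measurable (F (s - 1))" if "r \<in> {1..s}" for r
    proof -
      have [measurable]: "(\<lambda>w. proj_orth \<theta> (a r w)) \<in> borel_measurable (F (s - 1))"
        using that \<open>s \<in> {1..T}\<close> by (intro measurable_proj_orth am) auto
      show ?thesis by measurable
    qed
    have "Bf s = (\<lambda>w. 1 + (\<Sum>r=1..s. (norm (proj_orth \<theta> (a r w)))\<^sup>2))"
      unfolding Bf_def design.B_def[OF Des] ..
    also have "... \<in> borel_measurable (F (s - 1))"
      by (intro borel_measurable_add borel_measurable_sum m) auto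
    finally show ?thesis .
  qed
  have Bset: "{w \<in> space (F (s - 1)). Bf s w \<le> b} \<in> sets (F (s - 1))" if "s \<in> {1..T}" for s
    using Bm[OF that] by measurable
  have an: "norm (a s w) = 1" if "s \<in> {1..T}" "w \<in> space M" for s w
  proof -
    interpret P: ucb_path "\<lambda>s. a s w" \<theta> "\<lambda>t. \<theta>h t w" \<beta> T by (rule path_at[OF that(2)])
    show ?thesis using P.norm_a_one[of s] that(1) by simp
  qed
  have kr: "\<bar>k s w\<bar> \<le> r / \<sigma>^2" if "s \<in> {1..T}" "w \<in> space M" for s w
  proof -
    have "\<bar>\<nu> \<bullet> a s w\<bar> \<le> r" using Cauchy_Schwarz_ineq2[of \<nu> "a s w"] an[OF that] nu by simp
    then show ?thesis using r0 by (simp add: k_def divide_right_mono)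
  qed
  interpret Ti: tilted_run M \<theta> \<sigma> \<beta> T a \<epsilon> \<theta>h k
  proof
    fix s assume s: "s \<in> {1..T}"
    have [measurable]: "a s \<in> borel_measurable (F (s - 1))" using s by (intro action_predictable)
    show "k s \<in> borel_measurable (F (s - 1))"
      unfolding k_def by (rule measurable_If[OF _ _ Bset[OF s]]) measurable
    fix w assume w: "w \<in> space M"
    show "\<bar>k s w\<bar> \<le> 1" using order_trans[OF kr[OF s w]] r1(2) s0 by (simp add: divide_le_eq)
    have "\<bar>k s w\<bar>\<^sup>2 \<le> (r / \<sigma>^2)\<^sup>2" using kr[OF s w] by (intro power_mono) auto
    also have "... \<le> (1 / \<sigma>)\<^sup>2"
    proof (rule power_mono)
      show "r / \<sigma>^2 \<le> 1 / \<sigma>" using r1(3) s0 by (simp add: power2_eq_square field_simps)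
    qed (use r0 in simp)
    finally show "\<sigma>^2 * (k s w)\<^sup>2 \<le> 1" using s0 by (simp add: power_divide field_simps)
  qed
  define yy where "yy s w = (if Bf s w \<le> b then proj_orth \<theta> (a s w) else 0)" for s w
  have yyb: "(\<Sum>s=1..n. (norm (yy s w))\<^sup>2) \<le> b" for w
  proof -
    interpret P: design "\<lambda>s. a s w" \<theta> by (rule Des)
    have "(\<Sum>s=1..n. (norm (yy s w))\<^sup>2) = (\<Sum>s=1..n. if P.B s \<le> b then (norm (P.y s))\<^sup>2 else 0)"
      by (intro sum.cong) (auto simp: yy_def Bf_def)
    then show ?thesis using P.truncated_sum_le[of b n] b0 by simp
  qed
  have kyy: "\<bar>k s w\<bar> \<le> r / \<sigma>^2 * norm (yy s w)" for s w
  proof -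
    have "\<nu> \<bullet> a s w = \<nu> \<bullet> proj_orth \<theta> (a s w)" using proj_orth_inner[OF nu(2)] by simp
    then have "\<bar>\<nu> \<bullet> a s w\<bar> \<le> r * norm (proj_orth \<theta> (a s w))"
      using Cauchy_Schwarz_ineq2[of \<nu> "proj_orth \<theta> (a s w)"] nu(1) by simp
    then have "\<bar>\<nu> \<bullet> a s w\<bar> / \<sigma>^2 \<le> (r * norm (proj_orth \<theta> (a s w))) / \<sigma>^2" by (intro divide_right_mono) auto
    then show ?thesis by (simp add: k_def yy_def)
  qed
  have ksum: "(\<Sum>s=1..n. (k s w)\<^sup>2) \<le> V" for w
  proof -
    have "(\<Sum>s=1..n. (k s w)\<^sup>2) \<le> (\<Sum>s=1..n. r\<^sup>2 / \<sigma>^4 * (norm (yy s w))\<^sup>2)"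
    proof (rule sum_mono)
      fix s
      have "\<bar>k s w\<bar>\<^sup>2 \<le> (r / \<sigma>^2 * norm (yy s w))\<^sup>2" using kyy by (intro power_mono) auto
      then show "(k s w)\<^sup>2 \<le> r^2 / \<sigma>^4 * (norm (yy s w))\<^sup>2" by (simp add: power_mult_distrib power_divide flip: power_mult)
    qed
    also have "... = r^2 / \<sigma>^4 * (\<Sum>s=1..n. (norm (yy s w))\<^sup>2)" by (simp add: sum_distrib_left)
    also have "... \<le> r^2 / \<sigma>^4 * b" using yyb by (intro mult_left_mono) auto
    also have "... = V" using rV by simp
    finally show ?thesis .
  qed
  define qc where "qc i s w = yy s w $ i" for i s w
  define qt where "qt s w = a s w \<bullet> \<theta>" for s w
  have qcm: "qc i s \<in> borel_measurable (F (s - 1))" if s: "s \<in> {1..T}" for i s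
  proof -
    have [measurable]: "a s \<in> borel_measurable (F (s - 1))" using s by (intro action_predictable)
    have "(\<lambda>w. proj_orth \<theta> (a s w) \<bullet> axis i 1) \<in> borel_measurable (F (s - 1))" by measurable
    then have m: "(\<lambda>w. proj_orth \<theta> (a s w) $ i) \<in> borel_measurable (F (s - 1))" by (simp add: inner_axis)
    have "qc i s = (\<lambda>w. if Bf s w \<le> b then proj_orth \<theta> (a s w) $ i else 0)" by (auto simp: qc_def yy_def)
    also have "... \<in> borel_measurable (F (s - 1))" by (rule measurable_If[OF m _ Bset[OF s]]) simp
    finally show ?thesis .
  qed
  have qtm: "qt s \<in> borel_measurable (F (s - 1))" if s: "s \<in> {1..T}" for s
  proof -
    have [measurable]: "a s \<in> borel_measurable (F (s - 1))" using s by (intro action_predictable)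
    show ?thesis unfolding qt_def by measurable
  qed
  have ny: "norm (yy s w) \<le> 1" if "s \<in> {1..T}" "w \<in> space M" for s w
    using norm_proj_orth_le[OF norm_theta, of "a s w"] an[OF that] by (simp add: yy_def)
  have qcb: "\<bar>qc i s w\<bar> \<le> 1" if "s \<in> {1..T}" "w \<in> space M" for i s w
    using abs_component_le[of "yy s w" i] ny[OF that] by (simp add: qc_def)
  have qtb: "\<bar>qt s w\<bar> \<le> 1" if "s \<in> {1..T}" "w \<in> space M" for s w
    using Cauchy_Schwarz_ineq2[of "a s w" \<theta>] an[OF that] norm_theta by (simp add: qt_def)
  define Xc where "Xc i w = (\<Sum>s=1..n. qc i s w * Ti.te s w)" for i w
  define Xt where "Xt w = (\<Sum>s=1..n. qt s w * Ti.te s w)" for w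
  \<comment> \<open>Each part is divided by the bound on its predictable variation, b for the
    orthogonal coordinates together and n for the direction \<theta>, so each contributes at most
    the variance constant.\<close>
  define St where "St w = (\<Sum>i\<in>UNIV. (Xc i w)\<^sup>2) / b + (Xt w)\<^sup>2 / real n" for w
  define td where "td = Ti.td n"
  have qcM: "all_moments (qc i s)" and qtM: "all_moments (qt s)" if "s \<in> {1..T}" for i s
    using that by (auto intro!: all_moments_bounded[OF measurable_F_M[OF qcm] qcb] all_moments_bounded[OF measurable_F_M[OF qtm] qtb])
  have XcM: "all_moments (Xc i)" for i unfolding Xc_def using n qcM Ti.te_moments by (intro all_moments_sum) auto
  have XtM: "all_moments Xt" unfolding Xt_def using n qtM Ti.te_moments by (intro all_moments_sum) auto
  have tdM: "all_moments td" unfolding td_def using n by (intro Ti.td_moments)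
  have StM: "all_moments St" unfolding St_def using XcM XtM
    by (intro all_moments_add all_moments_divide all_moments_sum all_moments_power)
  have td0: "0 \<le> td w" if "w \<in> space M" for w unfolding td_def using n(2) that by (rule Ti.td_nonneg)
  have td1: "expectation td = 1" unfolding td_def using n(2) by (rule Ti.expectation_td)
  have C40: "0 < tilt_var_const \<sigma>" by (rule tilt_const_pos(2))
  have part1: "(\<Sum>i\<in>UNIV. expectation (\<lambda>w. td w * (Xc i w)\<^sup>2)) \<le> tilt_var_const \<sigma> * b"
  proof -
    have "(\<Sum>i\<in>UNIV. expectation (\<lambda>w. td w * (Xc i w)\<^sup>2))
        \<le> (\<Sum>i\<in>UNIV. tilt_var_const \<sigma> * expectation (\<lambda>w. td w * (\<Sum>s=1..n. (qc i s w)\<^sup>2)))"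
      unfolding td_def Xc_def using n(2) qcm qcb by (intro sum_mono Ti.expectation_td_martingale) auto
    also have "... = tilt_var_const \<sigma> * (\<Sum>i\<in>UNIV. expectation (\<lambda>w. td w * (\<Sum>s=1..n. (qc i s w)\<^sup>2)))"
      by (simp add: sum_distrib_left)
    also have "(\<Sum>i\<in>UNIV. expectation (\<lambda>w. td w * (\<Sum>s=1..n. (qc i s w)\<^sup>2)))
        = expectation (\<lambda>w. \<Sum>i\<in>UNIV. td w * (\<Sum>s=1..n. (qc i s w)\<^sup>2))"
      using tdM qcM n by (intro Bochner_Integration.integral_sum[symmetric] all_moments_integrable all_moments_mult all_moments_sum all_moments_power) auto
    also have "... = expectation (\<lambda>w. td w * (\<Sum>s=1..n. (norm (yy s w))\<^sup>2))"
    proof (intro Bochner_Integration.integral_cong refl)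
      fix w
      have "(\<Sum>i\<in>UNIV. \<Sum>s=1..n. (qc i s w)\<^sup>2) = (\<Sum>s=1..n. (norm (yy s w))\<^sup>2)"
        unfolding qc_def by (subst sum.swap) (simp add: sum_components_sq)
      then show "(\<Sum>i\<in>UNIV. td w * (\<Sum>s=1..n. (qc i s w)\<^sup>2)) = td w * (\<Sum>s=1..n. (norm (yy s w))\<^sup>2)"
        by (simp add: sum_distrib_left[symmetric])
    qed
    also have "... \<le> expectation (\<lambda>w. td w * b)"
    proof (rule integral_mono)
      have yyM: "all_moments (\<lambda>w. (norm (yy s w))\<^sup>2)" if "s \<in> {1..n}" for s
      proof -
        have "all_moments (\<lambda>w. \<Sum>i\<in>UNIV. (qc i s w)\<^sup>2)" using qcM that n by (intro all_moments_sum all_moments_power) auto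
        then show ?thesis by (simp add: qc_def sum_components_sq)
      qed
      show "integrable M (\<lambda>w. td w * (\<Sum>s=1..n. (norm (yy s w))\<^sup>2))"
        using tdM yyM by (intro all_moments_integrable all_moments_mult all_moments_sum)
      show "integrable M (\<lambda>w. td w * b)" using tdM by (intro all_moments_integrable) auto
      show "td w * (\<Sum>s=1..n. (norm (yy s w))\<^sup>2) \<le> td w * b" if "w \<in> space M" for w
        using td0[OF that] yyb by (intro mult_left_mono)
    qed
    also have "expectation (\<lambda>w. td w * b) = b" using td1 by simp
    finally show ?thesis using C40 by (simp add: mult_left_mono)
  qed
  have part2: "expectation (\<lambda>w. td w * (Xt w)\<^sup>2) \<le> tilt_var_const \<sigma> * real n"
  proof -
    have "expectation (\<lambda>w. td w * (Xt w)\<^sup>2) \<le> tilt_var_const \<sigma> * expectation (\<lambda>w. td w * (\<Sum>s=1..n. (qt s w)\<^sup>2))"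
      unfolding td_def Xt_def using n(2) qtm qtb by (intro Ti.expectation_td_martingale) auto
    also have "expectation (\<lambda>w. td w * (\<Sum>s=1..n. (qt s w)\<^sup>2)) \<le> expectation (\<lambda>w. td w * real n)"
    proof (rule integral_mono)
      show "integrable M (\<lambda>w. td w * (\<Sum>s=1..n. (qt s w)\<^sup>2))"
        using tdM qtM n by (intro all_moments_integrable all_moments_mult all_moments_sum all_moments_power) auto
      show "integrable M (\<lambda>w. td w * real n)" using tdM by (intro all_moments_integrable) auto
      fix w assume w: "w \<in> space M"
      have "(\<Sum>s=1..n. (qt s w)\<^sup>2) \<le> (\<Sum>s=1..n. 1)"
        using qtb[OF _ w] n by (intro sum_mono) (simp add: abs_square_le_1)
      then show "td w * (\<Sum>s=1..n. (qt s w)\<^sup>2) \<le> td w * real n"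
        using td0[OF w] by (intro mult_left_mono) auto
    qed
    also have "expectation (\<lambda>w. td w * real n) = real n" using td1 by simp
    finally show ?thesis using C40 by (simp add: mult_left_mono)
  qed
  have ESt: "expectation (\<lambda>w. td w * St w) \<le> 2 * tilt_var_const \<sigma>"
  proof -
    have "expectation (\<lambda>w. td w * St w) = expectation (\<lambda>w. 1 / b * (\<Sum>i\<in>UNIV. td w * (Xc i w)\<^sup>2) + 1 / real n * (td w * (Xt w)\<^sup>2))"
      by (simp add: St_def algebra_simps sum_distrib_left sum_divide_distrib)
    also have "... = 1 / b * expectation (\<lambda>w. \<Sum>i\<in>UNIV. td w * (Xc i w)\<^sup>2) + 1 / real n * expectation (\<lambda>w. td w * (Xt w)\<^sup>2)"
    proof -
      have "all_moments (\<lambda>w. \<Sum>i\<in>UNIV. td w * (Xc i w)\<^sup>2)" using tdM XcM by (intro all_moments_sum) auto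
      then show ?thesis using tdM XtM by (simp only: expectation_linear)
    qed
    also have "expectation (\<lambda>w. \<Sum>i\<in>UNIV. td w * (Xc i w)\<^sup>2) = (\<Sum>i\<in>UNIV. expectation (\<lambda>w. td w * (Xc i w)\<^sup>2))"
      using tdM XcM by (intro Bochner_Integration.integral_sum all_moments_integrable all_moments_mult all_moments_power)
    also have "1 / b * ... \<le> 1 / b * (tilt_var_const \<sigma> * b)" using part1 b0 by (intro mult_left_mono) auto
    also have "1 / real n * expectation (\<lambda>w. td w * (Xt w)\<^sup>2) \<le> 1 / real n * (tilt_var_const \<sigma> * real n)"
      using part2 by (intro mult_left_mono) auto
    finally show ?thesis using b0 n by simp
  qed
  \<comment> \<open>If St were small, the recentred noise would be small in the dual norm, and
    \<open>shift_le\<close> would bound sqrt l * |\<nu>| below its actual value.\<close>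
  have far: "thr < St w" if w: "w \<in> E" for w
  proof (rule ccontr)
    assume "\<not> thr < St w"
    then have St: "St w \<le> thr" by simp
    have ws: "w \<in> space M" using w E(1) sets.sets_into_space by blast
    interpret P: ucb_path "\<lambda>s. a s w" \<theta> "\<lambda>t. \<theta>h t w" \<beta> T by (rule path_at[OF ws])
    define Y where "Y = (\<chi> i. Xc i w)"
    have nY: "(norm Y)\<^sup>2 = (\<Sum>i\<in>UNIV. (Xc i w)\<^sup>2)" by (simp add: Y_def sum_components_sq[symmetric])
    have nn: "0 \<le> (norm Y)\<^sup>2 / b" "0 \<le> (Xt w)\<^sup>2 / real n" using b0 by simp_all
    have "(norm Y)\<^sup>2 / b \<le> thr" using St nn unfolding St_def nY[symmetric] by linarith
    then have Yb: "norm Y \<le> sqrt (thr * b)" using b0 by (intro real_le_rsqrt) (simp add: divide_le_eq)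
    have "(Xt w)\<^sup>2 / real n \<le> thr" using St nn unfolding St_def nY[symmetric] by linarith
    then have Xb: "\<bar>Xt w\<bar> \<le> sqrt (thr * real n)" using n by (intro real_le_rsqrt) (simp add: divide_le_eq)
    have Bs: "Bf s w \<le> b" if "s \<in> {1..n}" for s
      using P.B_mono[of s n] Bb[OF w] that unfolding Bf_def by (auto intro: order_trans)
    define \<delta> where "\<delta> s = (k s w)\<^sup>2 / 2 * kap s w" for s
    \<comment> \<open>On E the truncation is inactive up to n, so the shift is exactly \<nu> . a;
      the leftover \<delta> is of second order in k and summable to a multiple of V.\<close>
    have te: "\<epsilon> s w - \<nu> \<bullet> a s w = Ti.te s w + \<delta> s" if "s \<in> {1..n}" for s
      using Bs[OF that] s0 by (simp add: Ti.te_def \<delta>_def k_def)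
    have \<delta>s: "(\<Sum>s=1..n. \<bar>\<delta> s\<bar>) \<le> cubic_const \<sigma> * V / 2"
    proof -
      have "(\<Sum>s=1..n. \<bar>\<delta> s\<bar>) \<le> (\<Sum>s=1..n. cubic_const \<sigma> / 2 * (k s w)\<^sup>2)"
      proof (rule sum_mono)
        fix s
        have "(k s w)\<^sup>2 / 2 * \<bar>kap s w\<bar> \<le> (k s w)\<^sup>2 / 2 * cubic_const \<sigma>"
          using abs_kap_le by (intro mult_left_mono) auto
        then show "\<bar>\<delta> s\<bar> \<le> cubic_const \<sigma> / 2 * (k s w)\<^sup>2" by (simp add: \<delta>_def abs_mult mult.commute)
      qed
      also have "... = cubic_const \<sigma> / 2 * (\<Sum>s=1..n. (k s w)\<^sup>2)" by (simp add: sum_distrib_left)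
      also have "... \<le> cubic_const \<sigma> / 2 * V" using ksum cubic_const_pos[of \<sigma>] by (intro mult_left_mono) auto
      finally show ?thesis by simp
    qed
    define S where "S = P.SS (\<lambda>s. \<epsilon> s w) n - (P.Lam n *v \<nu> - \<nu>)"
    have S: "S = (\<Sum>s=1..n. (Ti.te s w + \<delta> s) *\<^sub>R a s w)"
    proof -
      have "S = (\<Sum>s=1..n. \<epsilon> s w *\<^sub>R a s w) - (\<Sum>s=1..n. (a s w \<bullet> \<nu>) *\<^sub>R a s w)"
        by (simp add: S_def P.SS_def design_matrix_apply)
      also have "... = (\<Sum>s=1..n. (\<epsilon> s w - \<nu> \<bullet> a s w) *\<^sub>R a s w)"
        by (simp add: sum_subtractf scaleR_diff_left inner_commute)
      also have "... = (\<Sum>s=1..n. (Ti.te s w + \<delta> s) *\<^sub>R a s w)" using te by (intro sum.cong) auto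
      finally show ?thesis .
    qed
    have nSo: "norm (proj_orth \<theta> S) \<le> sqrt (thr * b) + cubic_const \<sigma> * V / 2"
    proof -
      have "proj_orth \<theta> S = (\<Sum>s=1..n. (Ti.te s w + \<delta> s) *\<^sub>R yy s w)"
        unfolding S proj_orth_sum proj_orth_scaleR using Bs by (intro sum.cong) (auto simp: yy_def)
      also have "... = (\<Sum>s=1..n. Ti.te s w *\<^sub>R yy s w) + (\<Sum>s=1..n. \<delta> s *\<^sub>R yy s w)"
        by (simp add: scaleR_add_left sum.distrib)
      also have "(\<Sum>s=1..n. Ti.te s w *\<^sub>R yy s w) = Y"
        by (simp add: Y_def vec_eq_iff Xc_def qc_def mult.commute)
      finally have "norm (proj_orth \<theta> S) \<le> norm Y + norm (\<Sum>s=1..n. \<delta> s *\<^sub>R yy s w)"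
        using norm_triangle_ineq by metis
      also have "norm (\<Sum>s=1..n. \<delta> s *\<^sub>R yy s w) \<le> (\<Sum>s=1..n. \<bar>\<delta> s\<bar>)"
      proof (rule order_trans[OF norm_sum sum_mono])
        fix s assume "s \<in> {1..n}"
        then have "norm (yy s w) \<le> 1" using n by (intro ny[OF _ ws]) auto
        then show "norm (\<delta> s *\<^sub>R yy s w) \<le> \<bar>\<delta> s\<bar>" by (simp add: mult_left_le)
      qed
      finally show ?thesis using Yb \<delta>s by linarith
    qed
    have nSt: "\<bar>S \<bullet> \<theta>\<bar> \<le> sqrt (thr * real n) + cubic_const \<sigma> * V / 2"
    proof -
      have "S \<bullet> \<theta> = Xt w + (\<Sum>s=1..n. \<delta> s * qt s w)"
        by (simp add: S Xt_def qt_def inner_sum_left sum.distrib algebra_simps)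
      then have "\<bar>S \<bullet> \<theta>\<bar> \<le> \<bar>Xt w\<bar> + \<bar>\<Sum>s=1..n. \<delta> s * qt s w\<bar>" by simp
      also have "\<bar>\<Sum>s=1..n. \<delta> s * qt s w\<bar> \<le> (\<Sum>s=1..n. \<bar>\<delta> s\<bar>)"
      proof (rule order_trans[OF sum_abs sum_mono])
        fix s assume "s \<in> {1..n}"
        then have "\<bar>qt s w\<bar> \<le> 1" using n by (intro qtb[OF _ ws]) auto
        then show "\<bar>\<delta> s * qt s w\<bar> \<le> \<bar>\<delta> s\<bar>" by (simp add: abs_mult mult_left_le)
      qed
      finally show ?thesis using Xb \<delta>s by linarith
    qed
    have lel: "l \<le> P.el n" using ell[OF w] by (simp add: P.D.ell_def)
    have BJ: "P.B n \<le> J * P.el n"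
    proof -
      have "P.B n \<le> J * l" using Bb[OF w] l(2) by simp
      also have "... \<le> J * P.el n" using lel l(3) by (intro mult_left_mono) auto
      finally show ?thesis .
    qed
    have GS: "seminorm_of (P.G n) S \<le> X0"
    proof -
      have "seminorm_of (P.G n) S \<le> norm (proj_orth \<theta> S) / sqrt l + \<bar>S \<bullet> \<theta>\<bar> * (1 + sqrt J) / sqrt (real n / 2)"
        by (rule P.seminorm_le_components[OF BJ pn[OF w] n(1) l(1) lel])
      also have "norm (proj_orth \<theta> S) / sqrt l \<le> sqrt (thr * J) + 1"
      proof -
        have "norm (proj_orth \<theta> S) \<le> (sqrt (thr * J) + 1) * sqrt l"
          using nSo small(4) l by (simp add: distrib_right real_sqrt_mult mult.assoc)
        then show ?thesis using sl by (simp add: divide_le_eq)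
      qed
      also have "\<bar>S \<bullet> \<theta>\<bar> * (1 + sqrt J) / sqrt (real n / 2) \<le> (1 + sqrt J) * (sqrt (2 * thr) + 1)"
      proof -
        have n2: "0 < sqrt (real n / 2)" using n by simp
        have sn: "sqrt (real n) = sqrt 2 * sqrt (real n / 2)" by (simp add: real_sqrt_mult[symmetric])
        have s2: "sqrt 2 \<le> (2::real)" by (intro real_le_lsqrt) auto
        have "cubic_const \<sigma> * V / 2 \<le> sqrt 2 * sqrt (real n / 2) / 2" using small(5) unfolding sn by simp
        also have "... \<le> 2 * sqrt (real n / 2) / 2" using s2 by (intro divide_right_mono mult_right_mono) auto
        finally have cv: "cubic_const \<sigma> * V / 2 \<le> 2 * sqrt (real n / 2) / 2" .
        have "\<bar>S \<bullet> \<theta>\<bar> \<le> (sqrt (2 * thr) + 1) * sqrt (real n / 2)"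
        proof -
          have "sqrt (thr * real n) = sqrt (2 * thr) * sqrt (real n / 2)" by (simp add: real_sqrt_mult[symmetric])
          then show ?thesis using nSt cv by (simp only: distrib_right)
        qed
        then have "\<bar>S \<bullet> \<theta>\<bar> / sqrt (real n / 2) \<le> sqrt (2 * thr) + 1" using n2 by (simp only: divide_le_eq if_True)
        then have "(1 + sqrt J) * (\<bar>S \<bullet> \<theta>\<bar> / sqrt (real n / 2)) \<le> (1 + sqrt J) * (sqrt (2 * thr) + 1)"
          using l(3) by (intro mult_left_mono) auto
        then show ?thesis by (simp add: mult.commute)
      qed
      finally show ?thesis by (simp add: X0_def dev_const_def thr_def)
    qed
    have "2 * \<beta> \<le> An * bt" using An7 bt mult_mono[of 2 An \<beta> bt] beta_gt_0 by linarith
    then have b2: "2 * \<beta> \<le> sqrt l" using small(1) by (simp add: An_def)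
    have "sqrt l * norm \<nu> \<le> 2 * \<beta> + 2 * X0 + 4"
      using r1(1) nu GS unfolding S_def
      by (intro P.shift_le[OF normalised_at[OF ws] n(2) opt[OF w] l(1) lel b2]) auto
    moreover have "sqrt l * norm \<nu> = An * bt" using nu sl by (simp add: r_def)
    moreover have "An * bt = 2 * (X0 * bt) + 7 * bt" by (simp add: An_def nu_const_def X0_def algebra_simps)
    moreover have "X0 * 1 \<le> X0 * bt" using X00 bt by (intro mult_left_mono)
    ultimately show False using bt by linarith
  qed
  have Ec: "prob (space M - E) \<le> 1 / ln (real T)" using prob_compl[OF E(1)] E(2) by simp
  \<comment> \<open>On E the density is paid for by St / thr, off E by td \<le> \<eta>/2 td^2 + 1/(2
    \<eta>). This \<eta> balances the second moment ln T / 16 against the probability 1 / ln T, for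
    a total of 1/4 + 1/8 + 1/8 < 1.\<close>
  define \<eta> where "\<eta> = 4 / ln (real T)"
  have \<eta>0: "0 < \<eta>" using es by (simp add: \<eta>_def)
  have "1 = expectation td" by (rule td1[symmetric])
  also have "... \<le> expectation (\<lambda>w. 1 / thr * (td w * St w) + \<eta> / 2 * (td w)\<^sup>2 + 1 / (2 * \<eta>) * indicator (space M - E) w)"
  proof (rule integral_mono)
    have IM: "all_moments (indicator (space M - E) :: 'w \<Rightarrow> real)"
      using E(1) by (intro all_moments_bounded[where c = 1]) auto
    show "integrable M td" using tdM by (rule all_moments_integrable)
    show "integrable M (\<lambda>w. 1 / thr * (td w * St w) + \<eta> / 2 * (td w)\<^sup>2 + 1 / (2 * \<eta>) * indicator (space M - E) w)"
      using tdM StM IM by (intro all_moments_integrable) auto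
    fix w assume w: "w \<in> space M"
    have St0: "0 \<le> St w" using b0 by (simp add: St_def sum_nonneg)
    show "td w \<le> 1 / thr * (td w * St w) + \<eta> / 2 * (td w)\<^sup>2 + 1 / (2 * \<eta>) * indicator (space M - E) w"
    proof (cases "w \<in> E")
      case True
      have "td w * thr \<le> td w * St w" using far[OF True] td0[OF w] by (intro mult_left_mono) auto
      then have "td w \<le> 1 / thr * (td w * St w)" using thr0 by (simp add: le_divide_eq)
      moreover have "0 \<le> \<eta> / 2 * (td w)\<^sup>2" using \<eta>0 by simp
      ultimately show ?thesis using True by simp
    next
      case False
      have "0 \<le> \<eta> / 2 * (td w - 1 / \<eta>)\<^sup>2" using \<eta>0 by simp
      also have "... = \<eta> / 2 * (td w)\<^sup>2 + 1 / (2 * \<eta>) - td w" using \<eta>0 by (simp add: power2_eq_square field_simps)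
      finally have "td w \<le> \<eta> / 2 * (td w)\<^sup>2 + 1 / (2 * \<eta>)" by simp
      moreover have "0 \<le> 1 / thr * (td w * St w)" using thr0 td0[OF w] St0 by simp
      ultimately show ?thesis using False w by simp
    qed
  qed
  also have "... = 1 / thr * expectation (\<lambda>w. td w * St w) + \<eta> / 2 * expectation (\<lambda>w. (td w)\<^sup>2)
      + 1 / (2 * \<eta>) * expectation (indicator (space M - E))"
  proof -
    have IM: "all_moments (\<lambda>w. indicator (space M - E) w :: real)"
      using E(1) by (intro all_moments_bounded[where c = 1]) auto
    then show ?thesis using tdM StM by (simp only: expectation_linear)
  qed
  also have "expectation (indicator (space M - E)) = prob (space M - E)" using E(1) by simp
  also have "1 / thr * expectation (\<lambda>w. td w * St w) \<le> 1 / thr * (2 * tilt_var_const \<sigma>)"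
    using ESt thr0 by (intro mult_left_mono) auto
  also have "\<eta> / 2 * expectation (\<lambda>w. (td w)\<^sup>2) \<le> \<eta> / 2 * (ln (real T) / 16)"
    using order_trans[OF Ti.expectation_td_square[OF n(2) ksum] big] \<eta>0 by (intro mult_left_mono) (auto simp: td_def)
  also have "1 / (2 * \<eta>) * prob (space M - E) \<le> 1 / (2 * \<eta>) * (1 / ln (real T))"
    using Ec \<eta>0 by (intro mult_left_mono) auto
  finally have "1 \<le> 1 / thr * (2 * tilt_var_const \<sigma>) + \<eta> / 2 * (ln (real T) / 16) + 1 / (2 * \<eta>) * (1 / ln (real T))" by simp
  also have "1 / thr * (2 * tilt_var_const \<sigma>) = 1 / 4" using C40 by (simp add: thr_def thr_const_def)
  also have "\<eta> / 2 * (ln (real T) / 16) = 1 / 8" using es by (simp add: \<eta>_def)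
  also have "1 / (2 * \<eta>) * (1 / ln (real T)) = 1 / 8" using es by (simp add: \<eta>_def)
  finally show False by simp
qed

end

definition "growth_const d = optA d * optD d"

definition "V_const \<sigma> d = (nu_const \<sigma> (growth_const d))\<^sup>2 * growth_const d / \<sigma>^4"

text \<open>One multiple of bt^4 that, as a lower bound on l, implies all the smallness assumptions
  of \<open>not_optimistic\<close> involving l: the terms with 1, 1 / \<sigma>^2 and 1 / \<sigma>^4
  serve the length of the shift, the last square the third-moment correction.\<close>

definition "H_const \<sigma> d = (nu_const \<sigma> (growth_const d))\<^sup>2 * (1 + 1 / \<sigma>^2 + 1 / \<sigma>^4)
  + (cubic_const \<sigma> * V_const \<sigma> d)\<^sup>2 + 1"

lemma opt_const_bounds:
  assumes "1 \<le> d"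
  shows "1 \<le> optA d" "1 \<le> optD d" "1 \<le> optC d" "1 \<le> growth_const d" "0 < small_beta d" "small_beta d \<le> 1"
proof -
  show A: "1 \<le> optA d" and C: "1 \<le> optC d" using opt_consts(1,2)[OF assms] assms by linarith+
  show D: "1 \<le> optD d" using opt_consts(4)[OF assms] A by linarith
  show "1 \<le> growth_const d" unfolding growth_const_def using mult_mono[OF A D] A by simp
  have "1 \<le> sqrt d" using assms by simp
  then have "1 \<le> 6 * sqrt d" by linarith
  then show "0 < small_beta d" "small_beta d \<le> 1" using assms by (simp_all add: small_beta_def)
qed

context linucb_unit
begin

text \<open>Optimism itself supplies the growth estimates, hence comparable B and el without any
  noise bound; these are the inputs that \<open>not_optimistic\<close> needs to refute optimism at
  this level.\<close>

lemma optimistic_false: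
  fixes bt :: real
  defines "d \<equiv> real CARD('d)"
  assumes d2: "2 \<le> CARD('d)" and s0: "0 < \<sigma>"
    and E: "E \<in> sets M" "1 - 1 / ln (real T) \<le> prob E" "\<And>w. w \<in> E \<Longrightarrow> optimistic \<theta> \<beta> T a \<theta>h w"
    and bt: "1 \<le> bt" "\<beta> \<le> bt"
    and R: "optA d * H_const \<sigma> d * bt^4 \<le> \<beta> * sqrt (real (T - 1))"
    and large: "small_beta d \<le> \<beta> \<Longrightarrow> 6 * optC d * \<beta>^2 \<le> real (T - 1)"
    and big: "exp (tilt_square_const \<sigma> * (V_const \<sigma> d * bt^2)) \<le> ln (real T) / 16"
  shows False
proof -
  \<comment> \<open>Optimism in round t concerns the estimator after round t - 1, so T - 1 is the
    last time it covers.\<close>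
  define n where "n = T - 1"
  define A where "A = optA d"
  define D where "D = optD d"
  define J where "J = growth_const d"
  define H where "H = H_const \<sigma> d"
  define An where "An = nu_const \<sigma> J"
  define cV where "cV = cubic_const \<sigma> * V_const \<sigma> d"
  have d1: "1 \<le> d" by (simp add: d_def)
  note ob = opt_const_bounds[OF d1]
  have H: "H = An^2 * (1 + 1 / \<sigma>^2 + 1 / \<sigma>^4) + cV^2 + 1" by (simp add: H_def H_const_def An_def cV_def J_def)
  have Hparts: "An^2 \<le> H" "An^2 / \<sigma>^2 \<le> H" "An^2 / \<sigma>^4 \<le> H" "cV^2 \<le> H" "1 \<le> H" "cV \<le> H"
  proof -
    have H': "H = An^2 + An^2 / \<sigma>^2 + An^2 / \<sigma>^4 + cV^2 + 1" unfolding H by (simp add: algebra_simps)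
    have p: "0 \<le> An^2" "0 \<le> An^2 / \<sigma>^2" "0 \<le> An^2 / \<sigma>^4" "0 \<le> cV^2" by simp_all
    show "An^2 \<le> H" "An^2 / \<sigma>^2 \<le> H" "An^2 / \<sigma>^4 \<le> H" "cV^2 \<le> H" "1 \<le> H" unfolding H' using p by linarith+
    have "0 \<le> (cV - 1)\<^sup>2" by simp
    then have "2 * cV \<le> cV^2 + 1" by (simp add: power2_diff)
    then show "cV \<le> H" unfolding H' using p by linarith
  qed
  have A1: "1 \<le> A" using ob by (simp add: A_def)
  have b0: "0 < \<beta>" by (rule beta_gt_0)
  have n1: "1 \<le> n" "n < T" "n \<le> T" using T3 by (auto simp: n_def)
  \<comment> \<open>The lower bound on el implied by the trace estimate; with J = A D the matching
    upper bound on B is exactly J l.\<close>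
  define l where "l = \<beta> * sqrt (real n) / A"
  have l0: "0 < l" using b0 n1 A1 by (simp add: l_def)
  have bt4: "1 \<le> bt^4" "bt^2 \<le> bt^4" using bt by (auto intro: power_increasing)
  have lH: "H * bt^4 \<le> l" using R A1 unfolding l_def A_def[symmetric] H_def[symmetric] n_def[symmetric]
    by (simp add: le_divide_eq mult_ac)
  have sm: "An * bt \<le> c * sqrt l" if c: "0 < c" "An^2 / c^2 \<le> H" for c
  proof -
    have "An * bt / c \<le> sqrt l"
    proof (rule real_le_rsqrt)
      have "(An * bt / c)\<^sup>2 = An^2 / c^2 * bt^2" by (simp add: power_divide power_mult_distrib)
      also have "... \<le> H * bt^4" using c(2) bt4 Hparts(5) by (intro mult_mono) auto
      finally show "(An * bt / c)\<^sup>2 \<le> l" using lH by linarith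
    qed
    then show ?thesis using c(1) by (simp add: divide_le_eq mult.commute)
  qed
  define V where "V = V_const \<sigma> d * bt^2"
  have cVV: "cubic_const \<sigma> * V = cV * bt^2" by (simp add: V_def cV_def)
  have cVl: "cV * bt^2 \<le> sqrt l"
  proof (rule real_le_rsqrt)
    have "(cV * bt^2)\<^sup>2 = cV^2 * bt^4" by (simp add: power_mult_distrib flip: power_mult)
    also have "... \<le> H * bt^4" using Hparts(4) bt4 by (intro mult_right_mono) auto
    finally show "(cV * bt^2)\<^sup>2 \<le> l" using lH by linarith
  qed
  have cVn: "cV * bt^2 \<le> sqrt (real n)"
  proof -
    have "1 * (H * bt^4) \<le> A * (H * bt^4)" using A1 Hparts(5) bt4 by (intro mult_right_mono) auto
    also have "... \<le> \<beta> * sqrt (real n)" using R by (simp add: A_def H_def n_def mult.assoc)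
    also have "... \<le> bt * sqrt (real n)" using bt by (intro mult_right_mono) auto
    finally have "bt * (H * bt^3) \<le> bt * sqrt (real n)" by (simp add: eval_nat_numeral mult_ac)
    then have h: "H * bt^3 \<le> sqrt (real n)" using bt by simp
    have "cV * bt^2 \<le> H * bt^2" using Hparts(6) by (intro mult_right_mono) auto
    also have "... \<le> H * bt^3" using Hparts(5) bt by (intro mult_left_mono power_increasing) auto
    finally show ?thesis using h by linarith
  qed
  have facts: "seminorm_of (design_matrix (\<lambda>s. a s w) n) (\<theta> - \<theta>h n w) \<le> \<beta> \<and> l \<le> ell_at w n \<and>
      design.B (\<lambda>s. a s w) \<theta> n \<le> D * \<beta> * sqrt (real n) \<and>
      real n / 2 \<le> posdef_dir.pp (design_matrix (\<lambda>s. a s w) n) \<theta>" if w: "w \<in> E" for w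
  proof -
    have ws: "w \<in> space M" using w E(1) sets.sets_into_space by blast
    interpret P: ucb_path "\<lambda>s. a s w" \<theta> "\<lambda>t. \<theta>h t w" \<beta> T by (rule path_at[OF ws])
    have opt: "P.opt_upto n"
      unfolding P.opt_upto_def
    proof (intro allI impI)
      fix r assume "r \<le> n"
      then have r: "Suc r \<in> {1..T}" using n1 by auto
      show "seminorm_of (P.Lam r) (\<theta> - \<theta>h r w) \<le> \<beta>"
        using E(3)[OF w] r unfolding optimistic_def by (intro P.optimism_dist) force
    qed
    have g: "P.ta n * \<beta> * sqrt (real n) \<le> A \<and> P.B n \<le> D * \<beta> * sqrt (real n) \<and> real n / 2 \<le> P.p n"
    proof (cases "small_beta d \<le> \<beta>")
      case True
      have n6: "6 * optC d * \<beta>^2 \<le> real n" using large[OF True] by (simp add: n_def)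
      show ?thesis using P.optimistic_growth_large[OF opt n1(2) True[unfolded d_def] n6[unfolded d_def]]
        by (simp add: A_def D_def d_def)
    next
      case False
      have "1 * 1 \<le> A * (H * bt^4)" using A1 Hparts(5) bt4 mult_mono[OF Hparts(5) bt4(1)] by (intro mult_mono) auto
      then have n6: "1 \<le> \<beta> * sqrt (real n)" using R by (simp add: A_def H_def n_def mult.assoc)
      have F: "\<beta> < small_beta d" using False by simp
      show ?thesis using P.optimistic_growth_small[OF opt n1(2) F[unfolded d_def] n6]
        by (simp add: A_def D_def d_def)
    qed
    have "l \<le> 1 / P.ta n"
    proof -
      have "\<beta> * sqrt (real n) \<le> A * (1 / P.ta n)" using g P.D.tau_pos[of n] by (simp add: le_divide_eq mult_ac)
      then show ?thesis using A1 by (simp add: l_def divide_le_eq mult.commute)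
    qed
    also have "... \<le> P.el n" by (rule P.D.ell_ge_tau)
    finally have "l \<le> P.el n" .
    then show ?thesis using g opt by (simp add: P.opt_upto_def P.D.ell_def)
  qed
  show False
  proof (rule not_optimistic[OF d2 s0 n1(1,3) E(1,2), of l "D * \<beta> * sqrt (real n)" J bt V])
    show "D * \<beta> * sqrt (real n) = J * l" using A1 by (simp add: J_def growth_const_def A_def[symmetric] D_def[symmetric] l_def)
    show "V = (nu_const \<sigma> J)\<^sup>2 * bt^2 * J / \<sigma>^4" by (simp add: V_def V_const_def J_def)
    show "nu_const \<sigma> J * bt \<le> sqrt l" using sm[of 1] Hparts(1) by (simp add: An_def)
    show "nu_const \<sigma> J * bt \<le> \<sigma>^2 * sqrt l"
      using sm[of "\<sigma>^2"] Hparts(3) s0 by (simp add: An_def flip: power_mult)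
    show "nu_const \<sigma> J * bt \<le> \<sigma> * sqrt l" using sm[of \<sigma>] Hparts(2) s0 by (simp add: An_def)
    show "cubic_const \<sigma> * V \<le> 2 * sqrt l" using cVl l0 unfolding cVV by (smt (verit) real_sqrt_ge_zero)
    show "cubic_const \<sigma> * V \<le> sqrt (real n)" using cVn unfolding cVV .
    show "exp (tilt_square_const \<sigma> * V) \<le> ln (real T) / 16" using big by (simp add: V_def)
    show "1 \<le> J" using ob(4) by (simp add: J_def)
  qed (use facts l0 bt in auto)
qed

text \<open>Unit vectors are at distance at most 2, so a bounded least eigenvalue makes the claimed
  rate hold with a large constant.\<close>

lemma trivial_bound:
  assumes w: "w \<in> space M" and t: "t \<le> T" and W: "ell_at w t \<le> W" and L: "1 \<le> L" and v: "norm v = 1"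
  shows "norm (v - \<theta>) \<le> 2 * sqrt W * (L / sqrt (ell_at w t))" "norm (v - \<theta>h t w) \<le> 2 * sqrt W * (L / sqrt (ell_at w t))"
proof -
  interpret P: ucb_path "\<lambda>s. a s w" \<theta> "\<lambda>t. \<theta>h t w" \<beta> T by (rule path_at[OF w])
  have e: "0 < ell_at w t" using P.D.ell_pos[of t] by (simp add: P.D.ell_def)
  have "sqrt (ell_at w t) * 1 \<le> sqrt W * L" using W L e by (intro mult_mono) auto
  then have "2 * (1 * sqrt (ell_at w t)) \<le> 2 * (sqrt W * L)" by simp
  then have 2: "2 \<le> 2 * sqrt W * (L / sqrt (ell_at w t))" using e by (simp add: le_divide_eq)
  have "norm (v - \<theta>) \<le> 2" using norm_triangle_ineq4[of v \<theta>] v norm_theta by simp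
  then show "norm (v - \<theta>) \<le> 2 * sqrt W * (L / sqrt (ell_at w t))" using 2 by linarith
  have "norm (v - \<theta>h t w) \<le> 2" using norm_triangle_ineq4[of v "\<theta>h t w"] v P.norm_hh_one[OF t] by simp
  then show "norm (v - \<theta>h t w) \<le> 2 * sqrt W * (L / sqrt (ell_at w t))" using 2 by linarith
qed

lemma ell_at_le:
  assumes d2: "2 \<le> CARD('d)" and w: "w \<in> space M" and t: "t \<le> T"
  shows "ell_at w t \<le> 1 + real T"
proof -
  interpret P: ucb_path "\<lambda>s. a s w" \<theta> "\<lambda>t. \<theta>h t w" \<beta> T by (rule path_at[OF w])
  have "P.el t \<le> P.B t" by (rule P.el_le_B[OF d2])
  also have "... \<le> 1 + real t" using P.norm_a_one t by (intro P.B_le) auto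
  finally show ?thesis using t by (simp add: P.D.ell_def)
qed

text \<open>Under optimism each action deviates from \<theta> by at most a multiple of \<beta> sqrt
  d, so B can have grown only by a multiple of \<beta>^2 per round. This bounds el when \<beta> sqrt
  T is bounded.\<close>

lemma ell_at_le_optimistic:
  assumes d2: "2 \<le> CARD('d)" and w: "w \<in> space M" and t: "t \<le> T" and opt: "optimistic \<theta> \<beta> T a \<theta>h w"
  shows "ell_at w t \<le> 1 + 18 * real CARD('d) * (\<beta> * sqrt (real (T - 1)))\<^sup>2"
proof -
  interpret P: ucb_path "\<lambda>s. a s w" \<theta> "\<lambda>t. \<theta>h t w" \<beta> T by (rule path_at[OF w])
  define d where "d = real CARD('d)"
  have ta: "P.ta r \<le> d" for r
  proof -
    have "P.ta r \<le> d / P.el r" unfolding d_def by (rule P.D.tau_le)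
    also have "... \<le> d / 1" using P.D.ell_ge_one[of r] by (intro divide_left_mono) (auto simp: d_def)
    finally show ?thesis by simp
  qed
  have y: "(norm (P.y s))\<^sup>2 \<le> 9 * \<beta>^2 * d" if "s \<in> {1..t}" for s
  proof -
    from that obtain r where r: "s = Suc r" using not0_implies_Suc[of s] by auto
    have rT: "r < T" "Suc r \<in> {1..T}" using that r t by auto
    have "seminorm_of (P.Lam r) (\<theta> - \<theta>h r w) \<le> \<beta>"
      using opt rT(2) unfolding optimistic_def by (intro P.optimism_dist) force
    then have "norm (P.y s) \<le> 3 * \<beta> * sqrt (P.ta r)" unfolding r using rT(1) by (rule P.optimistic_y_le)
    also have "... \<le> 3 * \<beta> * sqrt d" using ta[of r] beta_gt_0 by (intro mult_left_mono) auto
    finally have "(norm (P.y s))\<^sup>2 \<le> (3 * \<beta> * sqrt d)\<^sup>2" by (intro power_mono) auto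
    then show ?thesis by (simp add: power_mult_distrib d_def)
  qed
  have "P.el t \<le> P.B t" by (rule P.el_le_B[OF d2])
  also have "P.B t \<le> 1 + (\<Sum>s=1..t. 9 * \<beta>^2 * d)" unfolding P.B_def using y by (intro add_left_mono sum_mono)
  also have "... = 1 + 9 * \<beta>^2 * d * real t" by simp
  also have "... \<le> 1 + 9 * \<beta>^2 * d * (2 * real (T - 1))"
  proof -
    have "real t \<le> 2 * real (T - 1)" using t T3 by (simp add: of_nat_diff)
    then show ?thesis by (intro add_left_mono mult_left_mono) (auto simp: d_def)
  qed
  also have "... = 1 + 18 * d * (\<beta> * sqrt (real (T - 1)))\<^sup>2" by (simp add: power_mult_distrib)
  finally show ?thesis by (simp add: P.D.ell_def d_def)
qed

end

text \<open>With \<beta>^2 bounded by 1 + \<kappa>^2 (d + ln ln T), these are the three conditions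
  under which a \<beta> not below \<open>small_beta\<close> is refuted; each compares a power of ln
  ln T, or a constant, with a growing function of T.\<close>

lemma horizon_threshold:
  fixes \<kappa> d C A H sb Co :: real
  assumes "0 < \<kappa>" "0 < d" "0 < C" "0 < A" "0 < H" "0 < sb" "0 < Co"
  shows "\<exists>T0::nat. \<forall>T\<ge>T0. 16 * exp (C + d / 2) \<le> sqrt (ln (real T)) \<and>
    A * H * (1 + \<kappa>^2 * (d + ln (ln (real T))))\<^sup>2 \<le> sb * sqrt (real T - 1) \<and>
    6 * Co * (1 + \<kappa>^2 * (d + ln (ln (real T)))) \<le> real T - 1"
proof -
  have "\<forall>\<^sub>F T::nat in at_top. 16 * exp (C + d / 2) \<le> sqrt (ln (real T))" by real_asymp
  moreover have "\<forall>\<^sub>F T::nat in at_top. A * H * (1 + \<kappa>^2 * (d + ln (ln (real T))))\<^sup>2 \<le> sb * sqrt (real T - 1)"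
    using assms by real_asymp
  moreover have "\<forall>\<^sub>F T::nat in at_top. 6 * Co * (1 + \<kappa>^2 * (d + ln (ln (real T)))) \<le> real T - 1"
    using assms by real_asymp
  ultimately have "\<forall>\<^sub>F T::nat in at_top. 16 * exp (C + d / 2) \<le> sqrt (ln (real T)) \<and>
    A * H * (1 + \<kappa>^2 * (d + ln (ln (real T))))\<^sup>2 \<le> sb * sqrt (real T - 1) \<and>
    6 * Co * (1 + \<kappa>^2 * (d + ln (ln (real T)))) \<le> real T - 1"
    by eventually_elim blast
  then show ?thesis by (simp add: eventually_at_top_linorder)
qed

theorem proposition3:
  fixes \<sigma> :: real
  assumes "2 \<le> CARD('d::finite)" and "\<sigma> > 0"
  shows "\<exists>c0>0. \<exists>c1>0. \<exists>c2>0.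
    \<forall>(T::nat) (\<beta>::real) (\<theta>::real^'d) (M::'w measure) a \<epsilon> \<theta>h.
      T \<ge> 3 \<and> \<beta> > 0 \<and> norm \<theta> = 1 \<and> linucb_run M \<theta> \<sigma> \<beta> T a \<epsilon> \<theta>h \<and>
      with_prob_at_least M (1 - 1 / ln (real T)) (optimistic \<theta> \<beta> T a \<theta>h) \<longrightarrow>
      (\<exists>t2::nat. real t2 \<le> c0 * (\<beta> ^ 8 / (\<sigma> ^ 6 * (real CARD('d))\<^sup>2)) \<and>
        with_prob_at_least M (1 - 1 / ln (real T)) (\<lambda>\<omega>.
          \<forall>t\<in>{t2..T}. \<forall>v.
            let \<Lambda> = design_matrix (\<lambda>s. a s \<omega>) t;
                b = (\<sigma> * sqrt (real CARD('d) + ln (ln (real T))) + 1) / sqrt (min_eigenvalue \<Lambda>)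
            in unit_leading_eigenvector \<Lambda> v \<and> v \<bullet> \<theta> \<ge> 0 \<longrightarrow>
                 norm (v - \<theta>) \<le> c1 * b \<and> norm (v - \<theta>h t \<omega>) \<le> c2 * b))"
proof -
  note d2 = assms(1) and s0 = assms(2)
  define d where "d = real CARD('d)"
  have d1: "1 \<le> d" by (simp add: d_def)
  note ob = opt_const_bounds[OF d1]
  define A where "A = optA d"
  define H where "H = H_const \<sigma> d"
  define Q where "Q = tilt_square_const \<sigma> * V_const \<sigma> d"
  have H0: "0 < H" unfolding H_def H_const_def by (intro add_nonneg_pos add_nonneg_nonneg mult_nonneg_nonneg) auto
  have A0: "0 < A" using ob by (simp add: A_def)
  have nu0: "0 < nu_const \<sigma> (growth_const d)"
    using tilt_const_pos(2)[of \<sigma>] ob(4) by (simp add: nu_const_def dev_const_def thr_const_def add_nonneg_pos)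
  have Q0: "0 < Q" unfolding Q_def V_const_def using tilt_const_pos(1)[of \<sigma>] nu0 ob(4) s0
    by (intro mult_pos_pos divide_pos_pos) auto
  \<comment> \<open>Q \<beta>^2 is then at most d/2 + ln (sqrt (ln T)) for \<beta> \<le> \<kappa> L,
    so the second moment of the density is a constant times sqrt (ln T), eventually below ln T /
    16.\<close>
  define \<kappa> where "\<kappa> = 1 / sqrt (2 * Q)"
  have k0: "0 < \<kappa>" and Qk: "Q * \<kappa>^2 = 1 / 2" using Q0 by (simp_all add: \<kappa>_def power_divide)
  obtain c' c where c': "0 < c'" and c: "0 < c" and nr: "\<And>(M::'w measure) (\<theta>::real^'d) \<beta> T a \<epsilon> \<theta>h.
    linucb_unit M \<theta> \<sigma> \<beta> T a \<epsilon> \<theta>h \<Longrightarrow> \<kappa> * sqrt (real CARD('d) + ln (ln (real T))) \<le> \<beta> \<Longrightarrow>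
    with_prob_at_least M (1 - 1 / ln (real T)) (\<lambda>w. \<forall>t v.
      let \<Lambda> = design_matrix (\<lambda>s. a s w) t;
          b = c * sqrt (real CARD('d) + ln (ln (real T))) / sqrt (min_eigenvalue \<Lambda>)
      in c' * \<beta>^8 \<le> real t \<and> t \<le> T \<and> unit_leading_eigenvector \<Lambda> v \<and> 0 \<le> v \<bullet> \<theta> \<longrightarrow>
         norm (v - \<theta>) \<le> b \<and> norm (v - \<theta>h t w) \<le> b)"
    using noise_regime[OF d2 k0, of \<sigma>, where 'w = 'w] by blast
  obtain T0 :: nat where T0: "\<And>T. T0 \<le> T \<Longrightarrow> 16 * exp (Q + d / 2) \<le> sqrt (ln (real T)) \<and>
    A * H * (1 + \<kappa>^2 * (d + ln (ln (real T))))\<^sup>2 \<le> small_beta d * sqrt (real T - 1) \<and>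
    6 * optC d * (1 + \<kappa>^2 * (d + ln (ln (real T)))) \<le> real T - 1"
  proof -
    have "0 < optC d" "0 < d" using ob d1 by linarith+
    from horizon_threshold[OF k0 this(2) Q0 A0 H0 ob(5) this(1)] that show ?thesis by blast
  qed
  define W1 where "W1 = 1 + real T0"
  define W2 where "W2 = 1 + 18 * d * (A * H)\<^sup>2"
  \<comment> \<open>One summand per way the bound arises: the noise regime, short horizons with el
    at most 1 + T0, and tiny \<beta> with el at most W2.\<close>
  define cc where "cc = c / \<sigma> + 2 * sqrt W1 + 2 * sqrt W2"
  \<comment> \<open>The factor \<sigma>^6 d^2 cancels the denominator in the claim, and 1 /
    \<kappa>^8 pays for rounding t2 up to an integer, as \<beta> \<ge> \<kappa>.\<close>
  define c0 where "c0 = (c' + 1 / \<kappa>^8) * (\<sigma>^6 * d^2)"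
  have W0: "0 \<le> sqrt W1" "0 \<le> sqrt W2" using d1 by (simp_all add: W1_def W2_def)
  have cs0: "0 < c / \<sigma>" using c s0 by simp
  have cc0: "0 < cc" using W0 cs0 unfolding cc_def by linarith
  have c00: "0 < c0" using c' k0 s0 d1 by (simp add: c0_def add_pos_pos)
  show ?thesis
  proof (rule exI[of _ c0], rule conjI[OF c00], rule exI[of _ cc], rule conjI[OF cc0], rule exI[of _ cc],
      rule conjI[OF cc0], intro allI impI, elim conjE)
    fix T :: nat and \<beta> :: real and \<theta> :: "real^'d" and M :: "'w measure" and a \<epsilon> \<theta>h
    assume T3: "3 \<le> T" and b0: "0 < \<beta>" and th: "norm \<theta> = 1" and run: "linucb_run M \<theta> \<sigma> \<beta> T a \<epsilon> \<theta>h"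
      and opt: "with_prob_at_least M (1 - 1 / ln (real T)) (optimistic \<theta> \<beta> T a \<theta>h)"
    have unit: "linucb_unit M \<theta> \<sigma> \<beta> T a \<epsilon> \<theta>h"
      by (rule linucb_unit.intro[OF run], unfold_locales) (rule th b0 T3)+
    interpret U: linucb_unit M \<theta> \<sigma> \<beta> T a \<epsilon> \<theta>h by (rule unit)
    define L where "L = sqrt (d + ln (ln (real T)))"
    have l1: "1 \<le> ln (real T)" by (rule U.ln_T_ge_one)
    have ll0: "0 \<le> ln (ln (real T))" using l1 by simp
    have L1: "1 \<le> L" unfolding L_def using d1 ll0 by (intro real_sqrt_ge_one) linarith
    have L2: "L^2 = d + ln (ln (real T))" unfolding L_def using d1 ll0 by simp
    define Ls where "Ls = \<sigma> * L + 1"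
    have Ls1: "1 \<le> Ls" using s0 L1 by (simp add: Ls_def)
    define good where "good t2 w \<longleftrightarrow> (\<forall>t\<in>{t2..T}. \<forall>v.
            let \<Lambda> = design_matrix (\<lambda>s. a s w) t;
                b = (\<sigma> * sqrt (real CARD('d) + ln (ln (real T))) + 1) / sqrt (min_eigenvalue \<Lambda>)
            in unit_leading_eigenvector \<Lambda> v \<and> v \<bullet> \<theta> \<ge> 0 \<longrightarrow>
                 norm (v - \<theta>) \<le> cc * b \<and> norm (v - \<theta>h t w) \<le> cc * b)" for t2 w
    have good_iff: "good t2 w \<longleftrightarrow> (\<forall>t\<in>{t2..T}. \<forall>v. unit_leading_eigenvector (design_matrix (\<lambda>s. a s w) t) v \<and> v \<bullet> \<theta> \<ge> 0 \<longrightarrow>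
        norm (v - \<theta>) \<le> cc * (Ls / sqrt (U.ell_at w t)) \<and> norm (v - \<theta>h t w) \<le> cc * (Ls / sqrt (U.ell_at w t)))" for t2 w
      by (simp add: good_def Let_def Ls_def L_def d_def)
    have epos: "0 \<le> Ls / sqrt (U.ell_at w t)" if "w \<in> space M" for w t
    proof -
      interpret P: ucb_path "\<lambda>s. a s w" \<theta> "\<lambda>t. \<theta>h t w" \<beta> T by (rule U.path_at[OF that])
      show ?thesis using P.D.ell_pos[of t] Ls1 by (simp add: P.D.ell_def)
    qed
    have triv: "good 0 w" if w: "w \<in> space M" and W: "\<And>t. t \<le> T \<Longrightarrow> U.ell_at w t \<le> W" and cW: "2 * sqrt W \<le> cc" for w W
      unfolding good_iff
    proof (intro ballI allI impI)
      fix t v assume t: "t \<in> {0..T}" and "unit_leading_eigenvector (design_matrix (\<lambda>s. a s w) t) v \<and> v \<bullet> \<theta> \<ge> 0"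
      then have v: "norm v = 1" by (simp add: unit_leading_eigenvector_def)
      have tT: "t \<le> T" using t by simp
      show "norm (v - \<theta>) \<le> cc * (Ls / sqrt (U.ell_at w t)) \<and> norm (v - \<theta>h t w) \<le> cc * (Ls / sqrt (U.ell_at w t))"
        using U.trivial_bound[OF w tT W[OF tT] Ls1 v] mult_right_mono[OF cW epos[OF w, of t]] by linarith
    qed
    obtain E where E: "E \<in> sets M" "1 - 1 / ln (real T) \<le> U.prob E" "\<And>w. w \<in> E \<Longrightarrow> optimistic \<theta> \<beta> T a \<theta>h w"
      using opt unfolding with_prob_at_least_def by blast
    have "\<exists>t2. real t2 \<le> c0 * (\<beta> ^ 8 / (\<sigma> ^ 6 * d^2)) \<and> with_prob_at_least M (1 - 1 / ln (real T)) (good t2)"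
    \<comment> \<open>Above the threshold t2 is the rounded multiple of \<beta>^8; below it the
      bounds hold from time 0.\<close>
    proof (cases "\<kappa> * L \<le> \<beta>")
      case True
      define t2 where "t2 = nat \<lceil>c' * \<beta>^8\<rceil>"
      have kb: "\<kappa> \<le> \<beta>" using True mult_left_mono[OF L1, of \<kappa>] k0 by linarith
      have "1 = 1 / \<kappa>^8 * \<kappa>^8" using k0 by simp
      also have "... \<le> 1 / \<kappa>^8 * \<beta>^8" using kb k0 by (intro mult_left_mono power_mono) auto
      finally have one: "1 \<le> 1 / \<kappa>^8 * \<beta>^8" .
      have "0 \<le> c' * \<beta>^8" using c' b0 by simp
      then have "real t2 \<le> c' * \<beta>^8 + 1" unfolding t2_def by linarith
      also have "... \<le> (c' + 1 / \<kappa>^8) * \<beta>^8" using one by (simp add: distrib_right)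
      also have "... = c0 * (\<beta> ^ 8 / (\<sigma> ^ 6 * d^2))" using s0 d1 by (simp add: c0_def)
      finally have t2: "real t2 \<le> c0 * (\<beta> ^ 8 / (\<sigma> ^ 6 * d^2))" .
      obtain G where G: "G \<in> sets M" "1 - 1 / ln (real T) \<le> U.prob G"
        "\<And>w t v. w \<in> G \<Longrightarrow> c' * \<beta>^8 \<le> real t \<Longrightarrow> t \<le> T \<Longrightarrow> unit_leading_eigenvector (design_matrix (\<lambda>s. a s w) t) v \<Longrightarrow>
          0 \<le> v \<bullet> \<theta> \<Longrightarrow> norm (v - \<theta>) \<le> c * L / sqrt (U.ell_at w t) \<and> norm (v - \<theta>h t w) \<le> c * L / sqrt (U.ell_at w t)"
        using nr[OF unit True[unfolded L_def d_def]] unfolding with_prob_at_least_def Let_def L_def d_def by blast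
      have "good t2 w" if w: "w \<in> G" for w
        unfolding good_iff
      proof (intro ballI allI impI)
        fix t v assume t: "t \<in> {t2..T}" and v: "unit_leading_eigenvector (design_matrix (\<lambda>s. a s w) t) v \<and> v \<bullet> \<theta> \<ge> 0"
        have ws: "w \<in> space M" using w G(1) sets.sets_into_space by blast
        have "c' * \<beta>^8 \<le> real t2" unfolding t2_def by linarith
        then have tt: "c' * \<beta>^8 \<le> real t" "t \<le> T" using t by auto
        have e: "0 < sqrt (U.ell_at w t)"
        proof -
          interpret P: ucb_path "\<lambda>s. a s w" \<theta> "\<lambda>t. \<theta>h t w" \<beta> T by (rule U.path_at[OF ws])
          show ?thesis using P.D.ell_pos[of t] by (simp add: P.D.ell_def)
        qed
        have "c * L = c / \<sigma> * (\<sigma> * L)" using s0 by simp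
        also have "... \<le> cc * Ls" using W0 cs0 s0 L1 by (intro mult_mono) (auto simp: cc_def Ls_def)
        finally have "c * L / sqrt (U.ell_at w t) \<le> cc * (Ls / sqrt (U.ell_at w t))"
          using e by (simp add: divide_right_mono)
        then show "norm (v - \<theta>) \<le> cc * (Ls / sqrt (U.ell_at w t)) \<and> norm (v - \<theta>h t w) \<le> cc * (Ls / sqrt (U.ell_at w t))"
          using G(3)[OF w tt] v by fastforce
      qed
      then show ?thesis using t2 G(1,2) unfolding with_prob_at_least_def by blast
    next
      case False
      have "\<exists>G\<in>sets M. 1 - 1 / ln (real T) \<le> U.prob G \<and> (\<forall>w\<in>G. good 0 w)"
      \<comment> \<open>Short horizons are covered by the trivial bound, so the asymptotic
        conditions may be assumed.\<close>
      proof (cases "T0 \<le> T")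
        case small: False
        have "good 0 w" if w: "w \<in> space M" for w
        proof (rule triv[OF w])
          show "U.ell_at w t \<le> W1" if "t \<le> T" for t
            using U.ell_at_le[OF d2 w that] small by (simp add: W1_def)
          show "2 * sqrt W1 \<le> cc" using W0 cs0 by (simp add: cc_def)
        qed
        moreover have "1 - 1 / ln (real T) \<le> U.prob (space M)" using l1 by (simp add: U.prob_space)
        ultimately show ?thesis by blast
      next
        case T: True
        define bt where "bt = max 1 \<beta>"
        define UU where "UU = 1 + \<kappa>^2 * (d + ln (ln (real T)))"
        have bU: "\<beta>^2 \<le> UU" "bt^2 \<le> UU" "1 \<le> UU"
        proof -
          have "\<beta>^2 \<le> (\<kappa> * L)\<^sup>2" using False b0 by (intro power_mono) auto
          also have "... = UU - 1" by (simp add: power_mult_distrib L2 UU_def)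
          finally have 1: "\<beta>^2 \<le> UU - 1" .
          moreover have "0 \<le> \<beta>^2" by simp
          ultimately show "\<beta>^2 \<le> UU" "1 \<le> UU" by linarith+
          then show "bt^2 \<le> UU" by (simp add: bt_def max_def)
        qed
        have bt: "1 \<le> bt" "\<beta> \<le> bt" by (simp_all add: bt_def)
        have T0': "16 * exp (Q + d / 2) \<le> sqrt (ln (real T))" "A * H * UU^2 \<le> small_beta d * sqrt (real (T - 1))"
          "6 * optC d * UU \<le> real (T - 1)"
          using T0[OF T] T3 by (simp_all add: UU_def of_nat_diff)
        have big: "exp (tilt_square_const \<sigma> * (V_const \<sigma> d * bt^2)) \<le> ln (real T) / 16"
        proof -
          have "tilt_square_const \<sigma> * (V_const \<sigma> d * bt^2) = Q * bt^2" by (simp add: Q_def)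
          also have "... \<le> Q * UU" using bU(2) Q0 by (intro mult_left_mono) auto
          also have "... = Q + (Q * \<kappa>^2) * (d + ln (ln (real T)))" by (simp add: UU_def algebra_simps)
          also have "... = (Q + d / 2) + ln (sqrt (ln (real T)))" unfolding Qk using l1 by (simp add: ln_sqrt)
          finally have "exp (tilt_square_const \<sigma> * (V_const \<sigma> d * bt^2)) \<le> exp ((Q + d / 2) + ln (sqrt (ln (real T))))" by simp
          also have "... = exp (Q + d / 2) * sqrt (ln (real T))" using l1 by (simp only: exp_add) simp
          also have "... \<le> (sqrt (ln (real T)) / 16) * sqrt (ln (real T))" using T0'(1) l1 by (intro mult_right_mono) auto
          also have "... = ln (real T) / 16" using l1 by simp
          finally show ?thesis .
        qed
        have contra: False if "A * H * bt^4 \<le> \<beta> * sqrt (real (T - 1))"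
          "small_beta d \<le> \<beta> \<Longrightarrow> 6 * optC d * \<beta>^2 \<le> real (T - 1)"
        proof (rule U.optimistic_false[OF d2 s0 E(1,2) _ bt, folded d_def, folded A_def H_def])
          show "optimistic \<theta> \<beta> T a \<theta>h w" if "w \<in> E" for w by (rule E(3)[OF that])
        qed (use that big in auto)
        \<comment> \<open>A \<beta> that is not tiny makes \<beta> sqrt (T - 1) exceed A H bt^4 at
          these horizons, and optimism is contradicted.\<close>
        have sb: "\<beta> < small_beta d"
        proof (rule ccontr)
          assume "\<not> \<beta> < small_beta d"
          then have bs: "small_beta d \<le> \<beta>" by simp
          show False
          proof (rule contra)
            have "bt^4 = (bt^2)\<^sup>2" by simp
            also have "... \<le> UU^2" using bU(2) by (intro power_mono) auto
            finally have "A * H * bt^4 \<le> A * H * UU^2" using A0 H0 by (intro mult_left_mono) auto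
            also have "... \<le> small_beta d * sqrt (real (T - 1))" by (rule T0')
            also have "... \<le> \<beta> * sqrt (real (T - 1))" using bs by (intro mult_right_mono) auto
            finally show "A * H * bt^4 \<le> \<beta> * sqrt (real (T - 1))" .
            have "6 * optC d * \<beta>^2 \<le> 6 * optC d * UU" using bU(1) ob(3) by (intro mult_left_mono) auto
            then show "6 * optC d * \<beta>^2 \<le> real (T - 1)" using T0'(3) by linarith
          qed
        qed
        have bt1: "bt = 1" using sb ob(6) by (simp add: bt_def)
        \<comment> \<open>For tiny \<beta> the same contradiction leaves only a bounded \<beta> sqrt
          (T - 1), which bounds el on the optimistic event itself.\<close>
        have AH: "\<beta> * sqrt (real (T - 1)) < A * H"
        proof (rule ccontr)
          assume "\<not> ?thesis"
          then show False using sb by (intro contra) (auto simp: bt1)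
        qed
        have "good 0 w" if w: "w \<in> E" for w
        proof (rule triv)
          show ws: "w \<in> space M" using w E(1) sets.sets_into_space by blast
          have "(\<beta> * sqrt (real (T - 1)))\<^sup>2 \<le> (A * H)\<^sup>2" using AH b0 by (intro power_mono) auto
          then have "18 * d * (\<beta> * sqrt (real (T - 1)))\<^sup>2 \<le> 18 * d * (A * H)\<^sup>2" using d1 by (intro mult_left_mono) auto
          then show "U.ell_at w t \<le> W2" if "t \<le> T" for t
            using U.ell_at_le_optimistic[OF d2 ws that E(3)[OF w]] unfolding W2_def d_def by linarith
          show "2 * sqrt W2 \<le> cc" using W0 cs0 by (simp add: cc_def)
        qed
        then show ?thesis using E(1,2) by blast
      qed
      then have "with_prob_at_least M (1 - 1 / ln (real T)) (good 0)" unfolding with_prob_at_least_def by blast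
      moreover have "0 \<le> c0 * (\<beta> ^ 8 / (\<sigma> ^ 6 * d^2))" using c00 b0 s0 by simp
      ultimately show ?thesis by (intro exI[of _ 0]) simp
    qed
    then show "\<exists>t2::nat. real t2 \<le> c0 * (\<beta> ^ 8 / (\<sigma> ^ 6 * (real CARD('d))\<^sup>2)) \<and>
        with_prob_at_least M (1 - 1 / ln (real T)) (\<lambda>w.
          \<forall>t\<in>{t2..T}. \<forall>v.
            let \<Lambda> = design_matrix (\<lambda>s. a s w) t;
                b = (\<sigma> * sqrt (real CARD('d) + ln (ln (real T))) + 1) / sqrt (min_eigenvalue \<Lambda>)
            in unit_leading_eigenvector \<Lambda> v \<and> v \<bullet> \<theta> \<ge> 0 \<longrightarrow>
                 norm (v - \<theta>) \<le> cc * b \<and> norm (v - \<theta>h t w) \<le> cc * b)"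
      unfolding good_def d_def .
  qed
qed

end
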